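(* Let $G$ be the connected group of type $\mathsf G_2$, and let $H\cong\mathrm{SL}(3)$ be the connected subgroup of $G$ whose roots are the long roots of $G$. For $k\in\{1,2\}$ let $P_k$ be the parabolic subgroup of $H$ corresponding to $I=\{\beta_k\}$. Then, for each $k\in\{1,2\}$, the extended weight monoid $\widetilde\Gamma(G/P_k)$ is freely generated by $$(\omega_1,0),\ (\omega_1,-\varpi_k),\ (\omega_2,-\varpi_k).$$
   Context: Groups are over $\mathbb C$. Fix $T\subseteq B\subseteq G$ a maximal torus and Borel subgroup, and $T_H\subseteq B_H\subseteq H$ likewise, with $T_H\subseteq T$ and $B_H\subseteq B$; $B_H^-$ is the Borel subgroup of $H$ opposite to $B_H$. The simple roots of $G$ are $\alpha_1$ (short) and $\alpha_2$ (long), with fundamental dominant weights $\omega_1,\omega_2$; the simple roots of $H$ are $\beta_1,\beta_2$, with fundamental dominant weights $\varpi_1,\varpi_2$. For a set $I$ of simple roots of $H$, the corresponding parabolic subgroup $P$ of $H$ contains $B_H^-$, and its Levi subgroup containing $T_H$ has as simple roots all simple roots of $H$ not in $I$. Characters of $P$ are identified with their restrictions to $T_H$. The extended weight monoid $\widetilde\Gamma(G/P)$ is the set of pairs $(\omega,\chi)$, with $\omega$ a character of $B$ (equivalently of $T$) and $\chi$ a character of $P$, for which there is a non-zero $f\in\mathbb C[G]$ with $f(b^{-1}gp)=\omega(b)f(g)\chi(p)$ for all $b\in B$, $g\in G$, $p\in P$. *)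

theory Defs
  imports "HOL-Analysis.Analysis" "HOL-Algebra.Solvable_Groups" "HOL-Algebra.FiniteProduct"
begin

section \<open>Linear algebraic groups over the complex numbers\<close>

definition GL :: "(complex^'n^'n) monoid" where
  "GL = \<lparr>carrier = {A. invertible A}, mult = (**), one = mat 1\<rparr>"

inductive matrix_poly :: "(complex^'n^'n \<Rightarrow> complex) \<Rightarrow> bool" where
  const: "matrix_poly (\<lambda>A. c)"
| entry: "matrix_poly (\<lambda>A. A $ i $ j)"
| add: "matrix_poly p \<Longrightarrow> matrix_poly q \<Longrightarrow> matrix_poly (\<lambda>A. p A + q A)"
| mult: "matrix_poly p \<Longrightarrow> matrix_poly q \<Longrightarrow> matrix_poly (\<lambda>A. p A * q A)"

text \<open>Every linear algebraic group is a Zariski closed subgroup of some \<open>GL\<close>; ``subgroup'' of an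
  algebraic group always means Zariski closed subgroup.\<close>

definition algebraic_group :: "(complex^'n^'n) set \<Rightarrow> bool" where
  "algebraic_group K \<longleftrightarrow> subgroup K GL \<and>
     (\<exists>S. (\<forall>p\<in>S. matrix_poly p) \<and> K = {A. invertible A \<and> (\<forall>p\<in>S. p A = 0)})"

text \<open>The coordinate ring of a closed subgroup of \<open>GL\<close> consists of the restrictions of elements of
  the coordinate ring of \<open>GL\<close>, i.e. of polynomials in the entries and the inverse determinant.\<close>

definition regular_on :: "(complex^'n^'n) set \<Rightarrow> (complex^'n^'n \<Rightarrow> complex) \<Rightarrow> bool" where
  "regular_on K f \<longleftrightarrow> (\<exists>p m. matrix_poly p \<and> (\<forall>A\<in>K. f A = p A / det A ^ m))"

text \<open>Connectedness is the library's \<open>connected\<close>, in the classical topology; for complex algebraic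
  groups it agrees with connectedness in the Zariski topology.\<close>

definition connected_algebraic_group :: "(complex^'n^'n) set \<Rightarrow> bool" where
  "connected_algebraic_group K \<longleftrightarrow> algebraic_group K \<and> connected K"

definition algebraic_torus :: "(complex^'n^'n) set \<Rightarrow> bool" where
  "algebraic_torus T \<longleftrightarrow> connected_algebraic_group T \<and>
     (\<exists>S :: complex^'n^'n. invertible S \<and> (\<forall>t\<in>T. \<forall>i j. i \<noteq> j \<longrightarrow> (S ** t ** matrix_inv S) $ i $ j = 0))"

definition maximal_torus :: "(complex^'n^'n) set \<Rightarrow> (complex^'n^'n) set \<Rightarrow> bool" where
  "maximal_torus T K \<longleftrightarrow> algebraic_torus T \<and> T \<subseteq> K \<and> (\<forall>S. algebraic_torus S \<and> T \<subseteq> S \<and> S \<subseteq> K \<longrightarrow> S = T)"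

definition connected_solvable :: "(complex^'n^'n) set \<Rightarrow> bool" where
  "connected_solvable B \<longleftrightarrow> connected_algebraic_group B \<and> solvable (GL\<lparr>carrier := B\<rparr>)"

definition borel_subgroup :: "(complex^'n^'n) set \<Rightarrow> (complex^'n^'n) set \<Rightarrow> bool" where
  "borel_subgroup B K \<longleftrightarrow> connected_solvable B \<and> B \<subseteq> K \<and>
     (\<forall>C. connected_solvable C \<and> B \<subseteq> C \<and> C \<subseteq> K \<longrightarrow> C = B)"

definition opposite_borel ::
  "(complex^'n^'n) set \<Rightarrow> (complex^'n^'n) set \<Rightarrow> (complex^'n^'n) set \<Rightarrow> (complex^'n^'n) set \<Rightarrow> bool" where
  "opposite_borel K T B B' \<longleftrightarrow> borel_subgroup B' K \<and> B \<inter> B' = T"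

definition unipotent_matrix :: "complex^'n^'n \<Rightarrow> bool" where
  "unipotent_matrix u \<longleftrightarrow> (\<exists>k. ((\<lambda>M. (u - mat 1) ** M) ^^ k) (mat 1) = 0)"

definition normal_connected_unipotent :: "(complex^'n^'n) set \<Rightarrow> (complex^'n^'n) set \<Rightarrow> bool" where
  "normal_connected_unipotent U P \<longleftrightarrow> connected_algebraic_group U \<and>
     U \<lhd> (GL\<lparr>carrier := P\<rparr>) \<and> (\<forall>u\<in>U. unipotent_matrix u)"

definition unipotent_radical :: "(complex^'n^'n) set \<Rightarrow> (complex^'n^'n) set \<Rightarrow> bool" where
  "unipotent_radical U P \<longleftrightarrow> normal_connected_unipotent U P \<and>
     (\<forall>V. normal_connected_unipotent V P \<longrightarrow> V \<subseteq> U)"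

definition levi_subgroup :: "(complex^'n^'n) set \<Rightarrow> (complex^'n^'n) set \<Rightarrow> bool" where
  "levi_subgroup L P \<longleftrightarrow> connected_algebraic_group L \<and> L \<subseteq> P \<and>
     (\<exists>U. unipotent_radical U P \<and> L \<inter> U = {mat 1} \<and> P = {l ** u | l u. l \<in> L \<and> u \<in> U})"

definition parabolic_subgroup :: "(complex^'n^'n) set \<Rightarrow> (complex^'n^'n) set \<Rightarrow> bool" where
  "parabolic_subgroup P K \<longleftrightarrow> algebraic_group P \<and> P \<subseteq> K \<and> (\<exists>B. borel_subgroup B K \<and> B \<subseteq> P)"


section \<open>Lie algebras\<close>

definition cscale :: "complex \<Rightarrow> complex^'n^'n \<Rightarrow> complex^'n^'n" where
  "cscale c X = (\<chi> i j. c * X $ i $ j)"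

definition lie_bracket :: "complex^'n^'n \<Rightarrow> complex^'n^'n \<Rightarrow> complex^'n^'n" where
  "lie_bracket X Y = X ** Y - Y ** X"

text \<open>The Zariski tangent space at the identity.\<close>

definition lie_algebra :: "(complex^'n^'n) set \<Rightarrow> (complex^'n^'n) set" where
  "lie_algebra K = {X. \<forall>p. matrix_poly p \<and> (\<forall>A\<in>K. p A = 0) \<longrightarrow>
     ((\<lambda>z. p (mat 1 + cscale z X)) has_field_derivative 0) (at 0)}"

definition lie_ideal :: "(complex^'n^'n) set \<Rightarrow> (complex^'n^'n) set \<Rightarrow> bool" where
  "lie_ideal I \<g> \<longleftrightarrow> I \<subseteq> \<g> \<and> 0 \<in> I \<and> (\<forall>X\<in>I. \<forall>Y\<in>I. X + Y \<in> I) \<and> (\<forall>c. \<forall>X\<in>I. cscale c X \<in> I) \<and>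
     (\<forall>X\<in>\<g>. \<forall>Y\<in>I. lie_bracket X Y \<in> I)"

definition semisimple_lie_algebra :: "(complex^'n^'n) set \<Rightarrow> bool" where
  "semisimple_lie_algebra \<g> \<longleftrightarrow>
     (\<forall>I. lie_ideal I \<g> \<and> (\<forall>X\<in>I. \<forall>Y\<in>I. lie_bracket X Y = 0) \<longrightarrow> I = {0})"

text \<open>The value on the tangent vector \<open>X\<close> of the differential at the identity of a regular function
  on \<open>K\<close>; for \<open>X\<close> in the Lie algebra of \<open>K\<close> it does not depend on the chosen extension to \<open>GL\<close>.\<close>

definition differential ::
  "(complex^'n^'n) set \<Rightarrow> (complex^'n^'n \<Rightarrow> complex) \<Rightarrow> complex^'n^'n \<Rightarrow> complex" where
  "differential K f X = (THE c. \<exists>p m. matrix_poly p \<and> (\<forall>A\<in>K. f A = p A / det A ^ m) \<and>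
     ((\<lambda>z. p (mat 1 + cscale z X) / det (mat 1 + cscale z X) ^ m) has_field_derivative c) (at 0))"


section \<open>Characters, roots and weights\<close>

text \<open>Characters are extensional functions, so that equal characters are equal functions.  The
  character group is written multiplicatively: what is usually denoted \<open>\<phi> + \<psi>\<close>, \<open>0\<close>, \<open>- \<phi>\<close> and
  \<open>n \<phi>\<close> is here the product, the constant \<open>1\<close>, the inverse and the power.\<close>

definition characters :: "(complex^'n^'n) set \<Rightarrow> (complex^'n^'n \<Rightarrow> complex) set" where
  "characters K = {\<phi> \<in> extensional K. regular_on K \<phi> \<and> (\<forall>x\<in>K. \<phi> x \<noteq> 0) \<and>
     (\<forall>x\<in>K. \<forall>y\<in>K. \<phi> (x ** y) = \<phi> x * \<phi> y)}"

definition char_group :: "(complex^'n^'n) set \<Rightarrow> (complex^'n^'n \<Rightarrow> complex) monoid" where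
  "char_group K = \<lparr>carrier = characters K, mult = (\<lambda>\<phi> \<psi>. \<lambda>x\<in>K. \<phi> x * \<psi> x), one = (\<lambda>x\<in>K. 1)\<rparr>"

definition root_space ::
  "(complex^'n^'n) set \<Rightarrow> (complex^'n^'n) set \<Rightarrow> (complex^'n^'n \<Rightarrow> complex) \<Rightarrow> (complex^'n^'n) set" where
  "root_space K T \<alpha> = {X \<in> lie_algebra K. \<forall>t\<in>T. t ** X ** matrix_inv t = cscale (\<alpha> t) X}"

definition roots ::
  "(complex^'n^'n) set \<Rightarrow> (complex^'n^'n) set \<Rightarrow> (complex^'n^'n \<Rightarrow> complex) set" where
  "roots K T = {\<alpha> \<in> characters T. \<alpha> \<noteq> \<one>\<^bsub>char_group T\<^esub> \<and> root_space K T \<alpha> \<noteq> {0}}"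

definition nonneg_combinations ::
  "(complex^'n^'n) set \<Rightarrow> (complex^'n^'n \<Rightarrow> complex) set \<Rightarrow> (complex^'n^'n \<Rightarrow> complex) set" where
  "nonneg_combinations T \<Delta> =
     {\<Otimes>\<^bsub>char_group T\<^esub>\<beta>\<in>\<Delta>. \<beta> [^]\<^bsub>char_group T\<^esub> n \<beta> | n :: (complex^'n^'n \<Rightarrow> complex) \<Rightarrow> nat. True}"

definition root_base ::
  "(complex^'n^'n) set \<Rightarrow> (complex^'n^'n \<Rightarrow> complex) set \<Rightarrow> (complex^'n^'n \<Rightarrow> complex) set \<Rightarrow> bool" where
  "root_base T \<Phi> \<Delta> \<longleftrightarrow> finite \<Delta> \<and> \<Delta> \<subseteq> \<Phi> \<and>
     (\<forall>n :: _ \<Rightarrow> int. (\<Otimes>\<^bsub>char_group T\<^esub>\<beta>\<in>\<Delta>. \<beta> [^]\<^bsub>char_group T\<^esub> n \<beta>) = \<one>\<^bsub>char_group T\<^esub>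
        \<longrightarrow> (\<forall>\<beta>\<in>\<Delta>. n \<beta> = 0)) \<and>
     (\<forall>\<alpha>\<in>\<Phi>. \<alpha> \<in> nonneg_combinations T \<Delta> \<or> inv\<^bsub>char_group T\<^esub> \<alpha> \<in> nonneg_combinations T \<Delta>)"

text \<open>The simple roots of \<open>K\<close> with respect to \<open>T \<subseteq> B\<close>: the positive roots are the roots of \<open>B\<close>.\<close>

definition simple_roots ::
  "(complex^'n^'n) set \<Rightarrow> (complex^'n^'n) set \<Rightarrow> (complex^'n^'n) set \<Rightarrow>
    (complex^'n^'n \<Rightarrow> complex) set \<Rightarrow> bool" where
  "simple_roots K T B \<Delta> \<longleftrightarrow> root_base T (roots K T) \<Delta> \<and>
     roots B T = roots K T \<inter> nonneg_combinations T \<Delta>"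

text \<open>Coroots are identified with elements of the Lie algebra of \<open>T\<close>, via the differential of the
  cocharacter at \<open>1\<close>: the coroot of \<open>\<alpha>\<close> is the element of the bracket of the root spaces of \<open>\<alpha>\<close> and
  \<open>- \<alpha>\<close> on which \<open>\<alpha>\<close> takes the value \<open>2\<close>.\<close>

definition coroot ::
  "(complex^'n^'n) set \<Rightarrow> (complex^'n^'n) set \<Rightarrow> (complex^'n^'n \<Rightarrow> complex) \<Rightarrow> complex^'n^'n" where
  "coroot K T \<alpha> = (THE h. (\<exists>X\<in>root_space K T \<alpha>. \<exists>Y\<in>root_space K T (inv\<^bsub>char_group T\<^esub> \<alpha>).
     h = lie_bracket X Y) \<and> differential T \<alpha> h = 2)"

definition fundamental_weight ::
  "(complex^'n^'n) set \<Rightarrow> (complex^'n^'n) set \<Rightarrow> (complex^'n^'n \<Rightarrow> complex) set \<Rightarrow>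
    (complex^'n^'n \<Rightarrow> complex) \<Rightarrow> (complex^'n^'n \<Rightarrow> complex) \<Rightarrow> bool" where
  "fundamental_weight K T \<Delta> \<alpha> \<omega> \<longleftrightarrow> \<omega> \<in> characters T \<and>
     (\<forall>\<beta>\<in>\<Delta>. differential T \<omega> (coroot K T \<beta>) = (if \<beta> = \<alpha> then 1 else 0))"


section \<open>Type \<open>G\<^sub>2\<close>\<close>

text \<open>Connected semisimple groups (equivalently, in characteristic \<open>0\<close>: with semisimple Lie algebra)
  together with a maximal torus.  The last two conjuncts, which say that the Lie algebra is the direct
  sum of that of \<open>T\<close> and of root spaces of dimension \<open>1\<close>, hold for every such pair; they are recorded
  as part of the notion so that root systems can be used without the general structure theory.\<close>

definition semisimple_pair :: "(complex^'n^'n) set \<Rightarrow> (complex^'n^'n) set \<Rightarrow> bool" where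
  "semisimple_pair K T \<longleftrightarrow> connected_algebraic_group K \<and> semisimple_lie_algebra (lie_algebra K) \<and>
     maximal_torus T K \<and>
     {X \<in> lie_algebra K. \<forall>t\<in>T. t ** X = X ** t} = lie_algebra T \<and>
     (\<forall>\<alpha>\<in>roots K T. \<exists>X. X \<noteq> 0 \<and> root_space K T \<alpha> = {cscale c X | c. True})"

text \<open>Coordinates of the short and long roots of the root system \<open>G\<^sub>2\<close> in the base consisting of
  the short simple root and the long simple root, in this order.\<close>

definition G2_short :: "(int \<times> int) set" where
  "G2_short = {(1, 0), (1, 1), (2, 1), (- 1, 0), (- 1, - 1), (- 2, - 1)}"

definition G2_long :: "(int \<times> int) set" where
  "G2_long = {(0, 1), (3, 1), (3, 2), (0, - 1), (- 3, - 1), (- 3, - 2)}"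

definition int_combinations ::
  "(complex^'n^'n) set \<Rightarrow> (complex^'n^'n \<Rightarrow> complex) \<Rightarrow> (complex^'n^'n \<Rightarrow> complex) \<Rightarrow>
    (int \<times> int) set \<Rightarrow> (complex^'n^'n \<Rightarrow> complex) set" where
  "int_combinations T \<alpha> \<alpha>' C =
     {\<alpha> [^]\<^bsub>char_group T\<^esub> a \<otimes>\<^bsub>char_group T\<^esub> \<alpha>' [^]\<^bsub>char_group T\<^esub> b | a b. (a, b) \<in> C}"

text \<open>\<open>G\<close> is the connected group of type \<open>G\<^sub>2\<close>, with simple roots \<open>\<alpha>\<^sub>1\<close> (short) and \<open>\<alpha>\<^sub>2\<close> (long).\<close>

definition type_G2 ::
  "(complex^'n^'n) set \<Rightarrow> (complex^'n^'n) set \<Rightarrow> (complex^'n^'n) set \<Rightarrow>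
    (complex^'n^'n \<Rightarrow> complex) \<Rightarrow> (complex^'n^'n \<Rightarrow> complex) \<Rightarrow> bool" where
  "type_G2 G T B \<alpha>\<^sub>1 \<alpha>\<^sub>2 \<longleftrightarrow> semisimple_pair G T \<and> \<alpha>\<^sub>1 \<noteq> \<alpha>\<^sub>2 \<and> simple_roots G T B {\<alpha>\<^sub>1, \<alpha>\<^sub>2} \<and>
     roots G T = int_combinations T \<alpha>\<^sub>1 \<alpha>\<^sub>2 (G2_short \<union> G2_long)"


section \<open>Parabolic subgroups and the extended weight monoid\<close>

text \<open>\<open>P\<close> is the parabolic subgroup of \<open>K\<close> containing \<open>B'\<close> (the Borel subgroup opposite to the one
  defining the simple roots \<open>\<Delta>\<close>) that corresponds to \<open>I \<subseteq> \<Delta>\<close>.\<close>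

definition parabolic_of ::
  "(complex^'n^'n) set \<Rightarrow> (complex^'n^'n) set \<Rightarrow> (complex^'n^'n) set \<Rightarrow>
    (complex^'n^'n \<Rightarrow> complex) set \<Rightarrow> (complex^'n^'n \<Rightarrow> complex) set \<Rightarrow> (complex^'n^'n) set \<Rightarrow> bool" where
  "parabolic_of K T B' \<Delta> I P \<longleftrightarrow> parabolic_subgroup P K \<and> B' \<subseteq> P \<and>
     (\<exists>L. levi_subgroup L P \<and> T \<subseteq> L \<and> root_base T (roots L T) (\<Delta> - I))"

text \<open>Characters of \<open>B\<close> and \<open>P\<close> are identified with their restrictions to \<open>T \<subseteq> B\<close> and \<open>T' \<subseteq> P\<close>.\<close>

definition extended_weight_monoid ::
  "(complex^'n^'n) set \<Rightarrow> (complex^'n^'n) set \<Rightarrow> (complex^'n^'n) set \<Rightarrow>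
   (complex^'n^'n) set \<Rightarrow> (complex^'n^'n) set \<Rightarrow>
   ((complex^'n^'n \<Rightarrow> complex) \<times> (complex^'n^'n \<Rightarrow> complex)) set" where
  "extended_weight_monoid G B T P T' =
     {(restrict \<omega> T, restrict \<phi> T') | \<omega> \<phi>. \<omega> \<in> characters B \<and> \<phi> \<in> characters P \<and>
        (\<exists>f. regular_on G f \<and> (\<exists>g\<in>G. f g \<noteq> 0) \<and>
          (\<forall>b\<in>B. \<forall>g\<in>G. \<forall>p\<in>P. f (matrix_inv b ** g ** p) = \<omega> b * f g * \<phi> p))}"

text \<open>The submonoid \<open>S\<close> of the commutative monoid \<open>M\<close> is freely generated by the finite set \<open>A\<close>.\<close>

definition freely_generated :: "('a, 'b) monoid_scheme \<Rightarrow> 'a set \<Rightarrow> 'a set \<Rightarrow> bool" where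
  "freely_generated M S A \<longleftrightarrow> finite A \<and> A \<subseteq> carrier M \<and>
     bij_betw (\<lambda>n. \<Otimes>\<^bsub>M\<^esub>a\<in>A. a [^]\<^bsub>M\<^esub> n a) (A \<rightarrow>\<^sub>E (UNIV :: nat set)) S"

end

theory Submission
  imports Defs "HOL-Complex_Analysis.Cauchy_Integral_Formula" "HOL-Library.Function_Algebras"
begin

text \<open>Roots of \<open>G\<close> are written in the base \<open>a\<^sub>1\<close> (short), \<open>a\<^sub>2\<close>
  (long), so that \<open>\<omega>\<^sub>1 = 2a\<^sub>1 + a\<^sub>2\<close> and \<open>\<omega>\<^sub>2 = 3a\<^sub>1 +
  2a\<^sub>2\<close>. The simple roots of \<open>H\<close> are \<open>a\<^sub>2\<close> and
  \<open>3a\<^sub>1 + a\<^sub>2\<close>, and its fundamental weights are \<open>2a\<^sub>1 + a\<^sub>2\<close> and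
  \<open>a\<^sub>1 + a\<^sub>2\<close>. The reflection in \<open>a\<^sub>1\<close> normalises \<open>H\<close> and
  exchanges its two simple roots, and right translation by a representative of it exchanges the two parabolic subgroups
  (\<open>right_translate\<close>). So let \<open>P\<close> be the one whose Levi subgroup has the root
  \<open>a\<^sub>2\<close>; the weight \<open>\<chi>\<close> of a semi-invariant function is then \<open>-n\<close>
  times \<open>\<varpi> = 2a\<^sub>1 + a\<^sub>2\<close>. The theorem says that the pairs \<open>(a\<omega>\<^sub>1 +
  b\<omega>\<^sub>2, - n\<varpi>)\<close> in the extended weight monoid are those with
  \<open>b \<le> n \<le> a + b\<close>: these are the combinations of the three generators with the unique coefficients
  \<open>a + b - n\<close>, \<open>n - b\<close> and \<open>b\<close>.

  The proof takes place on Lie algebras. A connected group is generated by the exponentials of its Lie algebra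
  (\<open>connected_algebraic_induct\<close>), so semi-invariance of a regular function under \<open>B\<close> from the
  left and under \<open>P\<close> from the right can be tested by the left and right invariant derivations; and a
  function is determined by the values at one point of all words in left invariant derivations applied to it
  (\<open>words_determine\<close>).

  The inequalities. Non-negativity of \<open>a\<close> and \<open>b\<close> is the theory of \<open>sl\<^sub>2\<close>.
  If the Lie algebra of \<open>G\<close> is the sum of \<open>Ad(g\<^sup>-\<^sup>1)\<close> applied to the Lie algebra
  of \<open>B\<close>, of the Lie algebra of \<open>P\<close> and of the span of a set \<open>C\<close>, then a
  semi-invariant function \<open>f \<noteq> 0\<close> has a word in elements of \<open>C\<close> that does not vanish at
  \<open>g\<close> (\<open>word_reduction\<close>); comparing the two actions of a suitable element of the Lie algebra
  of \<open>T\<close> on this value restricts the weights. At the identity \<open>C\<close> consists of the negative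
  short root vectors, and the result is \<open>n \<le> a + b\<close> (\<open>upper_bound_1\<close>). At the exponential
  of a root vector of \<open>-(2a\<^sub>1 + a\<^sub>2)\<close> two root vectors of \<open>H\<close> are enough, one of
  which annihilates \<open>f\<close> when it is applied more than \<open>n\<close> times; the result is
  \<open>b \<le> n\<close> (\<open>upper_bound_2\<close>).

  The generators. A matrix coefficient of the adjoint representation has weight \<open>\<omega>\<^sub>2\<close> under
  \<open>B\<close> and is a lowest weight vector from the right (\<open>lowest_function_2\<close>). The representation
  of highest weight \<open>\<omega>\<^sub>1\<close> occurs in the third symmetric power of the adjoint representation,
  which provides a function for \<open>\<omega>\<^sub>1\<close> as an explicit cubic polynomial in such coefficients
  (\<open>lowest_function_1\<close>). The function for \<open>\<omega>\<^sub>1\<close>, and derivatives of both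
  functions along single root vectors, have the weights of the three generators (\<open>generators_Q0\<close>). Products
  of semi-invariant functions are semi-invariant, and not zero because \<open>G\<close> is connected, so that the
  generated monoid consists of weights.

  The structure theory of \<open>G\<close> that enters is derived from the decomposition into root spaces and the
  absence of non-zero abelian ideals: that every root has a coroot (\<open>no_bad\<close>), which gives the Cartan
  matrix and the root strings, that the determinant is \<open>1\<close> on \<open>G\<close> (\<open>det_G\<close>), and
  the roots of the parabolic subgroups (\<open>parabolic_roots\<close>).\<close>

section \<open>The matrix exponential\<close>

lemma cscale_nth [simp]: "cscale c X $ i $ j = c * X $ i $ j"
  by (simp add: cscale_def)

lemma vector_space_cscale: "vector_space (cscale :: complex \<Rightarrow> complex^'n^'n \<Rightarrow> complex^'n^'n)"
  by standard (auto simp: vec_eq_iff algebra_simps)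

interpretation cm: vector_space "cscale :: complex \<Rightarrow> complex^'n^'n \<Rightarrow> complex^'n^'n"
  by (rule vector_space_cscale)

lemma cscale_simps [simp]:
  "cscale 1 X = X" "cscale 0 X = 0" "cscale c 0 = (0 :: complex^'n^'n)" "cscale a (cscale b X) = cscale (a * b) X"
  "cscale (-1) X = - X"
  by (auto simp: vec_eq_iff)

lemma mm_nth: "(A ** B) $ i $ j = (\<Sum>k\<in>UNIV. A $ i $ k * B $ k $ j)"
  by (simp add: matrix_matrix_mult_def)

lemma cscale_mult_left [simp]: "cscale c A ** B = cscale c (A ** B :: complex^'n^'n)"
  by (simp add: vec_eq_iff mm_nth sum_distrib_left mult.assoc)

lemma cscale_mult_right [simp]: "A ** cscale c B = cscale c (A ** B :: complex^'n^'n)"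
  by (simp add: vec_eq_iff mm_nth sum_distrib_left algebra_simps)

lemma matrix_distribs:
  fixes A B C :: "complex^'n^'n"
  shows "A ** (B + C) = A ** B + A ** C" "(A + B) ** C = A ** C + B ** C"
    "A ** (B - C) = A ** B - A ** C" "(A - B) ** C = A ** C - B ** C"
    "A ** (- B) = - (A ** B)" "(- A) ** B = - (A ** B)"
  by (simp_all add: vec_eq_iff mm_nth algebra_simps sum.distrib sum_subtractf sum_negf)

lemma matrix_zero_mult [simp]: "A ** (0 :: complex^'n^'n) = 0" "(0 :: complex^'n^'n) ** A = 0"
  by (simp_all add: vec_eq_iff mm_nth)

definition mpow :: "complex^'n^'n \<Rightarrow> nat \<Rightarrow> complex^'n^'n" where
  "mpow X k = (((**) X) ^^ k) (mat 1)"

lemma mpow_0 [simp]: "mpow X 0 = mat 1"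
  and mpow_Suc: "mpow X (Suc k) = X ** mpow X k"
  by (simp_all add: mpow_def)

lemma mpow_commute: "X ** mpow X k = mpow X k ** X"
proof (induction k)
  case (Suc k)
  have "mpow X (Suc k) ** X = X ** (mpow X k ** X)"
    by (simp add: mpow_Suc matrix_mul_assoc)
  also have "\<dots> = X ** (X ** mpow X k)"
    by (simp only: Suc)
  finally show ?case
    by (simp add: mpow_Suc)
qed simp

lemma mpow_cscale: "mpow (cscale c X) k = cscale (c ^ k) (mpow X k)"
  by (induction k) (simp_all add: mpow_Suc algebra_simps)

lemma norm_nth_nth_le: "cmod (X $ i $ j) \<le> norm (X :: complex^'n^'n)"
  by (meson Finite_Cartesian_Product.norm_nth_le order_trans)

text \<open>The crude bound \<open>CARD('n) * norm X\<close> for the entries is enough for convergence,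
  and needs no operator norm.\<close>

lemma mpow_bound: "cmod (mpow X k $ i $ j) \<le> (CARD('n) * norm (X :: complex^'n^'n)) ^ k"
proof (induction k arbitrary: i j)
  case 0
  then show ?case by (simp add: mat_def)
next
  case (Suc k)
  have "cmod (mpow X (Suc k) $ i $ j) \<le> (\<Sum>l\<in>UNIV. cmod (X $ i $ l) * cmod (mpow X k $ l $ j))"
    by (simp add: mpow_Suc mm_nth norm_mult flip: norm_mult) (metis (no_types, lifting) norm_mult norm_sum sum.cong)
  also have "\<dots> \<le> (\<Sum>l\<in>(UNIV :: 'n set). norm X * (CARD('n) * norm X) ^ k)"
    by (intro sum_mono mult_mono norm_nth_nth_le Suc.IH) auto
  finally show ?case by simp
qed

text \<open>Entrywise convergence of the exponential series suffices: only finitely many entries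
  occur.\<close>

definition mexp :: "complex^'n^'n \<Rightarrow> complex^'n^'n" where
  "mexp X = (\<chi> i j. \<Sum>k. mpow X k $ i $ j / fact k)"

lemma summable_mexp_majorant: "summable (\<lambda>k. (c :: real) ^ k / fact k)"
  using summable_exp[of c] by (simp add: field_simps)

lemma summable_mexp: "summable (\<lambda>k. mpow (X :: complex^'n^'n) k $ i $ j / fact k)"
proof (rule summable_comparison_test'[where N = 0])
  show "summable (\<lambda>k. (CARD('n) * norm X) ^ k / fact k)"
    by (rule summable_mexp_majorant)
  show "norm (mpow X k $ i $ j / fact k) \<le> (CARD('n) * norm X) ^ k / fact k" for k
    using mpow_bound[of X k i j] by (simp add: norm_divide divide_right_mono)
qed

text \<open>Curves of matrices are differentiated entrywise, with respect to a complex parameter.\<close>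

definition mderiv :: "(complex \<Rightarrow> complex^'n^'n) \<Rightarrow> complex^'n^'n \<Rightarrow> complex \<Rightarrow> bool" where
  "mderiv \<gamma> D z \<longleftrightarrow> (\<forall>i j. ((\<lambda>w. \<gamma> w $ i $ j) has_field_derivative D $ i $ j) (at z))"

lemma mderiv_mult:
  assumes "mderiv f f' z" "mderiv g g' z"
  shows "mderiv (\<lambda>w. f w ** g w) (f' ** g z + f z ** g') z"
  using assms unfolding mderiv_def mm_nth vector_add_component sum.distrib[symmetric]
  by (auto intro!: DERIV_sum derivative_eq_intros)

lemma mderiv_const [simp]: "mderiv (\<lambda>w. A) 0 z"
  by (simp add: mderiv_def)

lemma mderiv_linear: "mderiv (\<lambda>w. cscale w X) X z"
  by (auto simp: mderiv_def intro!: derivative_eq_intros)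

lemma mderiv_add: "mderiv f f' z \<Longrightarrow> mderiv g g' z \<Longrightarrow> mderiv (\<lambda>w. f w + g w) (f' + g') z"
  by (auto simp: mderiv_def intro!: derivative_eq_intros)

lemma mderiv_reflect:
  assumes "mderiv f f' (c - z)"
  shows "mderiv (\<lambda>w. f (c - w)) (- f') z"
  unfolding mderiv_def
proof (intro allI)
  fix i j
  have "((\<lambda>w. f w $ i $ j) has_field_derivative f' $ i $ j) (at (c - z))"
    using assms by (simp add: mderiv_def)
  then have "((\<lambda>w. f (c - w) $ i $ j) has_field_derivative f' $ i $ j * (- 1)) (at z)"
    by (rule DERIV_chain2) (auto intro!: derivative_eq_intros)
  then show "((\<lambda>w. f (c - w) $ i $ j) has_field_derivative (- f') $ i $ j) (at z)"
    by simp
qed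

lemma mderiv_zero_const:
  assumes "\<And>z. mderiv f 0 z"
  shows "f z = f w"
proof -
  have "f z $ i $ j = f w $ i $ j" for i j
  proof -
    have "((\<lambda>w. f w $ i $ j) has_field_derivative 0) (at x)" for x
      using assms by (simp add: mderiv_def)
    then show ?thesis
      using has_field_derivative_zero_constant[of UNIV "\<lambda>w. f w $ i $ j"] by (metis UNIV_I convex_UNIV)
  qed
  then show ?thesis by (simp add: vec_eq_iff)
qed

lemma mderiv_mexp: "mderiv (\<lambda>w. mexp (cscale w X)) (mexp (cscale z X) ** X) z" (is ?A)
  and mexp_commute: "X ** mexp (cscale z X) = mexp (cscale z X) ** X" (is ?B)
proof -
  define a where "a i j k = mpow X k $ i $ j / fact k" for i j k
  have E: "mexp (cscale w X) $ i $ j = (\<Sum>k. a i j k * w ^ k)" for w i j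
    by (simp add: mexp_def a_def mpow_cscale algebra_simps)
  have sm: "summable (\<lambda>k. a i j k * w ^ k)" for i j w
    using summable_mexp[of "cscale w X" i j] by (simp add: a_def mpow_cscale algebra_simps)
  have diffs: "diffs (a i j) k = mpow X (Suc k) $ i $ j / fact k" for i j k
    by (simp add: diffs_def a_def del: of_nat_Suc)
  have r: "(\<Sum>k. diffs (a i j) k * z ^ k) = (mexp (cscale z X) ** X) $ i $ j" for i j
  proof -
    have "diffs (a i j) k * z ^ k = (\<Sum>l\<in>UNIV. (a i l k * z ^ k) * X $ l $ j)" for k
      unfolding diffs mpow_Suc mpow_commute mm_nth a_def sum_distrib_right sum_divide_distrib
      by (simp add: field_simps)
    then have "(\<Sum>k. diffs (a i j) k * z ^ k) = (\<Sum>k. \<Sum>l\<in>UNIV. (a i l k * z ^ k) * X $ l $ j)"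
      by simp
    also have "\<dots> = (\<Sum>l\<in>UNIV. \<Sum>k. (a i l k * z ^ k) * X $ l $ j)"
      by (intro suminf_sum summable_mult2 sm)
    also have "\<dots> = (\<Sum>l\<in>UNIV. (\<Sum>k. a i l k * z ^ k) * X $ l $ j)"
      by (simp add: suminf_mult2[OF sm])
    finally show ?thesis by (simp add: mm_nth E)
  qed
  have l: "(\<Sum>k. diffs (a i j) k * z ^ k) = (X ** mexp (cscale z X)) $ i $ j" for i j
  proof -
    have "diffs (a i j) k * z ^ k = (\<Sum>l\<in>UNIV. X $ i $ l * (a l j k * z ^ k))" for k
      unfolding diffs mpow_Suc mm_nth a_def sum_distrib_right sum_divide_distrib
      by (simp add: field_simps)
    then have "(\<Sum>k. diffs (a i j) k * z ^ k) = (\<Sum>k. \<Sum>l\<in>UNIV. X $ i $ l * (a l j k * z ^ k))"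
      by simp
    also have "\<dots> = (\<Sum>l\<in>UNIV. \<Sum>k. X $ i $ l * (a l j k * z ^ k))"
      by (intro suminf_sum summable_mult sm)
    also have "\<dots> = (\<Sum>l\<in>UNIV. X $ i $ l * (\<Sum>k. a l j k * z ^ k))"
      by (simp add: suminf_mult[OF sm])
    finally show ?thesis by (simp add: mm_nth E)
  qed
  show ?A
    unfolding mderiv_def E
    using termdiffs_strong_converges_everywhere[OF sm] r by metis
  show ?B
    using l r by (simp add: vec_eq_iff)
qed

lemma mexp_0 [simp]: "mexp (0 :: complex^'n^'n) = mat 1"
proof -
  have "mpow (0 :: complex^'n^'n) k = (if k = 0 then mat 1 else 0)" for k
    by (cases k) (auto simp: mpow_Suc)
  then have "(\<Sum>k. mpow (0 :: complex^'n^'n) k $ i $ j / fact k) = mat 1 $ i $ j" for i j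
    by (subst suminf_finite[of "{0::nat}"]) auto
  then show ?thesis by (simp add: mexp_def vec_eq_iff)
qed

lemma mderiv_mexp_0: "mderiv (\<lambda>w. mexp (cscale w X)) X 0"
  using mderiv_mexp[of X 0] by simp

lemma mderiv_eq: "mderiv f a z \<Longrightarrow> a = b \<Longrightarrow> mderiv f b z"
  by simp

lemma mexp_add: "mexp (cscale (a + b) X) = mexp (cscale a X) ** mexp (cscale b X)"
proof -
  let ?c = "a + b"
  let ?F = "\<lambda>w. mexp (cscale (?c - w) X) ** mexp (cscale w X)"
  have "mderiv ?F 0 z" for z
    by (rule mderiv_eq[OF mderiv_mult[OF mderiv_reflect[OF mderiv_mexp] mderiv_mexp]])
      (simp add: matrix_distribs matrix_mul_assoc[symmetric] mexp_commute)
  from mderiv_zero_const[OF this, of b 0] show ?thesis by simp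
qed

lemma mexp_minus [simp]: "mexp X ** mexp (- X) = mat 1" "mexp (- X) ** mexp X = mat 1"
  using mexp_add[of 1 "-1" X] mexp_add[of "-1" 1 X] by simp_all

lemma matrix_inv_unique: "A ** B = mat 1 \<Longrightarrow> B ** A = mat 1 \<Longrightarrow> matrix_inv A = (B :: complex^'n^'n)"
proof -
  assume *: "A ** B = mat 1" "B ** A = mat 1"
  then have "A ** matrix_inv A = mat 1 \<and> matrix_inv A ** A = mat 1"
    unfolding matrix_inv_def by (rule someI[of "\<lambda>A'. A ** A' = mat 1 \<and> A' ** A = mat 1", OF conjI])
  with * show ?thesis
    by (metis matrix_mul_assoc matrix_mul_lid matrix_mul_rid)
qed

lemma invertible_mexp [simp]: "invertible (mexp X)"
  using mexp_minus invertible_def by blast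

lemma matrix_inv_mexp [simp]: "matrix_inv (mexp X) = mexp (- X)"
  by (rule matrix_inv_unique) (fact mexp_minus)+


text \<open>A curve that solves the adjoint differential equation is the conjugate of its starting point.\<close>

lemma mexp_conj_unique:
  assumes "\<And>z. mderiv Q (X ** Q z - Q z ** X) z"
  shows "mexp (cscale z X) ** Q 0 ** mexp (- cscale z X) = Q z"
proof -
  let ?F = "\<lambda>w. mexp (cscale (0 - w) X) ** (Q w ** mexp (cscale w X))"
  have "mderiv ?F 0 w" for w
    by (rule mderiv_eq[OF mderiv_mult[OF mderiv_reflect[OF mderiv_mexp] mderiv_mult[OF assms mderiv_mexp]]])
      (simp add: matrix_distribs matrix_mul_assoc[symmetric] mexp_commute)
  from mderiv_zero_const[OF this, of z 0]
  have "mexp (- cscale z X) ** (Q z ** mexp (cscale z X)) = Q 0" by simp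
  then have "mexp (cscale z X) ** Q 0 ** mexp (- cscale z X)
    = (mexp (cscale z X) ** mexp (- cscale z X)) ** Q z ** (mexp (cscale z X) ** mexp (- cscale z X))"
    by (metis matrix_mul_assoc)
  then show ?thesis by simp
qed

lemma continuous_on_mpow_nth: "continuous_on S (\<lambda>X :: complex^'n^'n. mpow X k $ i $ j)"
proof (induction k arbitrary: i j)
  case (Suc k)
  then show ?case
    unfolding mpow_Suc mm_nth by (intro continuous_on_sum continuous_on_mult Suc.IH continuous_intros)
qed simp

lemma continuous_on_mexp: "continuous_on S (mexp :: complex^'n^'n \<Rightarrow> _)"
proof -
  have "isCont (mexp :: complex^'n^'n \<Rightarrow> _) X" for X :: "complex^'n^'n"
  proof -
    define r where "r = norm X + 1"
    have "uniform_limit (ball 0 r) (\<lambda>n Y. \<Sum>k<n. mpow Y k $ i $ j / fact k)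
        (\<lambda>Y. \<Sum>k. mpow Y k $ i $ j / fact k) sequentially" for i j :: 'n
    proof (rule Weierstrass_m_test)
      show "norm (mpow Y k $ i $ j / fact k) \<le> (CARD('n) * r) ^ k / fact k" if "Y \<in> ball 0 r" for k Y
      proof -
        have "(CARD('n) * norm Y) ^ k \<le> (CARD('n) * r) ^ k"
          using that by (intro power_mono mult_left_mono) auto
        with mpow_bound[of Y k i j] show ?thesis
          by (simp add: norm_divide divide_right_mono)
      qed
    qed (rule summable_mexp_majorant)
    then have "continuous_on (ball 0 r) (\<lambda>Y. \<Sum>k. mpow Y k $ i $ j / fact k)" for i j :: 'n
      by (rule uniform_limit_theorem[rotated])
        (auto intro!: always_eventually continuous_intros continuous_on_mpow_nth)
    then have "continuous_on (ball 0 r) (mexp :: complex^'n^'n \<Rightarrow> _)"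
      unfolding mexp_def by (intro continuous_on_vec_lambda)
    moreover have "X \<in> ball 0 r"
      by (simp add: r_def)
    ultimately show ?thesis
      by (simp add: continuous_on_eq_continuous_at)
  qed
  then show ?thesis
    by (simp add: continuous_at_imp_continuous_on)
qed

text \<open>With constants that are uniform in \<open>X\<close> on the unit ball, so that the exponential
  is differentiable at \<open>0\<close>.\<close>

lemma mexp_remainder:
  fixes X :: "complex^'n^'n"
  assumes "norm X \<le> 1"
  shows "cmod ((mexp X - mat 1 - X) $ i $ j) \<le> (CARD('n) ^ 2 * exp (CARD('n))) * norm X ^ 2"
proof -
  let ?N = "real CARD('n)" and ?a = "\<lambda>k. mpow X k $ i $ j / fact k"
  have "(\<Sum>k. ?a k) = (\<Sum>k. ?a (k + 2)) + (\<Sum>k<2. ?a k)"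
    by (rule suminf_split_initial_segment[OF summable_mexp])
  then have eq: "(mexp X - mat 1 - X) $ i $ j = (\<Sum>k. ?a (k + 2))"
    by (simp add: mexp_def numeral_2_eq_2 mpow_Suc)
  have b: "norm (?a (k + 2)) \<le> (?N ^ 2 * norm X ^ 2) * (?N ^ k / fact k)" for k
  proof -
    have "norm (?a (k + 2)) \<le> (?N * norm X) ^ (k + 2) / fact (k + 2)"
      using mpow_bound[of X "k + 2" i j] unfolding norm_divide norm_fact by (intro divide_right_mono) auto
    also have "\<dots> \<le> (?N * norm X) ^ (k + 2) / fact k"
    proof (rule divide_left_mono)
      show "(fact k :: real) \<le> fact (k + 2)"
        by (rule fact_mono) simp
    qed auto
    also have "\<dots> = (?N ^ 2 * norm X ^ 2) * (?N ^ k * norm X ^ k / fact k)"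
      by (simp add: power_add power_mult_distrib power2_eq_square)
    also have "\<dots> \<le> (?N ^ 2 * norm X ^ 2) * (?N ^ k * 1 / fact k)"
      using assms by (intro mult_left_mono divide_right_mono power_le_one) auto
    finally show ?thesis by simp
  qed
  have sm: "summable (\<lambda>k. (?N ^ 2 * norm X ^ 2) * (?N ^ k / fact k))"
    by (intro summable_mult summable_mexp_majorant)
  have "norm (\<Sum>k. ?a (k + 2)) \<le> (\<Sum>k. (?N ^ 2 * norm X ^ 2) * (?N ^ k / fact k))"
    by (rule norm_suminf_le[OF b sm])
  also have "\<dots> = (?N ^ 2 * norm X ^ 2) * exp ?N"
    by (subst suminf_mult[OF summable_mexp_majorant]) (simp add: exp_def divide_inverse mult.commute scaleR_conv_of_real)
  finally show ?thesis
    unfolding eq by (simp only: mult_ac of_nat_power)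
qed


section \<open>Invariant derivations of polynomial functions\<close>

text \<open>The left invariant vector field on \<open>GL\<close> with value \<open>X\<close> at the
  identity, as a derivation of polynomial functions.\<close>

definition ideriv :: "complex^'n^'n \<Rightarrow> (complex^'n^'n \<Rightarrow> complex) \<Rightarrow> complex^'n^'n \<Rightarrow> complex" where
  "ideriv X p A = deriv (\<lambda>z. p (A + cscale z (A ** X))) 0"

lemma matrix_poly_ideriv_curve:
  assumes "matrix_poly p"
  shows "matrix_poly (ideriv X p) \<and>
    (\<forall>\<gamma> z. mderiv \<gamma> (\<gamma> z ** X) z \<longrightarrow> ((\<lambda>w. p (\<gamma> w)) has_field_derivative ideriv X p (\<gamma> z)) (at z))"
    (is "_ \<and> ?C p (ideriv X p)")
proof -
  have eq: "ideriv X p = d" if "?C p d" for p d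
  proof
    fix A
    have "mderiv (\<lambda>z. A + cscale z (A ** X)) (A ** X) 0"
      using mderiv_add[OF mderiv_const mderiv_linear[of "A ** X" 0], of A] by simp
    then have "((\<lambda>z. p (A + cscale z (A ** X))) has_field_derivative d A) (at 0)"
      using that[rule_format, of "\<lambda>z. A + cscale z (A ** X)" 0] by simp
    then show "ideriv X p A = d A"
      by (simp add: ideriv_def DERIV_imp_deriv)
  qed
  have "\<exists>d. matrix_poly d \<and> ?C p d"
    using assms
  proof induction
    case (const c)
    show ?case by (rule exI[of _ "\<lambda>A. 0"]) (auto intro: matrix_poly.const)
  next
    case (entry i j)
    have "matrix_poly (\<lambda>A. \<Sum>k\<in>K. A $ i $ k * X $ k $ j)" if "finite K" for K
      using that by (induction K) (auto intro!: matrix_poly.intros)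
    then show ?case
      by (intro exI[of _ "\<lambda>A. (A ** X) $ i $ j"]) (auto simp: mderiv_def mm_nth)
  next
    case (add p q)
    then obtain d e where "matrix_poly d \<and> ?C p d" "matrix_poly e \<and> ?C q e" by blast
    then show ?case
      by (intro exI[of _ "\<lambda>A. d A + e A"]) (auto intro!: matrix_poly.intros derivative_eq_intros)
  next
    case (mult p q)
    then obtain d e where *: "matrix_poly d \<and> ?C p d" "matrix_poly e \<and> ?C q e" by blast
    then have "?C (\<lambda>A. p A * q A) (\<lambda>A. d A * q A + p A * e A)"
    proof (intro allI impI)
      fix \<gamma> z
      assume "mderiv \<gamma> (\<gamma> z ** X) z"
      with * have "((\<lambda>w. p (\<gamma> w)) has_field_derivative d (\<gamma> z)) (at z)"
        "((\<lambda>w. q (\<gamma> w)) has_field_derivative e (\<gamma> z)) (at z)"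
        by auto
      from DERIV_mult'[OF this]
      show "((\<lambda>w. p (\<gamma> w) * q (\<gamma> w)) has_field_derivative d (\<gamma> z) * q (\<gamma> z) + p (\<gamma> z) * e (\<gamma> z)) (at z)"
        by (simp add: algebra_simps)
    qed
    then show ?case
      using * mult.hyps by (intro exI[of _ "\<lambda>A. d A * q A + p A * e A"]) (auto intro!: matrix_poly.intros)
  qed
  with eq show ?thesis by metis
qed

lemma matrix_poly_ideriv [intro]: "matrix_poly p \<Longrightarrow> matrix_poly (ideriv X p)"
  using matrix_poly_ideriv_curve by blast

lemma ideriv_curve:
  "matrix_poly p \<Longrightarrow> mderiv \<gamma> (\<gamma> z ** X) z \<Longrightarrow> ((\<lambda>w. p (\<gamma> w)) has_field_derivative ideriv X p (\<gamma> z)) (at z)"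
  using matrix_poly_ideriv_curve by blast

lemma ideriv_line:
  "matrix_poly p \<Longrightarrow> ((\<lambda>z. p (A + cscale z (A ** X))) has_field_derivative ideriv X p A) (at 0)"
  using ideriv_curve[of p "\<lambda>z. A + cscale z (A ** X)" 0 X]
    mderiv_add[OF mderiv_const mderiv_linear[of "A ** X" 0], of A] by simp

lemma ideriv_line_1:
  "matrix_poly p \<Longrightarrow> ((\<lambda>z. p (mat 1 + cscale z X)) has_field_derivative ideriv X p (mat 1)) (at 0)"
  using ideriv_line[of p "mat 1" X] by simp

lemma mderiv_mexp_right: "mderiv (\<lambda>w. A ** mexp (cscale w X)) (A ** mexp (cscale z X) ** X) z"
  by (rule mderiv_eq[OF mderiv_mult[OF mderiv_const mderiv_mexp]]) (simp add: matrix_mul_assoc)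

lemma ideriv_mexp:
  "matrix_poly p \<Longrightarrow> ((\<lambda>w. p (A ** mexp (cscale w X))) has_field_derivative ideriv X p (A ** mexp (cscale z X))) (at z)"
  by (rule ideriv_curve[OF _ mderiv_mexp_right])

lemma ideriv_unique:
  assumes "matrix_poly p" "((\<lambda>w. p (A ** mexp (cscale w X))) has_field_derivative d) (at 0)"
  shows "ideriv X p A = d"
  using ideriv_mexp[OF assms(1), of A X 0] assms(2) DERIV_unique by fastforce

lemma ideriv_const [simp]: "ideriv X (\<lambda>A. c) = (\<lambda>A. 0)"
  by (rule ext) (rule ideriv_unique, auto intro: matrix_poly.const)

lemma ideriv_entry [simp]: "ideriv X (\<lambda>A. A $ i $ j) = (\<lambda>A. (A ** X) $ i $ j)"
proof (rule ext, rule ideriv_unique)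
  show "((\<lambda>w. (A ** mexp (cscale w X)) $ i $ j) has_field_derivative (A ** X) $ i $ j) (at 0)" for A
    using mderiv_mexp_right[of A X 0] by (simp add: mderiv_def)
qed (rule matrix_poly.entry)

lemma ideriv_add:
  "matrix_poly p \<Longrightarrow> matrix_poly q \<Longrightarrow> ideriv X (\<lambda>A. p A + q A) = (\<lambda>A. ideriv X p A + ideriv X q A)"
  by (rule ext, rule ideriv_unique)
    (auto intro!: matrix_poly.intros derivative_eq_intros ideriv_mexp[where z = 0, simplified])

lemma ideriv_mult:
  "matrix_poly p \<Longrightarrow> matrix_poly q \<Longrightarrow>
    ideriv X (\<lambda>A. p A * q A) = (\<lambda>A. ideriv X p A * q A + p A * ideriv X q A)"
proof (rule ext, rule ideriv_unique)
  fix A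
  assume *: "matrix_poly p" "matrix_poly q"
  show "((\<lambda>w. p (A ** mexp (cscale w X)) * q (A ** mexp (cscale w X))) has_field_derivative
      ideriv X p A * q A + p A * ideriv X q A) (at 0)"
    using DERIV_mult'[OF ideriv_mexp[OF *(1), of A X 0] ideriv_mexp[OF *(2), of A X 0]]
    by (simp add: algebra_simps)
qed (auto intro!: matrix_poly.intros)

lemma ideriv_cmult: "matrix_poly p \<Longrightarrow> ideriv X (\<lambda>A. c * p A) = (\<lambda>A. c * ideriv X p A)"
  using ideriv_mult[OF matrix_poly.const, of p X c] by simp

lemma matrix_poly_cmult: "matrix_poly p \<Longrightarrow> matrix_poly (\<lambda>A. c * p A)"
  by (intro matrix_poly.intros)

lemma matrix_poly_sum: "(\<And>i. i \<in> I \<Longrightarrow> matrix_poly (p i)) \<Longrightarrow> matrix_poly (\<lambda>A. \<Sum>i\<in>I. p i A)"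
  by (induction I rule: infinite_finite_induct) (auto intro!: matrix_poly.intros)

lemma matrix_poly_prod: "(\<And>i. i \<in> I \<Longrightarrow> matrix_poly (p i)) \<Longrightarrow> matrix_poly (\<lambda>A. \<Prod>i\<in>I. p i A)"
  by (induction I rule: infinite_finite_induct) (auto intro!: matrix_poly.intros)

lemma matrix_poly_power: "matrix_poly p \<Longrightarrow> matrix_poly (\<lambda>A. p A ^ k)"
  by (induction k) (auto intro!: matrix_poly.intros)

lemma matrix_poly_det: "matrix_poly (det :: complex^'n^'n \<Rightarrow> complex)"
  unfolding det_def by (intro matrix_poly_sum matrix_poly_cmult matrix_poly_prod matrix_poly.entry)

text \<open>Polynomial maps between spaces of matrices.\<close>

lemma matrix_poly_comp:
  assumes "matrix_poly p" "\<And>i j. matrix_poly (\<lambda>A. F A $ i $ j)"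
  shows "matrix_poly (\<lambda>A. p (F A))"
  using assms(1) by induction (auto intro!: matrix_poly.intros assms(2))

lemma matrix_poly_mult_right: "matrix_poly p \<Longrightarrow> matrix_poly (\<lambda>A. p (A ** C))"
  and matrix_poly_mult_left: "matrix_poly p \<Longrightarrow> matrix_poly (\<lambda>A. p (C ** A))"
  by (auto elim!: matrix_poly_comp simp: mm_nth intro!: matrix_poly_sum matrix_poly.intros)

lemma ideriv_lin:
  assumes "matrix_poly p"
  shows "ideriv (X + Y) p A = ideriv X p A + ideriv Y p A" "ideriv (cscale c X) p A = c * ideriv X p A"
  using assms
  by (induction) (simp_all add: ideriv_add ideriv_mult matrix_distribs algebra_simps)

lemma lie_bracket_lin:
  "lie_bracket (X + Y) Z = lie_bracket X Z + lie_bracket Y Z" "lie_bracket Z (X + Y) = lie_bracket Z X + lie_bracket Z Y"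
  "lie_bracket (cscale c X) Z = cscale c (lie_bracket X Z)" "lie_bracket Z (cscale c X) = cscale c (lie_bracket Z X)"
  "lie_bracket (X - Y) Z = lie_bracket X Z - lie_bracket Y Z" "lie_bracket Z (X - Y) = lie_bracket Z X - lie_bracket Z Y"
  "lie_bracket (- X) Z = - lie_bracket X Z" "lie_bracket Z (- X) = - lie_bracket Z X"
  "lie_bracket 0 X = 0" "lie_bracket X 0 = 0"
  by (auto simp: lie_bracket_def matrix_distribs cm.scale_right_diff_distrib)

lemma lie_bracket_self [simp]: "lie_bracket X X = 0"
  and lie_bracket_swap: "lie_bracket X Y = - lie_bracket Y X"
  and jacobi: "lie_bracket X (lie_bracket Y Z) = lie_bracket (lie_bracket X Y) Z + lie_bracket Y (lie_bracket X Z)"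
  by (simp_all add: lie_bracket_def matrix_distribs matrix_mul_assoc)

text \<open>Both sides are derivations, so that it is enough to compare them on the entries.\<close>

lemma ideriv_commutator:
  assumes "matrix_poly p"
  shows "ideriv X (ideriv Y p) A - ideriv Y (ideriv X p) A = ideriv (lie_bracket X Y) p A"
  using assms
proof induction
  case (entry i j)
  have e: "ideriv X (\<lambda>A. (A ** Y) $ i $ j) A = (A ** X ** Y) $ i $ j" for X Y A
  proof (rule ideriv_unique)
    show "((\<lambda>w. (A ** mexp (cscale w X) ** Y) $ i $ j) has_field_derivative (A ** X ** Y) $ i $ j) (at 0)"
      using mderiv_mult[OF mderiv_mexp_right[of A X 0] mderiv_const, of Y] by (simp add: mderiv_def)
  qed (use matrix_poly_mult_right[OF matrix_poly.entry] in auto)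
  show ?case
    by (simp add: e lie_bracket_def matrix_distribs matrix_mul_assoc)
qed (simp_all add: ideriv_add ideriv_mult matrix_poly_ideriv matrix_poly.intros algebra_simps)


section \<open>Lie algebras of algebraic groups\<close>

lemma invertible_iff_inverse: "invertible A \<longleftrightarrow> (\<exists>B. A ** B = mat 1 \<and> B ** A = mat 1)"
  by (simp add: invertible_def)

lemma invertible_inv_mult [simp]:
  "invertible (A :: complex^'n^'n) \<Longrightarrow> A ** matrix_inv A = mat 1"
  "invertible (A :: complex^'n^'n) \<Longrightarrow> matrix_inv A ** A = mat 1"
  using matrix_inv_unique[of A] by (auto simp: invertible_iff_inverse)

lemma invertible_matrix_inv [simp]: "invertible (A :: complex^'n^'n) \<Longrightarrow> invertible (matrix_inv A)"
  using invertible_inv_mult invertible_iff_inverse by blast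

lemma matrix_inv_inv [simp]: "invertible (A :: complex^'n^'n) \<Longrightarrow> matrix_inv (matrix_inv A) = A"
  by (rule matrix_inv_unique) simp_all

lemma matrix_inv_mult:
  assumes "invertible (A :: complex^'n^'n)" "invertible (B :: complex^'n^'n)"
  shows "matrix_inv (A ** B) = matrix_inv B ** matrix_inv A"
proof (rule matrix_inv_unique)
  show "A ** B ** (matrix_inv B ** matrix_inv A) = mat 1" "matrix_inv B ** matrix_inv A ** (A ** B) = mat 1"
    using assms by (metis matrix_mul_assoc matrix_mul_lid invertible_inv_mult)+
qed

lemma matrix_inv_1 [simp]: "matrix_inv (mat 1) = (mat 1 :: complex^'n^'n)"
  by (rule matrix_inv_unique) simp_all

lemma inv_cancel [simp]:
  fixes A B :: "complex^'n^'n"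
  assumes "invertible A"
  shows "matrix_inv A ** (A ** B) = B" "A ** (matrix_inv A ** B) = B"
    "B ** A ** matrix_inv A = B" "B ** matrix_inv A ** A = B"
  using invertible_inv_mult[OF assms] by (metis matrix_mul_assoc matrix_mul_lid matrix_mul_rid)+

lemma group_GL: "group (GL :: (complex^'n^'n) monoid)"
proof (rule groupI)
  fix x :: "complex^'n^'n" assume "x \<in> carrier GL"
  then show "\<exists>y\<in>carrier GL. y \<otimes>\<^bsub>GL\<^esub> x = \<one>\<^bsub>GL\<^esub>"
    by (intro bexI[of _ "matrix_inv x"]) (auto simp: GL_def)
qed (auto simp: GL_def matrix_mul_assoc invertible_mult invertible_iff_inverse[of "mat 1"])

lemma inv_GL: "invertible (A :: complex^'n^'n) \<Longrightarrow> inv\<^bsub>GL\<^esub> A = matrix_inv A"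
  by (rule group.inv_equality[OF group_GL]) (auto simp: GL_def)

lemma algebraic_groupD:
  assumes "algebraic_group K"
  shows "A \<in> K \<Longrightarrow> invertible A" "mat 1 \<in> K" "A \<in> K \<Longrightarrow> B \<in> K \<Longrightarrow> A ** B \<in> K"
    "A \<in> K \<Longrightarrow> matrix_inv A \<in> K"
proof -
  have s: "subgroup K GL"
    using assms by (simp add: algebraic_group_def)
  then show inv: "A \<in> K \<Longrightarrow> invertible A" for A
    using subgroup.subset[OF s] by (auto simp: GL_def)
  show "mat 1 \<in> K"
    using subgroup.one_closed[OF s] by (simp add: GL_def)
  show "A ** B \<in> K" if "A \<in> K" "B \<in> K"
    using subgroup.m_closed[OF s that] by (simp add: GL_def)
  show "matrix_inv A \<in> K" if "A \<in> K"
    using subgroup.m_inv_closed[OF s that] inv_GL[OF inv[OF that]] by simp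
qed

text \<open>The definition differentiates along lines; the invariant derivations replace them by
  arbitrary curves, in particular by one-parameter subgroups.\<close>

lemma lie_algebra_iff:
  "X \<in> lie_algebra K \<longleftrightarrow> (\<forall>p. matrix_poly p \<and> (\<forall>A\<in>K. p A = 0) \<longrightarrow> ideriv X p (mat 1) = 0)"
proof -
  have "((\<lambda>z. p (mat 1 + cscale z X)) has_field_derivative 0) (at 0) \<longleftrightarrow> ideriv X p (mat 1) = 0"
    if "matrix_poly p" for p
    using ideriv_line_1[OF that, of X] DERIV_unique by metis
  then show ?thesis
    unfolding lie_algebra_def by blast
qed

lemma lie_algebra_0: "0 \<in> lie_algebra K"
  and lie_algebra_add: "X \<in> lie_algebra K \<Longrightarrow> Y \<in> lie_algebra K \<Longrightarrow> X + Y \<in> lie_algebra K"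
  and lie_algebra_cscale: "X \<in> lie_algebra K \<Longrightarrow> cscale c X \<in> lie_algebra K"
  using ideriv_lin(2)[of _ 0 0] by (auto simp: lie_algebra_iff ideriv_lin)

lemma lie_algebra_minus: "X \<in> lie_algebra K \<Longrightarrow> - X \<in> lie_algebra K"
  using lie_algebra_cscale[of X K "-1"] by simp

lemma lie_algebra_diff: "X \<in> lie_algebra K \<Longrightarrow> Y \<in> lie_algebra K \<Longrightarrow> X - Y \<in> lie_algebra K"
  using lie_algebra_add[OF _ lie_algebra_minus] by fastforce

lemma lie_algebra_mono: "K \<subseteq> K' \<Longrightarrow> lie_algebra K \<subseteq> lie_algebra K'"
  unfolding lie_algebra_iff subset_iff by blast

lemma lie_algebra_curve:
  assumes "\<And>z. \<gamma> z \<in> K" "\<gamma> 0 = mat 1" "mderiv \<gamma> X 0"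
  shows "X \<in> lie_algebra K"
  unfolding lie_algebra_iff
proof (intro allI impI)
  fix p assume p: "matrix_poly p \<and> (\<forall>A\<in>K. p A = 0)"
  then have "((\<lambda>w. p (\<gamma> w)) has_field_derivative ideriv X p (\<gamma> 0)) (at 0)"
    using assms by (intro ideriv_curve) auto
  moreover have "((\<lambda>w. p (\<gamma> w)) has_field_derivative 0) (at 0)"
    using p assms(1) by simp
  ultimately show "ideriv X p (mat 1) = 0"
    using assms(2) DERIV_unique by metis
qed

lemma ideriv_vanish:
  assumes "algebraic_group K" "matrix_poly p" "\<And>A. A \<in> K \<Longrightarrow> p A = 0" "X \<in> lie_algebra K" "A \<in> K"
  shows "ideriv X p A = 0"
proof -
  have q: "matrix_poly (\<lambda>M. p (A ** M))"
    by (rule matrix_poly_mult_left[OF assms(2)])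
  have "ideriv X (\<lambda>M. p (A ** M)) (mat 1) = ideriv X p A"
    using ideriv_mexp[OF assms(2), of A X 0] by (intro ideriv_unique[OF q]) simp
  moreover have "ideriv X (\<lambda>M. p (A ** M)) (mat 1) = 0"
    using assms q algebraic_groupD(3)[OF assms(1,5)] by (auto simp: lie_algebra_iff)
  ultimately show ?thesis by simp
qed

lemma matrix_poly_ideriv_funpow: "matrix_poly p \<Longrightarrow> matrix_poly ((ideriv X ^^ k) p)"
  by (induction k) auto

lemma ideriv_taylor:
  assumes "matrix_poly p" "\<And>k. (ideriv X ^^ k) p A = 0"
  shows "p (A ** mexp (cscale z X)) = 0"
proof -
  let ?f = "\<lambda>w. p (A ** mexp (cscale w X))"
  have d: "(deriv ^^ k) ?f = (\<lambda>w. (ideriv X ^^ k) p (A ** mexp (cscale w X)))" for k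
  proof (induction k)
    case (Suc k)
    show ?case
      using DERIV_imp_deriv[OF ideriv_mexp[OF matrix_poly_ideriv_funpow[OF assms(1), where k = k and X = X], of A X]]
      by (simp add: Suc)
  qed simp
  have "?f holomorphic_on UNIV"
    using ideriv_mexp[OF assms(1)] by (auto simp: holomorphic_on_open)
  moreover have "(deriv ^^ k) ?f 0 = 0" for k
    using assms(2)[of k] by (simp add: d)
  ultimately show ?thesis
    using holomorphic_fun_eq_0_on_connected[of ?f UNIV 0 z] by auto
qed

text \<open>The ideal of \<open>K\<close> is stable under the derivation defined by \<open>X\<close>; hence all derivatives of its
  elements along the one-parameter group of \<open>X\<close> vanish at the identity.\<close>

lemma mexp_mem:
  assumes "algebraic_group K" "X \<in> lie_algebra K"
  shows "mexp (cscale z X) \<in> K" "mexp X \<in> K"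
proof -
  obtain S where S: "\<forall>p\<in>S. matrix_poly p" and K: "K = {A. invertible A \<and> (\<forall>p\<in>S. p A = 0)}"
    using assms(1) unfolding algebraic_group_def by blast
  have "p (mexp (cscale z X)) = 0" if "p \<in> S" for p z
  proof -
    have p: "matrix_poly p"
      using S that by blast
    have "(ideriv X ^^ k) p A = 0" if "A \<in> K" for k A
      using that
    proof (induction k arbitrary: A)
      case 0
      then show ?case using K \<open>p \<in> S\<close> by auto
    next
      case (Suc k)
      then show ?case
        using ideriv_vanish[OF assms(1) matrix_poly_ideriv_funpow[OF p] Suc.IH assms(2)] by simp
    qed
    from ideriv_taylor[OF p this[OF algebraic_groupD(2)[OF assms(1)]]] show ?thesis by simp
  qed
  then show *: "mexp (cscale z X) \<in> K" for z
    by (simp add: K)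
  show "mexp X \<in> K"
    using *[of 1] by simp
qed

text \<open>The commutator of two derivations that preserve the ideal of \<open>K\<close> preserves it as
  well.\<close>

lemma lie_algebra_bracket:
  assumes "algebraic_group K" "X \<in> lie_algebra K" "Y \<in> lie_algebra K"
  shows "lie_bracket X Y \<in> lie_algebra K"
  unfolding lie_algebra_iff
proof (intro allI impI)
  fix p assume p: "matrix_poly p \<and> (\<forall>A\<in>K. p A = 0)"
  then have "ideriv X (ideriv Y p) A = 0" "ideriv Y (ideriv X p) A = 0" if "A \<in> K" for A
    using that assms by (auto intro!: ideriv_vanish)
  then show "ideriv (lie_bracket X Y) p (mat 1) = 0"
    using p algebraic_groupD(2)[OF assms(1)] by (subst ideriv_commutator[symmetric]) auto
qed

lemma lie_algebra_conj:
  fixes s :: "complex^'n^'n"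
  assumes "\<And>A. A \<in> K \<Longrightarrow> s ** A ** matrix_inv s \<in> K'" "invertible s" "algebraic_group K" "X \<in> lie_algebra K"
  shows "s ** X ** matrix_inv s \<in> lie_algebra K'"
proof (rule lie_algebra_curve)
  show "s ** mexp (cscale z X) ** matrix_inv s \<in> K'" for z
    using assms mexp_mem by blast
  show "mderiv (\<lambda>z. s ** mexp (cscale z X) ** matrix_inv s) (s ** X ** matrix_inv s) 0"
    using mderiv_mult[OF mderiv_mexp_right[of s X 0] mderiv_const[of "matrix_inv s"]] by simp
qed (use assms in simp)

lemma lie_algebra_Ad:
  assumes "algebraic_group K" "s \<in> K" "X \<in> lie_algebra K"
  shows "s ** X ** matrix_inv s \<in> lie_algebra K"
  using assms by (intro lie_algebra_conj[of K s K]) (auto intro: algebraic_groupD)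


section \<open>Connected groups are generated by exponentials\<close>

lemma scaleR_cscale: "r *\<^sub>R (X :: complex^'n^'n) = cscale (of_real r) X"
  by (simp add: vec_eq_iff) (simp add: scaleR_conv_of_real)

lemma norm_matrix_le: "norm (X :: complex^'n^'n) \<le> (\<Sum>i\<in>UNIV. \<Sum>j\<in>UNIV. cmod (X $ i $ j))"
proof -
  have v: "norm x \<le> (\<Sum>i\<in>UNIV. norm (x $ i))" for x :: "'a::real_normed_vector^'n"
    unfolding norm_vec_def by (rule L2_set_le_sum) simp
  show ?thesis
    by (rule order_trans[OF v]) (intro sum_mono v)
qed

lemma has_derivative_mexp_0: "((mexp :: complex^'n^'n \<Rightarrow> _) has_derivative (\<lambda>X. X)) (at 0)"
proof (rule has_derivativeI_sandwich[where e = 1])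
  let ?C = "CARD('n) ^ 2 * (CARD('n) ^ 2 * exp (CARD('n)))"
  show "((\<lambda>X :: complex^'n^'n. ?C * norm X) \<longlongrightarrow> 0) (at 0)"
    by (intro tendsto_mult_right_zero tendsto_norm_zero tendsto_ident_at)
  fix X :: "complex^'n^'n"
  assume X: "X \<noteq> 0" "dist X 0 < 1"
  have "norm (mexp X - mat 1 - X) \<le> (\<Sum>i\<in>(UNIV::'n set). \<Sum>j\<in>(UNIV::'n set). (CARD('n) ^ 2 * exp (CARD('n))) * norm X ^ 2)"
  proof -
    have "cmod ((mexp X - mat 1 - X) $ i $ j) \<le> (CARD('n) ^ 2 * exp (CARD('n))) * norm X ^ 2" for i j
      using X mexp_remainder[of X i j] by simp
    then show ?thesis
      by (intro order_trans[OF norm_matrix_le] sum_mono)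
  qed
  also have "\<dots> = ?C * norm X * norm X"
    by (simp add: power2_eq_square)
  finally show "norm (mexp X - mexp 0 - (X - 0)) / norm (X - 0) \<le> ?C * norm X"
    using X by (simp add: divide_simps)
qed (auto simp: bounded_linear_ident)

lemma bounded_bilinear_mm: "bounded_bilinear ((**) :: complex^'n^'n \<Rightarrow> _ \<Rightarrow> complex^'n^'n)"
  unfolding bilinear_conv_bounded_bilinear[symmetric] bilinear_def
  by (auto intro!: linearI simp: matrix_distribs scaleR_cscale)

lemma has_derivative_matrix_poly_1:
  fixes p :: "complex^'n^'n \<Rightarrow> complex"
  assumes "matrix_poly p"
  shows "(p has_derivative (\<lambda>Y. ideriv Y p (mat 1))) (at (mat 1))"
  using assms
proof induction
  case (entry i j)
  have "bounded_linear (\<lambda>A :: complex^'n^'n. A $ i $ j)"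
    by (intro bounded_linear_compose[OF bounded_linear_vec_nth bounded_linear_vec_nth])
  then show ?case
    by (simp add: bounded_linear_imp_has_derivative)
next
  case (mult p q)
  then show ?case
    by (auto simp: ideriv_mult intro!: derivative_eq_intros)
qed (auto simp: ideriv_add intro!: derivative_eq_intros)

text \<open>If \<open>K\<close> were larger than \<open>mexp ` lie_algebra K\<close> near the identity, then it would contain elements
  \<open>mat 1 + Y\<close> with \<open>Y\<close> arbitrarily small in a fixed complement of the Lie algebra; a limit of the
  directions of such \<open>Y\<close> is tangent to \<open>K\<close>, so that it lies in the Lie algebra after all.\<close>

lemma mexp_onto_neighbourhood:
  assumes K: "algebraic_group K"
  obtains e where "e > 0" "\<And>A. A \<in> K \<Longrightarrow> dist A (mat 1) < e \<Longrightarrow> \<exists>X\<in>lie_algebra K. A = mexp X"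
proof (rule ccontr)
  note witness = that
  assume "\<not> thesis"
  have neg: "\<exists>A\<in>K. dist A (mat 1) < e \<and> A \<notin> mexp ` lie_algebra K" if "e > 0" for e
  proof (rule ccontr)
    assume "\<not> ?thesis"
    then have "\<exists>X\<in>lie_algebra K. A = mexp X" if "A \<in> K" "dist A (mat 1) < e" for A
      using that by auto
    from witness[OF \<open>e > 0\<close> this] \<open>\<not> thesis\<close> show False by blast
  qed
  define L where "L = lie_algebra K"
  have "subspace L"
    unfolding subspace_def L_def
    by (auto intro: lie_algebra_0 lie_algebra_add lie_algebra_cscale simp: scaleR_cscale)
  then obtain P where P: "range P \<subseteq> L" "linear P" "\<And>v. v \<in> L \<Longrightarrow> P v = v"
    using linear_exists_left_inverse_on[of id L] by (auto simp: linear_id)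
  have bP: "bounded_linear P"
    using P(2) by (simp add: linear_conv_bounded_linear)
  have PP: "P (P v) = P v" for v
    using P by blast
  have Pd: "P (v - P v) = 0" for v
    by (simp add: linear_diff[OF P(2)] PP)
  define F where "F Z = mexp (P Z) ** (mat 1 + (Z - P Z))" for Z
  have F0: "F 0 = mat 1"
    by (simp add: F_def linear_0[OF P(2)])
  have dmP: "((\<lambda>Z. mexp (P Z)) has_derivative P) (at 0)"
  proof -
    have "(P has_derivative P) (at 0)"
      by (rule bounded_linear_imp_has_derivative[OF bP])
    moreover have "(mexp has_derivative (\<lambda>X. X)) (at (P 0))"
      using has_derivative_mexp_0 by (simp add: linear_0[OF P(2)])
    ultimately show ?thesis
      using has_derivative_compose by fastforce
  qed
  have dF: "(F has_derivative id) (at 0)"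
    unfolding F_def id_def
    by (rule has_derivative_eq_rhs[OF bounded_bilinear.FDERIV[OF bounded_bilinear_mm dmP
          has_derivative_add[OF has_derivative_const has_derivative_diff[OF has_derivative_ident
          bounded_linear_imp_has_derivative[OF bP]]]]])
      (simp add: linear_0[OF P(2)])
  have cF: "continuous_on UNIV F"
    unfolding F_def
    by (intro bounded_bilinear.continuous_on[OF bounded_bilinear_mm] continuous_intros
        continuous_on_compose2[OF continuous_on_mexp[of UNIV]] linear_continuous_on bP) auto
  have small: "\<exists>Y. Y \<noteq> 0 \<and> norm Y < d \<and> P Y = 0 \<and> mat 1 + Y \<in> K" if d: "d > 0" for d
  proof -
    obtain c where c: "c > 0" "\<And>x. norm (x - P x) \<le> norm x * c"
      using bounded_linear.pos_bounded[OF bounded_linear_sub[OF bounded_linear_ident bP]] by blast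
    have "F 0 \<in> interior (F ` ball 0 (d / c))"
      by (rule sussmann_open_mapping[OF open_UNIV cF _ dF, where g' = id])
        (use d c in \<open>auto simp: bounded_linear_ident[folded id_def]\<close>)
    then obtain e where e: "e > 0" "ball (F 0) e \<subseteq> F ` ball 0 (d / c)"
      unfolding mem_interior by blast
    obtain A where A: "A \<in> K" "dist A (mat 1) < e" "A \<notin> mexp ` L"
      using neg[OF e(1)] L_def by blast
    then have "A \<in> F ` ball 0 (d / c)"
      using e(2) F0 by (auto simp: dist_commute)
    then obtain Z where Z: "A = F Z" "norm Z < d / c"
      by auto
    define Y where "Y = Z - P Z"
    have "P Z \<in> L" using P(1) by blast
    have "Y \<noteq> 0"
      using A(3) Z(1) \<open>P Z \<in> L\<close> by (auto simp: F_def Y_def)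
    moreover have "norm Y < d"
      using c(2)[of Z] Z(2) c(1) unfolding Y_def by (simp add: divide_simps split: if_splits)
    moreover have "P Y = 0"
      by (simp add: Y_def Pd)
    moreover have "mat 1 + Y \<in> K"
    proof -
      have "mexp (- P Z) \<in> K"
        using \<open>P Z \<in> L\<close> mexp_mem(2)[OF K lie_algebra_minus] by (simp add: L_def)
      then have "mexp (- P Z) ** F Z \<in> K"
        using A(1) Z(1) algebraic_groupD(3)[OF K] by blast
      then show ?thesis
        by (simp add: F_def Y_def matrix_mul_assoc)
    qed
    ultimately show ?thesis by blast
  qed
  have "\<forall>n :: nat. \<exists>Y. Y \<noteq> 0 \<and> norm Y < inverse (Suc n) \<and> P Y = 0 \<and> mat 1 + Y \<in> K"
    using small by simp
  then obtain Y where Y: "\<And>n. Y n \<noteq> 0" "\<And>n. norm (Y n) < inverse (Suc n)" "\<And>n. P (Y n) = 0" "\<And>n. mat 1 + Y n \<in> K"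
    by metis
  have Y0: "Y \<longlonglongrightarrow> 0"
    by (rule Lim_null_comparison[OF _ LIMSEQ_inverse_real_of_nat])
      (use Y(2) in \<open>auto intro!: always_eventually less_imp_le\<close>)
  define u where "u n = (1 / norm (Y n)) *\<^sub>R Y n" for n
  have "\<forall>n. u n \<in> sphere 0 1"
    using Y(1) by (simp add: u_def)
  then obtain U r where U: "U \<in> sphere 0 1" "strict_mono r" "(u \<circ> r) \<longlonglongrightarrow> U"
    using compact_sphere[of 0 1] unfolding compact_def by blast
  have "P (u n) = 0" for n
    by (simp add: u_def linear_cmul[OF P(2)] Y(3))
  then have "(\<lambda>n. P ((u \<circ> r) n)) \<longlonglongrightarrow> 0"
    by simp
  moreover have "(\<lambda>n. P ((u \<circ> r) n)) \<longlonglongrightarrow> P U"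
    by (rule bounded_linear.tendsto[OF bP U(3)])
  ultimately have PU: "P U = 0"
    by (simp add: LIMSEQ_unique)
  have "U \<in> lie_algebra K"
    unfolding lie_algebra_iff
  proof (intro allI impI)
    fix p assume p: "matrix_poly p \<and> (\<forall>A\<in>K. p A = 0)"
    let ?D = "\<lambda>X. ideriv X p (mat 1)"
    have D: "(p has_derivative ?D) (at (mat 1))"
      using p by (intro has_derivative_matrix_poly_1) simp
    have bl: "bounded_linear ?D"
      using D has_derivative_bounded_linear by blast
    have lim: "((\<lambda>h. norm (p (mat 1 + h) - p (mat 1) - ?D h) / norm h) \<longlongrightarrow> 0) (at 0)"
      using D by (simp add: has_derivative_at)
    have yr: "filterlim (Y \<circ> r) (at 0) sequentially"
      using LIMSEQ_subseq_LIMSEQ[OF Y0 U(2)] Y(1) by (simp add: filterlim_at)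
    have "(\<lambda>n. norm (p (mat 1 + Y (r n)) - p (mat 1) - ?D (Y (r n))) / norm (Y (r n))) \<longlonglongrightarrow> 0"
      using filterlim_compose[OF lim yr] by simp
    moreover have "norm (p (mat 1 + Y (r n)) - p (mat 1) - ?D (Y (r n))) / norm (Y (r n)) = norm (?D ((u \<circ> r) n))" for n
      using p Y(4) algebraic_groupD(2)[OF K]
      by (simp add: u_def linear_cmul[OF bounded_linear.linear[OF bl]])
    ultimately have "(\<lambda>n. norm (?D ((u \<circ> r) n))) \<longlonglongrightarrow> 0"
      by simp
    then have "(\<lambda>n. ?D ((u \<circ> r) n)) \<longlonglongrightarrow> 0"
      by (rule tendsto_norm_zero_cancel)
    moreover have "(\<lambda>n. ?D ((u \<circ> r) n)) \<longlonglongrightarrow> ?D U"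
      by (rule bounded_linear.tendsto[OF bl U(3)])
    ultimately show "?D U = 0"
      by (simp add: LIMSEQ_unique)
  qed
  then have "P U = U"
    using P(3) L_def by blast
  with PU U(1) show False by simp
qed

text \<open>The exponential products form a subgroup that contains a neighbourhood of the identity; it is
  open and closed.\<close>

lemma connected_algebraic_induct:
  assumes K: "connected_algebraic_group K" and A: "A \<in> K"
    and one: "P (mat 1)"
    and step: "\<And>A X. A \<in> K \<Longrightarrow> P A \<Longrightarrow> X \<in> lie_algebra K \<Longrightarrow> P (A ** mexp X)"
  shows "P A"
proof -
  define S where "S = \<Inter> {S. mat 1 \<in> S \<and> (\<forall>A\<in>S. \<forall>X\<in>lie_algebra K. A ** mexp X \<in> S)}"
  have alg: "algebraic_group K" and conn: "connected K"
    using K by (auto simp: connected_algebraic_group_def)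
  have S1: "mat 1 \<in> S" and Sstep: "\<And>A X. A \<in> S \<Longrightarrow> X \<in> lie_algebra K \<Longrightarrow> A ** mexp X \<in> S"
    unfolding S_def by auto
  have "S \<subseteq> K \<inter> {A. P A}"
    unfolding S_def
    by (rule Inter_lower) (auto simp: one step algebraic_groupD(2,3)[OF alg] mexp_mem(2)[OF alg])
  then have SK: "S \<subseteq> K" and SP: "\<And>A. A \<in> S \<Longrightarrow> P A"
    by auto
  obtain e where e: "e > 0" "\<And>A. A \<in> K \<Longrightarrow> dist A (mat 1) < e \<Longrightarrow> \<exists>X\<in>lie_algebra K. A = mexp X"
    using mexp_onto_neighbourhood[OF alg] by blast
  define N where "N A = {B \<in> K. dist (matrix_inv A ** B) (mat 1) < e}" for A
  have Nopen: "openin (top_of_set K) (N A)" for A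
  proof -
    have c: "continuous_on K (\<lambda>B. matrix_inv A ** B)"
      by (intro bounded_bilinear.continuous_on[OF bounded_bilinear_mm] continuous_intros)
    have "N A = K \<inter> (\<lambda>B. matrix_inv A ** B) -` ball (mat 1) e"
      by (auto simp: N_def dist_commute)
    then show ?thesis
      using continuous_openin_preimage_gen[OF c open_ball] by metis
  qed
  have NA: "A \<in> N A" if "A \<in> K" for A
    using that e(1) algebraic_groupD(1)[OF alg that] by (simp add: N_def)
  have N_exp: "\<exists>X\<in>lie_algebra K. B = A ** mexp X" if "A \<in> K" "B \<in> N A" for A B
  proof -
    have "matrix_inv A ** B \<in> K" "dist (matrix_inv A ** B) (mat 1) < e"
      using that algebraic_groupD[OF alg] by (simp_all add: N_def)
    then have "\<exists>X\<in>lie_algebra K. matrix_inv A ** B = mexp X"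
      by (rule e(2))
    then show ?thesis
      using inv_cancel(2)[OF algebraic_groupD(1)[OF alg that(1)], of B] by metis
  qed
  have "openin (top_of_set K) S"
  proof (subst openin_subopen, intro ballI exI conjI)
    fix A assume "A \<in> S"
    then show "N A \<subseteq> S" "A \<in> N A" "openin (top_of_set K) (N A)"
      using SK Nopen NA N_exp Sstep by auto blast
  qed
  moreover have "openin (top_of_set K) (K - S)"
  proof (subst openin_subopen, intro ballI exI conjI)
    fix A assume A: "A \<in> K - S"
    show "N A \<subseteq> K - S"
    proof
      fix B assume B: "B \<in> N A"
      then obtain X where X: "X \<in> lie_algebra K" "B = A ** mexp X"
        using N_exp A by blast
      have "A = B ** mexp (- X)"
        by (simp add: X(2) flip: matrix_mul_assoc)
      then show "B \<in> K - S"
        using A Sstep[of B "- X"] lie_algebra_minus[OF X(1)] B by (auto simp: N_def)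
    qed
  qed (use A NA Nopen in auto)
  ultimately have "S = {} \<or> S = K"
    using conn SK unfolding connected_clopen by (metis Diff_Diff_Int closedin_def inf.absorb_iff2 topspace_euclidean_subtopology)
  with S1 A SP show ?thesis by blast
qed

section \<open>Lowest weight vectors\<close>

text \<open>The usual \<open>sl\<^sub>2\<close> computation \<open>F E\<^sup>k v = - k (c + k - 1) E\<^sup>k\<^sup>-\<^sup>1 v\<close>.\<close>

lemma sl2_lowest:
  fixes s :: "complex \<Rightarrow> 'v::ab_group_add \<Rightarrow> 'v"
  assumes vs: "vector_space s"
    and M: "\<And>v. v \<in> M \<Longrightarrow> E v \<in> M"
    and Es: "\<And>v c. v \<in> M \<Longrightarrow> E (s c v) = s c (E v)"
    and comm: "\<And>v. v \<in> M \<Longrightarrow> F (E v) = E (F v) - H v"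
    and HE: "\<And>v. v \<in> M \<Longrightarrow> H (E v) = E (H v) + s 2 (E v)"
    and F0: "F 0 = 0"
    and v: "v \<in> M" "v \<noteq> 0" "F v = 0" "H v = s c v" "(E ^^ k) v = 0"
  shows "\<exists>n. c = - of_nat n \<and> (\<forall>i\<le>n. (E ^^ i) v \<noteq> 0) \<and> (\<forall>i>n. (E ^^ i) v = 0)"
proof -
  interpret vector_space s by (rule vs)
  have inM: "(E ^^ i) v \<in> M" for i
    by (induction i) (auto simp: v M)
  have E0: "E 0 = 0"
    using Es[OF v(1), of 0] by simp
  have Hk: "H ((E ^^ i) v) = s (c + 2 * of_nat i) ((E ^^ i) v)" for i
  proof (induction i)
    case (Suc i)
    then show ?case
      using HE[OF inM[of i]] Es[OF inM[of i]] by (simp add: algebra_simps flip: scale_left_distrib)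
  qed (simp add: v)
  have Fk: "F ((E ^^ Suc i) v) = s (- of_nat (Suc i) * (c + of_nat i)) ((E ^^ i) v)" for i
  proof (induction i)
    case 0
    show ?case using comm[OF v(1)] v(3,4) E0 by simp
  next
    case (Suc i)
    have "F ((E ^^ Suc (Suc i)) v) = E (F ((E ^^ Suc i) v)) - H ((E ^^ Suc i) v)"
      using comm[OF inM[of "Suc i"]] by simp
    also have "\<dots> = s (- of_nat (Suc i) * (c + of_nat i) - (c + 2 * of_nat (Suc i))) ((E ^^ Suc i) v)"
      unfolding Suc Hk by (subst Es[OF inM]) (simp add: scale_left_diff_distrib)
    also have "- of_nat (Suc i) * (c + of_nat i) - (c + 2 * of_nat (Suc i)) = - of_nat (Suc (Suc i)) * (c + of_nat (Suc i))"
      by (simp add: algebra_simps)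
    finally show ?case .
  qed
  define N where "N = (LEAST i. (E ^^ i) v = 0)"
  have N: "(E ^^ N) v = 0" "\<And>i. i < N \<Longrightarrow> (E ^^ i) v \<noteq> 0"
    unfolding N_def using v(5) by (auto intro: LeastI dest: not_less_Least)
  then have "N \<noteq> 0"
    using v(2) by (metis funpow_0)
  then obtain n where n: "N = Suc n"
    using not0_implies_Suc by blast
  have "s (- of_nat (Suc n) * (c + of_nat n)) ((E ^^ n) v) = 0"
    using Fk[of n] N(1) n F0 by simp
  then have "c = - of_nat n"
    using N(2)[of n] n by (simp add: eq_neg_iff_add_eq_0 del: of_nat_Suc)
  moreover have "(E ^^ i) v = 0" if "i > n" for i
  proof -
    have "(E ^^ m) 0 = 0" for m
      by (induction m) (simp_all add: E0)
    moreover have "i = (i - N) + N"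
      using that n by simp
    ultimately show ?thesis
      using N(1) by (metis funpow_add o_apply)
  qed
  ultimately show ?thesis
    using N(2) n by (intro exI[of _ n]) auto
qed

section \<open>The coordinate ring of an algebraic group\<close>

text \<open>Functions on \<open>K\<close> are extended by \<open>0\<close>, so that equality of elements
  of the coordinate ring is equality of functions.\<close>

definition res :: "(complex^'n^'n) set \<Rightarrow> (complex^'n^'n \<Rightarrow> complex) \<Rightarrow> complex^'n^'n \<Rightarrow> complex" where
  "res K p = (\<lambda>A. if A \<in> K then p A else 0)"

definition coord_ring :: "(complex^'n^'n) set \<Rightarrow> (complex^'n^'n \<Rightarrow> complex) set" where
  "coord_ring K = {res K p | p. matrix_poly p}"

text \<open>The derivations of the coordinate ring that commute with left translations.\<close>

definition rder :: "(complex^'n^'n) set \<Rightarrow> complex^'n^'n \<Rightarrow> (complex^'n^'n \<Rightarrow> complex) \<Rightarrow> complex^'n^'n \<Rightarrow> complex" where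
  "rder K X f = (\<lambda>A. if A \<in> K then deriv (\<lambda>z. f (A ** mexp (cscale z X))) 0 else 0)"

definition fscale :: "complex \<Rightarrow> ('a \<Rightarrow> complex) \<Rightarrow> 'a \<Rightarrow> complex" where
  "fscale c f = (\<lambda>A. c * f A)"

lemma fscale_apply [simp]: "fscale c f A = c * f A"
  by (simp add: fscale_def)

lemma vector_space_fscale: "vector_space (fscale :: complex \<Rightarrow> ('a \<Rightarrow> complex) \<Rightarrow> _)"
  by standard (auto simp: fun_eq_iff algebra_simps)

interpretation fs: vector_space "fscale :: complex \<Rightarrow> ('a \<Rightarrow> complex) \<Rightarrow> _"
  by (rule vector_space_fscale)

lemma coord_ringE:
  assumes "f \<in> coord_ring K"
  obtains p where "matrix_poly p" "f = res K p"
  using assms by (auto simp: coord_ring_def)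

lemma res_coord [intro]: "matrix_poly p \<Longrightarrow> res K p \<in> coord_ring K"
  by (auto simp: coord_ring_def)

lemma coord_ring_outside: "f \<in> coord_ring K \<Longrightarrow> A \<notin> K \<Longrightarrow> f A = 0"
  by (auto elim!: coord_ringE simp: res_def)

lemma coord_ring_eqI: "f \<in> coord_ring K \<Longrightarrow> g \<in> coord_ring K \<Longrightarrow> (\<And>A. A \<in> K \<Longrightarrow> f A = g A) \<Longrightarrow> f = g"
  by (rule ext) (metis coord_ring_outside)

lemma coord_ring_0: "0 \<in> coord_ring K"
  using res_coord[OF matrix_poly.const[of 0]] by (simp add: res_def zero_fun_def)

lemma coord_ring_add: "f \<in> coord_ring K \<Longrightarrow> g \<in> coord_ring K \<Longrightarrow> f + g \<in> coord_ring K"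
  and coord_ring_mult: "f \<in> coord_ring K \<Longrightarrow> g \<in> coord_ring K \<Longrightarrow> (\<lambda>A. f A * g A) \<in> coord_ring K"
  and coord_ring_fscale: "f \<in> coord_ring K \<Longrightarrow> fscale c f \<in> coord_ring K"
proof -
  assume "f \<in> coord_ring K"
  then obtain p where p: "matrix_poly p" "f = res K p" by (elim coord_ringE)
  from res_coord[OF matrix_poly_cmult[OF p(1), of c], of K]
  show "fscale c f \<in> coord_ring K"
    by (simp add: p(2) res_def fscale_def if_distrib cong: if_cong)
  assume "g \<in> coord_ring K"
  then obtain q where q: "matrix_poly q" "g = res K q" by (elim coord_ringE)
  show "f + g \<in> coord_ring K"
    using res_coord[OF matrix_poly.add[OF p(1) q(1)], of K]
    by (simp add: p(2) q(2) res_def plus_fun_def if_distrib cong: if_cong)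
  have "(\<lambda>A. f A * g A) = res K (\<lambda>A. p A * q A)"
    by (auto simp: p(2) q(2) res_def)
  then show "(\<lambda>A. f A * g A) \<in> coord_ring K"
    using res_coord[OF matrix_poly.mult[OF p(1) q(1)], of K] by simp
qed

locale linear_group =
  fixes K :: "(complex^'n^'n) set"
  assumes conn: "connected_algebraic_group K"
begin

abbreviation "L \<equiv> lie_algebra K"
abbreviation "R \<equiv> coord_ring K"
abbreviation "D \<equiv> rder K"

lemma alg: "algebraic_group K"
  using conn by (simp add: connected_algebraic_group_def)

lemmas K_inv = algebraic_groupD(1)[OF alg]
  and K_one = algebraic_groupD(2)[OF alg]
  and K_mult = algebraic_groupD(3)[OF alg]
  and K_minv = algebraic_groupD(4)[OF alg]
  and K_mexp = mexp_mem[OF alg]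
  and L_bracket = lie_algebra_bracket[OF alg]

lemma rder_res: "matrix_poly p \<Longrightarrow> X \<in> L \<Longrightarrow> D X (res K p) = res K (ideriv X p)"
proof
  fix A assume p: "matrix_poly p" "X \<in> L"
  show "D X (res K p) A = res K (ideriv X p) A"
  proof (cases "A \<in> K")
    case True
    then have "A ** mexp (cscale z X) \<in> K" for z
      using p K_mexp K_mult by blast
    then show ?thesis
      using True DERIV_imp_deriv[OF ideriv_mexp[OF p(1), of A X 0]] by (simp add: rder_def res_def)
  qed (simp add: rder_def res_def)
qed

lemma rder_closed [intro]: "f \<in> R \<Longrightarrow> X \<in> L \<Longrightarrow> D X f \<in> R"
  by (elim coord_ringE) (auto simp: rder_res)

lemma rder_curve:
  assumes "f \<in> R" "X \<in> L" "A \<in> K"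
  shows "((\<lambda>w. f (A ** mexp (cscale w X))) has_field_derivative D X f (A ** mexp (cscale z X))) (at z)"
proof -
  obtain p where p: "matrix_poly p" "f = res K p"
    using assms(1) by (elim coord_ringE)
  have "A ** mexp (cscale z X) \<in> K" for z
    using assms K_mexp K_mult by blast
  then show ?thesis
    using ideriv_mexp[OF p(1)] by (simp add: p rder_res assms(2)) (simp add: res_def)
qed

lemma rder_curve_0:
  "f \<in> R \<Longrightarrow> X \<in> L \<Longrightarrow> A \<in> K \<Longrightarrow> ((\<lambda>w. f (A ** mexp (cscale w X))) has_field_derivative D X f A) (at 0)"
  using rder_curve[of f X A 0] by simp

lemma rder_unique:
  "f \<in> R \<Longrightarrow> X \<in> L \<Longrightarrow> A \<in> K \<Longrightarrow> ((\<lambda>w. f (A ** mexp (cscale w X))) has_field_derivative d) (at 0) \<Longrightarrow> D X f A = d"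
  using rder_curve_0 DERIV_unique by blast

lemma rder_outside: "A \<notin> K \<Longrightarrow> D X f A = 0"
  by (simp add: rder_def)

lemma rder_add:
  assumes "f \<in> R" "g \<in> R" "X \<in> L"
  shows "D X (f + g) = D X f + D X g"
proof (rule coord_ring_eqI)
  show "D X (f + g) A = (D X f + D X g) A" if "A \<in> K" for A
    using that assms by (intro rder_unique)
      (auto simp: plus_fun_def intro!: coord_ring_add[unfolded plus_fun_def] derivative_eq_intros rder_curve_0)
qed (use assms in \<open>auto intro!: coord_ring_add\<close>)

lemma rder_mult:
  assumes "f \<in> R" "g \<in> R" "X \<in> L"
  shows "D X (\<lambda>A. f A * g A) = (\<lambda>A. D X f A * g A + f A * D X g A)"
proof
  fix A
  show "D X (\<lambda>A. f A * g A) A = D X f A * g A + f A * D X g A"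
  proof (cases "A \<in> K")
    case True
    show ?thesis
      using DERIV_mult'[OF rder_curve_0[OF assms(1,3) True] rder_curve_0[OF assms(2,3) True]]
      by (intro rder_unique[OF coord_ring_mult[OF assms(1,2)] assms(3) True]) (simp add: algebra_simps)
  qed (simp add: rder_outside)
qed

lemma rder_fscale:
  assumes "f \<in> R" "X \<in> L"
  shows "D X (fscale c f) = fscale c (D X f)"
proof (rule coord_ring_eqI)
  show "D X (fscale c f) A = fscale c (D X f) A" if "A \<in> K" for A
    using that assms DERIV_cmult[OF rder_curve_0[OF assms that], of c]
    by (intro rder_unique) (auto intro!: coord_ring_fscale)
qed (use assms in \<open>auto intro!: coord_ring_fscale\<close>)

lemma rder_0: "X \<in> L \<Longrightarrow> D X 0 = 0"
  using rder_fscale[OF coord_ring_0, of X 0] by simp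

lemma rder_lin:
  assumes "f \<in> R" "X \<in> L" "Y \<in> L"
  shows "D (X + Y) f = D X f + D Y f" "D (cscale c X) f = fscale c (D X f)"
proof -
  obtain p where p: "matrix_poly p" "f = res K p"
    using assms(1) by (elim coord_ringE)
  show "D (X + Y) f = D X f + D Y f" "D (cscale c X) f = fscale c (D X f)"
    unfolding p(2) using assms(2,3) p(1)
    by (simp_all add: rder_res lie_algebra_add lie_algebra_cscale) (auto simp: res_def ideriv_lin fun_eq_iff)
qed

lemma rder_commutator:
  assumes "f \<in> R" "X \<in> L" "Y \<in> L"
  shows "D X (D Y f) = D Y (D X f) + D (lie_bracket X Y) f"
proof -
  obtain p where p: "matrix_poly p" "f = res K p"
    using assms(1) by (elim coord_ringE)
  have "D X (D Y f) A = (D Y (D X f) + D (lie_bracket X Y) f) A" for A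
    using assms ideriv_commutator[OF p(1), of X Y A] 
    by (simp add: p rder_res L_bracket matrix_poly_ideriv) (auto simp: res_def algebra_simps)
  then show ?thesis by blast
qed

abbreviation word :: "(complex^'n^'n) list \<Rightarrow> (complex^'n^'n \<Rightarrow> complex) \<Rightarrow> complex^'n^'n \<Rightarrow> complex" where
  "word Xs f \<equiv> foldr D Xs f"

lemma word_closed: "f \<in> R \<Longrightarrow> set Xs \<subseteq> L \<Longrightarrow> word Xs f \<in> R"
  by (induction Xs) auto

lemma word_add: "f \<in> R \<Longrightarrow> g \<in> R \<Longrightarrow> set Xs \<subseteq> L \<Longrightarrow> word Xs (f + g) = word Xs f + word Xs g"
  by (induction Xs) (auto simp: rder_add word_closed)

lemma word_fscale: "f \<in> R \<Longrightarrow> set Xs \<subseteq> L \<Longrightarrow> word Xs (fscale c f) = fscale c (word Xs f)"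
  by (induction Xs) (auto simp: rder_fscale word_closed)

lemma word_0: "set Xs \<subseteq> L \<Longrightarrow> word Xs 0 = 0"
  by (induction Xs) (auto simp: rder_0)

lemma funpow_word: "(D X ^^ k) f = word (replicate k X) f"
  by (induction k) auto

lemma rder_taylor:
  assumes "f \<in> R" "X \<in> L" "A \<in> K" "\<And>k. (D X ^^ k) f A = 0"
  shows "f (A ** mexp (cscale z X)) = 0"
proof -
  obtain p where p: "matrix_poly p" "f = res K p"
    using assms(1) by (elim coord_ringE)
  have "(D X ^^ k) f = res K ((ideriv X ^^ k) p)" for k
    by (induction k) (use p assms(2) in \<open>auto simp: rder_res matrix_poly_ideriv_funpow\<close>)
  then have "(ideriv X ^^ k) p A = 0" for k
    using assms(3,4) by (simp add: res_def)
  from ideriv_taylor[OF p(1) this] show ?thesis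
    by (simp add: p(2) res_def)
qed

text \<open>By Taylor expansion the vanishing of all words at \<open>A\<close> propagates along
  one-parameter subgroups, and these generate a connected group.\<close>

lemma words_determine:
  assumes f: "f \<in> R" and A: "A \<in> K" and z: "\<And>Xs. set Xs \<subseteq> L \<Longrightarrow> word Xs f A = 0"
  shows "f = 0"
proof (rule coord_ring_eqI[OF f coord_ring_0])
  fix B assume "B \<in> K"
  then have "matrix_inv A ** B \<in> K"
    using A K_minv K_mult by blast
  moreover have "\<forall>Xs. set Xs \<subseteq> L \<longrightarrow> word Xs f (A ** C) = 0" if "C \<in> K" for C
  proof (rule connected_algebraic_induct[OF conn that])
    show "\<forall>Xs. set Xs \<subseteq> L \<longrightarrow> word Xs f (A ** mat 1) = 0"
      using z by simp
    fix C X assume C: "C \<in> K" "\<forall>Xs. set Xs \<subseteq> L \<longrightarrow> word Xs f (A ** C) = 0" and X: "X \<in> L"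
    show "\<forall>Xs. set Xs \<subseteq> L \<longrightarrow> word Xs f (A ** (C ** mexp X)) = 0"
    proof (intro allI impI)
      fix Xs assume Xs: "set Xs \<subseteq> L"
      have "word Xs f (A ** C ** mexp (cscale 1 X)) = 0"
      proof (rule rder_taylor[OF word_closed[OF f Xs] X K_mult[OF A C(1)]])
        fix k
        have "word (replicate k X @ Xs) f (A ** C) = 0"
          by (rule C(2)[rule_format]) (use X Xs in auto)
        then show "(D X ^^ k) (word Xs f) (A ** C) = 0"
          by simp
      qed
      then show "word Xs f (A ** (C ** mexp X)) = 0"
        by (simp add: matrix_mul_assoc)
    qed
  qed
  ultimately have "f (A ** (matrix_inv A ** B)) = 0"
    by (metis (no_types, lifting) empty_subsetI foldr.simps(1) id_apply list.set(1))
  then show "f B = 0 B"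
    using K_inv[OF A] by simp
qed

text \<open>Where \<open>f\<close> is non-zero, \<open>g\<close> and all of its derivatives vanish, and
  one such point suffices for \<open>g = 0\<close>.  This is the irreducibility of a connected
  group.\<close>

lemma coord_ring_no_zero_divisors:
  assumes f: "f \<in> R" "f \<noteq> 0" and g: "g \<in> R" "g \<noteq> 0"
  shows "(\<lambda>A. f A * g A) \<noteq> 0"
proof
  assume fg: "(\<lambda>A. f A * g A) = 0"
  obtain A where A: "f A \<noteq> 0" "A \<in> K"
    using f by (metis coord_ring_outside ext zero_fun_apply)
  define U where "U = {B \<in> K. f B \<noteq> 0}"
  have z: "h = 0" if h: "h \<in> R" "\<And>B. B \<in> U \<Longrightarrow> h B = 0" for h
  proof (rule words_determine[OF h(1) A(2)])
    have "\<forall>B\<in>U. word Xs h B = 0" if "set Xs \<subseteq> L" for Xs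
      using that
    proof (induction Xs)
      case (Cons X Xs)
      show ?case
      proof
        fix B assume B: "B \<in> U"
        then have BK: "B \<in> K" "f B \<noteq> 0" by (auto simp: U_def)
        have X: "X \<in> L" and Xs: "set Xs \<subseteq> L" using Cons.prems by auto
        have "((\<lambda>w. f (B ** mexp (cscale w X))) \<longlongrightarrow> f (B ** mexp (cscale 0 X))) (at 0)"
          using DERIV_isCont[OF rder_curve_0[OF f(1) X BK(1)]] by (simp add: isCont_def)
        then have "\<forall>\<^sub>F w in at 0. f (B ** mexp (cscale w X)) \<noteq> 0"
          using BK(2) by (intro tendsto_imp_eventually_ne[where c = "f B"]) auto
        then have "\<forall>\<^sub>F w in at 0. word Xs h (B ** mexp (cscale w X)) = 0"
          by (rule eventually_mono) (use Cons.IH[OF Xs] BK X K_mexp K_mult in \<open>auto simp: U_def\<close>)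
        then have ev: "\<forall>\<^sub>F w in nhds 0. word Xs h (B ** mexp (cscale w X)) = 0"
          using Cons.IH[OF Xs] B by (auto simp: eventually_nhds_conv_at)
        have "((\<lambda>w. word Xs h (B ** mexp (cscale w X))) has_field_derivative 0) (at 0)"
          using DERIV_cong_ev[OF refl ev refl, of 0] by simp
        then show "word (X # Xs) h B = 0"
          using rder_unique[OF word_closed[OF h(1) Xs] X BK(1)] by simp
      qed
    qed (use h in simp)
    then show "word Xs h A = 0" if "set Xs \<subseteq> L" for Xs
      using that A by (auto simp: U_def)
  qed
  have "g B = 0" if "B \<in> U" for B
    using that fg by (auto simp: U_def fun_eq_iff)
  then show False
    using z[OF g(1)] g(2) by blast
qed

text \<open>The restriction of \<open>f\<close> to a coset of a one-parameter subgroup solves \<open>y' =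
  c y\<close>.\<close>

lemma rder_eigen_exp:
  assumes "f \<in> R" "X \<in> L" "D X f = fscale c f" "A \<in> K"
  shows "f (A ** mexp (cscale z X)) = exp (c * z) * f A"
proof -
  let ?h = "\<lambda>w. exp (- c * w) * f (A ** mexp (cscale w X))"
  have "(?h has_field_derivative 0) (at w)" for w
  proof -
    have "((\<lambda>w. exp (- c * w)) has_field_derivative exp (- c * w) * (- c)) (at w)"
      by (auto intro!: derivative_eq_intros)
    from DERIV_mult'[OF this rder_curve[OF assms(1,2,4), of w]] show ?thesis
      by (simp add: assms(3))
  qed
  then obtain c' where c': "\<And>w. ?h w = c'"
    using has_field_derivative_zero_constant[of UNIV ?h] by auto
  have "?h z = ?h 0"
    by (rule trans[OF c' c'[symmetric]])
  then show ?thesis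
    by (simp add: exp_minus field_simps)
qed

text \<open>Commuting a letter through a word changes the value by values of shorter words.  Hence, by
  induction on the length, a letter of \<open>a\<close> may be moved to the left and a letter of \<open>p\<close> to the right,
  where both act by scalars, until only letters of \<open>C\<close> remain.\<close>

lemma word_reduction:
  assumes v: "v \<in> R"
    and a: "\<And>Y Xs. Y \<in> a \<Longrightarrow> set Xs \<subseteq> L \<Longrightarrow> \<exists>c. word (Y # Xs) v g = c * word Xs v g"
    and p: "\<And>Z. Z \<in> p \<Longrightarrow> \<exists>c. D Z v = fscale c v"
    and sub: "a \<subseteq> L" "p \<subseteq> L" "C \<subseteq> L"
    and dec: "\<And>X. X \<in> L \<Longrightarrow> \<exists>Y\<in>a. \<exists>Z\<in>p. \<exists>W\<in>cm.span C. X = Y + W + Z"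
    and nz: "set Xs \<subseteq> L" "word Xs v g \<noteq> 0"
  shows "\<exists>Ys. set Ys \<subseteq> C \<and> word Ys v g \<noteq> 0"
proof (rule ccontr)
  assume "\<not> ?thesis"
  then have C0: "word Ys v g = 0" if "set Ys \<subseteq> C" for Ys
    using that by blast
  have "word Xs v g = 0" if "length Xs = k" "set Xs \<subseteq> L" for k Xs
    using that
  proof (induction k arbitrary: Xs rule: less_induct)
    case (less k)
    have IH: "word Xs v g = 0" if "length Xs < k" "set Xs \<subseteq> L" for Xs
      by (rule less.IH[OF that(1) refl that(2)])
    have swap: "word (u @ X # Y # w) v g = word (u @ Y # X # w) v g"
      if "length (u @ X # Y # w) = k" "set (u @ X # Y # w) \<subseteq> L" for u X Y w
    proof -
      have "word (u @ X # Y # w) v = word (u @ Y # X # w) v + word (u @ lie_bracket X Y # w) v"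
        using that v rder_commutator[of "word w v" X Y]
        by (simp add: word_closed word_add rder_closed L_bracket)
      moreover have "word (u @ lie_bracket X Y # w) v g = 0"
        using that by (intro IH) (auto intro: L_bracket)
      ultimately show ?thesis by simp
    qed
    have move: "word (u @ X # w @ w') v g = word (u @ w @ X # w') v g"
      if "length (u @ X # w @ w') = k" "set (u @ X # w @ w') \<subseteq> L" for u X w w'
      using that
    proof (induction w arbitrary: u)
      case (Cons Y w)
      have "word (u @ X # (Y # w) @ w') v g = word ((u @ [Y]) @ X # w @ w') v g"
        using swap[of u X Y "w @ w'"] Cons.prems by simp
      also have "\<dots> = word ((u @ [Y]) @ w @ X # w') v g"
        using Cons.prems by (intro Cons.IH) auto
      finally show ?case by simp
    qed simp
    have "word (u @ w) v g = 0" if "length (u @ w) = k" "set u \<subseteq> C" "set w \<subseteq> L" "length w = j" for j u w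
      using that
    proof (induction j arbitrary: u w)
      case 0
      then show ?case using C0 by simp
    next
      case (Suc j)
      then obtain X w' where w: "w = X # w'" by (cases w) auto
      have L: "set u \<subseteq> L" "set w' \<subseteq> L" "X \<in> L" and len: "length u + Suc (length w') = k" "length w' = j"
        using Suc.prems w sub by auto
      from dec[OF L(3)] obtain Y Z W where XYZ: "Y \<in> a" "Z \<in> p" "W \<in> cm.span C" "X = Y + W + Z"
        by blast
      let ?e = "\<lambda>X. word (u @ X # w') v g"
      have YZ: "Y \<in> L" "Z \<in> L" using XYZ sub by auto
      have lin: "?e (A + B) = ?e A + ?e B" "?e (cscale c A) = c * ?e A" if "A \<in> L" "B \<in> L" for A B c
        using that L v by (simp_all add: rder_lin word_add word_fscale word_closed rder_closed)
      have "W \<in> {W \<in> L. ?e W = 0}"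
      proof (rule set_mp[OF cm.span_minimal XYZ(3)])
        show "C \<subseteq> {W \<in> L. ?e W = 0}"
        proof
          fix W assume "W \<in> C"
          then have "word ((u @ [W]) @ w') v g = 0"
            by (intro Suc.IH) (use Suc.prems L len in \<open>simp_all del: foldr_append\<close>)
          then show "W \<in> {W \<in> L. ?e W = 0}"
            using \<open>W \<in> C\<close> sub by auto
        qed
        show "cm.subspace {W \<in> L. ?e W = 0}"
        proof (rule cm.subspaceI)
          show "0 \<in> {W \<in> L. ?e W = 0}"
            using lin(2)[OF lie_algebra_0 lie_algebra_0, of 0] lie_algebra_0 by simp
        next
          fix A B c assume AB: "A \<in> {W \<in> L. ?e W = 0}"
          then have A: "A \<in> L" "?e A = 0" by auto
          show "cscale c A \<in> {W \<in> L. ?e W = 0}"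
            using lin(2)[OF A(1,1), of c] A lie_algebra_cscale by simp
          assume "B \<in> {W \<in> L. ?e W = 0}"
          then have B: "B \<in> L" "?e B = 0" by auto
          show "A + B \<in> {W \<in> L. ?e W = 0}"
            using lin(1)[OF A(1) B(1)] A B lie_algebra_add by simp
        qed
      qed
      moreover have "?e Y = 0"
      proof -
        have "?e Y = word (Y # u @ w') v g"
          using move[of "[]" Y u w'] L YZ len by simp
        also have "\<dots> = 0"
        proof -
          have "set (u @ w') \<subseteq> L" "length (u @ w') < k"
            using L len by auto
          then show ?thesis
            using a[OF XYZ(1), of "u @ w'"] IH[of "u @ w'"] by (metis mult_zero_right)
        qed
        finally show ?thesis .
      qed
      moreover have "?e Z = 0"
      proof -
        obtain c where c: "D Z v = fscale c v" using p[OF XYZ(2)] by blast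
        have "?e Z = word (u @ w' @ [Z]) v g"
          using move[of u Z w' "[]"] L YZ len by simp
        also have "\<dots> = c * word (u @ w') v g"
          using L by (simp add: c word_fscale[OF v, of "u @ w'", simplified])
        also have "\<dots> = 0"
          using IH[of "u @ w'"] L len by simp
        finally show ?thesis .
      qed
      ultimately have "?e X = 0"
        using lin(1)[of "Y + W" Z] lin(1)[of Y W] YZ XYZ(4) lie_algebra_add[of Y K W]
        by (simp del: foldr_append)
      then show ?case by (simp add: w)
    qed
    from this[of "[]" Xs k] less.prems show ?case by simp
  qed
  with nz show False by blast
qed

lemma word_weight:
  assumes "v \<in> R" "H \<in> L" "D H v = fscale c v" "set Xs \<subseteq> L" "\<And>X. X \<in> set Xs \<Longrightarrow> lie_bracket H X = cscale (wt X) X"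
  shows "D H (word Xs v) = fscale (c + sum_list (map wt Xs)) (word Xs v)"
  using assms(4,5)
proof (induction Xs)
  case (Cons X Xs)
  then have "D H (D X (word Xs v)) = D X (D H (word Xs v)) + fscale (wt X) (D X (word Xs v))"
    using assms(1,2) rder_commutator[of "word Xs v" H X] rder_lin(2)[of "word Xs v" X X "wt X"]
    by (simp add: word_closed)
  also have "D X (D H (word Xs v)) = fscale (c + sum_list (map wt Xs)) (D X (word Xs v))"
  proof -
    have "D H (word Xs v) = fscale (c + sum_list (map wt Xs)) (word Xs v)"
      by (rule Cons.IH) (use Cons.prems in auto)
    moreover have "D X (fscale (c + sum_list (map wt Xs)) (word Xs v)) = fscale (c + sum_list (map wt Xs)) (D X (word Xs v))"
      by (rule rder_fscale) (use Cons.prems assms(1) word_closed in auto)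
    ultimately show ?thesis
      by metis
  qed
  finally show ?case
    by (simp add: fun_eq_iff algebra_simps)
qed (use assms in simp)

text \<open>A nilpotent matrix acts on the entries as a nilpotent operator, so the product rule makes its
  derivation locally nilpotent.\<close>

lemma rder_locally_nilpotent:
  assumes "X \<in> L" "mpow X N = 0" "f \<in> R"
  shows "\<exists>k. (D X ^^ k) f = 0"
proof -
  have prod: "(ideriv X ^^ n) (\<lambda>A. p A * q A) = (\<lambda>A. 0)"
    if "matrix_poly p" "matrix_poly q" "(ideriv X ^^ k) p = (\<lambda>A. 0)" "(ideriv X ^^ l) q = (\<lambda>A. 0)" "n = k + l" for k l n p q
    using that
  proof (induction n arbitrary: k l p q)
    case (Suc n)
    have z: "(ideriv X ^^ m) (\<lambda>A. 0) = (\<lambda>A. 0)" for m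
      by (induction m) auto
    have s: "(ideriv X ^^ m) (\<lambda>A. p A + q A) = (\<lambda>A. (ideriv X ^^ m) p A + (ideriv X ^^ m) q A)"
      if "matrix_poly p" "matrix_poly q" for m p q
      by (induction m) (use that in \<open>auto simp: ideriv_add matrix_poly_ideriv_funpow\<close>)
    have "(ideriv X ^^ n) (\<lambda>A. ideriv X p A * q A) = (\<lambda>A. 0)"
    proof (cases k)
      case 0
      then have "p = (\<lambda>A. 0)" using Suc.prems by simp
      then show ?thesis by (simp add: z)
    next
      case (Suc k')
      then have "(ideriv X ^^ k') (ideriv X p) = (\<lambda>A. 0)"
        using Suc.prems(3) by (simp only: funpow_Suc_right o_apply)
      then show ?thesis
        using Suc.prems Suc by (intro Suc.IH[of _ _ k' l]) auto
    qed
    moreover have "(ideriv X ^^ n) (\<lambda>A. p A * ideriv X q A) = (\<lambda>A. 0)"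
    proof (cases l)
      case 0
      then have "q = (\<lambda>A. 0)" using Suc.prems by simp
      then show ?thesis by (simp add: z)
    next
      case (Suc l')
      then have "(ideriv X ^^ l') (ideriv X q) = (\<lambda>A. 0)"
        using Suc.prems(4) by (simp only: funpow_Suc_right o_apply)
      then show ?thesis
        using Suc.prems Suc by (intro Suc.IH[of _ _ k l']) auto
    qed
    ultimately show ?case
      using Suc.prems(1,2)
      by (simp add: funpow_Suc_right ideriv_mult s matrix_poly.mult matrix_poly_ideriv del: funpow.simps)
  qed simp
  have "\<exists>k. (ideriv X ^^ k) p = (\<lambda>A. 0)" if "matrix_poly p" for p
    using that
  proof induction
    case (const c)
    show ?case by (rule exI[of _ 1]) simp
  next
    case (entry i j)
    have "(ideriv X ^^ k) (\<lambda>A. A $ i $ j) = (\<lambda>A. (A ** mpow X k) $ i $ j)" for k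
    proof (induction k)
      case (Suc k)
      have "ideriv X (\<lambda>A. (A ** mpow X k) $ i $ j) A = (A ** X ** mpow X k) $ i $ j" for A
      proof (rule ideriv_unique)
        show "((\<lambda>w. (A ** mexp (cscale w X) ** mpow X k) $ i $ j) has_field_derivative (A ** X ** mpow X k) $ i $ j) (at 0)"
          using mderiv_mult[OF mderiv_mexp_right[of A X 0] mderiv_const, of "mpow X k"] by (simp add: mderiv_def)
      qed (use matrix_poly_mult_right[OF matrix_poly.entry] in auto)
      then show ?case
        by (simp add: Suc mpow_Suc matrix_mul_assoc)
    qed simp
    then show ?case
      using assms(2) by (intro exI[of _ N]) simp
  next
    case (add p q)
    then obtain k l where kl: "(ideriv X ^^ k) p = (\<lambda>A. 0)" "(ideriv X ^^ l) q = (\<lambda>A. 0)" by blast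
    have z: "(ideriv X ^^ m) (\<lambda>A. 0) = (\<lambda>A. 0)" for m
      by (induction m) auto
    have s: "(ideriv X ^^ m) (\<lambda>A. p A + q A) = (\<lambda>A. (ideriv X ^^ m) p A + (ideriv X ^^ m) q A)" for m
      by (induction m) (use add.hyps in \<open>auto simp: ideriv_add matrix_poly_ideriv_funpow\<close>)
    have "(ideriv X ^^ (l + k)) p = (\<lambda>A. 0)" "(ideriv X ^^ (k + l)) q = (\<lambda>A. 0)"
      by (simp_all only: funpow_add o_apply kl z)
    then show ?case
      by (intro exI[of _ "k + l"]) (simp add: s add.commute)
  next
    case (mult p q)
    then show ?case using prod by blast
  qed
  moreover obtain p where p: "matrix_poly p" "f = res K p"
    using assms(3) by (elim coord_ringE)
  moreover have "(D X ^^ k) f = res K ((ideriv X ^^ k) p)" for k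
    by (induction k) (use p assms(1) in \<open>auto simp: rder_res matrix_poly_ideriv_funpow\<close>)
  moreover from calculation(1)[OF p(1)] obtain k where "(ideriv X ^^ k) p = (\<lambda>A. 0)"
    by blast
  ultimately have "(D X ^^ k) f = res K (\<lambda>A. 0)"
    by simp
  then show ?thesis
    by (intro exI[of _ k]) (simp add: res_def zero_fun_def)
qed

lemma rder_sl2_lowest:
  assumes "E \<in> L" "F \<in> L" "lie_bracket E F = H" "lie_bracket H E = cscale 2 E" "mpow E N = 0"
    and "v \<in> R" "v \<noteq> 0" "D F v = 0" "D H v = fscale c v"
  shows "\<exists>n. c = - of_nat n \<and> (\<forall>i\<le>n. (D E ^^ i) v \<noteq> 0) \<and> (\<forall>i>n. (D E ^^ i) v = 0)"
proof -
  have H: "H \<in> L"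
    using assms(1-3) L_bracket by blast
  obtain k where k: "(D E ^^ k) v = 0"
    using rder_locally_nilpotent[OF assms(1,5,6)] by blast
  show ?thesis
  proof (rule sl2_lowest[OF vector_space_fscale, where M = R and H = "D H" and F = "D F"])
    show "D F (D E v) = D E (D F v) - D H v" if "v \<in> R" for v
      using rder_commutator[OF that assms(1,2)] assms(3) by simp
    show "D H (D E v) = D E (D H v) + fscale 2 (D E v)" if "v \<in> R" for v
      using rder_commutator[OF that H assms(1)] rder_lin(2)[OF that assms(1,1)] assms(4) by simp
  qed (use assms k in \<open>auto simp: rder_fscale rder_0\<close>)
qed

end

section \<open>Characters and their differentials\<close>

lemma det_ne_0: "invertible (A :: complex^'n^'n) \<Longrightarrow> det A \<noteq> 0"
  by (simp add: invertible_det_nz)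

text \<open>Cramer's rule.\<close>

lemma matrix_inv_entry_poly:
  "\<exists>q. matrix_poly q \<and> (\<forall>A :: complex^'n^'n. invertible A \<longrightarrow> matrix_inv A $ i $ j = q A / det A)"
proof -
  define q where "q A = det (\<chi> k l. if l = i then axis j 1 $ k else A $ k $ l)" for A :: "complex^'n^'n"
  have "matrix_poly q"
    unfolding q_def
  proof (rule matrix_poly_comp[OF matrix_poly_det])
    show "matrix_poly (\<lambda>A :: complex^'n^'n. (\<chi> k l. if l = i then axis j 1 $ k else A $ k $ l) $ k $ l)" for k l
      by (cases "l = i") (auto intro: matrix_poly.intros)
  qed
  moreover have "matrix_inv A $ i $ j = q A / det A" if "invertible A" for A
  proof -
    have "A *v column j (matrix_inv A) = axis j 1"
    proof -
      have "(A ** matrix_inv A) $ k $ j = axis j 1 $ k" for k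
        using that by (simp add: mat_def axis_def)
      then show ?thesis
        by (simp add: vec_eq_iff matrix_vector_mult_def column_def mm_nth)
    qed
    then show ?thesis
      using cramer[OF det_ne_0[OF that], of "column j (matrix_inv A)" "axis j 1"]
      by (simp add: column_def vec_eq_iff q_def)
  qed
  ultimately show ?thesis by blast
qed

lemma matrix_poly_inv:
  assumes "matrix_poly p"
  shows "\<exists>q k. matrix_poly q \<and> (\<forall>A :: complex^'n^'n. invertible A \<longrightarrow> p (matrix_inv A) = q A / det A ^ k)"
  using assms
proof induction
  case (const c)
  show ?case by (rule exI[of _ "\<lambda>A. c"], rule exI[of _ 0]) (auto intro: matrix_poly.intros)
next
  case (entry i j)
  obtain q where q: "matrix_poly q" "\<forall>A :: complex^'n^'n. invertible A \<longrightarrow> matrix_inv A $ i $ j = q A / det A"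
    using matrix_inv_entry_poly by blast
  then show ?case
    by (intro exI[of _ q] exI[of _ 1]) simp
next
  case (add p p')
  then obtain q k q' k' where *: "matrix_poly q" "\<forall>A :: complex^'n^'n. invertible A \<longrightarrow> p (matrix_inv A) = q A / det A ^ k"
     "matrix_poly q'" "\<forall>A :: complex^'n^'n. invertible A \<longrightarrow> p' (matrix_inv A) = q' A / det A ^ k'" by blast
  then show ?case
    by (intro exI[of _ "\<lambda>A. q A * det A ^ k' + q' A * det A ^ k"] exI[of _ "k + k'"])
      (auto intro!: matrix_poly.intros matrix_poly_power matrix_poly_det simp: det_ne_0 power_add add_divide_distrib)
next
  case (mult p p')
  then obtain q k q' k' where *: "matrix_poly q" "\<forall>A :: complex^'n^'n. invertible A \<longrightarrow> p (matrix_inv A) = q A / det A ^ k"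
     "matrix_poly q'" "\<forall>A :: complex^'n^'n. invertible A \<longrightarrow> p' (matrix_inv A) = q' A / det A ^ k'" by blast
  then show ?case
    by (intro exI[of _ "\<lambda>A. q A * q' A"] exI[of _ "k + k'"])
      (auto intro!: matrix_poly.intros simp: power_add)
qed

lemma regular_on_inv:
  assumes "algebraic_group K" "regular_on K f"
  shows "regular_on K (\<lambda>A. f (matrix_inv A))"
proof -
  obtain p m where p: "matrix_poly p" "\<forall>A\<in>K. f A = p A / det A ^ m"
    using assms(2) unfolding regular_on_def by blast
  obtain q k where q: "matrix_poly q" "\<forall>A. invertible A \<longrightarrow> p (matrix_inv A) = q A / det A ^ k"
    using matrix_poly_inv[OF p(1)] by blast
  have "f (matrix_inv A) = (q A * det A ^ m) / det A ^ k" if A: "A \<in> K" for A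
  proof -
    have inv: "invertible A" using algebraic_groupD(1)[OF assms(1) A] .
    then have "det (matrix_inv A) * det A = 1"
      by (metis det_I det_mul invertible_inv_mult(2))
    then have d: "det (matrix_inv A) = 1 / det A"
      using det_ne_0[OF inv] by (simp add: field_simps)
    show ?thesis
      using p(2) algebraic_groupD(4)[OF assms(1) A] q(2) inv by (simp add: d power_divide)
  qed
  then show ?thesis
    unfolding regular_on_def
    by (intro exI[of _ "\<lambda>A. q A * det A ^ m"] exI[of _ k])
      (auto intro!: matrix_poly.intros q matrix_poly_power matrix_poly_det)
qed

lemma regular_on_cong: "(\<And>A. A \<in> K \<Longrightarrow> f A = g A) \<Longrightarrow> regular_on K f \<longleftrightarrow> regular_on K g"
  by (simp add: regular_on_def)

lemma regular_on_poly: "matrix_poly p \<Longrightarrow> regular_on K p"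
  unfolding regular_on_def by (intro exI[of _ p] exI[of _ 0]) simp

lemma regular_on_mult:
  assumes "regular_on K f" "regular_on K g"
  shows "regular_on K (\<lambda>A. f A * g A)"
proof -
  obtain p m q k where *: "matrix_poly p" "\<forall>A\<in>K. f A = p A / det A ^ m"
      "matrix_poly q" "\<forall>A\<in>K. g A = q A / det A ^ k"
    using assms unfolding regular_on_def by blast
  then show ?thesis
    unfolding regular_on_def
    by (intro exI[of _ "\<lambda>A. p A * q A"] exI[of _ "m + k"]) (auto intro: matrix_poly.intros simp: power_add)
qed

lemma charactersD:
  assumes "\<phi> \<in> characters K"
  shows "\<phi> \<in> extensional K" "regular_on K \<phi>" "x \<in> K \<Longrightarrow> \<phi> x \<noteq> 0"
    "x \<in> K \<Longrightarrow> y \<in> K \<Longrightarrow> \<phi> (x ** y) = \<phi> x * \<phi> y"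
  using assms by (auto simp: characters_def)

lemma char_one:
  assumes "algebraic_group K" "\<phi> \<in> characters K"
  shows "\<phi> (mat 1) = 1"
  using charactersD(3,4)[OF assms(2), of "mat 1"] charactersD(4)[OF assms(2), of "mat 1" "mat 1"] algebraic_groupD(2)[OF assms(1)]
  by simp

lemma char_inv:
  assumes "algebraic_group K" "\<phi> \<in> characters K" "x \<in> K"
  shows "\<phi> (matrix_inv x) = inverse (\<phi> x)"
proof -
  have "\<phi> (x ** matrix_inv x) = \<phi> x * \<phi> (matrix_inv x)"
    using assms algebraic_groupD by (intro charactersD(4)) auto
  then show ?thesis
    using assms char_one[OF assms(1,2)] algebraic_groupD(1)[OF assms(1,3)]
    by (metis inverse_unique invertible_inv_mult(1))
qed

lemma charactersI:
  assumes "regular_on K f" "\<And>x. x \<in> K \<Longrightarrow> f x \<noteq> 0" "\<And>x y. x \<in> K \<Longrightarrow> y \<in> K \<Longrightarrow> f (x ** y) = f x * f y"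
    "algebraic_group K"
  shows "restrict f K \<in> characters K"
  unfolding characters_def using assms algebraic_groupD(3)[OF assms(4)]
  by (auto simp: regular_on_cong[of K "restrict f K" f])

lemma carrier_char_group [simp]: "carrier (char_group K) = characters K"
  and mult_char_group: "\<phi> \<otimes>\<^bsub>char_group K\<^esub> \<psi> = (\<lambda>x\<in>K. \<phi> x * \<psi> x)"
  and one_char_group: "\<one>\<^bsub>char_group K\<^esub> = (\<lambda>x\<in>K. 1)"
  by (simp_all add: char_group_def)

lemma comm_group_char_group:
  assumes K: "algebraic_group K"
  shows "comm_group (char_group K)"
proof (rule comm_groupI)
  fix \<phi> \<psi> assume "\<phi> \<in> carrier (char_group K)" "\<psi> \<in> carrier (char_group K)"
  then show "\<phi> \<otimes>\<^bsub>char_group K\<^esub> \<psi> \<in> carrier (char_group K)"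
    unfolding carrier_char_group mult_char_group
    by (intro charactersI regular_on_mult K) (auto dest: charactersD simp: charactersD(4))
next
  show "\<one>\<^bsub>char_group K\<^esub> \<in> carrier (char_group K)"
    unfolding carrier_char_group one_char_group
    by (intro charactersI regular_on_poly K matrix_poly.const) auto
next
  fix \<phi> assume \<phi>: "\<phi> \<in> carrier (char_group K)"
  then show "\<one>\<^bsub>char_group K\<^esub> \<otimes>\<^bsub>char_group K\<^esub> \<phi> = \<phi>"
    by (auto simp: mult_char_group one_char_group restrict_def fun_eq_iff extensional_arb[OF charactersD(1)])
  show "\<exists>\<psi>\<in>carrier (char_group K). \<psi> \<otimes>\<^bsub>char_group K\<^esub> \<phi> = \<one>\<^bsub>char_group K\<^esub>"
  proof (intro bexI[of _ "\<lambda>x\<in>K. \<phi> (matrix_inv x)"])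
    show "(\<lambda>x\<in>K. \<phi> (matrix_inv x)) \<otimes>\<^bsub>char_group K\<^esub> \<phi> = \<one>\<^bsub>char_group K\<^esub>"
      using \<phi> by (auto simp: mult_char_group one_char_group char_inv[OF K] charactersD(3) intro!: restrict_ext)
    show "(\<lambda>x\<in>K. \<phi> (matrix_inv x)) \<in> carrier (char_group K)"
      unfolding carrier_char_group
    proof (rule charactersI[OF regular_on_inv[OF K charactersD(2)] _ _ K])
      show "\<phi> (matrix_inv (x ** y)) = \<phi> (matrix_inv x) * \<phi> (matrix_inv y)" if "x \<in> K" "y \<in> K" for x y
        using \<phi> that by (simp add: char_inv[OF K] charactersD(4) algebraic_groupD(3)[OF K])
    qed (use \<phi> algebraic_groupD(4)[OF K] in \<open>auto dest: charactersD(3)\<close>)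
  qed
qed (auto simp: mult_char_group intro!: restrict_ext)

lemma char_inv_apply:
  assumes "algebraic_group K" "\<phi> \<in> characters K" "x \<in> K"
  shows "(inv\<^bsub>char_group K\<^esub> \<phi>) x = inverse (\<phi> x)"
proof -
  interpret comm_group "char_group K" by (rule comm_group_char_group[OF assms(1)])
  have "((inv\<^bsub>char_group K\<^esub> \<phi>) \<otimes>\<^bsub>char_group K\<^esub> \<phi>) x = \<one>\<^bsub>char_group K\<^esub> x"
    using assms(2) by simp
  then show ?thesis
    using assms(3) by (intro inverse_unique[symmetric]) (simp add: mult_char_group one_char_group mult.commute)
qed

lemma char_pow_nat_apply: "x \<in> K \<Longrightarrow> (\<phi> [^]\<^bsub>char_group K\<^esub> (n :: nat)) x = \<phi> x ^ n"
  by (induction n) (auto simp: nat_pow_def mult_char_group one_char_group)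

lemma char_pow_int_apply:
  assumes "algebraic_group K" "\<phi> \<in> characters K" "x \<in> K"
  shows "(\<phi> [^]\<^bsub>char_group K\<^esub> (n :: int)) x = \<phi> x powi n"
proof -
  interpret comm_group "char_group K" by (rule comm_group_char_group[OF assms(1)])
  have "\<phi> [^]\<^bsub>char_group K\<^esub> m \<in> characters K" for m :: nat
    using nat_pow_closed[of \<phi> m] assms(2) by simp
  then have "(inv\<^bsub>char_group K\<^esub> (\<phi> [^]\<^bsub>char_group K\<^esub> m)) x = inverse (\<phi> x) ^ m" for m :: nat
    using char_inv_apply[OF assms(1) _ assms(3), of "\<phi> [^]\<^bsub>char_group K\<^esub> m"] char_pow_nat_apply[OF assms(3), of \<phi> m]
    by (simp only: power_inverse)
  moreover have "\<phi> [^]\<^bsub>char_group K\<^esub> n =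
      (if n < 0 then inv\<^bsub>char_group K\<^esub> (\<phi> [^]\<^bsub>char_group K\<^esub> nat (- n)) else \<phi> [^]\<^bsub>char_group K\<^esub> nat n)"
    by (rule int_pow_def2)
  ultimately show ?thesis
    using char_pow_nat_apply[OF assms(3), of \<phi> "nat n"] unfolding power_int_def not_less[symmetric]
    by (cases "n < 0") (simp_all only: if_True if_False simp_thms)
qed

lemma characters_eqI:
  "\<phi> \<in> characters K \<Longrightarrow> \<psi> \<in> characters K \<Longrightarrow> (\<And>x. x \<in> K \<Longrightarrow> \<phi> x = \<psi> x) \<Longrightarrow> \<phi> = \<psi>"
  by (meson charactersD(1) extensionalityI)

text \<open>The derivative of a homomorphism at one point determines it.\<close>

lemma exp_character:
  assumes h: "\<And>a b. h (a + b) = h a * h b" "h 0 = (1::complex)" "(h has_field_derivative c) (at 0)"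
  shows "h z = exp (c * z)"
proof -
  have d: "(h has_field_derivative h w * c) (at w)" for w
  proof -
    have "((\<lambda>x. h w * h (x - w)) has_field_derivative h w * c) (at w)"
    proof (rule DERIV_cmult)
      have "((\<lambda>x. h (x - w)) has_field_derivative c * 1) (at w)"
        by (rule DERIV_chain2[where f = h]) (auto intro!: derivative_eq_intros simp: h(3))
      then show "((\<lambda>x. h (x - w)) has_field_derivative c) (at w)" by simp
    qed
    moreover have "(\<lambda>x. h w * h (x - w)) = h"
      using h(1)[of w] by (auto simp flip: h(1))
    ultimately show ?thesis by simp
  qed
  let ?g = "\<lambda>w. exp (- c * w) * h w"
  have "(?g has_field_derivative 0) (at w)" for w
  proof -
    have "((\<lambda>w. exp (- c * w)) has_field_derivative exp (- c * w) * (- c)) (at w)"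
      by (auto intro!: derivative_eq_intros)
    from DERIV_mult'[OF this d[of w]] show ?thesis by simp
  qed
  then obtain c' where c': "\<And>w. ?g w = c'"
    using has_field_derivative_zero_constant[of UNIV ?g] by auto
  have "?g z = ?g 0"
    by (rule trans[OF c' c'[symmetric]])
  then show ?thesis
    using h(2) by (simp add: exp_minus field_simps)
qed

text \<open>The differential is defined through an arbitrary extension of \<open>\<phi>\<close> along
  lines; comparing with one-parameter subgroups shows that it is well defined, linear, and the
  logarithmic derivative of \<open>\<phi>\<close>.\<close>

lemma differential_formula:
  fixes K :: "(complex^'n^'n) set"
  assumes K: "algebraic_group K" and \<phi>: "\<phi> \<in> characters K"
  obtains p m where "matrix_poly p" "\<And>X. X \<in> lie_algebra K \<Longrightarrow>
      differential K \<phi> X = ideriv X p (mat 1) - of_nat m * p (mat 1) * ideriv X det (mat 1)"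
    "\<And>X z. X \<in> lie_algebra K \<Longrightarrow> \<phi> (mexp (cscale z X)) = exp (differential K \<phi> X * z)"
proof -
  have *: "((\<lambda>z. p (\<gamma> z) / det (\<gamma> z :: complex^'n^'n) ^ m) has_field_derivative
        ideriv X p (mat 1) - of_nat m * p (mat 1) * ideriv X det (mat 1)) (at 0)"
    if p: "matrix_poly p" and \<gamma>: "\<gamma> 0 = mat 1" "mderiv \<gamma> X 0" for p m \<gamma> X
  proof -
    have a: "((\<lambda>z. p (\<gamma> z)) has_field_derivative ideriv X p (mat 1)) (at 0)"
      "((\<lambda>z. det (\<gamma> z)) has_field_derivative ideriv X det (mat 1)) (at 0)"
      using ideriv_curve[OF p, of \<gamma> 0 X] ideriv_curve[OF matrix_poly_det, of \<gamma> 0 X] \<gamma> by simp_all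
    have b: "((\<lambda>z. det (\<gamma> z) ^ m) has_field_derivative of_nat m * ideriv X det (mat 1)) (at 0)"
      using DERIV_power[OF a(2), of m] by (simp add: \<gamma>)
    show ?thesis
      using DERIV_divide[OF a(1) b] by (simp add: \<gamma> algebra_simps)
  qed
  have line: "mat 1 + cscale 0 X = mat 1" "mderiv (\<lambda>z. mat 1 + cscale z X) X 0" for X :: "complex^'n^'n"
    using mderiv_add[OF mderiv_const mderiv_linear[of X 0], of "mat 1"] by simp_all
  obtain p m where p: "matrix_poly p" "\<forall>A\<in>K. \<phi> A = p A / det A ^ m"
    using charactersD(2)[OF \<phi>] unfolding regular_on_def by blast
  define c where "c X = ideriv X p (mat 1) - of_nat m * p (mat 1) * ideriv X det (mat 1)" for X
  have h: "((\<lambda>z. \<phi> (mexp (cscale z X))) has_field_derivative d) (at 0) \<longleftrightarrow>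
      d = ideriv X q (mat 1) - of_nat k * q (mat 1) * ideriv X det (mat 1)"
    if "X \<in> lie_algebra K" "matrix_poly q" "\<forall>A\<in>K. \<phi> A = q A / det A ^ k" for X q k d
  proof -
    have "((\<lambda>z. \<phi> (mexp (cscale z X))) has_field_derivative
        ideriv X q (mat 1) - of_nat k * q (mat 1) * ideriv X det (mat 1)) (at 0)"
      using *[OF that(2), of "\<lambda>z. mexp (cscale z X)" X k] mderiv_mexp_0[of X] that(3) mexp_mem(1)[OF K that(1)]
      by simp
    then show ?thesis
      using DERIV_unique by blast
  qed
  have diff: "differential K \<phi> X = c X" if X: "X \<in> lie_algebra K" for X
    unfolding differential_def
  proof (rule the_equality)
    show "\<exists>p m. matrix_poly p \<and> (\<forall>A\<in>K. \<phi> A = p A / det A ^ m) \<and>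
     ((\<lambda>z. p (mat 1 + cscale z X) / det (mat 1 + cscale z X) ^ m) has_field_derivative c X) (at 0)"
      using p *[OF p(1) line[of X], of m] unfolding c_def by (intro exI[of _ p] exI[of _ m] conjI)
    fix d assume "\<exists>p m. matrix_poly p \<and> (\<forall>A\<in>K. \<phi> A = p A / det A ^ m) \<and>
     ((\<lambda>z. p (mat 1 + cscale z X) / det (mat 1 + cscale z X) ^ m) has_field_derivative d) (at 0)"
    then obtain q k where q: "matrix_poly q" "\<forall>A\<in>K. \<phi> A = q A / det A ^ k"
     "((\<lambda>z. q (mat 1 + cscale z X) / det (mat 1 + cscale z X) ^ k) has_field_derivative d) (at 0)" by blast
    then have "d = ideriv X q (mat 1) - of_nat k * q (mat 1) * ideriv X det (mat 1)"
      using DERIV_unique[OF q(3) *[OF q(1) line[of X]]] by simp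
    then have "((\<lambda>z. \<phi> (mexp (cscale z X))) has_field_derivative d) (at 0)"
      using h[OF X q(1,2)] by simp
    then show "d = c X"
      using h[OF X p] by (simp add: c_def)
  qed
  have "\<phi> (mexp (cscale z X)) = exp (differential K \<phi> X * z)" if X: "X \<in> lie_algebra K" for X z
  proof (rule exp_character[of "\<lambda>z. \<phi> (mexp (cscale z X))"])
    show "\<phi> (mexp (cscale (a + b) X)) = \<phi> (mexp (cscale a X)) * \<phi> (mexp (cscale b X))" for a b
      unfolding mexp_add using mexp_mem(1)[OF K X] by (intro charactersD(4)[OF \<phi>])
    show "\<phi> (mexp (cscale 0 X)) = 1"
      by (simp add: char_one[OF K \<phi>])
    show "((\<lambda>z. \<phi> (mexp (cscale z X))) has_field_derivative differential K \<phi> X) (at 0)"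
      using h[OF X p] diff[OF X] by (simp add: c_def)
  qed
  then show ?thesis
    using p(1) diff unfolding c_def by (intro that[of p m])
qed

lemma char_mexp:
  assumes "algebraic_group K" "\<phi> \<in> characters K" "X \<in> lie_algebra K"
  shows "\<phi> (mexp (cscale z X)) = exp (differential K \<phi> X * z)" "\<phi> (mexp X) = exp (differential K \<phi> X)"
proof -
  show *: "\<phi> (mexp (cscale z X)) = exp (differential K \<phi> X * z)" for z
    by (rule differential_formula[OF assms(1,2)]) (use assms(3) in blast)
  show "\<phi> (mexp X) = exp (differential K \<phi> X)"
    using *[of 1] by simp
qed

lemma differential_eqI:
  assumes "algebraic_group K" "\<phi> \<in> characters K" "X \<in> lie_algebra K" "\<And>z. \<phi> (mexp (cscale z X)) = exp (c * z)"
  shows "differential K \<phi> X = c"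
proof -
  have "exp (differential K \<phi> X * z) = exp (c * z)" for z
    using char_mexp(1)[OF assms(1-3)] assms(4) by simp
  moreover have "((\<lambda>z. exp (c * z)) has_field_derivative c) (at 0)" for c :: complex
    by (auto intro!: derivative_eq_intros)
  ultimately show ?thesis
    using DERIV_unique[of "\<lambda>z. exp (c * z)" c 0 "differential K \<phi> X"] by (metis (no_types, lifting) ext)
qed

lemma differential_lin:
  assumes "algebraic_group K" "\<phi> \<in> characters K" "X \<in> lie_algebra K" "Y \<in> lie_algebra K"
  shows "differential K \<phi> (X + Y) = differential K \<phi> X + differential K \<phi> Y"
    "differential K \<phi> (cscale c X) = c * differential K \<phi> X"
proof -
  have "\<exists>p m. matrix_poly p \<and> (\<forall>X\<in>lie_algebra K. differential K \<phi> X =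
      ideriv X p (mat 1) - of_nat m * p (mat 1) * ideriv X det (mat 1))"
    by (rule differential_formula[OF assms(1,2)]) blast
  then obtain p m where *: "matrix_poly p" "\<And>X. X \<in> lie_algebra K \<Longrightarrow>
      differential K \<phi> X = ideriv X p (mat 1) - of_nat m * p (mat 1) * ideriv X det (mat 1)"
    by blast
  show "differential K \<phi> (X + Y) = differential K \<phi> X + differential K \<phi> Y"
    using assms(3,4) *(1)
    by (simp add: *(2) lie_algebra_add ideriv_lin matrix_poly_det algebra_simps)
  show "differential K \<phi> (cscale c X) = c * differential K \<phi> X"
    using assms(3,4) *(1)
    by (simp add: *(2) lie_algebra_cscale ideriv_lin matrix_poly_det algebra_simps)
qed

lemma differential_mult:
  assumes "algebraic_group K" "\<phi> \<in> characters K" "\<psi> \<in> characters K" "X \<in> lie_algebra K"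
  shows "differential K (\<phi> \<otimes>\<^bsub>char_group K\<^esub> \<psi>) X = differential K \<phi> X + differential K \<psi> X"
proof (rule differential_eqI[OF assms(1) _ assms(4)])
  interpret comm_group "char_group K" by (rule comm_group_char_group[OF assms(1)])
  show "\<phi> \<otimes>\<^bsub>char_group K\<^esub> \<psi> \<in> characters K"
    using m_closed assms(2,3) by simp
  show "(\<phi> \<otimes>\<^bsub>char_group K\<^esub> \<psi>) (mexp (cscale z X)) = exp ((differential K \<phi> X + differential K \<psi> X) * z)" for z
    using assms mexp_mem(1)[OF assms(1,4)] by (simp add: mult_char_group char_mexp algebra_simps exp_add)
qed

lemma differential_one:
  "algebraic_group K \<Longrightarrow> X \<in> lie_algebra K \<Longrightarrow> differential K \<one>\<^bsub>char_group K\<^esub> X = 0"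
  using comm_group_char_group[of K] mexp_mem(1)[of K X]
  by (intro differential_eqI) (auto simp: one_char_group comm_group_def group_def monoid.one_closed[of "char_group K", simplified one_char_group carrier_char_group] comm_monoid_def)

lemma differential_pow_int:
  assumes "algebraic_group K" "\<phi> \<in> characters K" "X \<in> lie_algebra K"
  shows "differential K (\<phi> [^]\<^bsub>char_group K\<^esub> (n :: int)) X = of_int n * differential K \<phi> X"
proof (rule differential_eqI[OF assms(1) _ assms(3)])
  interpret comm_group "char_group K" by (rule comm_group_char_group[OF assms(1)])
  show "\<phi> [^]\<^bsub>char_group K\<^esub> n \<in> characters K"
    using int_pow_closed assms(2) by simp
  show "(\<phi> [^]\<^bsub>char_group K\<^esub> n) (mexp (cscale z X)) = exp (of_int n * differential K \<phi> X * z)" for z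
    using assms mexp_mem(1)[OF assms(1,3)]
    by (simp add: char_pow_int_apply char_mexp exp_power_int mult.assoc)
qed

lemma characters_eq_differential:
  assumes K: "connected_algebraic_group K" and \<phi>: "\<phi> \<in> characters K" "\<psi> \<in> characters K"
    and eq: "\<And>X. X \<in> lie_algebra K \<Longrightarrow> differential K \<phi> X = differential K \<psi> X"
  shows "\<phi> = \<psi>"
proof (rule characters_eqI[OF \<phi>])
  have alg: "algebraic_group K" using K by (simp add: connected_algebraic_group_def)
  fix x assume x: "x \<in> K"
  show "\<phi> x = \<psi> x"
  proof (rule connected_algebraic_induct[OF K x, where P = "\<lambda>x. \<phi> x = \<psi> x"])
    show "\<phi> (mat 1) = \<psi> (mat 1)"
      using char_one[OF alg \<phi>(1)] char_one[OF alg \<phi>(2)] by simp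
    show "\<phi> (A ** mexp X) = \<psi> (A ** mexp X)" if "A \<in> K" "\<phi> A = \<psi> A" "X \<in> lie_algebra K" for A X
      using that mexp_mem(2)[OF alg] \<phi> by (simp add: charactersD(4) char_mexp(2)[OF alg] eq)
  qed
qed

section \<open>Weight spaces of a torus\<close>

lemma mderiv_unique:
  assumes "mderiv f a z" "mderiv f b z"
  shows "a = b"
proof -
  have "a $ i $ j = b $ i $ j" for i j
  proof (rule DERIV_unique)
    show "((\<lambda>w. f w $ i $ j) has_field_derivative a $ i $ j) (at z)"
      using assms(1) by (simp add: mderiv_def)
    show "((\<lambda>w. f w $ i $ j) has_field_derivative b $ i $ j) (at z)"
      using assms(2) by (simp add: mderiv_def)
  qed
  then show ?thesis
    by (simp add: vec_eq_iff)
qed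

lemma trace_cscale: "trace (cscale c X) = c * trace (X :: complex^'n^'n)"
  by (simp add: trace_def sum_distrib_left)

lemma trace_mult3: "trace (A ** B ** C) = trace (C ** A ** (B :: complex^'n^'n))"
  using trace_mul_sym[of "A ** B" C] by (simp add: matrix_mul_assoc)

lemma trace_lie_bracket: "trace (lie_bracket X Y ** Z) = trace (X ** lie_bracket Y (Z :: complex^'n^'n))"
  using trace_mult3[of Y X Z] trace_mult3[of X Z Y] 
  by (simp add: lie_bracket_def matrix_distribs trace_sub matrix_mul_assoc)

locale diag_torus =
  fixes T :: "(complex^'n^'n) set" and S :: "complex^'n^'n"
  assumes connT: "connected_algebraic_group T" and S: "invertible S"
    and diag: "\<And>t i j. t \<in> T \<Longrightarrow> i \<noteq> j \<Longrightarrow> (S ** t ** matrix_inv S) $ i $ j = 0"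
begin

lemma algT: "algebraic_group T"
  using connT by (simp add: connected_algebraic_group_def)

lemmas T_inv = algebraic_groupD(1)[OF algT] and T_minv = algebraic_groupD(4)[OF algT]

text \<open>Passage to a basis in which the torus is diagonal.\<close>

definition cj :: "complex^'n^'n \<Rightarrow> complex^'n^'n" where "cj X = S ** X ** matrix_inv S"

definition uncj :: "complex^'n^'n \<Rightarrow> complex^'n^'n" where "uncj X = matrix_inv S ** X ** S"

lemma cj_uncj [simp]: "cj (uncj X) = X" and uncj_cj [simp]: "uncj (cj X) = X"
  using S by (simp_all add: cj_def uncj_def matrix_mul_assoc)

lemma cj_inj: "cj X = cj Y \<Longrightarrow> X = Y"
  by (metis uncj_cj)

lemma cj_mult: "cj (X ** Y) = cj X ** cj Y"
  using S by (simp add: cj_def matrix_mul_assoc)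

lemma cj_lin: "cj (X + Y) = cj X + cj Y" "cj (X - Y) = cj X - cj Y" "cj (cscale c X) = cscale c (cj X)" "cj 0 = 0"
  by (simp_all add: cj_def matrix_distribs)

lemma cj_1 [simp]: "cj (mat 1) = mat 1"
  using S by (simp add: cj_def)

lemma cj_bracket: "cj (lie_bracket X Y) = lie_bracket (cj X) (cj Y)"
  by (simp add: lie_bracket_def cj_mult cj_lin)

lemma trace_cj: "trace (cj X) = trace X"
  using trace_mul_sym[of "S ** X" "matrix_inv S"] S by (simp add: cj_def matrix_mul_assoc)

text \<open>For elements of the torus these are its weights on the natural representation, for elements
  of its Lie algebra their differentials.\<close>

definition wt :: "'n \<Rightarrow> complex^'n^'n \<Rightarrow> complex" where "wt i t = cj t $ i $ i"

lemma cj_diag: "t \<in> T \<Longrightarrow> i \<noteq> j \<Longrightarrow> cj t $ i $ j = 0"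
  using diag by (simp add: cj_def)

lemma diag_mult:
  assumes "\<And>i j. i \<noteq> j \<Longrightarrow> cj t $ i $ j = 0"
  shows "(cj t ** Y) $ i $ j = wt i t * Y $ i $ j" "(Y ** cj t) $ i $ j = Y $ i $ j * wt j t"
proof -
  have "(\<Sum>k\<in>UNIV. cj t $ i $ k * Y $ k $ j) = (\<Sum>k\<in>UNIV. if k = i then cj t $ i $ i * Y $ i $ j else 0)"
    by (intro sum.cong) (auto simp: assms)
  then show "(cj t ** Y) $ i $ j = wt i t * Y $ i $ j"
    by (simp add: mm_nth wt_def)
  have "(\<Sum>k\<in>UNIV. Y $ i $ k * cj t $ k $ j) = (\<Sum>k\<in>UNIV. if k = j then Y $ i $ j * cj t $ j $ j else 0)"
    by (intro sum.cong) (auto simp: assms)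
  then show "(Y ** cj t) $ i $ j = Y $ i $ j * wt j t"
    by (simp add: mm_nth wt_def)
qed

lemma wt_mult: "s \<in> T \<Longrightarrow> wt i (s ** t) = wt i s * wt i t"
  using diag_mult(1)[of s "cj t" i i] cj_diag by (simp add: wt_def cj_mult)

lemma wt_inv:
  assumes "t \<in> T"
  shows "wt i (matrix_inv t) = inverse (wt i t)" "wt i t \<noteq> 0"
proof -
  have "wt i t * wt i (matrix_inv t) = 1"
    using wt_mult[OF assms, of i "matrix_inv t"] T_inv[OF assms] by (simp add: wt_def) (simp add: mat_def)
  then show "wt i (matrix_inv t) = inverse (wt i t)" "wt i t \<noteq> 0"
    using inverse_unique[of "wt i t"] by auto
qed

text \<open>The weights of the torus on the space of all matrices, under conjugation.\<close>

definition rt :: "'n \<Rightarrow> 'n \<Rightarrow> complex^'n^'n \<Rightarrow> complex" where "rt i j = (\<lambda>t\<in>T. wt i t * wt j (matrix_inv t))"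

lemma rt_char: "rt i j \<in> characters T"
  unfolding rt_def
proof (rule charactersI[OF _ _ _ algT])
  have "matrix_poly (\<lambda>t. (S ** t ** matrix_inv S) $ i $ i)" for i
    by (intro matrix_poly_mult_left[of "\<lambda>A. (A ** matrix_inv S) $ i $ i"] matrix_poly_mult_right matrix_poly.entry)
  then have p: "matrix_poly (wt i)" for i
    by (simp add: wt_def[abs_def] cj_def)
  show "regular_on T (\<lambda>t. wt i t * wt j (matrix_inv t))"
    by (intro regular_on_mult regular_on_inv[OF algT] regular_on_poly p)
next
  fix x y assume "x \<in> T" "y \<in> T"
  then show "wt i (x ** y) * wt j (matrix_inv (x ** y)) = wt i x * wt j (matrix_inv x) * (wt i y * wt j (matrix_inv y))"
    using algebraic_groupD(3)[OF algT, of x y] by (simp add: wt_mult wt_inv)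
qed (simp add: wt_inv)

text \<open>The projection to the \<open>\<psi>\<close>-weight space.\<close>

definition comp :: "(complex^'n^'n \<Rightarrow> complex) \<Rightarrow> complex^'n^'n \<Rightarrow> complex^'n^'n" where
  "comp \<psi> X = uncj (\<chi> i j. if rt i j = \<psi> then cj X $ i $ j else 0)"

lemma cj_comp: "cj (comp \<psi> X) $ i $ j = (if rt i j = \<psi> then cj X $ i $ j else 0)"
  by (simp add: comp_def)

lemma comp_lin: "comp \<psi> (X - Y) = comp \<psi> X - comp \<psi> Y" "comp \<psi> (cscale c X) = cscale c (comp \<psi> X)"
  by (rule cj_inj; simp add: vec_eq_iff cj_comp cj_lin)+

definition wts :: "(complex^'n^'n \<Rightarrow> complex) set" where "wts = range (\<lambda>(i, j). rt i j)"

lemma finite_wts: "finite wts"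
  by (simp add: wts_def)

lemma comp_sum: "X = (\<Sum>\<psi>\<in>wts. comp \<psi> X)"
proof (rule cj_inj)
  have cs: "cj (\<Sum>\<psi>\<in>F. comp \<psi> X) = (\<Sum>\<psi>\<in>F. cj (comp \<psi> X))" for F
    by (induction F rule: infinite_finite_induct) (auto simp: cj_lin)
  have "(\<Sum>\<psi>\<in>wts. cj (comp \<psi> X)) $ i $ j = cj X $ i $ j" for i j
  proof -
    have "rt i j \<in> wts" by (auto simp: wts_def)
    then show ?thesis
      using finite_wts by (simp add: cj_comp)
  qed
  then show "cj X = cj (\<Sum>\<psi>\<in>wts. comp \<psi> X)"
    by (simp add: cs vec_eq_iff)
qed

lemma cj_Ad: "t \<in> T \<Longrightarrow> cj (t ** X ** matrix_inv t) $ i $ j = rt i j t * cj X $ i $ j"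
  using diag_mult(1)[of t "cj X ** cj (matrix_inv t)" i j] diag_mult(2)[of "matrix_inv t" "cj X" i j]
    cj_diag[of t] cj_diag[OF T_minv, of t]
  by (simp add: cj_mult rt_def matrix_mul_assoc)

lemma Ad_comp: "t \<in> T \<Longrightarrow> t ** comp \<psi> X ** matrix_inv t = cscale (\<psi> t) (comp \<psi> X)"
  by (rule cj_inj) (auto simp: vec_eq_iff cj_Ad cj_lin cj_comp)

lemma comp_Ad: "t \<in> T \<Longrightarrow> comp \<psi> (t ** X ** matrix_inv t) = cscale (\<psi> t) (comp \<psi> X)"
  by (rule cj_inj) (auto simp: vec_eq_iff cj_Ad cj_lin cj_comp)

text \<open>The components of the other weights are removed one after the other, by operators
  \<open>Ad t - \<phi> t\<close> with \<open>\<phi> t \<noteq> \<psi> t\<close>.\<close>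

lemma comp_mem:
  assumes W: "cm.subspace W" "\<And>t X. t \<in> T \<Longrightarrow> X \<in> W \<Longrightarrow> t ** X ** matrix_inv t \<in> W" and X: "X \<in> W"
    and \<psi>: "\<psi> \<in> characters T"
  shows "comp \<psi> X \<in> W"
proof -
  have "\<exists>Y\<in>W. comp \<psi> Y = comp \<psi> X \<and> (\<forall>\<phi>\<in>F. comp \<phi> Y = 0)" if "finite F" "\<psi> \<notin> F" "F \<subseteq> wts" for F
    using that
  proof (induction F)
    case (insert \<phi> F)
    then obtain Y where Y: "Y \<in> W" "comp \<psi> Y = comp \<psi> X" "\<forall>\<phi>\<in>F. comp \<phi> Y = 0"
      by auto
    have "\<phi> \<in> characters T"
      using insert.prems rt_char by (auto simp: wts_def)
    then obtain t where t: "t \<in> T" "\<phi> t \<noteq> \<psi> t"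
      using characters_eqI[OF _ \<psi>] insert.prems by blast
    define Z where "Z = cscale (1 / (\<psi> t - \<phi> t)) (t ** Y ** matrix_inv t - cscale (\<phi> t) Y)"
    have cZ: "comp \<theta> Z = cscale ((\<theta> t - \<phi> t) / (\<psi> t - \<phi> t)) (comp \<theta> Y)" for \<theta>
      by (simp add: Z_def comp_lin comp_Ad[OF t(1)] flip: cm.scale_left_diff_distrib)
    have "Z \<in> W"
      unfolding Z_def using W Y(1) t(1) by (intro cm.subspace_scale cm.subspace_diff) auto
    then show ?case
      using Y t by (intro bexI[of _ Z]) (auto simp: cZ)
  qed (use X in blast)
  from this[of "wts - {\<psi>}"] finite_wts obtain Y where
    Y: "Y \<in> W" "comp \<psi> Y = comp \<psi> X" "\<forall>\<phi>\<in>wts - {\<psi>}. comp \<phi> Y = 0" by auto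
  show ?thesis
  proof (cases "\<psi> \<in> wts")
    case True
    have "(\<Sum>\<phi>\<in>wts. comp \<phi> Y) = comp \<psi> Y"
      using Y(3) sum.remove[OF finite_wts True, of "\<lambda>\<phi>. comp \<phi> Y"] by simp
    then have "Y = comp \<psi> Y"
      by (rule trans[OF comp_sum])
    then have "comp \<psi> X = Y"
      using Y(2) by (rule trans[OF sym sym, rotated])
    with Y(1) show ?thesis by simp
  next
    case False
    then have "cj (comp \<psi> X) = cj 0"
      by (auto simp: vec_eq_iff cj_comp cj_lin wts_def)
    then have "comp \<psi> X = 0"
      by (rule cj_inj)
    then show ?thesis
      using cm.subspace_0[OF W(1)] by simp
  qed
qed

lemma lie_algebra_subspace: "cm.subspace (lie_algebra K)"
  by (rule cm.subspaceI) (auto intro: lie_algebra_0 lie_algebra_add lie_algebra_cscale)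

text \<open>A weight component that is not fixed by the torus is a root vector.\<close>

lemma lie_decomp:
  assumes K: "algebraic_group K" "T \<subseteq> K" and X: "X \<in> lie_algebra K"
  shows "X \<in> cm.span ({X \<in> lie_algebra K. \<forall>t\<in>T. t ** X = X ** t} \<union> (\<Union>\<psi>\<in>roots K T. root_space K T \<psi>))"
    (is "_ \<in> cm.span ?U")
proof -
  have "comp \<psi> X \<in> cm.span ?U" if "\<psi> \<in> wts" for \<psi>
  proof -
    have \<psi>: "\<psi> \<in> characters T"
      using that rt_char by (auto simp: wts_def)
    have c: "comp \<psi> X \<in> lie_algebra K"
      using K by (intro comp_mem[OF lie_algebra_subspace _ X \<psi>] lie_algebra_Ad) auto
    show ?thesis
    proof (cases "\<psi> = \<one>\<^bsub>char_group T\<^esub> \<or> comp \<psi> X = 0")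
      case True
      have "t ** comp \<psi> X = comp \<psi> X ** t" if t: "t \<in> T" for t
      proof -
        have "t ** comp \<psi> X ** matrix_inv t = comp \<psi> X"
          using Ad_comp[OF t, of \<psi> X] True t by (auto simp: one_char_group)
        then have "t ** comp \<psi> X ** matrix_inv t ** t = comp \<psi> X ** t"
          by simp
        then show ?thesis
          using T_inv[OF t] by (simp add: matrix_mul_assoc)
      qed
      with c show ?thesis
        by (intro cm.span_base) auto
    next
      case False
      then have "\<psi> \<in> roots K T" "comp \<psi> X \<in> root_space K T \<psi>"
        using c \<psi> Ad_comp unfolding roots_def root_space_def by blast+
      then show ?thesis
        by (intro cm.span_base) auto
    qed
  qed
  then have "(\<Sum>\<psi>\<in>wts. comp \<psi> X) \<in> cm.span ?U"
    by (rule cm.span_sum)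
  then show ?thesis
    by (rule back_subst[of "\<lambda>X. X \<in> cm.span ?U", OF _ comp_sum[symmetric]])
qed

lemma lieT_diag: "x \<in> lie_algebra T \<Longrightarrow> i \<noteq> j \<Longrightarrow> cj x $ i $ j = 0"
proof -
  assume x: "x \<in> lie_algebra T" "i \<noteq> j"
  have "mderiv (\<lambda>z. S ** mexp (cscale z x) ** matrix_inv S) (S ** x ** matrix_inv S) 0"
    using mderiv_mult[OF mderiv_mexp_right[of S x 0] mderiv_const[of "matrix_inv S"]] by simp
  then have "((\<lambda>z. cj (mexp (cscale z x)) $ i $ j) has_field_derivative cj x $ i $ j) (at 0)"
    by (simp add: mderiv_def cj_def)
  moreover have "cj (mexp (cscale z x)) $ i $ j = 0" for z
    using cj_diag[OF mexp_mem(1)[OF algT x(1)] x(2)] .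
  ultimately have "((\<lambda>z. 0) has_field_derivative cj x $ i $ j) (at 0)"
    by (simp only:)
  then show ?thesis
    by (rule DERIV_unique[OF _ DERIV_const])
qed

lemma cj_ad: "x \<in> lie_algebra T \<Longrightarrow> cj (lie_bracket x Y) $ i $ j = (wt i x - wt j x) * cj Y $ i $ j"
  using diag_mult[of x "cj Y" i j] lieT_diag[of x]
  by (simp add: lie_bracket_def cj_mult cj_lin algebra_simps)

text \<open>Diagonal matrices commute.\<close>

lemma lieT_abelian:
  assumes "x \<in> lie_algebra T" "y \<in> lie_algebra T"
  shows "lie_bracket x y = 0"
proof (rule cj_inj)
  have "cj (lie_bracket x y) $ i $ j = 0" for i j
    using assms lieT_diag[OF assms(2), of i j] by (cases "i = j") (simp_all add: cj_ad)
  then show "cj (lie_bracket x y) = cj 0"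
    by (simp add: vec_eq_iff cj_lin)
qed

lemma lieT_eq_0: "x \<in> lie_algebra T \<Longrightarrow> (\<And>i. wt i x = 0) \<Longrightarrow> x = 0"
proof (rule cj_inj)
  assume x: "x \<in> lie_algebra T" "\<And>i. wt i x = 0"
  have "cj x $ i $ j = 0" for i j
    using lieT_diag[OF x(1), of i j] x(2)[of i] by (cases "i = j") (simp_all add: wt_def)
  then show "cj x = cj 0"
    by (simp add: vec_eq_iff cj_lin)
qed

lemma trace_lieT_square:
  assumes "x \<in> lie_algebra T"
  shows "trace (x ** x) = (\<Sum>i\<in>UNIV. wt i x ^ 2)"
proof -
  have "trace (x ** x) = trace (cj x ** cj x)"
    unfolding cj_mult[symmetric] trace_cj ..
  then show ?thesis
    using diag_mult(1)[OF lieT_diag[OF assms], of "cj x"] by (simp add: trace_def wt_def power2_eq_square)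
qed

lemma ad_mexp:
  assumes "lie_bracket h X = cscale c X"
  shows "mexp (cscale z h) ** X ** mexp (- cscale z h) = cscale (exp (c * z)) X"
proof -
  let ?Q = "\<lambda>z. cscale (exp (c * z)) X"
  have "mderiv ?Q (h ** ?Q z - ?Q z ** h) z" for z
  proof -
    have "h ** ?Q z - ?Q z ** h = cscale (exp (c * z) * c) X"
      using assms by (simp add: lie_bracket_def flip: cm.scale_right_diff_distrib)
    then show ?thesis
      by (auto simp: mderiv_def intro!: derivative_eq_intros)
  qed
  from mexp_conj_unique[OF this, of z] show ?thesis by simp
qed

text \<open>Weight spaces of a connected torus are the eigenspaces of its Lie algebra.\<close>

lemma root_space_iff:
  assumes "\<gamma> \<in> characters T"
  shows "X \<in> root_space K T \<gamma> \<longleftrightarrow> X \<in> lie_algebra K \<and> (\<forall>h\<in>lie_algebra T. lie_bracket h X = cscale (differential T \<gamma> h) X)"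
    (is "_ \<longleftrightarrow> ?R")
proof
  assume X: "X \<in> root_space K T \<gamma>"
  have "lie_bracket h X = cscale (differential T \<gamma> h) X" if h: "h \<in> lie_algebra T" for h
  proof -
    have e: "mexp (cscale z h) ** X = cscale (exp (differential T \<gamma> h * z)) (X ** mexp (cscale z h))" for z
    proof -
      have "mexp (cscale z h) ** X ** matrix_inv (mexp (cscale z h)) = cscale (\<gamma> (mexp (cscale z h))) X"
        using X mexp_mem(1)[OF algT h] by (simp add: root_space_def del: matrix_inv_mexp)
      then have "mexp (cscale z h) ** X ** matrix_inv (mexp (cscale z h)) ** mexp (cscale z h)
         = cscale (\<gamma> (mexp (cscale z h))) X ** mexp (cscale z h)"
        by simp
      then show ?thesis
        by (simp add: char_mexp(1)[OF algT assms h] flip: matrix_mul_assoc)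
    qed
    have "mderiv (\<lambda>z. mexp (cscale z h) ** X) (h ** X) 0"
      using mderiv_mult[OF mderiv_mexp[of h 0] mderiv_const[of X]] by simp
    moreover have "mderiv (\<lambda>z. cscale (exp (differential T \<gamma> h * z)) (X ** mexp (cscale z h)))
        (cscale (differential T \<gamma> h) X + X ** h) 0"
    proof -
      have "mderiv (\<lambda>z. X ** mexp (cscale z h)) (X ** h) 0"
        using mderiv_mexp_right[of X h 0] by simp
      then have *: "((\<lambda>z. (X ** mexp (cscale z h)) $ i $ j) has_field_derivative (X ** h) $ i $ j) (at 0)" for i j
        by (simp add: mderiv_def)
      have **: "((\<lambda>z. exp (differential T \<gamma> h * z)) has_field_derivative differential T \<gamma> h) (at 0)"
        by (auto intro!: derivative_eq_intros)
      show ?thesis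
        unfolding mderiv_def
      proof (intro allI)
        fix i j
        show "((\<lambda>z. cscale (exp (differential T \<gamma> h * z)) (X ** mexp (cscale z h)) $ i $ j)
          has_field_derivative (cscale (differential T \<gamma> h) X + X ** h) $ i $ j) (at 0)"
          using DERIV_mult'[OF ** *[of i j]] by (simp add: algebra_simps)
      qed
    qed
    ultimately have "h ** X = cscale (differential T \<gamma> h) X + X ** h"
      unfolding e by (rule mderiv_unique)
    then show ?thesis
      by (simp add: lie_bracket_def)
  qed
  then show ?R using X by (auto simp: root_space_def)
next
  assume R: ?R
  have "t ** X ** matrix_inv t = cscale (\<gamma> t) X" if t: "t \<in> T" for t
  proof (rule connected_algebraic_induct[OF connT t, where P = "\<lambda>t. t ** X ** matrix_inv t = cscale (\<gamma> t) X"])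
    show "mat 1 ** X ** matrix_inv (mat 1) = cscale (\<gamma> (mat 1)) X"
      by (simp add: char_one[OF algT assms])
    fix A h assume A: "A \<in> T" "A ** X ** matrix_inv A = cscale (\<gamma> A) X" and h: "h \<in> lie_algebra T"
    have "mexp h ** X ** mexp (- h) = cscale (\<gamma> (mexp h)) X"
      using ad_mexp[of h X _ 1] R h char_mexp(2)[OF algT assms h] by simp
    then have "A ** (mexp h ** X ** mexp (- h)) ** matrix_inv A = cscale (\<gamma> (mexp h)) (A ** X ** matrix_inv A)"
      by simp
    then show "(A ** mexp h) ** X ** matrix_inv (A ** mexp h) = cscale (\<gamma> (A ** mexp h)) X"
      using A(2) charactersD(4)[OF assms A(1) mexp_mem(2)[OF algT h]] T_inv[OF A(1)]
      by (simp add: matrix_inv_mult matrix_mul_assoc mult.commute)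
  qed
  then show "X \<in> root_space K T \<gamma>"
    using R by (simp add: root_space_def)
qed

lemma character_differential_ne_0:
  assumes "\<gamma> \<in> characters T" "\<gamma> \<noteq> \<one>\<^bsub>char_group T\<^esub>"
  shows "\<exists>x\<in>lie_algebra T. differential T \<gamma> x = 1"
proof -
  interpret comm_group "char_group T" by (rule comm_group_char_group[OF algT])
  obtain x where x: "x \<in> lie_algebra T" "differential T \<gamma> x \<noteq> 0"
    using characters_eq_differential[OF connT assms(1), of "\<one>\<^bsub>char_group T\<^esub>"] assms(2) one_closed differential_one[OF algT]
    by (metis carrier_char_group)
  then show ?thesis
    using differential_lin(2)[OF algT assms(1) x(1) x(1), of "1 / differential T \<gamma> x"]
    by (intro bexI[of _ "cscale (1 / differential T \<gamma> x) x"]) (auto intro: lie_algebra_cscale)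
qed

text \<open>The weights that differ from a given one by multiples of \<open>c\<close> span a subspace stable under
  \<open>e\<close> and \<open>f\<close>, on which \<open>[e, f]\<close> has trace zero.\<close>

lemma bracket_weights_proportional:
  assumes e: "\<And>x. x \<in> lie_algebra T \<Longrightarrow> lie_bracket x e = cscale (c x) e"
    and f: "\<And>x. x \<in> lie_algebra T \<Longrightarrow> lie_bracket x f = cscale (- c x) f"
    and H: "lie_bracket e f \<in> lie_algebra T"
  shows "\<exists>r :: real. wt i (lie_bracket e f) = of_real r * c (lie_bracket e f)"
proof -
  let ?H = "lie_bracket e f"
  define C where "C = {j. \<exists>k :: int. \<forall>x\<in>lie_algebra T. wt j x = wt i x + of_int k * c x}"
  have "\<exists>k :: int. \<forall>x\<in>lie_algebra T. wt j x = wt i x + of_int k * c x" if "j \<in> C" for j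
    using that by (simp add: C_def)
  then obtain k :: "'n \<Rightarrow> int" where k: "\<And>j x. j \<in> C \<Longrightarrow> x \<in> lie_algebra T \<Longrightarrow> wt j x = wt i x + of_int (k j) * c x"
    by metis
  have iC: "i \<in> C"
    unfolding C_def by (auto intro!: exI[of _ 0])
  have ee: "wt a x = wt b x + c x" if "cj e $ a $ b \<noteq> 0" "x \<in> lie_algebra T" for a b x
  proof -
    have "(wt a x - wt b x) * cj e $ a $ b = c x * cj e $ a $ b"
      unfolding cj_ad[OF that(2), symmetric] e[OF that(2)] cj_lin cscale_nth ..
    then have "wt a x - wt b x = c x"
      using that(1) mult_right_cancel by blast
    then show ?thesis by (simp add: algebra_simps)
  qed
  have ff: "wt a x = wt b x - c x" if "cj f $ a $ b \<noteq> 0" "x \<in> lie_algebra T" for a b x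
  proof -
    have "(wt a x - wt b x) * cj f $ a $ b = - c x * cj f $ a $ b"
      using cj_ad[OF that(2), of f a b] f[OF that(2)] by (simp add: cj_lin del: cm.scale_minus_left)
    then have "wt a x - wt b x = - c x"
      using that(1) mult_right_cancel by blast
    then show ?thesis by (simp add: algebra_simps)
  qed
  have C1: "b \<in> C" if "a \<in> C" "cj e $ a $ b \<noteq> 0 \<or> cj f $ a $ b \<noteq> 0" for a b
    using that(2)
  proof
    assume "cj e $ a $ b \<noteq> 0"
    then have "\<forall>x\<in>lie_algebra T. wt b x = wt i x + of_int (k a - 1) * c x"
      using ee[of a b] k[OF that(1)] by (auto simp: algebra_simps)
    then show ?thesis unfolding C_def by blast
  next
    assume "cj f $ a $ b \<noteq> 0"
    then have "\<forall>x\<in>lie_algebra T. wt b x = wt i x + of_int (k a + 1) * c x"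
      using ff[of a b] k[OF that(1)] by (auto simp: algebra_simps) 
    then show ?thesis unfolding C_def by blast
  qed
  have red: "(\<Sum>b\<in>UNIV. g b) = (\<Sum>b\<in>C. g b)" if "\<And>b. b \<notin> C \<Longrightarrow> g b = 0" for g :: "'n \<Rightarrow> complex"
    using that by (intro sum.mono_neutral_right) auto
  have "(\<Sum>a\<in>C. wt a ?H) = (\<Sum>a\<in>C. (\<Sum>b\<in>C. cj e $ a $ b * cj f $ b $ a) - (\<Sum>b\<in>C. cj f $ a $ b * cj e $ b $ a))"
  proof (rule sum.cong[OF refl])
    fix a assume a: "a \<in> C"
    have "(\<Sum>b\<in>UNIV. cj e $ a $ b * cj f $ b $ a) = (\<Sum>b\<in>C. cj e $ a $ b * cj f $ b $ a)"
      by (rule red) (use C1[OF a] in auto)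
    moreover have "(\<Sum>b\<in>UNIV. cj f $ a $ b * cj e $ b $ a) = (\<Sum>b\<in>C. cj f $ a $ b * cj e $ b $ a)"
      by (rule red) (use C1[OF a] in auto)
    ultimately show "wt a ?H = (\<Sum>b\<in>C. cj e $ a $ b * cj f $ b $ a) - (\<Sum>b\<in>C. cj f $ a $ b * cj e $ b $ a)"
      by (simp add: wt_def cj_bracket) (simp add: lie_bracket_def mm_nth)
  qed
  also have "\<dots> = 0"
    unfolding sum_subtractf
    by (subst sum.swap[of "\<lambda>a b. cj f $ a $ b * cj e $ b $ a"]) (simp add: mult.commute)
  finally have "(\<Sum>a\<in>C. wt i ?H + of_int (k a) * c ?H) = 0"
    using k[OF _ H] by simp
  then have eq: "of_nat (card C) * wt i ?H = - (of_int (\<Sum>a\<in>C. k a) * c ?H)"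
    by (simp add: sum.distrib flip: sum_distrib_right) (simp add: eq_neg_iff_add_eq_0)
  have "card C \<noteq> 0"
    using iC by auto
  with eq have "wt i ?H = of_real (- real_of_int (\<Sum>a\<in>C. k a) / real (card C)) * c ?H"
    by (simp add: field_simps)
  then show ?thesis by blast
qed

text \<open>A product of \<open>k\<close> factors \<open>X\<close> raises the weights by
  \<open>k\<close>, and there are only finitely many weights.\<close>

lemma root_vector_nilpotent:
  assumes x: "x \<in> lie_algebra T" "lie_bracket x X = X"
  shows "\<exists>N. mpow X N = 0"
proof -
  have e: "wt a x = wt b x + 1" if "cj X $ a $ b \<noteq> 0" for a b
  proof -
    have "(wt a x - wt b x) * cj X $ a $ b = 1 * cj X $ a $ b"
      using cj_ad[OF x(1), of X a b] x(2) by simp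
    then have "wt a x - wt b x = 1"
      using that mult_right_cancel by blast
    then show ?thesis by (simp add: algebra_simps)
  qed
  have ek: "wt a x = wt b x + of_nat k" if "cj (mpow X k) $ a $ b \<noteq> 0" for a b k
    using that
  proof (induction k arbitrary: a)
    case 0
    then have "(mat 1 :: complex^'n^'n) $ a $ b \<noteq> 0"
      by (simp only: mpow_0 cj_1 simp_thms)
    then show ?case by (auto simp: mat_def split: if_splits)
  next
    case (Suc k)
    have "(\<Sum>l\<in>UNIV. cj X $ a $ l * cj (mpow X k) $ l $ b) \<noteq> 0"
      using Suc.prems by (simp add: mpow_Suc cj_mult mm_nth)
    then obtain l where "cj X $ a $ l * cj (mpow X k) $ l $ b \<noteq> 0"
      by (meson sum.neutral)
    then show ?case
      using e[of a l] Suc.IH[of l] by simp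
  qed
  have "finite (range (\<lambda>(a, b). wt a x - wt b x))"
    by simp
  moreover have "infinite (range (of_nat :: nat \<Rightarrow> complex))"
    by (simp add: finite_image_iff infinite_UNIV_nat inj_on_def)
  ultimately obtain N :: nat where N: "of_nat N \<notin> range (\<lambda>(a, b). wt a x - wt b x)"
    by (metis (no_types, lifting) finite_subset image_subset_iff)
  have "cj (mpow X N) $ a $ b = 0" for a b
  proof (rule ccontr)
    assume "\<not> ?thesis"
    then have "of_nat N = wt a x - wt b x"
      using ek[of N a b] by simp
    with N show False by auto
  qed
  then have "cj (mpow X N) = cj 0"
    by (simp add: vec_eq_iff cj_lin)
  then show ?thesis
    using cj_inj by blast
qed

end

lemma algebraic_torusE:
  fixes T :: "(complex^'n^'n) set"
  assumes "algebraic_torus T"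
  obtains S where "diag_torus T S"
proof -
  obtain S :: "complex^'n^'n" where S: "connected_algebraic_group T" "invertible S"
      "\<forall>t\<in>T. \<forall>i j. i \<noteq> j \<longrightarrow> (S ** t ** matrix_inv S) $ i $ j = 0"
    using assms unfolding algebraic_torus_def by (elim conjE exE)
  have "diag_torus T S"
    by unfold_locales (fact S(1) | fact S(2) | rule S(3)[rule_format])+
  then show thesis by (rule that)
qed

section \<open>Weakly closed sets of root vectors\<close>

text \<open>Engel's theorem for a set \<open>W\<close> of one-dimensional weight spaces, in combinatorial form: \<open>nz p q\<close> says
  that the root vectors of \<open>p\<close> and \<open>q\<close> do not commute.  A maximal proper closed subset \<open>\<Delta>'\<close> of \<open>\<Delta>\<close> can be
  enlarged by a single root \<open>\<gamma>\<close> that it normalises; \<open>\<gamma>\<close> then acts on the null vectors of \<open>\<Delta>'\<close>, nilpotently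
  because the multiples of \<open>\<gamma>\<close> are distinct.\<close>

lemma weakly_closed_null_vector:
  fixes nz :: "int \<times> int \<Rightarrow> int \<times> int \<Rightarrow> bool"
  assumes J: "\<And>\<gamma> \<omega> \<delta>. \<gamma> \<in> \<Omega> \<Longrightarrow> \<omega> \<in> \<Omega> \<Longrightarrow> \<delta> \<in> \<Omega> \<Longrightarrow> \<gamma> + \<omega> \<in> \<Omega> \<Longrightarrow> nz \<gamma> \<omega> \<Longrightarrow> nz \<delta> (\<gamma> + \<omega>) \<Longrightarrow>
      (nz \<delta> \<gamma> \<and> nz (\<delta> + \<gamma>) \<omega>) \<or> (nz \<delta> \<omega> \<and> nz \<gamma> (\<delta> + \<omega>))"
    and sym: "\<And>p q. nz p q \<Longrightarrow> nz q p" and irr: "\<And>p. p \<in> \<Omega> \<Longrightarrow> \<not> nz p p"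
    and \<Omega>: "finite \<Omega>" "0 \<notin> \<Omega>"
    and \<Delta>: "\<Delta> \<subseteq> \<Omega>" "\<And>\<gamma> \<delta>. \<gamma> \<in> \<Delta> \<Longrightarrow> \<delta> \<in> \<Delta> \<Longrightarrow> nz \<gamma> \<delta> \<Longrightarrow> \<gamma> + \<delta> \<in> \<Delta>"
    and UW: "U \<subset> W" "W \<subseteq> \<Omega>" "\<And>\<delta> \<omega>. \<delta> \<in> \<Delta> \<Longrightarrow> \<omega> \<in> W \<Longrightarrow> nz \<delta> \<omega> \<Longrightarrow> \<delta> + \<omega> \<in> W"
      "\<And>\<delta> \<omega>. \<delta> \<in> \<Delta> \<Longrightarrow> \<omega> \<in> U \<Longrightarrow> nz \<delta> \<omega> \<Longrightarrow> \<delta> + \<omega> \<in> U"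
  shows "\<exists>\<omega>\<in>W - U. \<forall>\<delta>\<in>\<Delta>. nz \<delta> \<omega> \<longrightarrow> \<delta> + \<omega> \<in> U"
  using \<Delta> UW
proof (induction "card \<Delta>" arbitrary: \<Delta> U W rule: less_induct)
  case less
  define cl where "cl D \<longleftrightarrow> (\<forall>\<gamma>\<in>D. \<forall>\<delta>\<in>D. nz \<gamma> \<delta> \<longrightarrow> \<gamma> + \<delta> \<in> D)" for D
  have fin: "finite \<Delta>"
    using less.prems(1) \<Omega>(1) finite_subset by blast
  show ?case
  proof (cases "\<Delta> = {}")
    case True
    then show ?thesis using less.prems(3) by blast
  next
    case False
    define X where "X = {D. D \<subset> \<Delta> \<and> cl D}"
    have "finite X"
      unfolding X_def by (rule finite_subset[of _ "Pow \<Delta>"]) (use fin in auto)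
    moreover have "{} \<in> X"
      using False by (auto simp: X_def cl_def)
    ultimately obtain D where D: "D \<in> X" "\<And>D'. D' \<in> X \<Longrightarrow> D \<subseteq> D' \<Longrightarrow> D' = D"
      using finite_has_maximal2[of X "{}"] by auto
    have DD: "D \<subset> \<Delta>" and cD: "\<And>\<gamma> \<delta>. \<gamma> \<in> D \<Longrightarrow> \<delta> \<in> D \<Longrightarrow> nz \<gamma> \<delta> \<Longrightarrow> \<gamma> + \<delta> \<in> D"
      using D(1) by (auto simp: X_def cl_def)
    have card: "card D < card \<Delta>"
      by (rule psubset_card_mono[OF fin DD])
    have D\<Omega>: "D \<subseteq> \<Omega>"
      using DD less.prems(1) by blast
    have "\<exists>\<gamma>\<in>\<Delta> - D. \<forall>\<delta>\<in>D. nz \<delta> \<gamma> \<longrightarrow> \<delta> + \<gamma> \<in> D"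
      by (rule less.hyps[OF card D\<Omega> cD DD less.prems(1)]) (use DD less.prems(2) cD in blast)+
    then obtain \<gamma> where \<gamma>: "\<gamma> \<in> \<Delta>" "\<gamma> \<notin> D" "\<And>\<delta>. \<delta> \<in> D \<Longrightarrow> nz \<delta> \<gamma> \<Longrightarrow> \<delta> + \<gamma> \<in> D"
      by blast
    define N where "N = {\<omega> \<in> W - U. \<forall>\<delta>\<in>D. nz \<delta> \<omega> \<longrightarrow> \<delta> + \<omega> \<in> U}"
    have "\<exists>\<omega>\<in>W - U. \<forall>\<delta>\<in>D. nz \<delta> \<omega> \<longrightarrow> \<delta> + \<omega> \<in> U"
      by (rule less.hyps[OF card D\<Omega> cD less.prems(3,4)]) (use DD less.prems(5,6) in blast)+
    then obtain \<omega>0 where \<omega>0: "\<omega>0 \<in> N"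
      by (auto simp: N_def)
    have WS: "W \<subseteq> \<Omega>" "\<Delta> \<subseteq> \<Omega>" "U \<subseteq> W"
      using less.prems(1,3,4) by auto
    have step: "\<gamma> + \<omega> \<in> N" if \<omega>: "\<omega> \<in> N" "nz \<gamma> \<omega>" "\<gamma> + \<omega> \<notin> U" for \<omega>
    proof -
      have W: "\<gamma> + \<omega> \<in> W" "\<omega> \<in> W"
        using less.prems(5) \<gamma>(1) \<omega> by (auto simp: N_def)
      have "\<delta> + (\<gamma> + \<omega>) \<in> U" if \<delta>: "\<delta> \<in> D" "nz \<delta> (\<gamma> + \<omega>)" for \<delta>
      proof -
        have "(nz \<delta> \<gamma> \<and> nz (\<delta> + \<gamma>) \<omega>) \<or> (nz \<delta> \<omega> \<and> nz \<gamma> (\<delta> + \<omega>))"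
          by (rule J[OF _ _ _ _ \<omega>(2) \<delta>(2)]) (use \<gamma>(1) W WS DD \<delta>(1) in auto)
        then show ?thesis
        proof
          assume "nz \<delta> \<gamma> \<and> nz (\<delta> + \<gamma>) \<omega>"
          then have "(\<delta> + \<gamma>) + \<omega> \<in> U"
            using \<gamma>(3)[OF \<delta>(1)] \<omega>(1) by (simp add: N_def)
          then show ?thesis
            by (simp add: add.assoc)
        next
          assume a: "nz \<delta> \<omega> \<and> nz \<gamma> (\<delta> + \<omega>)"
          then have "\<delta> + \<omega> \<in> U"
            using \<omega>(1) \<delta>(1) by (simp add: N_def)
          then have "\<gamma> + (\<delta> + \<omega>) \<in> U"
            using less.prems(6) \<gamma>(1) a by blast
          then show ?thesis
            by (simp add: add.left_commute)
        qed
      qed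
      with W \<omega>(3) show ?thesis
        by (simp add: N_def)
    qed
    have "\<exists>\<omega>\<in>N. nz \<gamma> \<omega> \<longrightarrow> \<gamma> + \<omega> \<in> U"
    proof (rule ccontr)
      assume neg: "\<not> ?thesis"
      define s where "s k = (fst \<omega>0 + int k * fst \<gamma>, snd \<omega>0 + int k * snd \<gamma>)" for k
      have "s k \<in> N" for k
      proof (induction k)
        case 0
        then show ?case using \<omega>0 by (simp add: s_def)
      next
        case (Suc k)
        have "s (Suc k) = \<gamma> + s k"
          by (simp add: s_def prod_eq_iff algebra_simps)
        with step[OF Suc] neg Suc show ?case by auto
      qed
      then have "finite (range s)"
        using finite_subset[of "range s" \<Omega>] WS \<Omega>(1) by (auto simp: N_def)
      moreover have "inj s"
      proof (rule injI)
        fix k l assume "s k = s l"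
        moreover have "\<gamma> \<noteq> 0"
          using \<gamma>(1) WS \<Omega>(2) by auto
        ultimately show "k = l"
          by (auto simp: s_def prod_eq_iff)
      qed
      ultimately show False
        using infinite_UNIV_nat finite_imageD by blast
    qed
    then obtain \<omega> where \<omega>: "\<omega> \<in> N" "nz \<gamma> \<omega> \<Longrightarrow> \<gamma> + \<omega> \<in> U"
      by blast
    have "insert \<gamma> D = \<Delta>"
    proof (rule ccontr)
      assume "insert \<gamma> D \<noteq> \<Delta>"
      have "cl (insert \<gamma> D)"
        unfolding cl_def
      proof (intro ballI impI)
        fix a b assume ab: "a \<in> insert \<gamma> D" "b \<in> insert \<gamma> D" "nz a b"
        consider "a \<in> D" "b \<in> D" | "a \<in> D" "b = \<gamma>" | "a = \<gamma>" "b \<in> D" | "a = \<gamma>" "b = \<gamma>"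
          using ab(1,2) by blast
        then show "a + b \<in> insert \<gamma> D"
        proof cases
          case 3
          then have "b + \<gamma> \<in> D"
            using \<gamma>(3)[of b] sym[OF ab(3)] by blast
          then show ?thesis
            using 3 by (simp add: add.commute)
        next
          case 4
          then show ?thesis
            using irr[of \<gamma>] ab(3) \<gamma>(1) WS by blast
        qed (use cD \<gamma>(3) ab(3) in blast)+
      qed
      then show False
        using D(2)[of "insert \<gamma> D"] \<open>insert \<gamma> D \<noteq> \<Delta>\<close> DD \<gamma>(1,2) by (auto simp: X_def)
    qed
    then show ?thesis
      using \<omega> by (intro bexI[of _ \<omega>]) (auto simp: N_def)
  qed
qed


section \<open>Groups of type \<open>G\<^sub>2\<close>\<close>

text \<open>Roots are represented by their coordinates in the base \<open>a1\<close> (short), \<open>a2\<close> (long).\<close>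

abbreviation G2_roots :: "(int \<times> int) set" where "G2_roots \<equiv> G2_short \<union> G2_long"

lemmas G2_defs = G2_short_def G2_long_def

locale g2 = diag_torus T S for T :: "(complex^'n^'n) set" and S :: "complex^'n^'n" +
  fixes G B :: "(complex^'n^'n) set" and a1 a2 :: "complex^'n^'n \<Rightarrow> complex"
  assumes G2: "type_G2 G T B a1 a2"
begin

lemma pair: "semisimple_pair G T" and a12: "a1 \<noteq> a2" and simple: "simple_roots G T B {a1, a2}"
  and rootsG: "roots G T = int_combinations T a1 a2 G2_roots"
  using G2 by (simp_all add: type_G2_def)

lemma base: "root_base T (roots G T) {a1, a2}"
  using simple by (simp add: simple_roots_def)

sublocale linear_group G
  by unfold_locales (use pair in \<open>simp add: semisimple_pair_def\<close>)

lemma TG: "T \<subseteq> G"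
  using pair by (simp add: semisimple_pair_def maximal_torus_def)

abbreviation "\<tt> \<equiv> lie_algebra T"

lemma t_L: "x \<in> \<tt> \<Longrightarrow> x \<in> L"
  using lie_algebra_mono[OF TG] by blast

sublocale X: comm_group "char_group T"
  by (rule comm_group_char_group[OF algT])

lemma a_char: "a1 \<in> characters T" "a2 \<in> characters T"
  using base by (auto simp: root_base_def roots_def)

text \<open>The character with coordinates \<open>p\<close>.\<close>

definition rv :: "int \<times> int \<Rightarrow> complex^'n^'n \<Rightarrow> complex" where
  "rv p = a1 [^]\<^bsub>char_group T\<^esub> fst p \<otimes>\<^bsub>char_group T\<^esub> a2 [^]\<^bsub>char_group T\<^esub> snd p"

text \<open>The differential of \<open>rv p\<close>.\<close>

definition ev :: "int \<times> int \<Rightarrow> complex^'n^'n \<Rightarrow> complex" where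
  "ev p x = of_int (fst p) * differential T a1 x + of_int (snd p) * differential T a2 x"

lemma rv_char: "rv p \<in> characters T"
  using a_char X.int_pow_closed X.m_closed by (simp add: rv_def)

lemma rv_apply: "t \<in> T \<Longrightarrow> rv p t = a1 t powi fst p * a2 t powi snd p"
  using a_char by (simp add: rv_def mult_char_group char_pow_int_apply[OF algT])

lemma ev_differential: "x \<in> \<tt> \<Longrightarrow> differential T (rv p) x = ev p x"
  using a_char X.int_pow_closed
  by (simp add: rv_def ev_def differential_mult[OF algT] differential_pow_int[OF algT])

lemma rv_one: "rv p = \<one>\<^bsub>char_group T\<^esub> \<longleftrightarrow> p = 0"
proof
  assume *: "rv p = \<one>\<^bsub>char_group T\<^esub>"
  define n where "n \<beta> = (if \<beta> = a1 then fst p else snd p)" for \<beta>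
  have c: "a1 [^]\<^bsub>char_group T\<^esub> m \<in> carrier (char_group T)" "a2 [^]\<^bsub>char_group T\<^esub> m \<in> carrier (char_group T)" for m :: int
    using X.int_pow_closed[of a1 m] X.int_pow_closed[of a2 m] a_char by simp_all
  have "(\<Otimes>\<^bsub>char_group T\<^esub>\<beta>\<in>{a1, a2}. \<beta> [^]\<^bsub>char_group T\<^esub> n \<beta>) = rv p"
    using a12 X.finprod_insert[of "{a2}" a1 "\<lambda>\<beta>. \<beta> [^]\<^bsub>char_group T\<^esub> n \<beta>"]
      X.finprod_insert[of "{}" a2 "\<lambda>\<beta>. \<beta> [^]\<^bsub>char_group T\<^esub> n \<beta>"] c
    by (auto simp: rv_def n_def Pi_def simp del: carrier_char_group)
  then have e: "(\<Otimes>\<^bsub>char_group T\<^esub>\<beta>\<in>{a1, a2}. \<beta> [^]\<^bsub>char_group T\<^esub> n \<beta>) = \<one>\<^bsub>char_group T\<^esub>"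
    using * by (rule trans)
  have "\<forall>n :: _ \<Rightarrow> int. (\<Otimes>\<^bsub>char_group T\<^esub>\<beta>\<in>{a1, a2}. \<beta> [^]\<^bsub>char_group T\<^esub> n \<beta>) = \<one>\<^bsub>char_group T\<^esub>
        \<longrightarrow> (\<forall>\<beta>\<in>{a1, a2}. n \<beta> = 0)"
    using base unfolding root_base_def by (elim conjE)
  from this[THEN spec, THEN mp, OF e] have "\<forall>\<beta>\<in>{a1, a2}. n \<beta> = 0" .
  then show "p = 0"
    using a12 by (auto simp: n_def prod_eq_iff)
next
  assume "p = 0"
  then show "rv p = \<one>\<^bsub>char_group T\<^esub>"
    using a_char X.one_closed by (auto intro!: characters_eqI[OF rv_char] simp: rv_apply one_char_group)
qed

lemma rv_inj: "rv p = rv q \<longleftrightarrow> p = q"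
proof
  assume *: "rv p = rv q"
  have "rv (p - q) = \<one>\<^bsub>char_group T\<^esub>"
  proof (rule characters_eqI[OF rv_char])
    show "\<one>\<^bsub>char_group T\<^esub> \<in> characters T"
      using X.one_closed by simp
    fix t assume t: "t \<in> T"
    then have nz: "a1 t \<noteq> 0" "a2 t \<noteq> 0"
      using a_char charactersD(3) by blast+
    have "rv (p - q) t = rv p t / rv q t"
      using nz t by (simp add: rv_apply power_int_diff)
    also have "\<dots> = 1"
      using * charactersD(3)[OF rv_char t] by simp
    finally show "rv (p - q) t = \<one>\<^bsub>char_group T\<^esub> t"
      using t by (simp add: one_char_group)
  qed
  then show "p = q"
    by (simp add: rv_one)
qed simp

lemma ev_add: "ev (p + q) x = ev p x + ev q x" and ev_minus: "ev (- p) x = - ev p x" and ev_0: "ev 0 x = 0"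
  and ev_diff: "ev (p - q) x = ev p x - ev q x"
  by (simp_all add: ev_def algebra_simps)

lemma ev_lin:
  "x \<in> \<tt> \<Longrightarrow> y \<in> \<tt> \<Longrightarrow> ev p (x + y) = ev p x + ev p y" "x \<in> \<tt> \<Longrightarrow> ev p (cscale c x) = c * ev p x"
  "x \<in> \<tt> \<Longrightarrow> ev p (- x) = - ev p x" "x \<in> \<tt> \<Longrightarrow> y \<in> \<tt> \<Longrightarrow> ev p (x - y) = ev p x - ev p y"
proof -
  have a: "ev p (x + y) = ev p x + ev p y" if "x \<in> \<tt>" "y \<in> \<tt>" for x y
    using that a_char by (simp add: ev_def differential_lin[OF algT] algebra_simps)
  have b: "ev p (cscale c x) = c * ev p x" if "x \<in> \<tt>" for x c
    using that a_char by (simp add: ev_def differential_lin[OF algT] algebra_simps)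
  have c: "ev p (- x) = - ev p x" if "x \<in> \<tt>" for x
    using b[OF that, of "-1"] by simp
  have d: "ev p (x - y) = ev p x - ev p y" if "x \<in> \<tt>" "y \<in> \<tt>" for x y
    using a[OF that(1) lie_algebra_minus[OF that(2)]] c[OF that(2)] by simp
  show "x \<in> \<tt> \<Longrightarrow> y \<in> \<tt> \<Longrightarrow> ev p (x + y) = ev p x + ev p y"
    by (rule a)
  show "x \<in> \<tt> \<Longrightarrow> ev p (cscale c x) = c * ev p x"
    by (rule b)
  show "x \<in> \<tt> \<Longrightarrow> ev p (- x) = - ev p x"
    by (rule c)
  show "x \<in> \<tt> \<Longrightarrow> y \<in> \<tt> \<Longrightarrow> ev p (x - y) = ev p x - ev p y"
    by (rule d)
qed

lemma ev_ne_0: "p \<noteq> 0 \<Longrightarrow> \<exists>x\<in>\<tt>. ev p x = 1"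
  using character_differential_ne_0[OF rv_char, of p] by (auto simp: rv_one ev_differential)

text \<open>The root space, by eigenvalues of \<open>\<tt>\<close>; for \<open>p = 0\<close> it is
  \<open>\<tt>\<close> itself.\<close>

definition rs :: "int \<times> int \<Rightarrow> (complex^'n^'n) set" where
  "rs p = {X \<in> L. \<forall>x\<in>\<tt>. lie_bracket x X = cscale (ev p x) X}"

lemma rsD: "X \<in> rs p \<Longrightarrow> X \<in> L" "X \<in> rs p \<Longrightarrow> x \<in> \<tt> \<Longrightarrow> lie_bracket x X = cscale (ev p x) X"
  by (auto simp: rs_def)

lemma rs_root_space: "rs p = root_space G T (rv p)"
  using root_space_iff[OF rv_char, of _ G p] ev_differential by (auto simp: rs_def)

lemma rs_subspace: "cm.subspace (rs p)"
  by (rule cm.subspaceI)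
    (auto simp: rs_def lie_bracket_lin lie_algebra_0 lie_algebra_add lie_algebra_cscale cm.scale_right_distrib mult.commute)

lemma rs_0: "rs 0 = \<tt>"
proof -
  have "X \<in> \<tt>" if "X \<in> rs 0" for X
  proof -
    have "X \<in> root_space G T \<one>\<^bsub>char_group T\<^esub>"
      using that rv_one[of 0] by (simp add: rs_root_space)
    then have *: "t ** X ** matrix_inv t = X" if "t \<in> T" for t
      using that by (auto simp: root_space_def one_char_group)
    have "t ** X = X ** t" if "t \<in> T" for t
      using arg_cong[OF *[OF that], of "\<lambda>Y. Y ** t"] T_inv[OF that] by simp
    with that show ?thesis
      using pair by (auto simp: semisimple_pair_def rsD)
  qed
  moreover have "X \<in> rs 0" if "X \<in> \<tt>" for X
    using that t_L lieT_abelian by (auto simp: rs_def ev_0)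
  ultimately show ?thesis by blast
qed

lemma G2_0: "0 \<notin> G2_roots"
  by (auto simp: G2_defs prod_eq_iff)

lemma G2_minus: "p \<in> G2_roots \<Longrightarrow> - p \<in> G2_roots"
  by (auto simp: G2_defs)

lemma finite_G2: "finite G2_roots"
  by (simp add: G2_defs)

lemma roots_rv: "\<psi> \<in> roots G T \<longleftrightarrow> (\<exists>p\<in>G2_roots. \<psi> = rv p)"
  unfolding rootsG int_combinations_def rv_def by (auto simp: Bex_def)

lemma rs_1dim:
  assumes "p \<in> G2_roots"
  obtains X where "X \<noteq> 0" "rs p = range (\<lambda>c. cscale c X)"
proof -
  have "rv p \<in> roots G T"
    using assms roots_rv by blast
  then obtain X where "X \<noteq> 0" "root_space G T (rv p) = {cscale c X | c. True}"
    using pair by (auto simp: semisimple_pair_def)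
  then show thesis
    by (intro that[of X]) (auto simp: rs_root_space)
qed

lemma rs_prop:
  assumes "p \<in> G2_roots" "X \<in> rs p" "X \<noteq> 0" "Y \<in> rs p"
  shows "\<exists>c. Y = cscale c X"
proof -
  obtain Z where Z: "Z \<noteq> 0" "rs p = range (\<lambda>c. cscale c Z)"
    using rs_1dim[OF assms(1)] .
  then obtain a b where "X = cscale a Z" "Y = cscale b Z"
    using assms by auto
  then have "Y = cscale (b / a) X"
    using assms(3) by auto
  then show ?thesis by blast
qed

lemma rs_nonroot: "p \<notin> G2_roots \<Longrightarrow> p \<noteq> 0 \<Longrightarrow> X \<in> rs p \<Longrightarrow> X = 0"
proof (rule ccontr)
  assume *: "p \<notin> G2_roots" "p \<noteq> 0" "X \<in> rs p" "X \<noteq> 0"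
  then have "rv p \<in> roots G T"
    using rv_char[of p] rv_one[of p] by (auto simp: roots_def rs_root_space)
  then obtain q where "q \<in> G2_roots" "rv p = rv q"
    using roots_rv[of "rv p"] by auto
  then show False
    using *(1) rv_inj[of p q] by simp
qed

lemma rs_bracket:
  assumes "X \<in> rs p" "Y \<in> rs q"
  shows "lie_bracket X Y \<in> rs (p + q)"
proof -
  have "lie_bracket x (lie_bracket X Y) = cscale (ev (p + q) x) (lie_bracket X Y)" if "x \<in> \<tt>" for x
    using jacobi[of x X Y] rsD[OF assms(1)] rsD[OF assms(2)] that
    by (simp add: lie_bracket_lin ev_add cm.scale_left_distrib)
  then show ?thesis
    using L_bracket[OF rsD(1)[OF assms(1)] rsD(1)[OF assms(2)]] by (simp add: rs_def)
qed

lemma L_span: "L = cm.span (\<Union>p\<in>insert 0 G2_roots. rs p)"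
proof
  show "cm.span (\<Union>p\<in>insert 0 G2_roots. rs p) \<subseteq> L"
    by (rule cm.span_minimal[OF _ lie_algebra_subspace]) (auto simp: rsD)
  show "L \<subseteq> cm.span (\<Union>p\<in>insert 0 G2_roots. rs p)"
  proof
    fix X assume "X \<in> L"
    then have X: "X \<in> cm.span ({X \<in> L. \<forall>t\<in>T. t ** X = X ** t} \<union> (\<Union>\<psi>\<in>roots G T. root_space G T \<psi>))"
      by (rule lie_decomp[OF alg TG])
    have "{X \<in> L. \<forall>t\<in>T. t ** X = X ** t} = rs 0"
      using pair by (simp add: semisimple_pair_def rs_0)
    moreover have "(\<Union>\<psi>\<in>roots G T. root_space G T \<psi>) = (\<Union>p\<in>G2_roots. rs p)"
    proof -
      have "roots G T = rv ` G2_roots"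
        using roots_rv by blast
      then show ?thesis
        by (simp add: rs_root_space)
    qed
    ultimately have "{X \<in> L. \<forall>t\<in>T. t ** X = X ** t} \<union> (\<Union>\<psi>\<in>roots G T. root_space G T \<psi>) = (\<Union>p\<in>insert 0 G2_roots. rs p)"
      by simp
    with X show "X \<in> cm.span (\<Union>p\<in>insert 0 G2_roots. rs p)"
      by simp
  qed
qed

lemma L_induct [consumes 1, case_names zero add scale base]:
  assumes "X \<in> L" "P 0" "\<And>X Y. P X \<Longrightarrow> P Y \<Longrightarrow> P (X + Y)" "\<And>c X. P X \<Longrightarrow> P (cscale c X)"
    "\<And>p X. p \<in> insert 0 G2_roots \<Longrightarrow> X \<in> rs p \<Longrightarrow> P X"
  shows "P X"
proof -
  have "(\<Union>p\<in>insert 0 G2_roots. rs p) \<subseteq> {X. P X}"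
    using assms(5) by blast
  moreover have "cm.subspace {X. P X}"
    by (rule cm.subspaceI) (use assms in auto)
  ultimately show ?thesis
    using assms(1) cm.span_minimal[of "\<Union>p\<in>insert 0 G2_roots. rs p" "{X. P X}"] by (auto simp: L_span)
qed

text \<open>Invariance of the trace form.\<close>

lemma trace_orthogonal:
  assumes "X \<in> rs p" "Y \<in> rs q" "p + q \<noteq> 0"
  shows "trace (X ** Y) = 0"
proof -
  obtain x where x: "x \<in> \<tt>" "ev (p + q) x = 1"
    using ev_ne_0[OF assms(3)] by blast
  have "trace (lie_bracket X x ** Y) = trace (X ** lie_bracket x Y)"
    by (rule trace_lie_bracket)
  moreover have "lie_bracket X x = cscale (- ev p x) X"
    using lie_bracket_swap[of X x] rsD(2)[OF assms(1) x(1)] by simp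
  ultimately have "- ev p x * trace (X ** Y) = ev q x * trace (X ** Y)"
    using rsD(2)[OF assms(2) x(1)] by (simp add: trace_cscale del: cm.scale_minus_left)
  then have "ev (p + q) x * trace (X ** Y) = 0"
    unfolding ev_add distrib_right by (metis add.right_inverse mult_minus_left)
  then show ?thesis
    using x(2) by simp
qed

lemma bracket_opposite:
  assumes "e \<in> rs p" "f \<in> rs (- p)" "x \<in> \<tt>"
  shows "lie_bracket e f \<in> \<tt>" "trace (lie_bracket e f ** x) = ev p x * trace (e ** f)"
proof -
  show "lie_bracket e f \<in> \<tt>"
    using rs_bracket[OF assms(1,2)] by (simp add: rs_0)
  have "lie_bracket f x = cscale (ev p x) f"
    using lie_bracket_swap[of f x] rsD(2)[OF assms(2,3)] by (simp add: ev_minus)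
  then show "trace (lie_bracket e f ** x) = ev p x * trace (e ** f)"
    by (simp add: trace_lie_bracket trace_cscale)
qed

text \<open>The weights of \<open>[e, f]\<close> are real multiples of one number, so the sum of their squares vanishes
  only if they all do.\<close>

lemma bracket_opposite_eq_0:
  assumes "e \<in> rs p" "f \<in> rs (- p)" "trace (lie_bracket e f ** lie_bracket e f) = 0 \<or> ev p (lie_bracket e f) = 0"
  shows "lie_bracket e f = 0"
proof -
  let ?H = "lie_bracket e f"
  have H: "?H \<in> \<tt>"
    by (rule bracket_opposite(1)[OF assms(1,2) lie_algebra_0])
  have "\<exists>r :: real. wt i ?H = of_real r * ev p ?H" for i
    by (rule bracket_weights_proportional[OF rsD(2)[OF assms(1)] _ H])
      (use rsD(2)[OF assms(2)] in \<open>simp_all add: ev_minus\<close>)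
  then obtain r :: "'n \<Rightarrow> real" where r: "\<And>i. wt i ?H = of_real (r i) * ev p ?H"
    by metis
  have "wt i ?H = 0" for i
  proof (cases "ev p ?H = 0")
    case False
    then have "trace (?H ** ?H) = 0"
      using assms(3) by blast
    then have "(\<Sum>i\<in>UNIV. of_real ((r i)\<^sup>2)) * (ev p ?H)\<^sup>2 = 0"
      unfolding trace_lieT_square[OF H] r by (simp add: power_mult_distrib sum_distrib_right)
    then have "(\<Sum>i\<in>UNIV. of_real ((r i)\<^sup>2) :: complex) = 0"
      using False by simp
    then have "(\<Sum>i\<in>UNIV. (r i)\<^sup>2) = 0"
      by (metis of_real_eq_0_iff of_real_sum)
    then have "r i = 0"
      by (simp add: sum_nonneg_eq_0_iff)
    then show ?thesis
      by (simp add: r)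
  qed (simp add: r)
  then show ?thesis
    by (rule lieT_eq_0[OF H])
qed

text \<open>The roots whose root spaces lie in the radical of the trace form.  For a semisimple Lie
  algebra there are none, and then every root has a coroot.\<close>

definition bad :: "int \<times> int \<Rightarrow> bool" where
  "bad p \<longleftrightarrow> p \<in> G2_roots \<and> (\<forall>e\<in>rs p. \<forall>f\<in>rs (- p). trace (e ** f) = 0)"

lemma bad_bracket:
  assumes "bad p" "e \<in> rs p" "f \<in> rs (- p)"
  shows "lie_bracket e f = 0"
proof (rule bracket_opposite_eq_0[OF assms(2,3)])
  have "lie_bracket e f \<in> \<tt>"
    by (rule bracket_opposite(1)[OF assms(2,3) lie_algebra_0])
  then show "trace (lie_bracket e f ** lie_bracket e f) = 0 \<or> ev p (lie_bracket e f) = 0"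
    using bracket_opposite(2)[OF assms(2,3)] assms by (auto simp: bad_def)
qed

lemma bad_radical:
  assumes "bad p" "X \<in> rs p" "Y \<in> L"
  shows "trace (X ** Y) = 0"
  using assms(3)
proof (induction rule: L_induct)
  case (base q Y)
  then show ?case
    using trace_orthogonal[OF assms(2) base(2)] assms(1,2)
    by (cases "q = - p") (auto simp: bad_def eq_neg_iff_add_eq_0 add.commute)
qed (auto simp: matrix_distribs trace_add trace_cscale trace_0[of, simplified mat_0])

lemma bad_stable:
  assumes "bad p" "X \<in> rs p" "Y \<in> rs q" "lie_bracket Y X \<noteq> 0" "q \<in> insert 0 G2_roots"
  shows "bad (q + p)"
proof -
  have m: "lie_bracket Y X \<in> rs (q + p)"
    by (rule rs_bracket[OF assms(3,2)])
  have "q + p \<noteq> 0"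
  proof
    assume "q + p = 0"
    then have "q = - p"
      by (simp add: eq_neg_iff_add_eq_0)
    then have "Y \<in> rs (- p)"
      using assms(3) by simp
    then have "lie_bracket X Y = 0"
      by (rule bad_bracket[OF assms(1,2)])
    then show False
      using assms(4) lie_bracket_swap[of Y X] by simp
  qed
  then have "q + p \<in> G2_roots"
    using rs_nonroot[OF _ _ m] assms(4) by blast
  moreover have "trace (e ** f) = 0" if e: "e \<in> rs (q + p)" and f: "f \<in> rs (- (q + p))" for e f
  proof -
    obtain c where "e = cscale c (lie_bracket Y X)"
      using rs_prop[OF calculation m assms(4) e] by blast
    moreover have "trace (lie_bracket Y X ** f) = 0"
    proof -
      have "lie_bracket Y X = - lie_bracket X Y"
        by (rule lie_bracket_swap)
      then have "trace (lie_bracket Y X ** f) = trace (- (lie_bracket X Y ** f))"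
        by (simp only: matrix_distribs)
      also have "\<dots> = - trace (lie_bracket X Y ** f)"
        by (simp add: trace_def sum_negf)
      also have "trace (lie_bracket X Y ** f) = trace (X ** lie_bracket Y f)"
        by (rule trace_lie_bracket)
      also have "\<dots> = 0"
        by (rule bad_radical[OF assms(1,2) L_bracket[OF rsD(1)[OF assms(3)] rsD(1)[OF f]]])
      finally show ?thesis by simp
    qed
    ultimately show ?thesis
      by (simp add: trace_cscale)
  qed
  ultimately show ?thesis
    by (simp add: bad_def)
qed

lemma abelian_ideal_eq_0:
  assumes "lie_ideal I L" "\<And>X Y. X \<in> I \<Longrightarrow> Y \<in> I \<Longrightarrow> lie_bracket X Y = 0"
  shows "I = {0}"
  using pair assms by (auto simp: semisimple_pair_def semisimple_lie_algebra_def)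

text \<open>The bad root spaces span an ideal, all of whose root vectors act nilpotently; its centre would be a
  non-zero abelian ideal.\<close>

lemma no_bad: "\<not> bad p"
proof
  assume "bad p"
  define \<Sigma> where "\<Sigma> = {p. bad p}"
  define I where "I = cm.span (\<Union>p\<in>\<Sigma>. rs p)"
  define Z where "Z = {w \<in> I. \<forall>p\<in>\<Sigma>. \<forall>X\<in>rs p. lie_bracket X w = 0}"
  define nz where "nz p q \<longleftrightarrow> (\<exists>X\<in>rs p. \<exists>Y\<in>rs q. lie_bracket X Y \<noteq> 0)" for p q
  have \<Sigma>R: "\<Sigma> \<subseteq> G2_roots"
    by (auto simp: \<Sigma>_def bad_def)
  have Isub: "cm.subspace I"
    unfolding I_def by (rule cm.subspace_span)
  have IL: "I \<subseteq> L"
    unfolding I_def by (rule cm.span_minimal[OF _ lie_algebra_subspace]) (auto simp: rsD)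
  have Iind: "P w" if "w \<in> I" "P 0" "\<And>X Y. P X \<Longrightarrow> P Y \<Longrightarrow> P (X + Y)" "\<And>c X. P X \<Longrightarrow> P (cscale c X)"
    "\<And>p X. p \<in> \<Sigma> \<Longrightarrow> X \<in> rs p \<Longrightarrow> P X" for P w
  proof -
    have "cm.subspace {X. P X}"
      by (rule cm.subspaceI) (use that in auto)
    then have "I \<subseteq> {X. P X}"
      unfolding I_def by (rule cm.span_minimal[rotated]) (use that(5) in auto)
    then show ?thesis using that(1) by blast
  qed
  have ideal: "lie_bracket Y w \<in> I" if "Y \<in> L" "w \<in> I" for Y w
    using that(1)
  proof (induction rule: L_induct)
    case (base q Y)
    show ?case
      using that(2)
    proof (rule Iind)
      fix p X assume p: "p \<in> \<Sigma>" "X \<in> rs p"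
      show "lie_bracket Y X \<in> I"
      proof (cases "lie_bracket Y X = 0")
        case False
        then have "q + p \<in> \<Sigma>"
          using bad_stable[OF _ p(2) base(2) False base(1)] p(1) by (simp add: \<Sigma>_def)
        then show ?thesis
          unfolding I_def using rs_bracket[OF base(2) p(2)] by (intro cm.span_base) blast
      qed (simp add: cm.subspace_0[OF Isub])
    qed (auto simp: lie_bracket_lin intro: cm.subspace_0[OF Isub] cm.subspace_add[OF Isub] cm.subspace_scale[OF Isub])
  qed (auto simp: lie_bracket_lin intro: cm.subspace_0[OF Isub] cm.subspace_add[OF Isub] cm.subspace_scale[OF Isub])
  have Zann: "lie_bracket X w = 0" if "X \<in> I" "w \<in> Z" for X w
    using that(1)
    by (rule Iind) (use that(2) in \<open>auto simp: lie_bracket_lin Z_def\<close>)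
  have "lie_ideal Z L"
    unfolding lie_ideal_def
  proof (intro conjI ballI allI)
    show "Z \<subseteq> L"
      using IL by (auto simp: Z_def)
    show "0 \<in> Z"
      using cm.subspace_0[OF Isub] by (simp add: Z_def lie_bracket_lin)
    show "X + Y \<in> Z" if "X \<in> Z" "Y \<in> Z" for X Y
      using that cm.subspace_add[OF Isub] by (auto simp: Z_def lie_bracket_lin)
    show "cscale c X \<in> Z" if "X \<in> Z" for c X
      using that cm.subspace_scale[OF Isub] by (auto simp: Z_def lie_bracket_lin)
    show "lie_bracket Y w \<in> Z" if Y: "Y \<in> L" and w: "w \<in> Z" for Y w
    proof -
      have "lie_bracket X (lie_bracket Y w) = 0" if "p \<in> \<Sigma>" "X \<in> rs p" for p X
      proof -
        have XI: "X \<in> I"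
          unfolding I_def using that by (intro cm.span_base) blast
        then have "lie_bracket X Y \<in> I"
          using cm.subspace_neg[OF Isub ideal[OF Y XI]] lie_bracket_swap[of X Y] by simp
        then show ?thesis
          using jacobi[of X Y w] Zann[OF _ w] XI by (simp add: lie_bracket_lin)
      qed
      then show ?thesis
        using ideal[OF Y] w by (auto simp: Z_def)
    qed
  qed
  then have Z0: "Z = {0}"
    by (rule abelian_ideal_eq_0) (use Zann in \<open>auto simp: Z_def\<close>)
  have "\<exists>\<omega>\<in>\<Sigma> - {}. \<forall>\<delta>\<in>\<Sigma>. nz \<delta> \<omega> \<longrightarrow> \<delta> + \<omega> \<in> ({} :: (int \<times> int) set)"
  proof (rule weakly_closed_null_vector[where \<Omega> = \<Sigma> and nz = nz])
    show "finite \<Sigma>"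
      using \<Sigma>R finite_G2 finite_subset by blast
    show "0 \<notin> \<Sigma>"
      using \<Sigma>R G2_0 by blast
    show "{} \<subset> \<Sigma>"
      using \<open>bad p\<close> by (auto simp: \<Sigma>_def)
    show closed: "\<delta> + \<omega> \<in> \<Sigma>" if "\<delta> \<in> \<Sigma>" "\<omega> \<in> \<Sigma>" "nz \<delta> \<omega>" for \<delta> \<omega>
    proof -
      obtain X Y where XY: "X \<in> rs \<delta>" "Y \<in> rs \<omega>" "lie_bracket X Y \<noteq> 0"
        using \<open>nz \<delta> \<omega>\<close> unfolding nz_def by blast
      have "bad (\<delta> + \<omega>)"
        by (rule bad_stable[OF _ XY(2,1,3)]) (use that \<Sigma>R in \<open>auto simp: \<Sigma>_def\<close>)
      then show ?thesis
        by (simp add: \<Sigma>_def)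
    qed
    then show "\<delta> + \<omega> \<in> \<Sigma>" if "\<delta> \<in> \<Sigma>" "\<omega> \<in> \<Sigma>" "nz \<delta> \<omega>" for \<delta> \<omega>
      using that by blast
    show "nz q p" if "nz p q" for p q
    proof -
      obtain X Y where XY: "X \<in> rs p" "Y \<in> rs q" "lie_bracket X Y \<noteq> 0"
        using \<open>nz p q\<close> unfolding nz_def by blast
      then have "lie_bracket Y X \<noteq> 0"
        using lie_bracket_swap[of X Y] by simp
      with XY show ?thesis
        unfolding nz_def by blast
    qed
    show "\<not> nz p p" if p: "p \<in> \<Sigma>" for p
    proof -
      obtain X where "rs p = range (\<lambda>c. cscale c X)"
        using rs_1dim[of p] p \<Sigma>R by blast
      then show ?thesis
        by (auto simp: nz_def lie_bracket_lin)
    qed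
    fix \<gamma> \<omega> \<delta>
    assume \<Sigma>: "\<gamma> \<in> \<Sigma>" "\<omega> \<in> \<Sigma>" "\<delta> \<in> \<Sigma>" "\<gamma> + \<omega> \<in> \<Sigma>" and nz: "nz \<gamma> \<omega>" "nz \<delta> (\<gamma> + \<omega>)"
    obtain x y where xy: "x \<in> rs \<gamma>" "y \<in> rs \<omega>" "lie_bracket x y \<noteq> 0"
      using nz(1) by (auto simp: nz_def)
    obtain z w where zw: "z \<in> rs \<delta>" "w \<in> rs (\<gamma> + \<omega>)" "lie_bracket z w \<noteq> 0"
      using nz(2) by (auto simp: nz_def)
    obtain c where "w = cscale c (lie_bracket x y)"
      using rs_prop[OF _ rs_bracket[OF xy(1,2)] xy(3) zw(2)] \<Sigma>(4) \<Sigma>R by blast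
    then have "lie_bracket z (lie_bracket x y) \<noteq> 0"
      using zw(3) by (auto simp: lie_bracket_lin)
    then have "lie_bracket (lie_bracket z x) y \<noteq> 0 \<or> lie_bracket x (lie_bracket z y) \<noteq> 0"
      using jacobi[of z x y] by auto
    then show "(nz \<delta> \<gamma> \<and> nz (\<delta> + \<gamma>) \<omega>) \<or> (nz \<delta> \<omega> \<and> nz \<gamma> (\<delta> + \<omega>))"
    proof
      assume a: "lie_bracket (lie_bracket z x) y \<noteq> 0"
      then have "lie_bracket z x \<noteq> 0"
        by (auto simp: lie_bracket_lin)
      then show ?thesis
        using a xy zw rs_bracket[OF zw(1) xy(1)] unfolding nz_def by blast
    next
      assume a: "lie_bracket x (lie_bracket z y) \<noteq> 0"
      then have "lie_bracket z y \<noteq> 0"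
        by (auto simp: lie_bracket_lin)
      then show ?thesis
        using a xy zw rs_bracket[OF zw(1) xy(2)] unfolding nz_def by blast
    qed
  qed auto
  then obtain \<omega> where \<omega>: "\<omega> \<in> \<Sigma>" "\<And>\<delta>. \<delta> \<in> \<Sigma> \<Longrightarrow> \<not> nz \<delta> \<omega>"
    by blast
  obtain X where X: "X \<noteq> 0" "rs \<omega> = range (\<lambda>c. cscale c X)"
    using rs_1dim[of \<omega>] \<omega>(1) \<Sigma>R by blast
  then have Xrs: "X \<in> rs \<omega>"
    using rangeI[of "\<lambda>c. cscale c X" 1] by simp
  have "X \<in> I"
    unfolding I_def by (rule cm.span_base) (use \<omega>(1) Xrs in blast)
  moreover have "lie_bracket Y X = 0" if "p \<in> \<Sigma>" "Y \<in> rs p" for p Y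
    using \<omega>(2)[OF that(1)] that(2) Xrs unfolding nz_def by blast
  ultimately have "X \<in> Z"
    by (simp add: Z_def)
  with Z0 X(1) show False by simp
qed

text \<open>Standard generators of the \<open>sl\<^sub>2\<close> of a root; \<open>h\<close> is the
  coroot.\<close>

definition triple :: "int \<times> int \<Rightarrow> complex^'n^'n \<Rightarrow> complex^'n^'n \<Rightarrow> complex^'n^'n \<Rightarrow> bool" where
  "triple p e f h \<longleftrightarrow> e \<in> rs p \<and> f \<in> rs (- p) \<and> h \<in> \<tt> \<and> lie_bracket e f = h \<and> ev p h = 2 \<and> e \<noteq> 0 \<and> f \<noteq> 0"

text \<open>As the root is not bad, \<open>[e, f]\<close> is non-zero, so its value under
  \<open>p\<close> is non-zero and can be scaled to \<open>2\<close>.\<close>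

lemma triple_exists:
  assumes p: "p \<in> G2_roots"
  shows "\<exists>e f h. triple p e f h"
proof -
  obtain e f where ef: "e \<in> rs p" "f \<in> rs (- p)" "trace (e ** f) \<noteq> 0"
    using no_bad[of p] p by (auto simp: bad_def)
  have "p \<noteq> 0"
    using p G2_0 by blast
  then obtain x where x: "x \<in> \<tt>" "ev p x = 1"
    using ev_ne_0 by blast
  have H: "lie_bracket e f \<in> \<tt>"
    by (rule bracket_opposite(1)[OF ef(1,2) x(1)])
  have "trace (lie_bracket e f ** x) \<noteq> 0"
    using bracket_opposite(2)[OF ef(1,2) x(1)] x(2) ef(3) by simp
  then have "lie_bracket e f \<noteq> 0"
    by (auto simp: trace_def)
  then have nz: "ev p (lie_bracket e f) \<noteq> 0"
    using bracket_opposite_eq_0[OF ef(1,2)] by blast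
  define c where "c = 2 / ev p (lie_bracket e f)"
  have "triple p e (cscale c f) (cscale c (lie_bracket e f))"
    unfolding triple_def
    using ef H nz cm.subspace_scale[OF rs_subspace ef(2)] \<open>lie_bracket e f \<noteq> 0\<close>
    by (auto simp: c_def lie_bracket_lin ev_lin lie_algebra_cscale)
  then show ?thesis by blast
qed

lemma tripleD:
  assumes "triple p e f h"
  shows "e \<in> rs p" "f \<in> rs (- p)" "h \<in> \<tt>" "lie_bracket e f = h" "ev p h = 2" "e \<noteq> 0" "f \<noteq> 0"
    "lie_bracket h e = cscale 2 e" "lie_bracket h f = cscale (- 2) f" "e \<in> L" "f \<in> L" "h \<in> L"
  using assms rsD(2)[of e p h] rsD(2)[of f "- p" h] rsD(1)[of e p] rsD(1)[of f "- p"] t_L[of h] by (auto simp: triple_def ev_minus)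

lemma triple_swap: "triple p e f h \<Longrightarrow> triple (- p) f e (- h)"
  using lie_bracket_swap[of f e] by (auto simp: triple_def ev_lin ev_minus lie_algebra_minus)

lemma rs_nilpotent:
  assumes "p \<noteq> 0" "X \<in> rs p"
  shows "\<exists>N. mpow X N = 0"
proof -
  obtain x where "x \<in> \<tt>" "ev p x = 1"
    using ev_ne_0[OF assms(1)] by blast
  then show ?thesis
    using rsD(2)[OF assms(2)] by (intro root_vector_nilpotent[of x]) auto
qed

lemma funpow_rs:
  assumes "e \<in> rs p" "X \<in> rs q"
  shows "(lie_bracket e ^^ k) X \<in> rs (q + (int k * fst p, int k * snd p))"
proof (induction k)
  case (Suc k)
  from rs_bracket[OF assms(1) Suc] show ?case
    by (simp add: algebra_simps prod_eq_iff plus_prod_def)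
qed (simp add: assms(2) flip: zero_prod_def)

text \<open>A root string: the lowest vector has weight \<open>- n\<close>, where \<open>n\<close> is bounded by its length.\<close>

lemma string_lowest:
  assumes t: "triple p e f h" and X: "X \<in> rs q" "X \<noteq> 0" and q: "q - p \<notin> G2_roots" "q - p \<noteq> 0"
    and N: "q + (int (Suc N) * fst p, int (Suc N) * snd p) \<notin> insert 0 G2_roots"
  shows "\<exists>n\<le>N. ev q h = - of_nat n \<and> (\<forall>i\<le>n. (lie_bracket e ^^ i) X \<noteq> 0) \<and> (\<forall>i>n. (lie_bracket e ^^ i) X = 0)"
proof -
  note t' = tripleD[OF t]
  have N0: "(lie_bracket e ^^ Suc N) X = 0"
    by (rule rs_nonroot[OF _ _ funpow_rs[OF t'(1) X(1)]]) (use N in auto)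
  have "\<exists>n. ev q h = - of_nat n \<and> (\<forall>i\<le>n. (lie_bracket e ^^ i) X \<noteq> 0) \<and> (\<forall>i>n. (lie_bracket e ^^ i) X = 0)"
  proof (rule sl2_lowest[OF vector_space_cscale, where M = UNIV and F = "lie_bracket f" and H = "lie_bracket h"])
    show "lie_bracket f (lie_bracket e v) = lie_bracket e (lie_bracket f v) - lie_bracket h v" for v
      using jacobi[of f e v] t'(4) lie_bracket_swap[of f e] by (simp add: lie_bracket_lin)
    show "lie_bracket h (lie_bracket e v) = lie_bracket e (lie_bracket h v) + cscale 2 (lie_bracket e v)" for v
      using jacobi[of h e v] t'(8) by (simp add: lie_bracket_lin)
    show "lie_bracket f X = 0"
      using rs_nonroot[OF _ _ rs_bracket[OF t'(2) X(1)]] q by (simp add: add.commute)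
    show "lie_bracket h X = cscale (ev q h) X"
      by (rule rsD(2)[OF X(1) t'(3)])
    show "(lie_bracket e ^^ Suc N) X = 0"
      by (fact N0)
  qed (use X in \<open>auto simp: lie_bracket_lin\<close>)
  then obtain n where n: "ev q h = - of_nat n" "\<forall>i\<le>n. (lie_bracket e ^^ i) X \<noteq> 0" "\<forall>i>n. (lie_bracket e ^^ i) X = 0"
    by blast
  moreover have "n \<le> N"
    using n(2) N0 not_less_eq_eq by blast
  ultimately show ?thesis by blast
qed

lemma rs_nonzero: "p \<in> G2_roots \<Longrightarrow> \<exists>X\<in>rs p. X \<noteq> 0"
  using triple_exists tripleD(1,6) by blast

text \<open>The length of the string determines the weight of its lowest vector.\<close>

lemma cartan_integer:
  assumes t: "triple p e f h" and q: "q \<in> G2_roots" "q + (int N * fst p, int N * snd p) \<in> G2_roots"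
    and lo: "q - p \<notin> insert 0 G2_roots" and hi: "q + (int (Suc N) * fst p, int (Suc N) * snd p) \<notin> insert 0 G2_roots"
  shows "ev q h = - of_nat N"
proof -
  let ?q = "q + (int N * fst p, int N * snd p)"
  obtain X where X: "X \<in> rs q" "X \<noteq> 0"
    using rs_nonzero[OF q(1)] by blast
  obtain n where n: "n \<le> N" "ev q h = - of_nat n"
    using string_lowest[OF t X _ _ hi] lo by blast
  obtain Y where Y: "Y \<in> rs ?q" "Y \<noteq> 0"
    using rs_nonzero[OF q(2)] by blast
  have eq: "?q - - p = q + (int (Suc N) * fst p, int (Suc N) * snd p)"
    "?q + (int (Suc N) * fst (- p), int (Suc N) * snd (- p)) = q - p"
    by (simp_all add: prod_eq_iff algebra_simps)
  obtain m where m: "m \<le> N" "ev ?q (- h) = - of_nat m"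
    using string_lowest[OF triple_swap[OF t] Y, of N] lo hi unfolding eq by blast
  have "ev ?q h = ev q h + of_nat N * ev p h"
    by (simp add: ev_add) (simp add: ev_def algebra_simps)
  moreover have "ev ?q h = of_nat m"
    using m(2) ev_lin(3)[OF tripleD(3)[OF t], of ?q] by simp
  ultimately have "of_nat m = - of_nat n + 2 * (of_nat N :: complex)"
    using n(2) tripleD(5)[OF t] by simp
  then have "(of_nat (m + n) :: complex) = of_nat (2 * N)"
    by simp
  then have "m + n = 2 * N"
    by (simp only: of_nat_eq_iff)
  then show ?thesis
    using m(1) n by simp
qed

end

context g2
begin

section \<open>Coroots and the Cartan matrix\<close>

text \<open>The coroot; the choice does not matter, because root spaces are one-dimensional.\<close>

definition hh :: "int \<times> int \<Rightarrow> complex^'n^'n" where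
  "hh p = (SOME h. \<exists>e f. triple p e f h)"

lemma triple_h_unique:
  assumes p: "p \<in> G2_roots" and t: "triple p e f h" and e': "e' \<in> rs p" and f': "f' \<in> rs (- p)"
    and ev: "ev p (lie_bracket e' f') = 2"
  shows "lie_bracket e' f' = h"
proof -
  note t = tripleD[OF t]
  obtain c where c: "e' = cscale c e"
    using rs_prop[OF p t(1,6) e'] by blast
  obtain d where d: "f' = cscale d f"
    using rs_prop[OF G2_minus[OF p] t(2,7) f'] by blast
  have *: "lie_bracket e' f' = cscale (c * d) h"
    by (simp add: c d lie_bracket_lin t(4))
  then have "c * d = 1"
    using ev t(5) by (simp add: ev_lin[OF t(3)])
  with * show ?thesis by simp
qed

lemma hh_triple: "p \<in> G2_roots \<Longrightarrow> \<exists>e f. triple p e f (hh p)"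
  unfolding hh_def by (rule someI_ex) (use triple_exists[of p] in blast)

lemma hh_t: "p \<in> G2_roots \<Longrightarrow> hh p \<in> \<tt>"
  using hh_triple tripleD(3) by blast

lemma ev_hh_self: "p \<in> G2_roots \<Longrightarrow> ev p (hh p) = 2"
  using hh_triple tripleD(5) by blast

lemma hh_cartan:
  assumes "p \<in> G2_roots" "q \<in> G2_roots" "q + (int N * fst p, int N * snd p) \<in> G2_roots"
    "q - p \<notin> insert 0 G2_roots" "q + (int (Suc N) * fst p, int (Suc N) * snd p) \<notin> insert 0 G2_roots"
  shows "ev q (hh p) = - of_nat N"
  using hh_triple[OF assms(1)] cartan_integer[OF _ assms(2-5)] by blast

lemma ev_pair: "ev (a, b) x = of_int a * ev (1, 0) x + of_int b * ev (0, 1) x"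
  by (simp add: ev_def)

text \<open>The Cartan matrix of \<open>G\<^sub>2\<close>, and a few more entries, read off from root
  strings.\<close>

lemma ev_hh:
  "ev (1, 0) (hh (1, 0)) = 2" "ev (0, 1) (hh (1, 0)) = - 3" "ev (1, 0) (hh (0, 1)) = - 1" "ev (0, 1) (hh (0, 1)) = 2"
  "ev (1, 0) (hh (3, 1)) = 1" "ev (0, 1) (hh (3, 1)) = - 1" "ev (1, 0) (hh (3, 2)) = 0" "ev (0, 1) (hh (3, 2)) = 1"
  "ev (3, 2) (hh (1, 1)) = 3"
proof -
  show "ev (1, 0) (hh (1, 0)) = 2" "ev (0, 1) (hh (0, 1)) = 2"
    by (simp_all add: ev_hh_self G2_defs)
  show "ev (0, 1) (hh (1, 0)) = - 3"
    using hh_cartan[of "(1, 0)" "(0, 1)" 3] by (simp add: G2_defs zero_prod_def)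
  show "ev (1, 0) (hh (0, 1)) = - 1"
    using hh_cartan[of "(0, 1)" "(1, 0)" 1] by (simp add: G2_defs zero_prod_def)
  show c: "ev (0, 1) (hh (3, 1)) = - 1"
    using hh_cartan[of "(3, 1)" "(0, 1)" 1] by (simp add: G2_defs zero_prod_def)
  show "ev (1, 0) (hh (3, 1)) = 1"
    using ev_hh_self[of "(3, 1)"] c ev_pair[of 3 1 "hh (3, 1)"] by (simp add: G2_defs)
  have "ev (0, - 1) (hh (3, 2)) = - 1"
    using hh_cartan[of "(3, 2)" "(0, - 1)" 1] by (simp add: G2_defs zero_prod_def)
  then show d: "ev (0, 1) (hh (3, 2)) = 1"
    using ev_pair[of 0 "- 1" "hh (3, 2)"] by simp
  show "ev (1, 0) (hh (3, 2)) = 0"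
    using ev_hh_self[of "(3, 2)"] d ev_pair[of 3 2 "hh (3, 2)"] by (simp add: G2_defs)
  have "ev (- 3, - 2) (hh (1, 1)) = - 3"
    using hh_cartan[of "(1, 1)" "(- 3, - 2)" 3] by (simp add: G2_defs zero_prod_def)
  then show "ev (3, 2) (hh (1, 1)) = 3"
    using ev_minus[of "(3, 2)" "hh (1, 1)"] by simp
qed

text \<open>Such an element would be central, and span an abelian ideal.\<close>

lemma t_eq_0:
  assumes x: "x \<in> \<tt>" "ev (1, 0) x = 0" "ev (0, 1) x = 0"
  shows "x = 0"
proof -
  have ev0: "ev p x = 0" for p
    using ev_pair[of "fst p" "snd p" x] x by simp
  have c: "lie_bracket Y x = 0" if "Y \<in> L" for Y
    using that
  proof (induction rule: L_induct)
    case (base p Y)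
    then show ?case
      using lie_bracket_swap[of Y x] rsD(2)[OF base(2) x(1)] ev0 by simp
  qed (auto simp: lie_bracket_lin)
  have "lie_ideal (range (\<lambda>c. cscale c x)) L"
    unfolding lie_ideal_def
  proof (intro conjI ballI allI)
    show "range (\<lambda>c. cscale c x) \<subseteq> L"
      using t_L[OF x(1)] lie_algebra_cscale by blast
    show "0 \<in> range (\<lambda>c. cscale c x)"
      by (rule range_eqI[of _ _ 0]) simp
    show "X + Y \<in> range (\<lambda>c. cscale c x)" if XY: "X \<in> range (\<lambda>c. cscale c x)" "Y \<in> range (\<lambda>c. cscale c x)" for X Y
    proof -
      obtain a b where "X = cscale a x" "Y = cscale b x"
        using XY by blast
      then show ?thesis
        by (intro range_eqI[of _ _ "a + b"]) (simp add: cm.scale_left_distrib)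
    qed
    show "cscale c X \<in> range (\<lambda>c. cscale c x)" if X: "X \<in> range (\<lambda>c. cscale c x)" for c X
    proof -
      obtain a where "X = cscale a x"
        using X by blast
      then show ?thesis
        by (intro range_eqI[of _ _ "c * a"]) simp
    qed
    show "lie_bracket X Y \<in> range (\<lambda>c. cscale c x)" if X: "X \<in> L" and Y: "Y \<in> range (\<lambda>c. cscale c x)" for X Y
    proof -
      obtain a where "Y = cscale a x"
        using Y by blast
      then have "lie_bracket X Y = cscale 0 x"
        using c[OF X] by (simp add: lie_bracket_lin)
      then show ?thesis by blast
    qed
  qed
  then have "range (\<lambda>c. cscale c x) = {0}"
    by (rule abelian_ideal_eq_0) (auto simp: lie_bracket_lin)
  moreover have "x = cscale 1 x" by simp
  ultimately show ?thesis by blast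
qed

lemma t_coords:
  assumes x: "x \<in> \<tt>"
  shows "x = cscale (2 * ev (1, 0) x + ev (0, 1) x) (hh (1, 0)) + cscale (3 * ev (1, 0) x + 2 * ev (0, 1) x) (hh (0, 1))"
proof -
  have h: "hh (1, 0) \<in> \<tt>" "hh (0, 1) \<in> \<tt>"
    by (auto intro!: hh_t simp: G2_defs)
  let ?y = "cscale (2 * ev (1, 0) x + ev (0, 1) x) (hh (1, 0)) + cscale (3 * ev (1, 0) x + 2 * ev (0, 1) x) (hh (0, 1))"
  have y: "?y \<in> \<tt>"
    using h by (intro lie_algebra_add lie_algebra_cscale)
  have "x - ?y = 0"
  proof (rule t_eq_0)
    show "x - ?y \<in> \<tt>"
      by (rule lie_algebra_diff[OF x y])
    show "ev (1, 0) (x - ?y) = 0" "ev (0, 1) (x - ?y) = 0"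
      using x y h by (simp_all add: ev_lin lie_algebra_cscale ev_hh)
  qed
  then show ?thesis by simp
qed

lemma t_exists:
  obtains x where "x \<in> \<tt>" "ev (1, 0) x = s" "ev (0, 1) x = u"
proof (rule that)
  have h: "hh (1, 0) \<in> \<tt>" "hh (0, 1) \<in> \<tt>"
    by (auto intro!: hh_t simp: G2_defs)
  let ?y = "cscale (2 * s + u) (hh (1, 0)) + cscale (3 * s + 2 * u) (hh (0, 1))"
  show "?y \<in> \<tt>"
    using h by (intro lie_algebra_add lie_algebra_cscale)
  show "ev (1, 0) ?y = s" "ev (0, 1) ?y = u"
    using h by (simp_all add: ev_lin lie_algebra_cscale ev_hh)
qed

lemma characters_eq_coroots:
  assumes "\<phi> \<in> characters T" "\<psi> \<in> characters T"
    "differential T \<phi> (hh (1, 0)) = differential T \<psi> (hh (1, 0))" "differential T \<phi> (hh (0, 1)) = differential T \<psi> (hh (0, 1))"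
  shows "\<phi> = \<psi>"
proof (rule characters_eq_differential[OF connT assms(1,2)])
  fix x assume x: "x \<in> \<tt>"
  have h: "hh (1, 0) \<in> \<tt>" "hh (0, 1) \<in> \<tt>"
    by (auto intro!: hh_t simp: G2_defs)
  have lin: "differential T \<theta> (cscale a (hh (1, 0)) + cscale b (hh (0, 1))) =
      a * differential T \<theta> (hh (1, 0)) + b * differential T \<theta> (hh (0, 1))" if "\<theta> \<in> characters T" for \<theta> a b
    using h that by (simp add: differential_lin[OF algT] lie_algebra_cscale)
  show "differential T \<phi> x = differential T \<psi> x"
    by (subst (1 2) t_coords[OF x]) (simp add: lin assms)
qed

lemma rv_0: "rv 0 = \<one>\<^bsub>char_group T\<^esub>"
  by (simp add: rv_one)

lemma rv_add: "rv (p + q) = rv p \<otimes>\<^bsub>char_group T\<^esub> rv q"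
proof (rule characters_eqI[OF rv_char])
  show "rv p \<otimes>\<^bsub>char_group T\<^esub> rv q \<in> characters T"
    using X.m_closed[of "rv p" "rv q"] rv_char by simp
  show "rv (p + q) t = (rv p \<otimes>\<^bsub>char_group T\<^esub> rv q) t" if t: "t \<in> T" for t
    using charactersD(3)[OF a_char(1) t] charactersD(3)[OF a_char(2) t] t
    by (simp add: mult_char_group rv_apply power_int_add)
qed

lemma rv_inv: "inv\<^bsub>char_group T\<^esub> rv p = rv (- p)"
  by (rule X.inv_equality) (simp_all add: rv_char rv_0 flip: rv_add)

definition nmul :: "nat \<Rightarrow> int \<times> int \<Rightarrow> int \<times> int" where "nmul n p = (int n * fst p, int n * snd p)"

lemma rv_pow: "rv p [^]\<^bsub>char_group T\<^esub> (n :: nat) = rv (nmul n p)"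
proof (induction n)
  case 0
  then show ?case
    by (simp add: nmul_def rv_0 flip: zero_prod_def)
next
  case (Suc n)
  have "nmul (Suc n) p = nmul n p + p"
    by (simp add: nmul_def prod_eq_iff algebra_simps)
  then show ?case
    using Suc by (simp add: rv_add)
qed

lemma a_rv: "a1 = rv (1, 0)" "a2 = rv (0, 1)"
  using a_char by (auto intro!: characters_eqI[OF _ rv_char] simp: rv_apply)

text \<open>The finite product over a set of two characters, in coordinates.\<close>

lemma nonneg_pair:
  assumes "u \<noteq> v"
  shows "rv p \<in> nonneg_combinations T {rv u, rv v} \<longleftrightarrow> (\<exists>m n. p = nmul m u + nmul n v)"
proof -
  have e: "(\<Otimes>\<^bsub>char_group T\<^esub>\<beta>\<in>{rv u, rv v}. \<beta> [^]\<^bsub>char_group T\<^esub> n \<beta>) = rv (nmul (n (rv u)) u + nmul (n (rv v)) v)"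
    for n :: "_ \<Rightarrow> nat"
    using assms X.finprod_insert[of "{rv v}" "rv u" "\<lambda>\<beta>. \<beta> [^]\<^bsub>char_group T\<^esub> n \<beta>"]
      X.finprod_insert[of "{}" "rv v" "\<lambda>\<beta>. \<beta> [^]\<^bsub>char_group T\<^esub> n \<beta>"]
    by (simp add: rv_inj rv_char rv_pow rv_add Pi_def)
  show ?thesis
  proof
    assume "rv p \<in> nonneg_combinations T {rv u, rv v}"
    then show "\<exists>m n. p = nmul m u + nmul n v"
      unfolding nonneg_combinations_def e by (auto simp: rv_inj)
  next
    assume "\<exists>m n. p = nmul m u + nmul n v"
    then obtain m n where mn: "p = nmul m u + nmul n v" by blast
    define k where "k \<beta> = (if \<beta> = rv u then m else n)" for \<beta>
    have "rv p = rv (nmul (k (rv u)) u + nmul (k (rv v)) v)"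
      using assms by (simp add: k_def rv_inj mn)
    then show "rv p \<in> nonneg_combinations T {rv u, rv v}"
      unfolding nonneg_combinations_def e by blast
  qed
qed

lemma nonneg_single: "rv p \<in> nonneg_combinations T {rv u} \<Longrightarrow> \<exists>m. p = nmul m u"
proof -
  have e: "(\<Otimes>\<^bsub>char_group T\<^esub>\<beta>\<in>{rv u}. \<beta> [^]\<^bsub>char_group T\<^esub> n \<beta>) = rv (nmul (n (rv u)) u)" for n :: "_ \<Rightarrow> nat"
    using X.finprod_insert[of "{}" "rv u" "\<lambda>\<beta>. \<beta> [^]\<^bsub>char_group T\<^esub> n \<beta>"]
    by (simp add: rv_char rv_pow Pi_def)
  show "rv p \<in> nonneg_combinations T {rv u} \<Longrightarrow> \<exists>m. p = nmul m u"
    unfolding nonneg_combinations_def e by (auto simp: rv_inj)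
qed

section \<open>Subgroups containing the torus\<close>

text \<open>For subgroups that contain the torus this is the root system, in coordinates.\<close>

definition subroots :: "(complex^'n^'n) set \<Rightarrow> (int \<times> int) set" where
  "subroots K = {p \<in> G2_roots. rs p \<subseteq> lie_algebra K}"

lemma root_space_sub: "K \<subseteq> G \<Longrightarrow> root_space K T (rv p) = rs p \<inter> lie_algebra K"
  using lie_algebra_mono[of K G] by (auto simp: rs_root_space root_space_def)

lemma subroots_iff:
  assumes "K \<subseteq> G"
  shows "rv p \<in> roots K T \<longleftrightarrow> p \<in> subroots K"
proof
  assume "rv p \<in> roots K T"
  then have r: "rv p \<noteq> \<one>\<^bsub>char_group T\<^esub>" "root_space K T (rv p) \<noteq> {0}"
    by (auto simp: roots_def)
  have "0 \<in> rs p \<inter> lie_algebra K"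
    using cm.subspace_0[OF rs_subspace] lie_algebra_0 by blast
  then obtain X where X: "X \<in> rs p" "X \<in> lie_algebra K" "X \<noteq> 0"
    using r(2) unfolding root_space_sub[OF assms] by blast
  have p: "p \<in> G2_roots"
    using rs_nonroot[OF _ _ X(1)] X(3) r(1) rv_one by blast
  have "Y \<in> lie_algebra K" if "Y \<in> rs p" for Y
    using rs_prop[OF p X(1,3) that] X(2) lie_algebra_cscale by blast
  with p show "p \<in> subroots K"
    by (auto simp: subroots_def)
next
  assume p: "p \<in> subroots K"
  then have pr: "p \<in> G2_roots" and sub: "rs p \<subseteq> lie_algebra K"
    by (auto simp: subroots_def)
  obtain X where X: "X \<in> rs p" "X \<noteq> 0"
    using rs_nonzero[OF pr] by blast
  have "root_space K T (rv p) \<noteq> {0}"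
    unfolding root_space_sub[OF assms] using X sub by blast
  moreover have "p \<noteq> 0"
    using pr G2_0 by blast
  ultimately show "rv p \<in> roots K T"
    unfolding roots_def using rv_char[of p] rv_one[of p] by blast
qed

lemma roots_sub: "K \<subseteq> G \<Longrightarrow> \<psi> \<in> roots K T \<Longrightarrow> \<exists>p\<in>subroots K. \<psi> = rv p"
proof -
  assume K: "K \<subseteq> G" and \<psi>: "\<psi> \<in> roots K T"
  have "0 \<in> root_space K T \<psi>"
    by (simp add: root_space_def lie_algebra_0)
  then obtain X where "X \<in> root_space K T \<psi>" "X \<noteq> 0"
    using \<psi> unfolding roots_def by blast
  then have "X \<in> root_space G T \<psi>" "X \<noteq> 0"
    using lie_algebra_mono[OF K] by (auto simp: root_space_def)
  then have "\<psi> \<in> roots G T"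
    using \<psi> unfolding roots_def by blast
  then obtain p where "\<psi> = rv p"
    using roots_rv by blast
  with \<psi> show ?thesis
    using subroots_iff[OF K] by blast
qed

text \<open>The Lie algebra is stable under the torus, so that it is a sum of weight spaces, and root
  spaces are one-dimensional.\<close>

lemma lie_sub:
  assumes K: "algebraic_group K" "T \<subseteq> K" "K \<subseteq> G"
  shows "lie_algebra K = cm.span (\<Union>p\<in>insert 0 (subroots K). rs p)"
proof
  have "(\<Union>p\<in>insert 0 (subroots K). rs p) \<subseteq> lie_algebra K"
    using lie_algebra_mono[OF K(2)] by (auto simp: subroots_def rs_0)
  then show "cm.span (\<Union>p\<in>insert 0 (subroots K). rs p) \<subseteq> lie_algebra K"
    by (rule cm.span_minimal[OF _ lie_algebra_subspace])
  show "lie_algebra K \<subseteq> cm.span (\<Union>p\<in>insert 0 (subroots K). rs p)"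
  proof
    fix X assume "X \<in> lie_algebra K"
    then have X: "X \<in> cm.span ({X \<in> lie_algebra K. \<forall>t\<in>T. t ** X = X ** t} \<union> (\<Union>\<psi>\<in>roots K T. root_space K T \<psi>))"
      by (rule lie_decomp[OF K(1,2)])
    have "{X \<in> lie_algebra K. \<forall>t\<in>T. t ** X = X ** t} \<subseteq> rs 0"
      using pair lie_algebra_mono[OF K(3)] by (auto simp: semisimple_pair_def rs_0)
    moreover have "(\<Union>\<psi>\<in>roots K T. root_space K T \<psi>) \<subseteq> (\<Union>p\<in>subroots K. rs p)"
      using roots_sub[OF K(3)] root_space_sub[OF K(3)] by blast
    ultimately have "{X \<in> lie_algebra K. \<forall>t\<in>T. t ** X = X ** t} \<union> (\<Union>\<psi>\<in>roots K T. root_space K T \<psi>)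
        \<subseteq> (\<Union>p\<in>insert 0 (subroots K). rs p)"
      by blast
    then show "X \<in> cm.span (\<Union>p\<in>insert 0 (subroots K). rs p)"
      using X cm.span_mono by blast
  qed
qed

lemma coroot_sub:
  assumes K: "K \<subseteq> G" and p: "p \<in> subroots K" "- p \<in> subroots K"
  shows "coroot K T (rv p) = hh p"
proof -
  have pr: "p \<in> G2_roots" and rsp: "root_space K T (rv p) = rs p" "root_space K T (inv\<^bsub>char_group T\<^esub> rv p) = rs (- p)"
    using p unfolding rv_inv root_space_sub[OF K] by (auto simp: subroots_def)
  obtain e f where t: "triple p e f (hh p)"
    using hh_triple[OF pr] by blast
  note t' = tripleD[OF t]
  show ?thesis
    unfolding coroot_def rsp
  proof (rule the_equality)
    show "(\<exists>X\<in>rs p. \<exists>Y\<in>rs (- p). hh p = lie_bracket X Y) \<and> differential T (rv p) (hh p) = 2"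
      using t'(1,2,4,5) ev_differential[OF t'(3), of p] by (intro conjI bexI[of _ e] bexI[of _ f]) simp_all
    fix h assume h: "(\<exists>X\<in>rs p. \<exists>Y\<in>rs (- p). h = lie_bracket X Y) \<and> differential T (rv p) h = 2"
    then obtain X Y where XY: "X \<in> rs p" "Y \<in> rs (- p)" "h = lie_bracket X Y" by blast
    have "h \<in> \<tt>"
      unfolding XY(3) by (rule bracket_opposite(1)[OF XY(1,2) lie_algebra_0])
    then have "ev p (lie_bracket X Y) = 2"
      using h ev_differential XY(3) by simp
    then show "h = hh p"
      using triple_h_unique[OF pr t XY(1,2)] XY(3) by simp
  qed
qed

lemma subroots_G: "subroots G = G2_roots"
  by (auto simp: subroots_def rsD)

section \<open>The determinant\<close>

lemma ideriv_det: "ideriv X det A = det A * ideriv X det (mat 1 :: complex^'n^'n)"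
proof (rule ideriv_unique[OF matrix_poly_det])
  have "((\<lambda>w. det A * det (mexp (cscale w X))) has_field_derivative det A * ideriv X det (mat 1)) (at 0)"
    using ideriv_mexp[OF matrix_poly_det, of "mat 1" X 0] by (intro DERIV_cmult) simp
  then show "((\<lambda>w. det (A ** mexp (cscale w X))) has_field_derivative det A * ideriv X det (mat 1)) (at 0)"
    by (simp add: det_mul)
qed

lemma ideriv_det_bracket: "ideriv (lie_bracket X Y) det (mat 1 :: complex^'n^'n) = 0"
proof -
  have "ideriv X (ideriv Y det) (mat 1) = ideriv Y det (mat 1) * ideriv X det (mat 1 :: complex^'n^'n)" for X Y
  proof -
    have "ideriv Y det = (\<lambda>A. ideriv Y det (mat 1) * det (A :: complex^'n^'n))"
      by (rule ext) (subst ideriv_det, simp)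
    then have "ideriv X (ideriv Y det) = ideriv X (\<lambda>A. ideriv Y det (mat 1) * det (A :: complex^'n^'n))"
      by simp
    also have "\<dots> = (\<lambda>A. ideriv Y det (mat 1) * ideriv X det A)"
      by (rule ideriv_cmult[OF matrix_poly_det])
    finally show ?thesis by simp
  qed
  then show ?thesis
    using ideriv_commutator[OF matrix_poly_det, of X Y "mat 1"] by (simp add: mult.commute)
qed

text \<open>The differential of the determinant vanishes on brackets, and \<open>G\<close> is its own commutator subgroup.\<close>

lemma det_G: "A \<in> G \<Longrightarrow> det A = 1"
proof (rule connected_algebraic_induct[OF conn, where P = "\<lambda>A. det A = 1"])
  fix A X assume A: "A \<in> G" "det A = 1" and X: "X \<in> L"
  have c: "ideriv X det (mat 1 :: complex^'n^'n) = 0"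
    using X
  proof (induction rule: L_induct)
    case zero
    show ?case using ideriv_lin(2)[OF matrix_poly_det, of 0 0] by simp
  next
    case (base p X)
    show ?case
    proof (cases "p = 0")
      case True
      then have x: "X \<in> \<tt>"
        using base(2) rs_0 by simp
      have h: "ideriv (hh q) det (mat 1 :: complex^'n^'n) = 0" if q: "q \<in> G2_roots" for q
        using hh_triple[OF q] tripleD(4) ideriv_det_bracket by metis
      have hq: "(1, 0) \<in> G2_roots" "(0, 1) \<in> G2_roots"
        by (auto simp: G2_defs)
      show ?thesis
        by (subst t_coords[OF x]) (simp add: ideriv_lin[OF matrix_poly_det] h[OF hq(1)] h[OF hq(2)])
    next
      case False
      obtain x where x: "x \<in> \<tt>" "ev p x = 1"
        using ev_ne_0[OF False] by blast
      have "lie_bracket x X = X"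
        using rsD(2)[OF base(2) x(1)] x(2) by simp
      then show ?thesis
        using ideriv_det_bracket[of x X] by simp
    qed
  qed (auto simp: ideriv_lin[OF matrix_poly_det])
  have "((\<lambda>w. det (A ** mexp (cscale w X))) has_field_derivative 0) (at z)" for z
    using ideriv_mexp[OF matrix_poly_det, of A X z] ideriv_det[of X "A ** mexp (cscale z X)"] c by simp
  then obtain d where d: "\<And>w. det (A ** mexp (cscale w X)) = d"
    using has_field_derivative_zero_constant[of UNIV "\<lambda>w. det (A ** mexp (cscale w X))"] by auto
  show "det (A ** mexp X) = 1"
    using d[of 0] d[of 1] A(2) by simp
qed simp_all

text \<open>The determinant is \<open>1\<close>, so that denominators disappear.\<close>

lemma regular_on_G: "K \<subseteq> G \<Longrightarrow> regular_on K f \<longleftrightarrow> (\<exists>p. matrix_poly p \<and> (\<forall>A\<in>K. f A = p A))"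
proof
  assume K: "K \<subseteq> G"
  { assume "regular_on K f"
    then obtain p m where p: "matrix_poly p" "\<forall>A\<in>K. f A = p A / det A ^ m"
      unfolding regular_on_def by blast
    then have "\<forall>A\<in>K. f A = p A"
      using det_G K by auto
    with p(1) show "\<exists>p. matrix_poly p \<and> (\<forall>A\<in>K. f A = p A)" by blast }
  assume "\<exists>p. matrix_poly p \<and> (\<forall>A\<in>K. f A = p A)"
  then show "regular_on K f"
    using regular_on_poly regular_on_cong by metis
qed

lemma regular_coord: "regular_on G f \<Longrightarrow> res G f \<in> R"
proof -
  assume "regular_on G f"
  then obtain p where p: "matrix_poly p" "\<forall>A\<in>G. f A = p A"
    using regular_on_G[OF subset_refl] by blast
  then have "res G f = res G p"
    by (auto simp: res_def)
  with p(1) show ?thesis by auto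
qed

lemma coord_regular: "f \<in> R \<Longrightarrow> regular_on G f"
  unfolding regular_on_G[OF subset_refl] by (auto elim!: coord_ringE simp: res_def)

lemma coord_ring_inverse:
  assumes "f \<in> R"
  shows "res G (\<lambda>A. f (matrix_inv A)) \<in> R"
  by (rule regular_coord[OF regular_on_inv[OF alg coord_regular[OF assms]]])

lemma coord_ring_translate:
  assumes "f \<in> R" "s \<in> G"
  shows "res G (\<lambda>A. f (A ** s)) \<in> R"
proof -
  obtain p where p: "matrix_poly p" "f = res G p"
    using assms(1) by (elim coord_ringE)
  have "res G (\<lambda>A. f (A ** s)) = res G (\<lambda>A. p (A ** s))"
    using assms(2) K_mult by (auto simp: p(2) res_def)
  then show ?thesis
    using matrix_poly_mult_right[OF p(1)] by auto
qed

section \<open>Reflections\<close>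

text \<open>A representative of the reflection in the Weyl group.\<close>

definition reflection :: "complex^'n^'n \<Rightarrow> complex^'n^'n \<Rightarrow> complex^'n^'n" where
  "reflection e f = mexp e ** mexp (- f) ** mexp e"

lemma mderiv_affine: "mderiv (\<lambda>z. A + cscale z C) C z"
  using mderiv_add[OF mderiv_const mderiv_linear[of C z], of A] by simp

text \<open>The three exponentials are applied one after the other, on the plane spanned by
  \<open>h\<close> and the root vectors.\<close>

lemma reflection_t:
  assumes t: "triple p e f h" and x: "x \<in> \<tt>"
  shows "reflection e f ** x ** matrix_inv (reflection e f) = x - cscale (ev p x) h"
    "matrix_inv (reflection e f) ** x ** reflection e f = x - cscale (ev p x) h"
    "invertible (reflection e f)"
proof -
  note t' = tripleD[OF t]
  have inv: "invertible (reflection e f)"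
    by (simp add: reflection_def invertible_mult)
  have minv: "matrix_inv (reflection e f) = mexp (- e) ** (mexp f ** mexp (- e))"
    by (simp add: reflection_def matrix_inv_mult invertible_mult)
  have *: "reflection e f ** x ** matrix_inv (reflection e f) = x - cscale (ev p x) h" if x: "x \<in> \<tt>" for x
  proof -
    define c where "c = ev p x"
    have ex: "e ** x - x ** e = cscale (- c) e"
      using lie_bracket_swap[of e x] rsD(2)[OF t'(1) x] unfolding lie_bracket_def[of e x] c_def by simp
    have fx: "f ** x - x ** f = cscale c f"
      using lie_bracket_swap[of f x] rsD(2)[OF t'(2) x] unfolding lie_bracket_def[of f x] c_def by (simp add: ev_minus)
    have ef: "e ** f - f ** e = h"
      using t'(4) by (simp add: lie_bracket_def)
    have eh: "e ** h - h ** e = cscale (- 2) e"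
      using lie_bracket_swap[of e h] t'(8) unfolding lie_bracket_def[of e h] by simp
    have fh: "f ** h - h ** f = cscale 2 f"
      using lie_bracket_swap[of f h] t'(9) unfolding lie_bracket_def[of f h] by simp
    have 1: "mexp e ** x ** mexp (- e) = x + cscale (- c) e"
    proof -
      have "mderiv (\<lambda>z. x + cscale z (cscale (- c) e)) (e ** (x + cscale z (cscale (- c) e)) - (x + cscale z (cscale (- c) e)) ** e) z" for z
      proof (rule mderiv_eq[OF mderiv_affine])
        have "e ** (x + cscale z (cscale (- c) e)) - (x + cscale z (cscale (- c) e)) ** e = e ** x - x ** e"
          by (simp add: matrix_distribs)
        then show "cscale (- c) e = e ** (x + cscale z (cscale (- c) e)) - (x + cscale z (cscale (- c) e)) ** e"
          by (simp only: ex)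
      qed
      from mexp_conj_unique[OF this, of 1] show ?thesis by simp
    qed
    have 2: "mexp (- f) ** (x + cscale (- c) e) ** mexp f = x - cscale c e - cscale c h"
    proof -
      define Q where "Q z = (x + cscale (- c) e) + cscale z (cscale (- c) f + cscale (- c) h) + cscale (c * z\<^sup>2) f" for z
      have "mderiv Q (- f ** Q z - Q z ** - f) z" for z
      proof (rule mderiv_eq)
        have "mderiv (\<lambda>z. cscale (c * z\<^sup>2) f) (cscale (c * (2 * z)) f) z"
          by (auto simp: mderiv_def intro!: derivative_eq_intros)
        then show "mderiv Q (cscale (- c) f + cscale (- c) h + cscale (c * (2 * z)) f) z"
          unfolding Q_def by (intro mderiv_add[OF mderiv_affine])
        have "- f ** Q z - Q z ** - f = - (f ** Q z - Q z ** f)"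
          by (simp add: matrix_distribs)
        also have "f ** Q z - Q z ** f = (f ** x - x ** f) + cscale c (e ** f - f ** e) - cscale (c * z) (f ** h - h ** f)"
          by (simp add: Q_def matrix_distribs algebra_simps cm.scale_right_distrib cm.scale_right_diff_distrib)
        also have "\<dots> = cscale c f + cscale c h - cscale (c * z) (cscale 2 f)"
          by (simp only: fx ef fh)
        finally show "cscale (- c) f + cscale (- c) h + cscale (c * (2 * z)) f = - f ** Q z - Q z ** - f"
          by (simp add: algebra_simps)
      qed
      from mexp_conj_unique[OF this, of 1] show ?thesis
        by (simp add: Q_def cm.scale_right_distrib algebra_simps)
    qed
    have 3: "mexp e ** (x - cscale c e - cscale c h) ** mexp (- e) = x - cscale c h"
    proof -
      define y where "y = x - cscale c e - cscale c h"
      have ey: "e ** y - y ** e = cscale c e"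
      proof -
        have "e ** y - y ** e = (e ** x - x ** e) - cscale c (e ** h - h ** e)"
          by (simp add: y_def matrix_distribs algebra_simps cm.scale_right_diff_distrib)
        also have "\<dots> = cscale (- c) e - cscale c (cscale (- 2) e)"
          by (simp only: ex eh)
        also have "\<dots> = cscale c e"
          by (simp add: vec_eq_iff algebra_simps)
        finally show ?thesis .
      qed
      have "mderiv (\<lambda>z. y + cscale z (cscale c e)) (e ** (y + cscale z (cscale c e)) - (y + cscale z (cscale c e)) ** e) z" for z
      proof (rule mderiv_eq[OF mderiv_affine])
        have "e ** (y + cscale z (cscale c e)) - (y + cscale z (cscale c e)) ** e = e ** y - y ** e"
          by (simp add: matrix_distribs)
        then show "cscale c e = e ** (y + cscale z (cscale c e)) - (y + cscale z (cscale c e)) ** e"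
          by (simp only: ey)
      qed
      from mexp_conj_unique[OF this, of 1] show ?thesis by (simp add: y_def)
    qed
    have "reflection e f ** x ** matrix_inv (reflection e f) = mexp e ** (mexp (- f) ** (mexp e ** x ** mexp (- e)) ** mexp f) ** mexp (- e)"
      unfolding minv by (simp add: reflection_def matrix_mul_assoc)
    also have "\<dots> = x - cscale c h"
      by (simp only: 1 2 3)
    finally show ?thesis by (simp add: c_def)
  qed
  show "reflection e f ** x ** matrix_inv (reflection e f) = x - cscale (ev p x) h"
    by (rule *[OF x])
  show "invertible (reflection e f)" by (rule inv)
  define y where "y = x - cscale (ev p x) h"
  have y: "y \<in> \<tt>"
    unfolding y_def by (intro lie_algebra_diff lie_algebra_cscale x t'(3))
  have "ev p y = - ev p x"
    unfolding y_def using x t'(3,5) by (simp add: ev_lin lie_algebra_cscale)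
  then have "reflection e f ** y ** matrix_inv (reflection e f) = x"
    using *[OF y] by (simp add: y_def)
  then have "matrix_inv (reflection e f) ** (reflection e f ** y ** matrix_inv (reflection e f)) ** reflection e f = matrix_inv (reflection e f) ** x ** reflection e f"
    by simp
  then show "matrix_inv (reflection e f) ** x ** reflection e f = x - cscale (ev p x) h"
    using inv by (simp add: y_def matrix_mul_assoc)
qed

lemma reflection_mem: "algebraic_group K \<Longrightarrow> e \<in> lie_algebra K \<Longrightarrow> f \<in> lie_algebra K \<Longrightarrow> reflection e f \<in> K"
  unfolding reflection_def by (intro algebraic_groupD(3) mexp_mem(2) lie_algebra_minus)

lemma conj_bracket:
  fixes s X Y :: "complex^'n^'n"
  shows "invertible s \<Longrightarrow> lie_bracket X (s ** Y ** matrix_inv s) = s ** lie_bracket (matrix_inv s ** X ** s) Y ** matrix_inv s"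
  by (simp add: lie_bracket_def matrix_distribs matrix_mul_assoc)

text \<open>The conjugate has the reflected weight, because conjugation by the representative reflects
  \<open>\<tt>\<close>.\<close>

lemma reflection_rs:
  assumes t: "triple p e f h" and X: "X \<in> rs q" and n: "ev q h = of_int n"
  shows "reflection e f ** X ** matrix_inv (reflection e f) \<in> rs (q - (n * fst p, n * snd p))"
proof -
  note t' = tripleD[OF t]
  let ?s = "reflection e f"
  have s: "?s \<in> G"
    by (rule reflection_mem[OF alg t'(10,11)])
  have "lie_bracket x (?s ** X ** matrix_inv ?s) = cscale (ev (q - (n * fst p, n * snd p)) x) (?s ** X ** matrix_inv ?s)"
    if x: "x \<in> \<tt>" for x
  proof -
    have y: "x - cscale (ev p x) h \<in> \<tt>"
      by (intro lie_algebra_diff lie_algebra_cscale x t'(3))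
    have "lie_bracket (x - cscale (ev p x) h) X = cscale (ev q (x - cscale (ev p x) h)) X"
      by (rule rsD(2)[OF X y])
    moreover have "ev q (x - cscale (ev p x) h) = ev (q - (n * fst p, n * snd p)) x"
      using x t'(3) by (simp add: ev_lin lie_algebra_cscale n ev_diff) (simp add: ev_def algebra_simps)
    ultimately show ?thesis
      using conj_bracket[OF reflection_t(3)[OF t x], of x X] by (simp add: reflection_t(2)[OF t x])
  qed
  moreover have "?s ** X ** matrix_inv ?s \<in> L"
    by (rule lie_algebra_Ad[OF alg s rsD(1)[OF X]])
  ultimately show ?thesis
    by (simp add: rs_def)
qed

end

section \<open>The subgroup \<open>SL\<^sub>3\<close> and its parabolic subgroups\<close>

text \<open>A connected group is generated by the exponentials of its Lie algebra.\<close>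

lemma lie_algebra_subset_imp_subset:
  assumes K: "connected_algebraic_group K" and K': "algebraic_group K'" and sub: "lie_algebra K \<subseteq> lie_algebra K'"
  shows "K \<subseteq> K'"
proof
  fix A assume A: "A \<in> K"
  show "A \<in> K'"
    by (rule connected_algebraic_induct[OF K A, where P = "\<lambda>A. A \<in> K'"])
      (use algebraic_groupD[OF K'] mexp_mem(2)[OF K'] sub in blast)+
qed

lemma group_restrict: "algebraic_group K \<Longrightarrow> group (GL\<lparr>carrier := K\<rparr>)"
  by (rule subgroup.subgroup_is_group[OF _ group_GL]) (simp add: algebraic_group_def)

text \<open>Conjugates of connected solvable groups are connected and solvable.\<close>

lemma connected_solvable_conj:
  fixes K :: "(complex^'n^'n) set" and s :: "complex^'n^'n"
  assumes K: "connected_solvable K" and s: "invertible s"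
  shows "connected_solvable ((\<lambda>A. s ** A ** matrix_inv s) ` K)"
proof -
  let ?c = "\<lambda>A. s ** A ** matrix_inv s"
  have alg: "algebraic_group K" and con: "connected K" and sol: "solvable (GL\<lparr>carrier := K\<rparr>)"
    using K by (auto simp: connected_solvable_def connected_algebraic_group_def)
  have cm: "?c A ** ?c B = ?c (A ** B)" for A B :: "complex^'n^'n"
    using s by (simp add: matrix_mul_assoc)
  obtain S where S: "\<forall>p\<in>S. matrix_poly p" "K = {A. invertible A \<and> (\<forall>p\<in>S. p A = 0)}"
    using alg unfolding algebraic_group_def by blast
  have im: "A \<in> ?c ` K \<longleftrightarrow> matrix_inv s ** A ** s \<in> K" for A
  proof
    assume "matrix_inv s ** A ** s \<in> K"
    then have "?c (matrix_inv s ** A ** s) \<in> ?c ` K" by blast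
    then show "A \<in> ?c ` K"
      using s by (simp add: matrix_mul_assoc)
  next
    assume "A \<in> ?c ` K"
    then obtain C where "C \<in> K" "A = ?c C" by blast
    then show "matrix_inv s ** A ** s \<in> K"
      using s by (simp add: matrix_mul_assoc)
  qed
  have inv_iff: "invertible (matrix_inv s ** A ** s) \<longleftrightarrow> invertible A" for A :: "complex^'n^'n"
  proof
    assume "invertible (matrix_inv s ** A ** s)"
    then have "invertible (s ** (matrix_inv s ** A ** s) ** matrix_inv s)"
      by (rule invertible_mult[OF invertible_mult[OF s] invertible_matrix_inv[OF s]])
    then show "invertible A"
      using s by (simp add: matrix_mul_assoc)
  qed (use s in \<open>auto intro!: invertible_mult\<close>)
  have "algebraic_group (?c ` K)"
    unfolding algebraic_group_def
  proof
    show "subgroup (?c ` K) GL"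
    proof (rule subgroup.intro)
      show "?c ` K \<subseteq> carrier GL"
        using algebraic_groupD(1)[OF alg] s by (auto simp: GL_def intro!: invertible_mult)
      show "\<one>\<^bsub>GL\<^esub> \<in> ?c ` K"
        using algebraic_groupD(2)[OF alg] s by (simp add: im GL_def)
      show "x \<otimes>\<^bsub>GL\<^esub> y \<in> ?c ` K" if "x \<in> ?c ` K" "y \<in> ?c ` K" for x y
        using that cm algebraic_groupD(3)[OF alg] by (auto simp: GL_def)
      show "inv\<^bsub>GL\<^esub> x \<in> ?c ` K" if x: "x \<in> ?c ` K" for x
      proof -
        obtain A where A: "A \<in> K" "x = ?c A" using x by blast
        have iA: "invertible A"
          by (rule algebraic_groupD(1)[OF alg A(1)])
        have "invertible x"
          using A(2) iA s by (simp add: invertible_mult)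
        moreover have "matrix_inv x = ?c (matrix_inv A)"
          using A(2) iA s by (simp add: matrix_inv_mult invertible_mult matrix_mul_assoc)
        ultimately show ?thesis
          using algebraic_groupD(4)[OF alg A(1)] by (auto simp: inv_GL)
      qed
    qed
    have p: "matrix_poly (\<lambda>A. p (matrix_inv s ** A ** s))" if "p \<in> S" for p
      using matrix_poly_mult_left[OF matrix_poly_mult_right[of p s], of "matrix_inv s"] S(1) that by simp
    have mem: "A \<in> ?c ` K \<longleftrightarrow> invertible A \<and> (\<forall>p\<in>S. p (matrix_inv s ** A ** s) = 0)" for A
      unfolding im by (subst S(2)) (simp add: inv_iff)
    show "\<exists>S. (\<forall>p\<in>S. matrix_poly p) \<and> ?c ` K = {A. invertible A \<and> (\<forall>p\<in>S. p A = 0)}"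
    proof (intro exI[of _ "(\<lambda>p A. p (matrix_inv s ** A ** s)) ` S"] conjI Set.set_eqI)
      show "\<forall>p\<in>(\<lambda>p A. p (matrix_inv s ** A ** s)) ` S. matrix_poly p"
        using p by simp
      show "A \<in> ?c ` K \<longleftrightarrow> A \<in> {A. invertible A \<and> (\<forall>p\<in>(\<lambda>p A. p (matrix_inv s ** A ** s)) ` S. p A = 0)}" for A
        unfolding mem by simp
    qed
  qed
  moreover have "connected (?c ` K)"
    by (intro connected_continuous_image con bounded_bilinear.continuous_on[OF bounded_bilinear_mm] continuous_intros)
  moreover have "solvable (GL\<lparr>carrier := ?c ` K\<rparr>)"
  proof -
    have "group_hom (GL\<lparr>carrier := K\<rparr>) (GL\<lparr>carrier := ?c ` K\<rparr>) ?c"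
      using group_restrict[OF alg] group_restrict[OF \<open>algebraic_group (?c ` K)\<close>] cm
      by (auto simp: group_hom_def group_hom_axioms_def hom_def GL_def)
    then show ?thesis
      by (rule group_hom.surj_hom_imp_solvable) (use sol in simp_all)
  qed
  ultimately show ?thesis
    by (simp add: connected_solvable_def connected_algebraic_group_def)
qed

lemma normal_conj:
  assumes K: "algebraic_group P" and U: "U \<lhd> (GL\<lparr>carrier := P\<rparr>)" and gu: "g \<in> P" "u \<in> U"
  shows "g ** u ** matrix_inv g \<in> U"
proof -
  have sub: "subgroup P GL"
    using K by (simp add: algebraic_group_def)
  have "inv\<^bsub>GL\<lparr>carrier := P\<rparr>\<^esub> g = matrix_inv g"
    using group.m_inv_consistent[OF group_GL sub gu(1)] inv_GL algebraic_groupD(1)[OF K gu(1)] by simp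
  then show ?thesis
    using normal.inv_op_closed2[OF U, of g u] gu by (simp add: GL_def)
qed

definition pos_long :: "(int \<times> int) set" where "pos_long = {(0, 1), (3, 1), (3, 2)}"
definition neg_long :: "(int \<times> int) set" where "neg_long = {(0, - 1), (- 3, - 1), (- 3, - 2)}"

lemma G2_long_split: "G2_long = pos_long \<union> neg_long"
  by (auto simp: G2_long_def pos_long_def neg_long_def)

context g2
begin

text \<open>A unipotent diagonal matrix is the identity.\<close>

lemma lieT_unipotent_eq_0:
  assumes x: "x \<in> \<tt>" and u: "\<And>z. unipotent_matrix (mexp (cscale z x))"
  shows "x = 0"
proof (rule lieT_eq_0[OF x])
  fix i
  have m: "wt i (mexp (cscale z x)) = exp (wt i x * z)" for z
  proof (rule exp_character[where h = "\<lambda>z. wt i (mexp (cscale z x))"])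
    show "wt i (mexp (cscale (a + b) x)) = wt i (mexp (cscale a x)) * wt i (mexp (cscale b x))" for a b
      unfolding mexp_add by (rule wt_mult[OF mexp_mem(1)[OF algT x]])
    show "wt i (mexp (cscale 0 x)) = 1"
    proof -
      have "cj (mexp (cscale 0 x)) = mat 1" by simp
      then show ?thesis unfolding wt_def by (simp only: mat_def vec_lambda_beta if_True refl)
    qed
    have "mderiv (\<lambda>z. S ** mexp (cscale z x) ** matrix_inv S) (S ** x ** matrix_inv S) 0"
      using mderiv_mult[OF mderiv_mexp_right[of S x 0] mderiv_const[of "matrix_inv S"]] by simp
    then show "((\<lambda>z. wt i (mexp (cscale z x))) has_field_derivative wt i x) (at 0)"
      by (simp add: mderiv_def wt_def cj_def)
  qed
  show "wt i x = 0"
  proof (rule ccontr)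
    assume nz: "wt i x \<noteq> 0"
    define M where "M = mexp (cscale (1 / wt i x) x) - mat 1"
    obtain k where k: "(((**) M) ^^ k) (mat 1) = 0"
      using u[of "1 / wt i x"] unfolding unipotent_matrix_def M_def by blast
    have off: "cj M $ a $ b = 0" if "a \<noteq> b" for a b
      using cj_diag[OF mexp_mem(1)[OF algT x] that] that unfolding M_def cj_lin cj_1 by (simp add: mat_def)
    have "cj (mpow M l) $ i $ i = (wt i M) ^ l" for l
    proof (induction l)
      case 0
      have "cj (mpow M 0) = mat 1" by simp
      then show ?case by (simp add: mat_def)
    next
      case (Suc l)
      have "cj (mpow M (Suc l)) $ i $ i = (cj M ** cj (mpow M l)) $ i $ i"
        by (simp add: mpow_Suc cj_mult)
      also have "\<dots> = wt i M * cj (mpow M l) $ i $ i"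
        by (rule diag_mult(1)[OF off])
      finally show ?case using Suc by simp
    qed
    then have "(wt i M) ^ k = cj (mpow M k) $ i $ i" by simp
    also have "\<dots> = 0"
      using k by (simp add: mpow_def cj_lin)
    finally have "wt i M = 0" by simp
    moreover have "wt i M = wt i (mexp (cscale (1 / wt i x) x)) - 1"
      unfolding wt_def M_def cj_lin cj_1 by (simp add: mat_def)
    ultimately have "exp 1 = (1 :: complex)"
      using m[of "1 / wt i x"] nz by simp
    then show False
      by (metis exp_of_real exp_zero of_real_1 of_real_eq_iff one_neq_zero exp_inj_iff)
  qed
qed

text \<open>A unipotent normal subgroup of a group with root system \<open>- \<Phi> = \<Phi>\<close> is trivial: with a root vector
  it would contain the opposite one, and hence a coroot.\<close>

lemma unipotent_normal_trivial:
  assumes K: "algebraic_group K" "T \<subseteq> K" "K \<subseteq> G" and symm: "\<And>p. p \<in> subroots K \<Longrightarrow> - p \<in> subroots K"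
    and U: "normal_connected_unipotent U K"
  shows "U = {mat 1}"
proof -
  have conU: "connected_algebraic_group U" and algU: "algebraic_group U" and nor: "U \<lhd> (GL\<lparr>carrier := K\<rparr>)"
    and uni: "\<And>u. u \<in> U \<Longrightarrow> unipotent_matrix u"
    using U by (auto simp: normal_connected_unipotent_def connected_algebraic_group_def)
  have UK: "U \<subseteq> K"
    using normal_imp_subgroup[OF nor] subgroup.subset by fastforce
  have Ad: "s ** X ** matrix_inv s \<in> lie_algebra U" if s: "s \<in> K" and X: "X \<in> lie_algebra U" for s X
    by (rule lie_algebra_conj[OF _ algebraic_groupD(1)[OF K(1) s] algU X]) (rule normal_conj[OF K(1) nor s])
  have t0: "x = 0" if x: "x \<in> \<tt>" "x \<in> lie_algebra U" for x
    by (rule lieT_unipotent_eq_0[OF x(1)]) (rule uni[OF mexp_mem(1)[OF algU x(2)]])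
  have r0: "X = 0" if p: "p \<in> G2_roots" and X: "X \<in> rs p" "X \<in> lie_algebra U" for p X
  proof (rule ccontr)
    assume nz: "X \<noteq> 0"
    have LK: "lie_algebra U \<subseteq> lie_algebra K"
      by (rule lie_algebra_mono[OF UK])
    have subU: "Y \<in> lie_algebra U" if "Y \<in> rs p" for Y
      using rs_prop[OF p X(1) nz that] X(2) lie_algebra_cscale by blast
    then have pK: "p \<in> subroots K"
      using p LK by (auto simp: subroots_def)
    obtain e f where t: "triple p e f (hh p)"
      using hh_triple[OF p] by blast
    note t' = tripleD[OF t]
    have "e \<in> lie_algebra K" "f \<in> lie_algebra K"
      using t'(1,2) pK symm[OF pK] by (auto simp: subroots_def)
    then have s: "reflection e f \<in> K"
      by (rule reflection_mem[OF K(1)])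
    have "reflection e f ** X ** matrix_inv (reflection e f) \<in> rs (p - (2 * fst p, 2 * snd p))"
      using reflection_rs[OF t X(1), of 2] t'(5) by simp
    moreover have "p - (2 * fst p, 2 * snd p) = - p"
      by (simp add: prod_eq_iff)
    ultimately have Y: "reflection e f ** X ** matrix_inv (reflection e f) \<in> rs (- p)" (is "?Y \<in> _")
      by simp
    have "?Y \<noteq> 0"
    proof
      assume "?Y = 0"
      then have "matrix_inv (reflection e f) ** ?Y ** reflection e f = 0"
        by simp
      then show False
        using nz reflection_t(3)[OF t lie_algebra_0] by (simp add: matrix_mul_assoc)
    qed
    then obtain c where "f = cscale c ?Y"
      using rs_prop[OF G2_minus[OF p] Y _ t'(2)] by blast
    then have "f \<in> lie_algebra U"
      using lie_algebra_cscale[OF Ad[OF s X(2)], of c] by simp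
    then have "hh p \<in> lie_algebra U"
      using lie_algebra_bracket[OF algU subU[OF t'(1)], of f] t'(4) by simp
    then have "hh p = 0"
      by (rule t0[OF t'(3)])
    then have "cscale 2 e = 0"
      using t'(8) by (simp add: lie_bracket_lin)
    then show False
      using t'(6) by simp
  qed
  have z: "X = 0" if X: "X \<in> lie_algebra U" for X
  proof -
    have "comp \<psi> X = 0" if "\<psi> \<in> wts" for \<psi>
    proof -
      have \<psi>: "\<psi> \<in> characters T"
        using that rt_char by (auto simp: wts_def)
      have c: "comp \<psi> X \<in> lie_algebra U"
        by (rule comp_mem[OF lie_algebra_subspace _ X \<psi>]) (use Ad K(2) in blast)
      have cG: "comp \<psi> X \<in> root_space G T \<psi>"
        using c UK K(3) lie_algebra_mono[of U G] Ad_comp by (auto simp: root_space_def)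
      show ?thesis
      proof (rule ccontr)
        assume nz: "comp \<psi> X \<noteq> 0"
        show False
        proof (cases "\<psi> = \<one>\<^bsub>char_group T\<^esub>")
          case True
          then have "comp \<psi> X \<in> rs 0"
            using cG rv_0 by (simp add: rs_root_space)
          then show False
            using t0[OF _ c] nz by (simp add: rs_0)
        next
          case False
          then have "\<psi> \<in> roots G T"
            using \<psi> cG nz unfolding roots_def by blast
          then obtain p where p: "p \<in> G2_roots" "\<psi> = rv p"
            using roots_rv by blast
          then show False
            using r0[OF p(1) _ c] cG nz by (simp add: rs_root_space)
        qed
      qed
    qed
    then have "(\<Sum>\<psi>\<in>wts. comp \<psi> X) = 0"
      by (rule sum.neutral[OF ballI])
    then show ?thesis
      by (rule trans[OF comp_sum])
  qed
  have "A = mat 1" if A: "A \<in> U" for A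
  proof (rule connected_algebraic_induct[OF conU A, where P = "\<lambda>A. A = mat 1"])
    show "C ** mexp X = mat 1" if "C = mat 1" "X \<in> lie_algebra U" for C X
      using that(1) z[OF that(2)] by simp
  qed simp
  then show ?thesis
    using algebraic_groupD(2)[OF algU] by blast
qed

end

locale g2_sl3 = g2 T S G B a1 a2 for T :: "(complex^'n^'n) set" and S G B a1 a2 +
  fixes H BH BH' :: "(complex^'n^'n) set" and b1 b2 :: "complex^'n^'n \<Rightarrow> complex"
  assumes BG: "borel_subgroup B G" "T \<subseteq> B"
    and H: "connected_algebraic_group H" "T \<subseteq> H" "H \<subseteq> G" "roots H T = int_combinations T a1 a2 G2_long"
    and BH: "borel_subgroup BH H" "T \<subseteq> BH" "BH \<subseteq> B"
    and b: "b1 \<noteq> b2" "simple_roots H T BH {b1, b2}"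
    and BH': "opposite_borel H T BH BH'"
begin

lemma algB: "algebraic_group B" and BsubG: "B \<subseteq> G" and algH: "algebraic_group H" and algBH: "algebraic_group BH"
  and BHsubH: "BH \<subseteq> H" and conB: "connected_algebraic_group B"
  using BG H BH by (auto simp: borel_subgroup_def connected_solvable_def connected_algebraic_group_def)

lemma subroots_H: "subroots H = G2_long"
proof -
  have "\<psi> \<in> roots H T \<longleftrightarrow> (\<exists>p\<in>G2_long. \<psi> = rv p)" for \<psi>
    unfolding H(4) int_combinations_def rv_def by (auto simp: Bex_def)
  then have "rv p \<in> roots H T \<longleftrightarrow> p \<in> G2_long" for p
    by (auto simp: rv_inj)
  then show ?thesis
    using subroots_iff[OF H(3)] by blast
qed

lemma subroots_B: "subroots B = {p \<in> G2_roots. 0 \<le> fst p \<and> 0 \<le> snd p}"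
proof -
  have r1: "rv p \<in> roots B T \<longleftrightarrow> p \<in> G2_roots \<and> (\<exists>m n. p = nmul m (1, 0) + nmul n (0, 1))" for p
    using simple nonneg_pair[of "(1, 0)" "(0, 1)" p] roots_rv[of "rv p"] rv_inj
    by (auto simp: simple_roots_def simp flip: a_rv)
  have r2: "(\<exists>m n. p = nmul m (1, 0) + nmul n (0, 1)) \<longleftrightarrow> 0 \<le> fst p \<and> 0 \<le> snd p" for p
  proof
    assume "0 \<le> fst p \<and> 0 \<le> snd p"
    then have "p = nmul (nat (fst p)) (1, 0) + nmul (nat (snd p)) (0, 1)"
      by (simp add: nmul_def prod_eq_iff)
    then show "\<exists>m n. p = nmul m (1, 0) + nmul n (0, 1)" by blast
  qed (auto simp: nmul_def)
  show ?thesis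
  proof (rule Set.set_eqI)
    fix p
    show "p \<in> subroots B \<longleftrightarrow> p \<in> {p \<in> G2_roots. 0 \<le> fst p \<and> 0 \<le> snd p}"
      unfolding subroots_iff[OF BsubG, symmetric] r1 r2 by blast
  qed
qed

text \<open>The base of the long roots that is positive for \<open>B\<close>.\<close>

lemma base_H: "{b1, b2} = {rv (0, 1), rv (3, 1)}" and subroots_BH: "subroots BH = pos_long"
proof -
  have rb: "{b1, b2} \<subseteq> roots H T" "\<forall>\<alpha>\<in>roots H T. \<alpha> \<in> nonneg_combinations T {b1, b2} \<or> inv\<^bsub>char_group T\<^esub> \<alpha> \<in> nonneg_combinations T {b1, b2}"
    and rBH: "roots BH T = roots H T \<inter> nonneg_combinations T {b1, b2}"
    using b(2) by (auto simp: simple_roots_def root_base_def)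
  obtain u v where uv: "b1 = rv u" "b2 = rv v" "u \<in> G2_long" "v \<in> G2_long"
    using rb(1) roots_sub[OF H(3)] subroots_H by (metis insert_subset)
  have ne: "u \<noteq> v"
    using b(1) uv by auto
  have nn: "rv p \<in> nonneg_combinations T {b1, b2} \<longleftrightarrow> (\<exists>m n. p = nmul m u + nmul n v)" for p
    using nonneg_pair[OF ne] uv by simp
  have BHG: "BH \<subseteq> G"
    using BHsubH H(3) by blast
  have sBH: "p \<in> subroots BH \<longleftrightarrow> p \<in> G2_long \<and> (\<exists>m n. p = nmul m u + nmul n v)" for p
    using subroots_iff[OF BHG, of p] subroots_iff[OF H(3), of p] rBH nn[of p] subroots_H by blast
  have mono: "subroots BH \<subseteq> subroots B"
    using lie_algebra_mono[OF BH(3)] by (auto simp: subroots_def)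
  have "u = nmul 1 u + nmul 0 v" "v = nmul 0 u + nmul 1 v"
    by (simp_all add: nmul_def prod_eq_iff)
  then have "u \<in> subroots BH" "v \<in> subroots BH"
    using sBH uv by blast+
  then have "u \<in> subroots B" "v \<in> subroots B"
    using mono by blast+
  then have "0 \<le> fst u \<and> 0 \<le> snd u" "0 \<le> fst v \<and> 0 \<le> snd v"
    unfolding subroots_B by blast+
  then have pos: "u \<in> pos_long" "v \<in> pos_long"
    using uv(3,4) by (auto simp: G2_long_def pos_long_def)
  have all: "\<exists>m n. p = nmul m u + nmul n v \<or> - p = nmul m u + nmul n v" if "p \<in> G2_long" for p
  proof -
    have "rv p \<in> roots H T"
      using that subroots_H subroots_iff[OF H(3)] by blast
    then have "rv p \<in> nonneg_combinations T {b1, b2} \<or> rv (- p) \<in> nonneg_combinations T {b1, b2}"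
      using rb(2) rv_inv by metis
    then show ?thesis
      using nn by blast
  qed
  have uv': "{u, v} = {(0, 1), (3, 1)}"
  proof -
    have i1: "\<exists>m n. (3, 1) = nmul m u + nmul n v \<or> - (3, 1) = nmul m u + nmul n v"
      by (rule all) (simp add: G2_long_def)
    have i2: "\<exists>m n. (0, 1) = nmul m u + nmul n v \<or> - (0, 1) = nmul m u + nmul n v"
      by (rule all) (simp add: G2_long_def)
    have "(u, v) \<in> {((0, 1), (3, 1)), ((3, 1), (0, 1)), ((0, 1), (3, 2)), ((3, 2), (0, 1)), ((3, 1), (3, 2)), ((3, 2), (3, 1))}"
      using pos ne by (auto simp: pos_long_def)
    then consider "{u, v} = {(0, 1), (3, 1)}" | "u = (0, 1)" "v = (3, 2)" | "u = (3, 2)" "v = (0, 1)"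
      | "u = (3, 1)" "v = (3, 2)" | "u = (3, 2)" "v = (3, 1)"
      by auto
    then show ?thesis
    proof cases
      case 2
      then show ?thesis using i1 by (auto simp: nmul_def; presburger)
    next
      case 3
      then show ?thesis using i1 by (auto simp: nmul_def; presburger)
    next
      case 4
      then show ?thesis using i2 by (auto simp: nmul_def; presburger)
    next
      case 5
      then show ?thesis using i2 by (auto simp: nmul_def; presburger)
    qed
  qed
  then show "{b1, b2} = {rv (0, 1), rv (3, 1)}"
    using uv by (auto simp: doubleton_eq_iff)
  have r1: "(\<exists>m n. p = nmul m u + nmul n v) \<longleftrightarrow> (\<exists>m n. p = nmul m (0, 1) + nmul n (3, 1))" for p
  proof -
    have "(\<exists>m n. p = nmul m (3, 1) + nmul n (0, 1)) \<longleftrightarrow> (\<exists>m n. p = nmul m (0, 1) + nmul n (3, 1))"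
      by (subst add.commute) blast
    moreover have "u = (0, 1) \<and> v = (3, 1) \<or> u = (3, 1) \<and> v = (0, 1)"
      using uv' by (simp add: doubleton_eq_iff)
    ultimately show ?thesis by blast
  qed
  have r2: "p \<in> G2_long \<and> (\<exists>m n. p = nmul m (0, 1) + nmul n (3, 1)) \<longleftrightarrow> p \<in> pos_long" for p
  proof
    assume "p \<in> pos_long"
    then consider "p = nmul 1 (0, 1) + nmul 0 (3, 1)" | "p = nmul 0 (0, 1) + nmul 1 (3, 1)" | "p = nmul 1 (0, 1) + nmul 1 (3, 1)"
      by (auto simp: pos_long_def nmul_def)
    then show "p \<in> G2_long \<and> (\<exists>m n. p = nmul m (0, 1) + nmul n (3, 1))"
      using \<open>p \<in> pos_long\<close> G2_long_split by cases blast+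
  qed (auto simp: G2_long_def pos_long_def nmul_def)
  show "subroots BH = pos_long"
    by (rule Set.set_eqI) (simp only: sBH r1 r2)
qed

text \<open>The reflection in the highest root \<open>3a\<^sub>1 + 2a\<^sub>2\<close> is the longest element of the Weyl group of \<open>H\<close>, so that
  it conjugates \<open>BH\<close> to a Borel subgroup with negative roots; by maximality this is \<open>BH'\<close>.\<close>

lemma subroots_BH': "subroots BH' = neg_long"
proof -
  have bo: "borel_subgroup BH' H" "BH \<inter> BH' = T"
    using BH' by (auto simp: opposite_borel_def)
  then have algBH': "algebraic_group BH'" and conBH': "connected_algebraic_group BH'" and BH'H: "BH' \<subseteq> H" and TBH': "T \<subseteq> BH'"
    by (auto simp: borel_subgroup_def connected_solvable_def connected_algebraic_group_def)
  have BH'G: "BH' \<subseteq> G" using BH'H H(3) by blast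
  have long: "subroots BH' \<subseteq> G2_long"
    using lie_algebra_mono[OF BH'H] subroots_H by (auto simp: subroots_def)
  have disj: "p \<notin> pos_long" if p: "p \<in> subroots BH'" for p
  proof
    assume "p \<in> pos_long"
    then have "rs p \<subseteq> lie_algebra BH" "rs p \<subseteq> lie_algebra BH'" "p \<in> G2_roots"
      using subroots_BH p by (auto simp: subroots_def)
    moreover then obtain X where X: "X \<in> rs p" "X \<noteq> 0"
      using rs_nonzero by blast
    ultimately have "mexp (cscale z X) \<in> BH \<inter> BH'" for z
      using mexp_mem(1)[OF algBH] mexp_mem(1)[OF algBH'] by blast
    then have "X \<in> \<tt>"
      using lie_algebra_curve[OF _ _ mderiv_mexp_0[of X], of T] bo(2) by simp
    moreover obtain x where "x \<in> \<tt>" "ev p x = 1"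
      using ev_ne_0[of p] \<open>p \<in> G2_roots\<close> G2_0 by blast
    ultimately show False
      using rsD(2)[OF X(1), of x] lieT_abelian[of x X] X(2) by simp
  qed
  have neg: "subroots BH' \<subseteq> neg_long"
    using long disj G2_long_split by blast
  have th: "(3, 2) \<in> G2_roots" "(3, 2) \<in> subroots H" "- (3, 2) \<in> subroots H"
    using subroots_H by (simp_all add: G2_defs)
  obtain e f where t: "triple (3, 2) e f (hh (3, 2))"
    using hh_triple[OF th(1)] by blast
  note t' = tripleD[OF t]
  have "e \<in> lie_algebra H" "f \<in> lie_algebra H"
    using t'(1,2) th(2,3) by (auto simp: subroots_def)
  then have sH: "reflection e f \<in> H"
    by (rule reflection_mem[OF algH])
  let ?s = "reflection e f"
  have s: "invertible ?s"
    by (rule algebraic_groupD(1)[OF algH sH])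
  let ?K = "(\<lambda>A. ?s ** A ** matrix_inv ?s) ` BH"
  have csK: "connected_solvable ?K"
    using BH(1) s by (intro connected_solvable_conj) (auto simp: borel_subgroup_def)
  then have algK: "algebraic_group ?K"
    by (simp add: connected_solvable_def connected_algebraic_group_def)
  have KH: "?K \<subseteq> H"
    using sH BHsubH algebraic_groupD(3,4)[OF algH] by blast
  have AdK: "?s ** X ** matrix_inv ?s \<in> lie_algebra ?K" if "X \<in> lie_algebra BH" for X
    by (rule lie_algebra_conj[OF _ s algBH that]) blast
  have negK: "rs p \<subseteq> lie_algebra ?K" if p: "p \<in> neg_long" for p
  proof -
    have "\<exists>q\<in>pos_long. \<exists>n. ev q (hh (3, 2)) = of_int n \<and> q - (n * 3, n * 2) = p"
      using p ev_pair[of 3 1 "hh (3, 2)"] ev_pair[of 3 2 "hh (3, 2)"] ev_hh(7,8) by (auto simp: pos_long_def neg_long_def)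
    then obtain q n where q: "q \<in> pos_long" "ev q (hh (3, 2)) = of_int n" "q - (n * 3, n * 2) = p"
      by blast
    have qr: "q \<in> G2_roots" "rs q \<subseteq> lie_algebra BH"
      using q(1) subroots_BH by (auto simp: subroots_def)
    obtain Y where Y: "Y \<in> rs q" "Y \<noteq> 0"
      using rs_nonzero[OF qr(1)] by blast
    have Z: "?s ** Y ** matrix_inv ?s \<in> rs p"
      using reflection_rs[OF t Y(1) q(2)] q(3) by simp
    have "?s ** Y ** matrix_inv ?s \<noteq> 0"
    proof
      assume "?s ** Y ** matrix_inv ?s = 0"
      then have "matrix_inv ?s ** (?s ** Y ** matrix_inv ?s) ** ?s = 0"
        by simp
      then show False
        using Y(2) s by (simp add: matrix_mul_assoc)
    qed
    moreover have "p \<in> G2_roots"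
      using p by (auto simp: neg_long_def G2_defs)
    ultimately have "\<exists>c. X = cscale c (?s ** Y ** matrix_inv ?s)" if "X \<in> rs p" for X
      using rs_prop[OF _ Z _ that] by blast
    moreover have "?s ** Y ** matrix_inv ?s \<in> lie_algebra ?K"
      using AdK qr(2) Y(1) by blast
    ultimately show ?thesis
      using lie_algebra_cscale by blast
  qed
  have tK: "\<tt> \<subseteq> lie_algebra ?K"
  proof
    fix x assume x: "x \<in> \<tt>"
    have y: "matrix_inv ?s ** x ** ?s \<in> \<tt>"
      unfolding reflection_t(2)[OF t x] by (intro lie_algebra_diff lie_algebra_cscale x t'(3))
    have "?s ** (matrix_inv ?s ** x ** ?s) ** matrix_inv ?s \<in> lie_algebra ?K"
      by (rule AdK) (use y lie_algebra_mono[OF BH(2)] in blast)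
    then show "x \<in> lie_algebra ?K"
      using s by (simp add: matrix_mul_assoc)
  qed
  have "lie_algebra BH' \<subseteq> lie_algebra ?K"
    unfolding lie_sub[OF algBH' TBH' BH'G]
    by (rule cm.span_minimal[OF _ lie_algebra_subspace]) (use neg negK tK rs_0 in auto)
  then have "BH' \<subseteq> ?K"
    by (rule lie_algebra_subset_imp_subset[OF conBH' algK])
  then have "?K = BH'"
    using bo(1) csK KH unfolding borel_subgroup_def by blast
  then have "neg_long \<subseteq> subroots BH'"
    using negK by (auto simp: subroots_def) (auto simp: neg_long_def G2_defs)
  with neg show ?thesis by blast
qed

text \<open>The bracket of the two root spaces is non-zero, because the string has length one.\<close>

lemma subroots_bracket:
  assumes K: "algebraic_group K" and p: "p \<in> subroots K" and q: "q \<in> subroots K" and pq: "q + p \<in> G2_roots"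
    and ends: "q - p \<notin> insert 0 G2_roots" "q + (2 * fst p, 2 * snd p) \<notin> insert 0 G2_roots"
  shows "q + p \<in> subroots K"
proof -
  have pr: "p \<in> G2_roots" "q \<in> G2_roots"
    using p q by (auto simp: subroots_def)
  obtain e f where t: "triple p e f (hh p)"
    using hh_triple[OF pr(1)] by blast
  note t' = tripleD[OF t]
  obtain X where X: "X \<in> rs q" "X \<noteq> 0"
    using rs_nonzero[OF pr(2)] by blast
  have e1: "q + (int (Suc 1) * fst p, int (Suc 1) * snd p) \<notin> insert 0 G2_roots"
    "q + (int 1 * fst p, int 1 * snd p) \<in> G2_roots"
    using ends(2) pq by (simp_all add: plus_prod_def)
  have c: "ev q (hh p) = - of_nat 1"
    by (rule hh_cartan[OF pr e1(2) ends(1) e1(1)])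
  obtain n where n: "ev q (hh p) = - of_nat n" "\<forall>i\<le>n. (lie_bracket e ^^ i) X \<noteq> 0"
    using string_lowest[OF t X _ _ e1(1)] ends(1) by blast
  have "n = 1"
    using c n(1) by (metis neg_equal_iff_equal of_nat_eq_iff)
  then have nz: "lie_bracket e X \<noteq> 0"
    using n(2)[rule_format, of 1] by simp
  have m: "lie_bracket e X \<in> rs (q + p)"
    using rs_bracket[OF t'(1) X(1)] by (simp add: add.commute)
  have "lie_bracket e X \<in> lie_algebra K"
    by (rule lie_algebra_bracket[OF K]) (use p q t'(1) X(1) in \<open>auto simp: subroots_def\<close>)
  then have "Y \<in> lie_algebra K" if "Y \<in> rs (q + p)" for Y
    using rs_prop[OF pq m nz that] lie_algebra_cscale by blast
  with pq show ?thesis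
    by (auto simp: subroots_def)
qed

text \<open>If \<open>P\<close> had a positive root other than \<open>w\<close>, it would be all of \<open>H\<close>; then its unipotent radical would be
  trivial and its Levi subgroup too large.\<close>

lemma parabolic_roots:
  assumes P: "parabolic_of H T BH' {b1, b2} {b} P" and w: "{b1, b2} - {b} = {rv w}" "w = (0, 1) \<or> w = (3, 1)"
  shows "connected_algebraic_group P" "T \<subseteq> P" "P \<subseteq> H" "subroots P = insert w neg_long"
proof -
  have algP: "algebraic_group P" and PH: "P \<subseteq> H" and BP: "BH' \<subseteq> P"
    using P by (auto simp: parabolic_of_def parabolic_subgroup_def)
  obtain M where levi: "levi_subgroup M P" and TM: "T \<subseteq> M" and rbM: "root_base T (roots M T) ({b1, b2} - {b})"
    using P unfolding parabolic_of_def by blast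
  obtain U where conM: "connected_algebraic_group M" and MP: "M \<subseteq> P" and U: "unipotent_radical U P"
    and PMU: "P = {l ** u | l u. l \<in> M \<and> u \<in> U}"
    using levi unfolding levi_subgroup_def by blast
  have nU: "normal_connected_unipotent U P"
    using U by (simp add: unipotent_radical_def)
  have "connected M" "connected U"
    using conM nU by (auto simp: connected_algebraic_group_def normal_connected_unipotent_def)
  then have "connected ((\<lambda>z. fst z ** snd z) ` (M \<times> U))"
    by (intro connected_continuous_image bounded_bilinear.continuous_on[OF bounded_bilinear_mm] connected_Times continuous_intros)
  moreover have "P = (\<lambda>z. fst z ** snd z) ` (M \<times> U)"
    unfolding PMU by force
  ultimately show conP: "connected_algebraic_group P"
    using algP by (simp add: connected_algebraic_group_def)
  show TP: "T \<subseteq> P" and "P \<subseteq> H"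
    using TM MP PH by auto
  have PG: "P \<subseteq> G" and MG: "M \<subseteq> G"
    using PH H(3) MP by auto
  have mono: "subroots K \<subseteq> subroots K'" if "K \<subseteq> K'" for K K'
    using lie_algebra_mono[OF that] by (auto simp: subroots_def)
  have neg: "neg_long \<subseteq> subroots P"
    using mono[OF BP] subroots_BH' by simp
  have "rv w \<in> roots M T"
    using rbM w(1) by (auto simp: root_base_def)
  then have "w \<in> subroots P"
    using subroots_iff[OF MG] mono[OF MP] by blast
  with neg have low: "insert w neg_long \<subseteq> subroots P"
    by blast
  have up: "subroots P \<subseteq> G2_long"
    using mono[OF PH] subroots_H by simp
  have add: "q + p \<in> subroots P" if "p \<in> subroots P" "q \<in> subroots P" "q + p \<in> G2_roots"
    "q - p \<notin> insert 0 G2_roots" "q + (2 * fst p, 2 * snd p) \<notin> insert 0 G2_roots" for p q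
    by (rule subroots_bracket[OF algP that])
  have nl: "(0, - 1) \<in> subroots P" "(- 3, - 1) \<in> subroots P"
    using neg by (auto simp: neg_long_def)
  have False if full: "subroots P = G2_long"
  proof -
    have "lie_algebra H \<subseteq> lie_algebra P"
      unfolding lie_sub[OF algH H(2,3)] lie_sub[OF algP TP PG] full subroots_H by simp
    then have "H \<subseteq> P"
      by (rule lie_algebra_subset_imp_subset[OF H(1) algP])
    have "U = {mat 1}"
      by (rule unipotent_normal_trivial[OF algP TP PG _ nU]) (auto simp: full G2_long_def)
    then have "P = M"
      unfolding PMU by auto
    then have "rv (3, 2) \<in> roots M T"
      using subroots_iff[OF MG] full by (simp add: G2_long_def)
    then have "rv (3, 2) \<in> nonneg_combinations T {rv w} \<or> rv (- (3, 2)) \<in> nonneg_combinations T {rv w}"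
      using rbM w(1) rv_inv unfolding root_base_def by metis
    then have "\<exists>m. (3, 2) = nmul m w \<or> - (3, 2) = nmul m w"
      using nonneg_single by blast
    then show False
      using w(2) by (auto simp: nmul_def)
  qed
  moreover have "subroots P = G2_long" if "\<not> subroots P \<subseteq> insert w neg_long"
  proof -
    obtain p where p': "p \<in> subroots P" "p \<notin> insert w neg_long"
      using \<open>\<not> subroots P \<subseteq> insert w neg_long\<close> by blast
    then have p: "p \<in> subroots P" "p \<in> pos_long" "p \<noteq> w"
      using up G2_long_split by auto
    have "pos_long \<subseteq> subroots P"
      using w(2)
    proof
      assume w: "w = (0, 1)"
      have "(3, 1) \<in> subroots P"
      proof (cases "p = (3, 1)")
        case False
        then have "p = (3, 2)"
          using p w by (auto simp: pos_long_def)
        then show ?thesis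
          using add[of "(3, 2)" "(0, - 1)"] p(1) nl by (simp add: G2_defs zero_prod_def)
      qed (use p in simp)
      moreover have "(3, 2) \<in> subroots P"
        using add[of "(3, 1)" "(0, 1)"] calculation low w by (simp add: G2_defs zero_prod_def)
      ultimately show ?thesis
        using low w by (simp add: pos_long_def)
    next
      assume w: "w = (3, 1)"
      have "(0, 1) \<in> subroots P"
      proof (cases "p = (0, 1)")
        case False
        then have "p = (3, 2)"
          using p w by (auto simp: pos_long_def)
        then show ?thesis
          using add[of "(3, 2)" "(- 3, - 1)"] p(1) nl by (simp add: G2_defs zero_prod_def)
      qed (use p in simp)
      moreover have "(3, 2) \<in> subroots P"
        using add[of "(3, 1)" "(0, 1)"] calculation low w by (simp add: G2_defs zero_prod_def)
      ultimately show ?thesis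
        using low w by (simp add: pos_long_def)
    qed
    with neg up show ?thesis
      using G2_long_split by blast
  qed
  ultimately show "subroots P = insert w neg_long"
    using low by blast
qed

end

section \<open>Semi-invariant functions: necessary conditions\<close>

context linear_group
begin

lemma rder_curve_general:
  assumes "f \<in> R" "X \<in> L" "\<And>w. \<gamma> w \<in> K" "mderiv \<gamma> (\<gamma> z ** X) z"
  shows "((\<lambda>w. f (\<gamma> w)) has_field_derivative D X f (\<gamma> z)) (at z)"
proof -
  obtain p where p: "matrix_poly p" "f = res K p"
    using assms(1) by (elim coord_ringE)
  have "((\<lambda>w. p (\<gamma> w)) has_field_derivative ideriv X p (\<gamma> z)) (at z)"
    by (rule ideriv_curve[OF p(1) assms(4)])
  then show ?thesis
    by (simp add: p(2) rder_res[OF p(1) assms(2)]) (simp add: res_def assms(3))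
qed

text \<open>A locally nilpotent operator has no non-zero eigenvalue.\<close>

lemma nilpotent_eigenvalue:
  assumes "f \<in> R" "f \<noteq> 0" "X \<in> L" "mpow X N = 0" "D X f = fscale c f"
  shows "c = 0"
proof -
  have "(D X ^^ k) f = fscale (c ^ k) f" for k
  proof (induction k)
    case (Suc k)
    have "(D X ^^ Suc k) f = D X (fscale (c ^ k) f)"
      by (simp only: funpow.simps o_apply Suc)
    also have "\<dots> = fscale (c ^ k) (D X f)"
      by (rule rder_fscale[OF assms(1,3)])
    also have "\<dots> = fscale (c ^ Suc k) f"
      by (simp add: assms(5) mult.commute)
    finally show ?case .
  qed (simp add: fun_eq_iff)
  then obtain k where "fscale (c ^ k) f = 0"
    using rder_locally_nilpotent[OF assms(3,4,1)] by auto
  then show ?thesis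
    using assms(2) by (auto simp: fun_eq_iff)
qed

end

lemma span_sum3:
  assumes "cm.subspace a" "cm.subspace p" "X \<in> cm.span (a \<union> (C \<union> p))"
  shows "\<exists>Y\<in>a. \<exists>Z\<in>p. \<exists>W\<in>cm.span C. X = Y + W + Z"
proof -
  obtain Y V where 1: "Y \<in> cm.span a" "V \<in> cm.span (C \<union> p)" "X = Y + V"
    using assms(3) unfolding cm.span_Un[of a] by blast
  then obtain W Z where 2: "W \<in> cm.span C" "Z \<in> cm.span p" "V = W + Z"
    unfolding cm.span_Un[of C] by blast
  have "Y \<in> a" "Z \<in> p"
    using 1(1) 2(2) assms(1,2) by (simp_all add: cm.span_eq_iff[THEN iffD2])
  with 1 2 show ?thesis
    by (metis add.assoc)
qed

context g2_sl3
begin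

text \<open>Semi-invariance under \<open>B\<close>, on one-parameter subgroups; \<open>l\<close> is the
  differential of the character, and the sign comes from the inverse in the definition of the extended
  weight monoid.\<close>

definition left_eigen :: "(complex^'n^'n \<Rightarrow> complex) \<Rightarrow> (complex^'n^'n \<Rightarrow> complex) \<Rightarrow> bool" where
  "left_eigen l f \<longleftrightarrow> f \<in> R \<and> (\<forall>Y\<in>lie_algebra B. \<forall>g\<in>G. \<forall>z. f (mexp (cscale z Y) ** g) = exp (- l Y * z) * f g)"

text \<open>Semi-invariance under a group with roots \<open>Q\<close>, infinitesimally.\<close>

definition right_eigen :: "(int \<times> int) set \<Rightarrow> (complex^'n^'n \<Rightarrow> complex) \<Rightarrow> (complex^'n^'n \<Rightarrow> complex) \<Rightarrow> bool" where
  "right_eigen Q c f \<longleftrightarrow> (\<forall>q\<in>Q. \<forall>X\<in>rs q. D X f = 0) \<and> (\<forall>x\<in>\<tt>. D x f = fscale (c x) f)"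

lemma LB: "Y \<in> lie_algebra B \<Longrightarrow> Y \<in> L" "Y \<in> lie_algebra B \<Longrightarrow> mexp (cscale z Y) \<in> G"
  using lie_algebra_mono[OF BsubG] K_mexp(1) by blast+

lemma tB: "x \<in> \<tt> \<Longrightarrow> x \<in> lie_algebra B"
  using lie_algebra_mono[OF BG(2)] by blast

lemma rsB: "p \<in> G2_roots \<Longrightarrow> 0 \<le> fst p \<Longrightarrow> 0 \<le> snd p \<Longrightarrow> X \<in> rs p \<Longrightarrow> X \<in> lie_algebra B"
  using subroots_B by (auto simp: subroots_def)

text \<open>Left and right translations commute.\<close>

lemma left_eigen_rder:
  assumes f: "left_eigen l f" and X: "X \<in> L"
  shows "left_eigen l (D X f)"
  unfolding left_eigen_def
proof (intro conjI ballI allI)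
  have fR: "f \<in> R" using f by (simp add: left_eigen_def)
  then show "D X f \<in> R" using X by blast
  fix Y g z assume Y: "Y \<in> lie_algebra B" and g: "g \<in> G"
  let ?m = "mexp (cscale z Y)"
  have m: "?m \<in> G" by (rule LB(2)[OF Y])
  have "f (?m ** g ** mexp (cscale w X)) = exp (- l Y * z) * f (g ** mexp (cscale w X))" for w
    using f Y K_mult[OF g K_mexp(1)[OF X]] unfolding left_eigen_def by (metis matrix_mul_assoc)
  then have "((\<lambda>w. f (?m ** g ** mexp (cscale w X))) has_field_derivative exp (- l Y * z) * D X f g) (at 0)"
    using DERIV_cmult[OF rder_curve_0[OF fR X g], of "exp (- l Y * z)"] by simp
  then show "D X f (?m ** g) = exp (- l Y * z) * D X f g"
    by (rule rder_unique[OF fR X K_mult[OF m g]])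
qed

lemma left_eigen_word: "left_eigen l f \<Longrightarrow> set Xs \<subseteq> L \<Longrightarrow> left_eigen l (word Xs f)"
  by (induction Xs) (auto intro: left_eigen_rder)

text \<open>At \<open>g\<close> the left action of \<open>Y\<close> is the right action of \<open>Ad
  g\<^sup>-\<^sup>1 Y\<close>.\<close>

lemma left_eigen_value:
  assumes f: "left_eigen l f" and Y: "Y \<in> lie_algebra B" and g: "g \<in> G"
  shows "D (matrix_inv g ** Y ** g) f g = - l Y * f g" "matrix_inv g ** Y ** g \<in> L"
proof -
  have fR: "f \<in> R" using f by (simp add: left_eigen_def)
  show L: "matrix_inv g ** Y ** g \<in> L"
    using lie_algebra_Ad[OF alg K_minv[OF g] LB(1)[OF Y]] K_inv[OF g] by simp
  have "mderiv (\<lambda>w. mexp (cscale w Y) ** g) (Y ** g) 0"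
    using mderiv_mult[OF mderiv_mexp_0[of Y] mderiv_const[of g]] by simp
  moreover have "Y ** g = mexp (cscale 0 Y) ** g ** (matrix_inv g ** Y ** g)"
    using K_inv[OF g] by (simp add: matrix_mul_assoc)
  ultimately have "((\<lambda>w. f (mexp (cscale w Y) ** g)) has_field_derivative
      D (matrix_inv g ** Y ** g) f (mexp (cscale 0 Y) ** g)) (at 0)"
    by (intro rder_curve_general[OF fR L]) (auto simp: K_mult[OF LB(2)[OF Y] g])
  then have 1: "((\<lambda>w. f (mexp (cscale w Y) ** g)) has_field_derivative D (matrix_inv g ** Y ** g) f g) (at 0)"
    by simp
  have "(\<lambda>w. f (mexp (cscale w Y) ** g)) = (\<lambda>w. exp (- l Y * w) * f g)"
    using f Y g by (auto simp: left_eigen_def)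
  moreover have "((\<lambda>w. exp (- l Y * w) * f g) has_field_derivative - l Y * f g) (at 0)"
    by (auto intro!: derivative_eq_intros)
  ultimately show "D (matrix_inv g ** Y ** g) f g = - l Y * f g"
    using 1 DERIV_unique by fastforce
qed

text \<open>Inversion turns \<open>f\<close> into a highest weight vector for the right action.\<close>

lemma left_eigen_dominant:
  assumes f: "left_eigen l f" "f \<noteq> 0" and p: "p = (1, 0) \<or> p = (0, 1)"
  shows "\<exists>n. l (hh p) = of_nat n"
proof -
  have fR: "f \<in> R" using f by (simp add: left_eigen_def)
  have pr: "p \<in> G2_roots" "p \<noteq> 0" "0 \<le> fst p" "0 \<le> snd p"
    using p by (auto simp: G2_defs zero_prod_def)
  define v where "v = res G (\<lambda>A. f (matrix_inv A))"
  have vR: "v \<in> R"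
    unfolding v_def by (rule coord_ring_inverse[OF fR])
  obtain g where g: "f g \<noteq> 0" "g \<in> G"
    using f(2) coord_ring_outside[OF fR] by (metis ext zero_fun_apply)
  then have "v (matrix_inv g) \<noteq> 0"
    using K_minv K_inv by (simp add: v_def res_def)
  then have v0: "v \<noteq> 0" by auto
  have ve: "D Y v = fscale (l Y) v" if Y: "Y \<in> lie_algebra B" for Y
  proof (rule coord_ring_eqI)
    show "D Y v \<in> R" "fscale (l Y) v \<in> R"
      using vR LB(1)[OF Y] by (auto intro: coord_ring_fscale)
    fix A assume A: "A \<in> G"
    have "v (A ** mexp (cscale w Y)) = exp (l Y * w) * v A" for w
    proof -
      have "A ** mexp (cscale w Y) \<in> G"
        using A LB(2)[OF Y] K_mult by blast
      moreover have "matrix_inv (A ** mexp (cscale w Y)) = mexp (cscale (- w) Y) ** matrix_inv A"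
        using K_inv[OF A] by (simp add: matrix_inv_mult)
      moreover have "f (mexp (cscale (- w) Y) ** matrix_inv A) = exp (- l Y * (- w)) * f (matrix_inv A)"
        using f(1) Y K_minv[OF A] unfolding left_eigen_def by blast
      ultimately show ?thesis
        using A by (simp add: v_def res_def)
    qed
    moreover have "((\<lambda>w. exp (l Y * w) * v A) has_field_derivative l Y * v A) (at 0)"
      by (auto intro!: derivative_eq_intros)
    ultimately have "((\<lambda>w. v (A ** mexp (cscale w Y))) has_field_derivative l Y * v A) (at 0)"
      by simp
    then show "D Y v A = fscale (l Y) v A"
      using rder_unique[OF vR LB(1)[OF Y] A] by simp
  qed
  obtain e f' where t: "triple p e f' (hh p)"
    using hh_triple[OF pr(1)] by blast
  note t' = tripleD[OF t] and s' = tripleD[OF triple_swap[OF t]]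
  have eB: "e \<in> lie_algebra B"
    by (rule rsB[OF pr(1,3,4) t'(1)])
  obtain N where N: "mpow e N = 0"
    using rs_nilpotent[OF pr(2) t'(1)] by blast
  have De: "D e v = 0"
    using nilpotent_eigenvalue[OF vR v0 t'(10) N ve[OF eB]] ve[OF eB] by simp
  have "- p \<noteq> 0" using pr(2) by simp
  then obtain M where M: "mpow f' M = 0"
    using rs_nilpotent[OF _ t'(2)] by blast
  have Dh: "D (- hh p) v = fscale (- l (hh p)) v"
    using rder_lin(2)[OF vR t'(12,12), of "-1"] ve[OF tB[OF t'(3)]] by (simp add: fun_eq_iff)
  obtain n where "- l (hh p) = - of_nat n"
    using rder_sl2_lowest[OF t'(11,10) s'(4,8) M vR v0 De Dh] by blast
  then show ?thesis by auto
qed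

text \<open>The coroots of the simple roots of \<open>H\<close> form a basis as well.\<close>

lemma t_coords_H:
  assumes x: "x \<in> \<tt>"
  shows "x = cscale (ev (1, 0) x + ev (0, 1) x) (hh (0, 1)) + cscale (2 * ev (1, 0) x + ev (0, 1) x) (hh (3, 1))"
proof -
  have h: "hh (0, 1) \<in> \<tt>" "hh (3, 1) \<in> \<tt>"
    by (auto intro!: hh_t simp: G2_defs)
  let ?y = "cscale (ev (1, 0) x + ev (0, 1) x) (hh (0, 1)) + cscale (2 * ev (1, 0) x + ev (0, 1) x) (hh (3, 1))"
  have y: "?y \<in> \<tt>"
    using h by (intro lie_algebra_add lie_algebra_cscale)
  have "x - ?y = 0"
  proof (rule t_eq_0)
    show "x - ?y \<in> \<tt>"
      by (rule lie_algebra_diff[OF x y])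
    show "ev (1, 0) (x - ?y) = 0" "ev (0, 1) (x - ?y) = 0"
      using x y h by (simp_all add: ev_lin lie_algebra_cscale ev_hh)
  qed
  then show ?thesis by simp
qed

lemma sum_list_neg_nat:
  fixes w :: "complex^'n^'n \<Rightarrow> complex"
  assumes "\<And>X. X \<in> set Xs \<Longrightarrow> \<exists>k. w X = - (of_nat k :: complex)"
  shows "\<exists>k. sum_list (map w Xs) = - of_nat k"
  using assms
proof (induction Xs)
  case (Cons X Xs)
  then obtain k k' where "sum_list (map w Xs) = - of_nat k" "w X = - of_nat k'" by fastforce
  then show ?case by (intro exI[of _ "k + k'"]) simp
qed (auto intro: exI[of _ 0])

lemma rs_subset_span:
  assumes "p \<in> G2_roots" "X \<in> rs p" "X \<noteq> 0" "X \<in> cm.span A"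
  shows "rs p \<subseteq> cm.span A"
  using rs_prop[OF assms(1-3)] cm.span_scale[OF assms(4)] by blast

lemma L_subset_span: "(\<And>p. p \<in> insert 0 G2_roots \<Longrightarrow> rs p \<subseteq> cm.span A) \<Longrightarrow> L \<subseteq> cm.span A"
  unfolding L_span by (rule cm.span_minimal[OF _ cm.subspace_span]) blast

text \<open>For \<open>Q\<close> the set of roots of a group, this is its Lie algebra.\<close>

definition par :: "(int \<times> int) set \<Rightarrow> (complex^'n^'n) set" where
  "par Q = cm.span (\<Union>p\<in>insert 0 Q. rs p)"

lemma par_base: "q \<in> insert 0 Q \<Longrightarrow> rs q \<subseteq> par Q"
  unfolding par_def by (meson UN_upper cm.span_superset subset_trans)

lemma par_sub: "Q \<subseteq> G2_roots \<Longrightarrow> par Q \<subseteq> L"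
  unfolding par_def by (rule cm.span_minimal[OF _ lie_algebra_subspace]) (use rsD(1) in blast)

lemma right_eigen_par:
  assumes f: "f \<in> R" and r: "right_eigen Q c f" and Q: "Q \<subseteq> G2_roots" and Z: "Z \<in> par Q"
  shows "\<exists>d. D Z f = fscale d f"
proof -
  let ?S = "{Z \<in> L. \<exists>d. D Z f = fscale d f}"
  have "par Q \<subseteq> ?S"
    unfolding par_def
  proof (rule cm.span_minimal)
    show "(\<Union>p\<in>insert 0 Q. rs p) \<subseteq> ?S"
    proof
      fix X assume "X \<in> (\<Union>p\<in>insert 0 Q. rs p)"
      then obtain p where p: "p \<in> insert 0 Q" "X \<in> rs p" by blast
      show "X \<in> ?S"
      proof (cases "p = 0")
        case True
        then show ?thesis
          using p(2) r rs_0 t_L unfolding right_eigen_def by blast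
      next
        case False
        then have "D X f = fscale 0 f"
          using p r unfolding right_eigen_def by (simp add: fun_eq_iff)
        then show ?thesis
          using rsD(1)[OF p(2)] by blast
      qed
    qed
    show "cm.subspace ?S"
    proof (rule cm.subspaceI)
      show "0 \<in> ?S"
        using rder_lin(2)[OF f lie_algebra_0 lie_algebra_0, of 0] lie_algebra_0 by auto
      fix A B' k assume "A \<in> ?S"
      then obtain d where A: "A \<in> L" "D A f = fscale d f" by blast
      have "D (cscale k A) f = fscale (k * d) f"
        using rder_lin(2)[OF f A(1,1), of k] A(2) by simp
      then show "cscale k A \<in> ?S"
        using A(1) lie_algebra_cscale by blast
      assume "B' \<in> ?S"
      then obtain d' where B: "B' \<in> L" "D B' f = fscale d' f" by blast
      have "D (A + B') f = fscale (d + d') f"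
        using rder_lin(1)[OF f A(1) B(1)] A(2) B(2) by (simp add: fs.scale_left_distrib)
      then show "A + B' \<in> ?S"
        using A(1) B(1) lie_algebra_add by blast
    qed
  qed
  with Z show ?thesis by blast
qed

text \<open>The roots of the parabolic subgroup whose Levi factor has the root \<open>a\<^sub>2\<close>.\<close>

definition Q0 :: "(int \<times> int) set" where "Q0 = insert (0, 1) neg_long"

lemma Q0_roots: "Q0 \<subseteq> G2_roots"
  by (auto simp: Q0_def neg_long_def G2_defs)

text \<open>The weight vanishes on the coroot of \<open>a\<^sub>2\<close>, since \<open>f\<close> is
  killed by both of its root vectors, and it is \<open>- n\<close> on the coroot of \<open>3a\<^sub>1 +
  a\<^sub>2\<close>, since \<open>f\<close> is a lowest weight vector for it.\<close>

lemma right_weight: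
  assumes f: "f \<in> R" "f \<noteq> 0" and r: "right_eigen Q0 c f" and t: "triple (3, 1) e5 f5 (hh (3, 1))"
  shows "\<exists>n. (\<forall>x\<in>\<tt>. c x = - of_nat n * ev (2, 1) x) \<and> (\<forall>i>n. (D e5 ^^ i) f = 0)"
proof -
  note t' = tripleD[OF t]
  have c: "D x f = fscale (c x) f" if "x \<in> \<tt>" for x
    using r that by (simp add: right_eigen_def)
  have uniq: "a = b" if "fscale a f = fscale b f" for a b
    using that f(2) by (auto simp: fun_eq_iff)
  have clin: "c (cscale a x + cscale b y) = a * c x + b * c y" if xy: "x \<in> \<tt>" "y \<in> \<tt>" for a b x y
  proof (rule uniq)
    have L: "cscale a x \<in> L" "cscale b y \<in> L" "x \<in> L" "y \<in> L"
      using xy t_L lie_algebra_cscale by blast+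
    have "D (cscale a x + cscale b y) f = fscale a (D x f) + fscale b (D y f)"
      using rder_lin(1)[OF f(1) L(1,2)] rder_lin(2)[OF f(1) L(3,3), of a] rder_lin(2)[OF f(1) L(4,4), of b] by simp
    then show "fscale (c (cscale a x + cscale b y)) f = fscale (a * c x + b * c y) f"
      using c[of "cscale a x + cscale b y"] c[OF xy(1)] c[OF xy(2)] xy
      by (simp add: lie_algebra_add lie_algebra_cscale fs.scale_left_distrib)
  qed
  have h: "hh (0, 1) \<in> \<tt>" "hh (3, 1) \<in> \<tt>"
    by (auto intro!: hh_t simp: G2_defs)
  have "(3, 1) \<noteq> (0 :: int \<times> int)" by (simp add: zero_prod_def)
  then obtain N where N: "mpow e5 N = 0"
    using rs_nilpotent[OF _ t'(1)] by blast
  have "- (3, 1) \<in> Q0"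
    by (simp add: Q0_def neg_long_def)
  then have f5: "D f5 f = 0"
    using r t'(2) unfolding right_eigen_def by blast
  obtain n where n: "c (hh (3, 1)) = - of_nat n" "\<forall>i>n. (D e5 ^^ i) f = 0"
    using rder_sl2_lowest[OF t'(10,11,4,8) N f f5 c[OF h(2)]] by blast
  have "(0, 1) \<in> G2_roots"
    by (simp add: G2_defs)
  then obtain e2 f2 where t2: "triple (0, 1) e2 f2 (hh (0, 1))"
    using hh_triple by blast
  note t2' = tripleD[OF t2]
  have "(0, 1) \<in> Q0" "- (0, 1) \<in> Q0"
    by (simp_all add: Q0_def neg_long_def)
  then have z: "D e2 f = 0" "D f2 f = 0"
    using r t2'(1,2) unfolding right_eigen_def by blast+
  have "D (hh (0, 1)) f = 0"
    using rder_commutator[OF f(1) t2'(10,11)] z t2'(4,10,11) by (simp add: rder_0)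
  then have "fscale (c (hh (0, 1))) f = fscale 0 f"
    using c[OF h(1)] by (simp add: fun_eq_iff)
  then have c2: "c (hh (0, 1)) = 0"
    by (rule uniq)
  have "c x = - of_nat n * ev (2, 1) x" if x: "x \<in> \<tt>" for x
  proof -
    have "c x = c (cscale (ev (1, 0) x + ev (0, 1) x) (hh (0, 1)) + cscale (2 * ev (1, 0) x + ev (0, 1) x) (hh (3, 1)))"
      by (rule arg_cong[OF t_coords_H[OF x]])
    also have "\<dots> = (2 * ev (1, 0) x + ev (0, 1) x) * (- of_nat n)"
      by (simp add: clin[OF h] c2 n(1))
    finally show ?thesis
      by (simp add: ev_pair[of 2 1] algebra_simps)
  qed
  with n(2) show ?thesis by blast
qed

text \<open>Expansion at the identity: only the negative short root vectors matter, and the element of \<open>\<tt>\<close>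
  with \<open>a\<^sub>1 = 1\<close>, \<open>a\<^sub>2 = - 1\<close> acts on them with eigenvalues \<open>-1\<close>, \<open>0\<close>, \<open>-1\<close>.\<close>

lemma upper_bound_1:
  assumes f: "left_eigen l f" "f \<noteq> 0" and r: "right_eigen Q0 c f"
    and l: "\<And>a b. l (cscale a (hh (1, 0)) + cscale b (hh (0, 1))) = a * l (hh (1, 0)) + b * l (hh (0, 1))"
    and n: "\<And>x. x \<in> \<tt> \<Longrightarrow> c x = - of_nat n * ev (2, 1) x"
  shows "\<exists>k. l (hh (1, 0)) + l (hh (0, 1)) = of_nat (n + k)"
proof -
  have fR: "f \<in> R" using f(1) by (simp add: left_eigen_def)
  obtain x where x: "x \<in> \<tt>" "ev (1, 0) x = 1" "ev (0, 1) x = - 1"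
    using t_exists by blast
  define C where "C = rs (- 1, 0) \<union> rs (- 1, - 1) \<union> rs (- 2, - 1)"
  have CL: "C \<subseteq> L" using rsD(1) by (auto simp: C_def)
  define wgt where "wgt X = (if X \<in> rs (- 1, - 1) then 0 else - 1 :: complex)" for X :: "complex^'n^'n"
  have wgt: "lie_bracket x X = cscale (wgt X) X" if "X \<in> C" for X
    using that rsD(2)[OF _ x(1)] x(2,3) ev_pair[of "- 1" 0 x] ev_pair[of "- 1" "- 1" x] ev_pair[of "- 2" "- 1" x]
    by (auto simp: C_def wgt_def)
  have dec: "L \<subseteq> cm.span (lie_algebra B \<union> (C \<union> par Q0))"
  proof (rule L_subset_span)
    fix p :: "int \<times> int" assume p: "p \<in> insert 0 G2_roots"
    then consider "p = 0" | "p \<in> G2_roots" "0 \<le> fst p" "0 \<le> snd p" | "p \<in> Q0" | "p \<in> {(- 1, 0), (- 1, - 1), (- 2, - 1)}"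
      by (auto simp: G2_defs Q0_def neg_long_def)
    then have "rs p \<subseteq> lie_algebra B \<union> (C \<union> par Q0)"
    proof cases
      case 1
      then show ?thesis using tB by (auto simp: rs_0)
    next
      case 2
      then show ?thesis using rsB by blast
    next
      case 3
      then show ?thesis using par_base[of p Q0] by blast
    qed (auto simp: C_def)
    then show "rs p \<subseteq> cm.span (lie_algebra B \<union> (C \<union> par Q0))"
      using cm.span_superset by blast
  qed
  obtain Xs where Xs: "set Xs \<subseteq> L" "word Xs f (mat 1) \<noteq> 0"
    using words_determine[OF fR K_one] f(2) by blast
  have "\<exists>Ys. set Ys \<subseteq> C \<and> word Ys f (mat 1) \<noteq> 0"
  proof (rule word_reduction[OF fR _ _ _ par_sub[OF Q0_roots] CL _ Xs])
    show "lie_algebra B \<subseteq> L" using LB(1) by blast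
    show "\<exists>d. word (Y # Ys) f (mat 1) = d * word Ys f (mat 1)" if "Y \<in> lie_algebra B" "set Ys \<subseteq> L" for Y Ys
      using left_eigen_value(1)[OF left_eigen_word[OF f(1) that(2)] that(1) K_one] by (intro exI[of _ "- l Y"]) simp
    show "\<exists>d. D Z f = fscale d f" if "Z \<in> par Q0" for Z
      by (rule right_eigen_par[OF fR r Q0_roots that])
    show "\<exists>Y\<in>lie_algebra B. \<exists>Z\<in>par Q0. \<exists>W\<in>cm.span C. X = Y + W + Z" if "X \<in> L" for X
      by (rule span_sum3[OF lie_algebra_subspace]) (use dec that in \<open>auto simp: par_def\<close>)
  qed
  then obtain Ys where Ys: "set Ys \<subseteq> C" "word Ys f (mat 1) \<noteq> 0" by blast
  have YL: "set Ys \<subseteq> L" using Ys(1) CL by blast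
  have "D x f = fscale (c x) f"
    using r x(1) by (simp add: right_eigen_def)
  then have "D x (word Ys f) = fscale (c x + sum_list (map wgt Ys)) (word Ys f)"
    by (rule word_weight[OF fR t_L[OF x(1)] _ YL]) (use wgt Ys(1) in blast)
  moreover have "D x (word Ys f) (mat 1) = - l x * word Ys f (mat 1)"
    using left_eigen_value(1)[OF left_eigen_word[OF f(1) YL] tB[OF x(1)] K_one] by simp
  ultimately have "(c x + sum_list (map wgt Ys)) * word Ys f (mat 1) = - l x * word Ys f (mat 1)"
    by simp
  then have e: "- l x = c x + sum_list (map wgt Ys)"
    using Ys(2) by (metis mult_right_cancel)
  have "\<exists>k. wgt X = - of_nat k" for X
    by (auto simp: wgt_def intro: exI[of _ 0] exI[of _ 1])
  then obtain k where k: "sum_list (map wgt Ys) = - of_nat k"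
    using sum_list_neg_nat by blast
  have lx: "l x = l (hh (1, 0)) + l (hh (0, 1))"
  proof -
    have "l x = l (cscale (2 * ev (1, 0) x + ev (0, 1) x) (hh (1, 0)) + cscale (3 * ev (1, 0) x + 2 * ev (0, 1) x) (hh (0, 1)))"
      by (rule arg_cong[OF t_coords[OF x(1)]])
    then show ?thesis
      by (simp only: l) (simp add: x)
  qed
  have "c x = - of_nat n"
    using n[OF x(1)] ev_pair[of 2 1 x] x by simp
  with e k lx have "l (hh (1, 0)) + l (hh (0, 1)) = of_nat (n + k)"
    by (simp add: algebra_simps)
  then show ?thesis by blast
qed

text \<open>The cubic polynomial in \<open>z\<close> on the right solves the differential equation of the
  conjugates.\<close>

lemma conj_mexp_expand:
  assumes y: "lie_bracket X y0 = y1" "lie_bracket X y1 = y2" "lie_bracket X y2 = y3" "lie_bracket X y3 = 0"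
  shows "mexp (- X) ** y0 ** mexp X = y0 - y1 + cscale (1/2) y2 - cscale (1/6) y3"
proof -
  define Q where "Q z = y0 + cscale (- z) y1 + cscale (z\<^sup>2 / 2) y2 + cscale (- (z ^ 3) / 6) y3" for z :: complex
  have "mderiv Q (- X ** Q z - Q z ** - X) z" for z
  proof (rule mderiv_eq)
    show "mderiv Q (cscale (- 1) y1 + cscale z y2 + cscale (- z\<^sup>2 / 2) y3) z"
      unfolding mderiv_def Q_def
      by (auto intro!: derivative_eq_intros simp: power2_eq_square)
    have "- X ** Q z - Q z ** - X = - lie_bracket X (Q z)"
      by (simp add: lie_bracket_def matrix_distribs)
    also have "lie_bracket X (Q z) = y1 + cscale (- z) y2 + cscale (z\<^sup>2 / 2) y3"
      unfolding Q_def lie_bracket_lin y by simp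
    finally show "cscale (- 1) y1 + cscale z y2 + cscale (- z\<^sup>2 / 2) y3 = - X ** Q z - Q z ** - X"
      by (simp add: vec_eq_iff algebra_simps)
  qed
  from mexp_conj_unique[OF this, of 1] show ?thesis
    by (simp add: Q_def vec_eq_iff algebra_simps)
qed

text \<open>Expansion at the exponential of a root vector \<open>X\<close> of \<open>-(2a\<^sub>1 + a\<^sub>2)\<close>.  This point is generic: the strings
  of \<open>X\<close> through \<open>3a\<^sub>1 + a\<^sub>2\<close> and \<open>3a\<^sub>1 + 2a\<^sub>2\<close> show that \<open>Ad(exp(-X)) \<bb> + \<hh>\<close> is everything.  As \<open>X\<close> commutes
  with the coroot of \<open>a\<^sub>2\<close>, that coroot still acts by its weight.\<close>

lemma upper_bound_2:
  assumes f: "left_eigen l f" "f \<noteq> 0" and r: "right_eigen Q0 c f"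
    and t5: "triple (3, 1) e5 f5 (hh (3, 1))" and i: "\<And>i. i > n \<Longrightarrow> (D e5 ^^ i) f = 0"
    and c2: "c (hh (0, 1)) = 0"
  shows "\<exists>i j. i \<le> n \<and> l (hh (0, 1)) + of_nat j = of_nat i"
proof -
  have fR: "f \<in> R" using f(1) by (simp add: left_eigen_def)
  have rt: "(2, 1) \<in> G2_roots" "(3, 1) \<in> G2_roots" "(3, 2) \<in> G2_roots" "(0, 1) \<in> G2_roots" "(1, 0) \<in> G2_roots" "(1, 1) \<in> G2_roots"
    "(- 1, - 1) \<in> G2_roots" "(- 1, 0) \<in> G2_roots" "(- 2, - 1) \<in> G2_roots"
    by (simp_all add: G2_defs)
  obtain e4 X where t4: "triple (2, 1) e4 X (hh (2, 1))"
    using hh_triple[OF rt(1)] by blast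
  obtain e6 f6 where t6: "triple (3, 2) e6 f6 (hh (3, 2))"
    using hh_triple[OF rt(3)] by blast
  note t4' = tripleD[OF t4] and t5' = tripleD[OF t5] and t6' = tripleD[OF t6]
  have X: "X \<in> rs (- 2, - 1)" using t4'(2) by simp
  have h2: "hh (0, 1) \<in> \<tt>" by (rule hh_t[OF rt(4)])
  define g where "g = mexp X"
  have g: "g \<in> G" "matrix_inv g = mexp (- X)"
    unfolding g_def using K_mexp(2)[OF t4'(11)] by simp_all
  define Ad where "Ad Y = matrix_inv g ** Y ** g" for Y
  have Ad_expand: "Ad y0 = y0 - y1 + cscale (1/2) y2 - cscale (1/6) y3"
    if "lie_bracket X y0 = y1" "lie_bracket X y1 = y2" "lie_bracket X y2 = y3" "lie_bracket X y3 = 0" for y0 y1 y2 y3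
    unfolding Ad_def g(2) unfolding g_def by (rule conj_mexp_expand[OF that])
  define a where "a = Ad ` lie_algebra B"
  define C where "C = {e5, e6}"
  define V where "V = cm.span (a \<union> (C \<union> par Q0))"
  have aV: "Ad Y \<in> V" if "Y \<in> lie_algebra B" for Y
    unfolding V_def a_def by (rule cm.span_base) (use that in blast)
  have CV: "e5 \<in> V" "e6 \<in> V"
    unfolding V_def C_def by (simp_all add: cm.span_base)
  have QV: "rs q \<subseteq> V" if "q \<in> insert 0 Q0" for q
  proof -
    have "rs q \<subseteq> par Q0"
      by (rule par_base[OF that])
    then show ?thesis
      unfolding V_def using cm.span_superset[of "a \<union> (C \<union> par Q0)"] by (meson Un_subset_iff subset_trans)
  qed
  have tV: "x \<in> V" if "x \<in> \<tt>" for x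
    using QV[of 0] that by (auto simp: rs_0)
  have Vadd: "A + A' \<in> V" and Vdiff: "A - A' \<in> V" and Vsc: "cscale k A \<in> V" if "A \<in> V" "A' \<in> V" for A A' k
    using that unfolding V_def by (auto intro: cm.span_add cm.span_diff cm.span_scale)
  have VX: "X \<in> V"
  proof -
    have "lie_bracket X (hh (2, 1)) = cscale 2 X"
      using lie_bracket_swap[of X "hh (2, 1)"] t4'(9) by simp
    then have "Ad (hh (2, 1)) = hh (2, 1) - cscale 2 X + cscale (1/2) 0 - cscale (1/6) 0"
      by (rule Ad_expand) (simp_all add: lie_bracket_lin)
    then have "cscale 2 X = hh (2, 1) - Ad (hh (2, 1))"
      by simp
    also have "\<dots> \<in> V"
      by (rule Vdiff[OF tV[OF t4'(3)] aV[OF tB[OF t4'(3)]]])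
    finally have "cscale (1/2) (cscale 2 X) \<in> V"
      using Vsc by blast
    then show ?thesis by simp
  qed
  have Ve4: "e4 \<in> V"
  proof -
    define y1 where "y1 = lie_bracket X e4"
    have y1: "y1 = - hh (2, 1)"
      using lie_bracket_swap[of X e4] t4'(4) by (simp add: y1_def)
    have y2: "lie_bracket X y1 = cscale (- 2) X"
      using lie_bracket_swap[of X "hh (2, 1)"] t4'(9) by (simp add: y1 lie_bracket_lin)
    have "Ad e4 = e4 - y1 + cscale (1/2) (cscale (- 2) X) - cscale (1/6) 0"
      by (rule Ad_expand[OF y1_def[symmetric] y2]) (simp_all add: lie_bracket_lin)
    then have "e4 = Ad e4 - hh (2, 1) + X"
      by (simp add: y1)
    moreover have "e4 \<in> lie_algebra B"
      by (rule rsB[OF rt(1) _ _ t4'(1)]) simp_all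
    ultimately show ?thesis
      using Vadd[OF Vdiff[OF aV tV[OF t4'(3)]] VX] by metis
  qed
  have string: "rs (q1, q2) \<subseteq> V \<and> rs (q1 - 2, q2 - 1) \<subseteq> V"
    if y0: "y0 \<in> rs (q1 + 2, q2 + 1)" "y0 \<noteq> 0" "y0 \<in> V" "y0 \<in> lie_algebra B"
      and q: "(q1 + 2, q2 + 1) \<in> G2_roots" "(q1, q2) \<in> G2_roots" "0 \<le> q1" "0 \<le> q2" "(q1 - 2, q2 - 1) \<in> G2_roots"
        "(q1 - 4, q2 - 2) \<in> neg_long" "(q1 + 4, q2 + 2) \<notin> insert 0 G2_roots" "(q1 - 6, q2 - 3) \<notin> insert 0 G2_roots"
    for y0 q1 q2
  proof -
    note ts = triple_swap[OF t4]
    have top: "(q1 + 2, q2 + 1) - - (2, 1) \<notin> insert 0 G2_roots"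
      "(q1 + 2, q2 + 1) + (int (Suc 3) * fst (- (2, 1)), int (Suc 3) * snd (- (2, 1))) \<notin> insert 0 G2_roots"
      "(q1 + 2, q2 + 1) + (int 3 * fst (- (2, 1)), int 3 * snd (- (2, 1))) \<in> G2_roots"
      using q(6-8) by (simp_all add: algebra_simps) (auto simp: neg_long_def G2_defs)
    have ev: "ev (q1 + 2, q2 + 1) (- hh (2, 1)) = - of_nat 3"
      by (rule cartan_integer[OF ts q(1) top(3,1,2)])
    obtain m where m: "ev (q1 + 2, q2 + 1) (- hh (2, 1)) = - of_nat m" "\<forall>i\<le>m. (lie_bracket X ^^ i) y0 \<noteq> 0"
      using string_lowest[OF ts y0(1,2) _ _ top(2)] top(1) by blast
    have m3: "m = 3"
      using ev m(1) by (metis neg_equal_iff_equal of_nat_eq_iff)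
    define y1 where "y1 = lie_bracket X y0"
    define y2 where "y2 = lie_bracket X y1"
    define y3 where "y3 = lie_bracket X y2"
    have nz: "y1 \<noteq> 0" "y2 \<noteq> 0"
      using m(2)[rule_format, of 1] m(2)[rule_format, of 2] m3 by (simp_all add: y1_def y2_def numeral_2_eq_2)
    have y: "y1 \<in> rs (q1, q2)" "y2 \<in> rs (q1 - 2, q2 - 1)" "y3 \<in> rs (q1 - 4, q2 - 2)" "lie_bracket X y3 \<in> rs (q1 - 6, q2 - 3)"
    proof -
      show a: "y1 \<in> rs (q1, q2)"
        using rs_bracket[OF X y0(1)] by (simp add: y1_def)
      show b: "y2 \<in> rs (q1 - 2, q2 - 1)"
        using rs_bracket[OF X a] by (simp add: y2_def)
      show c: "y3 \<in> rs (q1 - 4, q2 - 2)"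
        using rs_bracket[OF X b] by (simp add: y3_def algebra_simps)
      show "lie_bracket X y3 \<in> rs (q1 - 6, q2 - 3)"
        using rs_bracket[OF X c] by (simp add: algebra_simps)
    qed
    have y4: "lie_bracket X y3 = 0"
      by (rule rs_nonroot[OF _ _ y(4)]) (use q(8) in auto)
    have y3V: "y3 \<in> V"
      using QV[of "(q1 - 4, q2 - 2)"] q(6) y(3) by (auto simp: Q0_def)
    have A0: "Ad y0 = y0 - y1 + cscale (1/2) y2 - cscale (1/6) y3"
      by (rule Ad_expand[OF y1_def[symmetric] y2_def[symmetric] y3_def[symmetric] y4])
    have A1: "Ad y1 = y1 - y2 + cscale (1/2) y3 - cscale (1/6) 0"
      by (rule Ad_expand[OF y2_def[symmetric] y3_def[symmetric] y4]) (simp add: lie_bracket_lin)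
    have y1B: "y1 \<in> lie_algebra B"
      by (rule rsB[OF q(2) _ _ y(1)]) (use q in simp_all)
    have "cscale (- 2) ((Ad y0 - y0 + cscale (1/6) y3) + (Ad y1 - cscale (1/2) y3)) = y2"
      unfolding A0 A1 by (simp add: vec_eq_iff algebra_simps)
    moreover have "(Ad y0 - y0 + cscale (1/6) y3) + (Ad y1 - cscale (1/2) y3) \<in> V"
      by (intro Vadd Vdiff Vsc[OF y3V y3V] aV y0(3,4) y1B)
    ultimately have y2V: "y2 \<in> V"
      using Vsc by metis
    have "y1 = Ad y1 + y2 - cscale (1/2) y3"
      unfolding A1 by (simp add: vec_eq_iff)
    moreover have "Ad y1 + y2 - cscale (1/2) y3 \<in> V"
      by (intro Vadd Vdiff Vsc[OF y3V y3V] aV y2V y1B)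
    ultimately have y1V: "y1 \<in> V" by simp
    show ?thesis
      using rs_subset_span[OF q(2) y(1) nz(1) y1V[unfolded V_def]] rs_subset_span[OF q(5) y(2) nz(2) y2V[unfolded V_def]]
      by (simp add: V_def)
  qed
  have s1: "rs (1, 0) \<subseteq> V \<and> rs (- 1, - 1) \<subseteq> V"
    using string[of e5 1 0] t5'(1,6) CV(1) rsB[OF rt(2) _ _ t5'(1)] by (simp add: G2_defs neg_long_def zero_prod_def)
  have s2: "rs (1, 1) \<subseteq> V \<and> rs (- 1, 0) \<subseteq> V"
    using string[of e6 1 1] t6'(1,6) CV(2) rsB[OF rt(3) _ _ t6'(1)] by (simp add: G2_defs neg_long_def zero_prod_def)
  have dec: "L \<subseteq> V"
    unfolding V_def
  proof (rule L_subset_span, unfold V_def[symmetric])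
    fix p :: "int \<times> int" assume p: "p \<in> insert 0 G2_roots"
    have "rs (3, 1) \<subseteq> V" "rs (3, 2) \<subseteq> V" "rs (2, 1) \<subseteq> V" "rs (- 2, - 1) \<subseteq> V"
      using rs_subset_span[OF rt(2) t5'(1,6) CV(1)[unfolded V_def]] rs_subset_span[OF rt(3) t6'(1,6) CV(2)[unfolded V_def]]
        rs_subset_span[OF rt(1) t4'(1,6) Ve4[unfolded V_def]] rs_subset_span[OF rt(9) X t4'(7) VX[unfolded V_def]]
      by (simp_all add: V_def)
    moreover have "p \<in> insert 0 Q0 \<union> {(3, 1), (3, 2), (2, 1), (- 2, - 1), (1, 0), (1, 1), (- 1, 0), (- 1, - 1)}"
      using p by (auto simp: G2_defs Q0_def neg_long_def)
    ultimately show "rs p \<subseteq> V"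
      using s1 s2 QV[of p] by auto
  qed
  have aL: "a \<subseteq> L"
    unfolding a_def Ad_def using left_eigen_value(2)[OF f(1) _ g(1)] by blast
  have asub: "cm.subspace a"
  proof (rule cm.subspaceI)
    show "0 \<in> a"
      unfolding a_def by (rule image_eqI[of _ _ 0]) (simp_all add: Ad_def lie_algebra_0)
    show "A + A' \<in> a" if "A \<in> a" "A' \<in> a" for A A'
      using that unfolding a_def by (auto simp: Ad_def matrix_distribs[symmetric] intro!: imageI lie_algebra_add)
    show "cscale k A \<in> a" if "A \<in> a" for k A
    proof -
      obtain Y where "Y \<in> lie_algebra B" "A = Ad Y"
        using \<open>A \<in> a\<close> unfolding a_def by blast
      then have "cscale k A = Ad (cscale k Y)" "cscale k Y \<in> lie_algebra B"
        by (simp_all add: Ad_def lie_algebra_cscale)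
      then show ?thesis
        unfolding a_def by blast
    qed
  qed
  have CL: "C \<subseteq> L"
    using t5'(10) t6'(10) by (simp add: C_def)
  obtain Xs where Xs: "set Xs \<subseteq> L" "word Xs f g \<noteq> 0"
    using words_determine[OF fR g(1)] f(2) by blast
  have "\<exists>Ys. set Ys \<subseteq> C \<and> word Ys f g \<noteq> 0"
  proof (rule word_reduction[OF fR _ _ aL par_sub[OF Q0_roots] CL _ Xs])
    show "\<exists>d. word (Y # Ys) f g = d * word Ys f g" if "Y \<in> a" "set Ys \<subseteq> L" for Y Ys
    proof -
      obtain Y' where Y': "Y' \<in> lie_algebra B" "Y = matrix_inv g ** Y' ** g"
        using \<open>Y \<in> a\<close> unfolding a_def Ad_def by blast
      show ?thesis
        using left_eigen_value(1)[OF left_eigen_word[OF f(1) that(2)] Y'(1) g(1)] Y'(2) by (intro exI[of _ "- l Y'"]) simp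
    qed
    show "\<exists>d. D Z f = fscale d f" if "Z \<in> par Q0" for Z
      by (rule right_eigen_par[OF fR r Q0_roots that])
    show "\<exists>Y\<in>a. \<exists>Z\<in>par Q0. \<exists>W\<in>cm.span C. X = Y + W + Z" if "X \<in> L" for X
      by (rule span_sum3[OF asub]) (use dec that in \<open>auto simp: par_def V_def\<close>)
  qed
  then obtain Ys where Ys: "set Ys \<subseteq> C" "word Ys f g \<noteq> 0" by blast
  have b5: "lie_bracket (hh (0, 1)) e5 = cscale (- 1) e5"
    using rsD(2)[OF t5'(1) h2] ev_pair[of 3 1 "hh (0, 1)"] by (simp add: ev_hh)
  have b6: "lie_bracket (hh (0, 1)) e6 = cscale 1 e6"
    using rsD(2)[OF t6'(1) h2] ev_pair[of 3 2 "hh (0, 1)"] by (simp add: ev_hh)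
  have comm: "D e5 (D e6 v) = D e6 (D e5 v)" if "v \<in> R" for v
  proof -
    have "lie_bracket e5 e6 = 0"
      by (rule rs_nonroot[OF _ _ rs_bracket[OF t5'(1) t6'(1)]]) (auto simp: G2_defs zero_prod_def)
    then show ?thesis
      using rder_commutator[OF that t5'(10) t6'(10)] rder_lin(2)[OF that lie_algebra_0 lie_algebra_0, of 0] by simp
  qed
  have "\<exists>i j. word Ys f = (D e6 ^^ j) ((D e5 ^^ i) f) \<and> D (hh (0, 1)) (word Ys f) = fscale (of_nat j - of_nat i) (word Ys f)"
    if "set Ys \<subseteq> C" for Ys
    using that
  proof (induction Ys)
    case Nil
    have "D (hh (0, 1)) f = fscale 0 f"
      using r h2 c2 by (simp add: right_eigen_def)
    then show ?case
      by (intro exI[of _ 0]) simp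
  next
    case (Cons Y Ys)
    then have "set Ys \<subseteq> C" by simp
    from Cons.IH[OF this] obtain i j where ij: "word Ys f = (D e6 ^^ j) ((D e5 ^^ i) f)"
      "D (hh (0, 1)) (word Ys f) = fscale (of_nat j - of_nat i) (word Ys f)" by blast
    have wR: "word Ys f \<in> R"
      by (rule word_closed[OF fR]) (use Cons.prems CL in auto)
    have hL: "hh (0, 1) \<in> L" by (rule t_L[OF h2])
    have step: "D (hh (0, 1)) (D Y (word Ys f)) = fscale (of_nat j - of_nat i + d) (D Y (word Ys f))"
      if "Y \<in> L" "lie_bracket (hh (0, 1)) Y = cscale d Y" for d
    proof -
      have "D (hh (0, 1)) (D Y (word Ys f)) = D Y (fscale (of_nat j - of_nat i) (word Ys f)) + D (cscale d Y) (word Ys f)"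
        using rder_commutator[OF wR hL that(1)] that(2) ij(2) by simp
      then show ?thesis
        using rder_fscale[OF wR that(1)] rder_lin(2)[OF wR that(1,1), of d] by (simp add: fs.scale_left_distrib)
    qed
    have "Y = e5 \<or> Y = e6" using Cons.prems by (auto simp: C_def)
    then show ?case
    proof
      assume Y: "Y = e5"
      have cp: "D e5 ((D e6 ^^ k) v) = (D e6 ^^ k) (D e5 v)" if "v \<in> R" for k v
      proof (induction k)
        case (Suc k)
        have "(D e6 ^^ k) v \<in> R"
          unfolding funpow_word by (rule word_closed[OF that]) (use t6'(10) in auto)
        then show ?case
          using Suc comm by simp
      qed simp
      have "(D e5 ^^ i) f \<in> R"
        unfolding funpow_word by (rule word_closed[OF fR]) (use t5'(10) in auto)
      then have "word (Y # Ys) f = (D e6 ^^ j) ((D e5 ^^ Suc i) f)"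
        using cp by (simp add: Y ij(1))
      moreover have "D (hh (0, 1)) (word (Y # Ys) f) = fscale (of_nat j - of_nat (Suc i)) (word (Y # Ys) f)"
        using step[of "- 1"] t5'(10) b5 Y by (simp add: algebra_simps)
      ultimately show ?thesis by blast
    next
      assume Y: "Y = e6"
      have "word (Y # Ys) f = (D e6 ^^ Suc j) ((D e5 ^^ i) f)"
        by (simp add: Y ij(1))
      moreover have "D (hh (0, 1)) (word (Y # Ys) f) = fscale (of_nat (Suc j) - of_nat i) (word (Y # Ys) f)"
        using step[of 1] t6'(10) b6 Y by (simp add: algebra_simps)
      ultimately show ?thesis by blast
    qed
  qed
  from this[OF Ys(1)] obtain i j where ij: "word Ys f = (D e6 ^^ j) ((D e5 ^^ i) f)"
    "D (hh (0, 1)) (word Ys f) = fscale (of_nat j - of_nat i) (word Ys f)" by blast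
  have "i \<le> n"
  proof (rule ccontr)
    assume "\<not> i \<le> n"
    then have "word Ys f = (D e6 ^^ j) 0"
      using i ij(1) by simp
    also have "(D e6 ^^ j) 0 = 0"
      unfolding funpow_word by (rule word_0) (use t6'(10) in auto)
    finally show False
      using Ys(2) by simp
  qed
  moreover have "l (hh (0, 1)) + of_nat j = of_nat i"
  proof -
    have "lie_bracket X (hh (0, 1)) = 0"
      using lie_bracket_swap[of X "hh (0, 1)"] rsD(2)[OF X h2] ev_pair[of "- 2" "- 1" "hh (0, 1)"] by (simp add: ev_hh)
    then have "Ad (hh (0, 1)) = hh (0, 1) - 0 + cscale (1/2) 0 - cscale (1/6) 0"
      by (rule Ad_expand) (simp_all add: lie_bracket_lin)
    then have "matrix_inv g ** hh (0, 1) ** g = hh (0, 1)"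
      by (simp add: Ad_def)
    then have "D (hh (0, 1)) (word Ys f) g = - l (hh (0, 1)) * word Ys f g"
      using left_eigen_value(1)[OF left_eigen_word[OF f(1)] tB[OF h2] g(1), of Ys] Ys(1) CL by auto
    then have "- l (hh (0, 1)) * word Ys f g = (of_nat j - of_nat i) * word Ys f g"
      using ij(2) by simp
    then have "- l (hh (0, 1)) = of_nat j - of_nat i"
      using Ys(2) by (metis mult_right_cancel)
    then show ?thesis
      by (metis add.commute add_diff_cancel_left' diff_add_cancel diff_minus_eq_add minus_diff_eq)
  qed
  ultimately show ?thesis by blast
qed

lemma upper_bound:
  assumes f: "left_eigen l f" "f \<noteq> 0" and r: "right_eigen Q0 c f"
    and l: "\<And>a b. l (cscale a (hh (1, 0)) + cscale b (hh (0, 1))) = a * l (hh (1, 0)) + b * l (hh (0, 1))"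
  shows "\<exists>a b n. l (hh (1, 0)) = of_nat a \<and> l (hh (0, 1)) = of_nat b \<and> (\<forall>x\<in>\<tt>. c x = - of_nat n * ev (2, 1) x) \<and>
    b \<le> n \<and> n \<le> a + b"
proof -
  have fR: "f \<in> R" using f(1) by (simp add: left_eigen_def)
  obtain a where a: "l (hh (1, 0)) = of_nat a"
    using left_eigen_dominant[OF f, of "(1, 0)"] by blast
  obtain b where b: "l (hh (0, 1)) = of_nat b"
    using left_eigen_dominant[OF f, of "(0, 1)"] by blast
  have rt: "(3, 1) \<in> G2_roots" "(0, 1) \<in> G2_roots"
    by (simp_all add: G2_defs)
  obtain e5 f5 where t: "triple (3, 1) e5 f5 (hh (3, 1))"
    using hh_triple[OF rt(1)] by blast
  obtain n where n: "\<And>x. x \<in> \<tt> \<Longrightarrow> c x = - of_nat n * ev (2, 1) x" "\<And>i. i > n \<Longrightarrow> (D e5 ^^ i) f = 0"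
    using right_weight[OF fR f(2) r t] by blast
  have "c (hh (0, 1)) = 0"
    using n(1)[OF hh_t[OF rt(2)]] ev_pair[of 2 1 "hh (0, 1)"] by (simp add: ev_hh)
  then obtain i j where ij: "i \<le> n" "of_nat b + of_nat j = (of_nat i :: complex)"
    using upper_bound_2[OF f r t, of n] n(2) b by metis
  obtain k where k: "of_nat a + of_nat b = (of_nat (n + k) :: complex)"
    using upper_bound_1[OF f r l n(1)] a b by auto
  have "b + j = i" "a + b = n + k"
    using ij(2) k by (metis of_nat_add of_nat_eq_iff)+
  with ij(1) a b n(1) show ?thesis by fastforce
qed

text \<open>The reflection in \<open>a\<^sub>1\<close> normalises \<open>H\<close> and exchanges its two simple roots.\<close>

definition s1 :: "int \<times> int \<Rightarrow> int \<times> int" where "s1 p = (3 * snd p - fst p, snd p)"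

lemma right_translate:
  assumes f: "left_eigen l f" "f \<noteq> 0" and r: "right_eigen Q c f" and Q': "\<And>q. q \<in> Q' \<Longrightarrow> s1 q \<in> Q"
  shows "\<exists>f'. left_eigen l f' \<and> f' \<noteq> 0 \<and> right_eigen Q' (\<lambda>x. c (x - cscale (ev (1, 0) x) (hh (1, 0)))) f'"
proof -
  have fR: "f \<in> R" using f(1) by (simp add: left_eigen_def)
  have "(1, 0) \<in> G2_roots" by (simp add: G2_defs)
  then obtain e1 f1 where t: "triple (1, 0) e1 f1 (hh (1, 0))"
    using hh_triple by blast
  note t' = tripleD[OF t]
  define s where "s = reflection e1 f1"
  have s: "s \<in> G" unfolding s_def by (rule reflection_mem[OF alg t'(10,11)])
  define f' where "f' = res G (\<lambda>A. f (A ** s))"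
  have f'R: "f' \<in> R"
    unfolding f'_def by (rule coord_ring_translate[OF fR s])
  have f'A: "f' A = f (A ** s)" if "A \<in> G" for A
    using that by (simp add: f'_def res_def)
  obtain g where g: "f g \<noteq> 0" "g \<in> G"
    using f(2) coord_ring_outside[OF fR] by (metis ext zero_fun_apply)
  have "f' (g ** matrix_inv s) = f g"
    using f'A[OF K_mult[OF g(2) K_minv[OF s]]] K_inv[OF s] by simp
  then have nz: "f' \<noteq> 0"
    using g(1) by auto
  have le: "left_eigen l f'"
    unfolding left_eigen_def
  proof (intro conjI ballI allI f'R)
    fix Y g z assume Y: "Y \<in> lie_algebra B" and g: "g \<in> G"
    have "f (mexp (cscale z Y) ** (g ** s)) = exp (- l Y * z) * f (g ** s)"
      using f(1) Y K_mult[OF g s] unfolding left_eigen_def by blast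
    then show "f' (mexp (cscale z Y) ** g) = exp (- l Y * z) * f' g"
      using f'A[OF g] f'A[OF K_mult[OF LB(2)[OF Y] g]] by (simp add: matrix_mul_assoc)
  qed
  have Df': "D X f' A = D (matrix_inv s ** X ** s) f (A ** s)" if X: "X \<in> L" and A: "A \<in> G" for X A
  proof -
    have L: "matrix_inv s ** X ** s \<in> L"
      using lie_algebra_Ad[OF alg K_minv[OF s] X] K_inv[OF s] by simp
    have mem: "A ** mexp (cscale w X) ** s \<in> G" for w
      using A K_mexp(1)[OF X] s K_mult by blast
    have "mderiv (\<lambda>w. A ** mexp (cscale w X) ** s) (A ** X ** s) 0"
      using mderiv_mult[OF mderiv_mexp_right[of A X 0] mderiv_const[of s]] by simp
    moreover have "A ** X ** s = A ** mexp (cscale 0 X) ** s ** (matrix_inv s ** X ** s)"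
      using K_inv[OF s] by (simp add: matrix_mul_assoc)
    ultimately have "((\<lambda>w. f (A ** mexp (cscale w X) ** s)) has_field_derivative
        D (matrix_inv s ** X ** s) f (A ** mexp (cscale 0 X) ** s)) (at 0)"
      by (intro rder_curve_general[OF fR L mem]) simp
    moreover have "f' (A ** mexp (cscale w X)) = f (A ** mexp (cscale w X) ** s)" for w
      by (rule f'A) (use A K_mexp(1)[OF X] K_mult in blast)
    ultimately have "((\<lambda>w. f' (A ** mexp (cscale w X))) has_field_derivative D (matrix_inv s ** X ** s) f (A ** s)) (at 0)"
      by simp
    then show ?thesis
      by (rule rder_unique[OF f'R X A])
  qed
  have conj: "matrix_inv s ** X ** s \<in> rs (s1 q)" if X: "X \<in> rs q" for X q
  proof -
    have inv: "invertible s" by (rule K_inv[OF s])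
    have "lie_bracket x (matrix_inv s ** X ** s) = cscale (ev (s1 q) x) (matrix_inv s ** X ** s)" if x: "x \<in> \<tt>" for x
    proof -
      have y: "x - cscale (ev (1, 0) x) (hh (1, 0)) \<in> \<tt>"
        by (intro lie_algebra_diff lie_algebra_cscale x t'(3))
      have "lie_bracket x (matrix_inv s ** X ** s) = matrix_inv s ** lie_bracket (s ** x ** matrix_inv s) X ** s"
        using conj_bracket[of "matrix_inv s" x X] inv by simp
      also have "s ** x ** matrix_inv s = x - cscale (ev (1, 0) x) (hh (1, 0))"
        unfolding s_def by (rule reflection_t(1)[OF t x])
      also have "lie_bracket (x - cscale (ev (1, 0) x) (hh (1, 0))) X = cscale (ev q (x - cscale (ev (1, 0) x) (hh (1, 0)))) X"
        by (rule rsD(2)[OF X y])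
      also have "ev q (x - cscale (ev (1, 0) x) (hh (1, 0))) = ev q x - ev (1, 0) x * ev q (hh (1, 0))"
        using x t'(3) by (simp add: ev_lin lie_algebra_cscale)
      also have "\<dots> = ev (s1 q) x"
      proof -
        have q: "ev q y = of_int (fst q) * ev (1, 0) y + of_int (snd q) * ev (0, 1) y" for y
          using ev_pair[of "fst q" "snd q" y] by simp
        have s: "ev (s1 q) x = of_int (3 * snd q - fst q) * ev (1, 0) x + of_int (snd q) * ev (0, 1) x"
          unfolding s1_def by (rule ev_pair)
        show ?thesis
          unfolding q[of x] q[of "hh (1, 0)"] s ev_hh by (simp add: algebra_simps)
      qed
      finally show ?thesis by simp
    qed
    moreover have "matrix_inv s ** X ** s \<in> L"
      using lie_algebra_Ad[OF alg K_minv[OF s] rsD(1)[OF X]] inv by simp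
    ultimately show ?thesis by (simp add: rs_def)
  qed
  have "right_eigen Q' (\<lambda>x. c (x - cscale (ev (1, 0) x) (hh (1, 0)))) f'"
    unfolding right_eigen_def
  proof (intro conjI ballI)
    fix q X assume q: "q \<in> Q'" "X \<in> rs q"
    have z: "D (matrix_inv s ** X ** s) f = 0"
      using r Q'[OF q(1)] conj[OF q(2)] unfolding right_eigen_def by blast
    show "D X f' = 0"
      by (rule coord_ring_eqI[OF rder_closed[OF f'R rsD(1)[OF q(2)]] coord_ring_0])
        (simp add: Df'[OF rsD(1)[OF q(2)]] z)
  next
    fix x assume x: "x \<in> \<tt>"
    let ?y = "x - cscale (ev (1, 0) x) (hh (1, 0))"
    have y: "?y \<in> \<tt>"
      by (intro lie_algebra_diff lie_algebra_cscale x t'(3))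
    have e: "D (matrix_inv s ** x ** s) f = fscale (c ?y) f"
      using r y reflection_t(2)[OF t x] unfolding right_eigen_def s_def by simp
    show "D x f' = fscale (c ?y) f'"
    proof (rule coord_ring_eqI[OF rder_closed[OF f'R t_L[OF x]] coord_ring_fscale[OF f'R]])
      fix A assume A: "A \<in> G"
      show "D x f' A = fscale (c ?y) f' A"
        using Df'[OF t_L[OF x] A] e f'A[OF A] by simp
    qed
  qed
  with le nz show ?thesis by blast
qed

end

section \<open>Semi-invariant functions: existence\<close>

lemma DERIV_trace:
  assumes "mderiv \<gamma> X z"
  shows "((\<lambda>w. trace (\<gamma> w)) has_field_derivative trace X) (at z)"
  using assms unfolding mderiv_def trace_def by (intro DERIV_sum) auto

context g2_sl3
begin

lemma coord_ring_pointwise: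
  "f \<in> R \<Longrightarrow> g \<in> R \<Longrightarrow> (\<lambda>A. f A + g A) \<in> R" "f \<in> R \<Longrightarrow> g \<in> R \<Longrightarrow> (\<lambda>A. f A - g A) \<in> R"
  "f \<in> R \<Longrightarrow> (\<lambda>A. c * f A) \<in> R" "f \<in> R \<Longrightarrow> g \<in> R \<Longrightarrow> (\<lambda>A. f A * g A) \<in> R"
proof -
  show "(\<lambda>A. f A + g A) \<in> R" if "f \<in> R" "g \<in> R" for f g
    using coord_ring_add[OF that] by (simp add: plus_fun_def)
  show "(\<lambda>A. c * f A) \<in> R" if "f \<in> R" for f c
    using coord_ring_fscale[OF that, of c] by (simp add: fscale_def)
  show "(\<lambda>A. f A * g A) \<in> R" if "f \<in> R" "g \<in> R" for f g
    by (rule coord_ring_mult[OF that])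
  show "(\<lambda>A. f A - g A) \<in> R" if "f \<in> R" "g \<in> R" for f g
    using coord_ring_add[OF that(1) coord_ring_fscale[OF that(2), of "- 1"]] by (simp add: plus_fun_def fscale_def)
qed

lemma coord_ring_sum: "finite I \<Longrightarrow> (\<And>i. i \<in> I \<Longrightarrow> f i \<in> R) \<Longrightarrow> (\<lambda>A. \<Sum>i\<in>I. f i A) \<in> R"
proof (induction I rule: finite_induct)
  case empty
  then show ?case using coord_ring_0 by (simp add: zero_fun_def)
next
  case (insert i I)
  then show ?case by (simp add: coord_ring_pointwise(1))
qed

text \<open>Matrix coefficients of the adjoint representation; \<open>Lf h Z\<close> is \<open>Rf h Z\<close> composed with inversion.\<close>

definition Lf :: "complex^'n^'n \<Rightarrow> complex^'n^'n \<Rightarrow> complex^'n^'n \<Rightarrow> complex" where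
  "Lf h Z = res G (\<lambda>A. trace (Z ** matrix_inv A ** h ** A))"

definition Rf :: "complex^'n^'n \<Rightarrow> complex^'n^'n \<Rightarrow> complex^'n^'n \<Rightarrow> complex" where
  "Rf h Z = res G (\<lambda>A. trace (Z ** A ** h ** matrix_inv A))"

lemma Lf_R: "Lf h Z \<in> R"
proof -
  let ?u = "\<lambda>i k. res G (\<lambda>A. (Z ** A) $ i $ k)" and ?w = "\<lambda>k i. res G (\<lambda>A. (h ** A) $ k $ i)"
  have u: "?u i k \<in> R" for i k
    by (rule res_coord[OF matrix_poly_mult_left[OF matrix_poly.entry]])
  have w: "?w k i \<in> R" for i k
    by (rule res_coord[OF matrix_poly_mult_left[OF matrix_poly.entry]])
  have "Lf h Z = (\<lambda>A. \<Sum>i\<in>UNIV. \<Sum>k\<in>UNIV. res G (\<lambda>A. ?u i k (matrix_inv A)) A * ?w k i A)"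
  proof
    fix A
    show "Lf h Z A = (\<Sum>i\<in>UNIV. \<Sum>k\<in>UNIV. res G (\<lambda>A. ?u i k (matrix_inv A)) A * ?w k i A)"
    proof (cases "A \<in> G")
      case True
      have "trace (Z ** matrix_inv A ** h ** A) = trace ((Z ** matrix_inv A) ** (h ** A))"
        by (simp only: matrix_mul_assoc)
      also have "\<dots> = (\<Sum>i\<in>UNIV. \<Sum>k\<in>UNIV. (Z ** matrix_inv A) $ i $ k * (h ** A) $ k $ i)"
        by (simp only: trace_def mm_nth)
      finally show ?thesis
        using True K_minv[OF True] by (simp add: Lf_def res_def)
    qed (simp add: Lf_def res_def)
  qed
  also have "\<dots> \<in> R"
    by (intro coord_ring_sum coord_ring_pointwise coord_ring_inverse[OF u] w) auto
  finally show ?thesis .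
qed

lemma Rf_Lf: "Rf h Z = res G (\<lambda>A. Lf h Z (matrix_inv A))"
  using K_minv K_inv by (auto simp: fun_eq_iff Rf_def Lf_def res_def inv_cancel)

lemma Rf_R: "Rf h Z \<in> R"
  unfolding Rf_Lf by (rule coord_ring_inverse[OF Lf_R])

lemma rder_Lf:
  assumes Y: "Y \<in> L"
  shows "D Y (Lf h Z) = Lf h (lie_bracket Y Z)"
proof (rule coord_ring_eqI[OF rder_closed[OF Lf_R Y] Lf_R])
  fix A assume A: "A \<in> G"
  have m: "A ** mexp (cscale w Y) \<in> G" for w
    using A K_mexp(1)[OF Y] K_mult by blast
  have inv: "matrix_inv (A ** mexp (cscale w Y)) = mexp (cscale w (- Y)) ** matrix_inv A" for w
    using K_inv[OF A] by (simp add: matrix_inv_mult)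
  let ?\<gamma> = "\<lambda>w. Z ** (mexp (cscale w (- Y)) ** (matrix_inv A ** h ** A ** mexp (cscale w Y)))"
  let ?M = "matrix_inv A ** h ** A"
  have M: "mderiv ?\<gamma> (Z ** (- Y ** ?M + ?M ** Y)) 0"
  proof -
    have "mderiv (\<lambda>w. ?M ** mexp (cscale w Y)) (?M ** Y) 0"
      using mderiv_mult[OF mderiv_const[of ?M 0] mderiv_mexp_0[of Y]] by simp
    from mderiv_mult[OF mderiv_const[of Z 0] mderiv_mult[OF mderiv_mexp_0[of "- Y"] this]] show ?thesis
      by simp
  qed
  have tr: "trace (Z ** (- Y ** ?M + ?M ** Y)) = trace (lie_bracket Y Z ** ?M)"
  proof -
    have "trace (Z ** ?M ** Y) = trace (Y ** Z ** ?M)"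
      by (rule trace_mult3)
    moreover have "Z ** (- Y ** ?M + ?M ** Y) = Z ** ?M ** Y - Z ** Y ** ?M"
      by (simp add: matrix_distribs matrix_mul_assoc)
    moreover have "lie_bracket Y Z ** ?M = Y ** Z ** ?M - Z ** Y ** ?M"
      by (simp add: lie_bracket_def matrix_distribs matrix_mul_assoc)
    ultimately show ?thesis
      by (simp add: trace_sub)
  qed
  have "Lf h (lie_bracket Y Z) A = trace (lie_bracket Y Z ** ?M)"
    using A by (simp add: Lf_def res_def matrix_mul_assoc)
  then have "((\<lambda>w. trace (?\<gamma> w)) has_field_derivative Lf h (lie_bracket Y Z) A) (at 0)"
    using DERIV_trace[OF M] by (simp only: tr)
  moreover have "Lf h Z (A ** mexp (cscale w Y)) = trace (?\<gamma> w)" for w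
    using m[of w] unfolding Lf_def res_def inv by (simp add: matrix_mul_assoc)
  ultimately show "D Y (Lf h Z) A = Lf h (lie_bracket Y Z) A"
    by (intro rder_unique[OF Lf_R Y A]) simp
qed

lemma rder_Rf:
  assumes X: "X \<in> L"
  shows "D X (Rf h Z) = Rf (lie_bracket X h) Z"
proof (rule coord_ring_eqI[OF rder_closed[OF Rf_R X] Rf_R])
  fix A assume A: "A \<in> G"
  have m: "A ** mexp (cscale w X) \<in> G" for w
    using A K_mexp(1)[OF X] K_mult by blast
  have inv: "matrix_inv (A ** mexp (cscale w X)) = mexp (cscale w (- X)) ** matrix_inv A" for w
    using K_inv[OF A] by (simp add: matrix_inv_mult)
  let ?\<gamma> = "\<lambda>w. (Z ** A) ** (mexp (cscale w X) ** (h ** (mexp (cscale w (- X)) ** matrix_inv A)))"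
  have "mderiv ?\<gamma> ((Z ** A) ** (lie_bracket X h ** matrix_inv A)) 0"
  proof -
    have 1: "mderiv (\<lambda>w. h ** (mexp (cscale w (- X)) ** matrix_inv A)) (h ** (- X ** matrix_inv A)) 0"
      using mderiv_mult[OF mderiv_const[of h 0] mderiv_mult[OF mderiv_mexp_0[of "- X"] mderiv_const[of "matrix_inv A"]]] by simp
    show ?thesis
      by (rule mderiv_eq[OF mderiv_mult[OF mderiv_const[of "Z ** A" 0] mderiv_mult[OF mderiv_mexp_0[of X] 1]]])
        (simp add: lie_bracket_def matrix_distribs matrix_mul_assoc)
  qed
  then have "((\<lambda>w. trace (?\<gamma> w)) has_field_derivative Rf (lie_bracket X h) Z A) (at 0)"
    using DERIV_trace[of ?\<gamma>] A by (simp add: Rf_def res_def matrix_mul_assoc)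
  moreover have "Rf h Z (A ** mexp (cscale w X)) = trace (?\<gamma> w)" for w
    using m[of w] unfolding Rf_def res_def inv by (simp add: matrix_mul_assoc)
  ultimately show "D X (Rf h Z) A = Rf (lie_bracket X h) Z A"
    by (intro rder_unique[OF Rf_R X A]) simp
qed

lemma Lf_lin: "Lf h 0 A = 0" "Lf h (- Z) A = - Lf h Z A" "Lf h (cscale c Z) A = c * Lf h Z A"
  by (auto simp: Lf_def res_def matrix_distribs trace_def sum_negf sum_distrib_left)

lemma Rf_lin: "Rf 0 Z A = 0" "Rf (cscale c h) Z A = c * Rf h Z A"
  by (auto simp: Rf_def res_def matrix_distribs trace_def sum_distrib_left)

lemma Rf_1: "Rf h Z (mat 1) = trace (Z ** h)"
  using K_one by (simp add: Rf_def res_def)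

text \<open>Otherwise the coroot would vanish.\<close>

lemma trace_root_vectors:
  assumes p: "p \<in> G2_roots" and e: "e \<in> rs p" "e \<noteq> 0" and f: "f \<in> rs (- p)" "f \<noteq> 0"
  shows "trace (e ** f) \<noteq> 0"
proof -
  obtain e' f' where t: "triple p e' f' (hh p)"
    using hh_triple[OF p] by blast
  note t' = tripleD[OF t]
  have "trace (e' ** f') \<noteq> 0"
  proof
    assume "trace (e' ** f') = 0"
    then have "hh p = 0"
      using bracket_opposite(2)[OF t'(1,2,3)] bracket_opposite_eq_0[OF t'(1,2)] t'(4) by simp
    then show False
      using t'(5) ev_lin(2)[OF t'(3), of p 0] by simp
  qed
  moreover obtain c where "e = cscale c e'"
    using rs_prop[OF p t'(1,6) e(1)] by blast
  moreover obtain d where "f = cscale d f'"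
    using rs_prop[OF G2_minus[OF p] t'(2,7) f(1)] by blast
  ultimately show ?thesis
    using e(2) f(2) by (auto simp: matrix_distribs trace_cscale)
qed

subsection \<open>From highest weight vectors to semi-invariants\<close>

text \<open>The positive root spaces are generated by the simple ones.\<close>

lemma pos_root_induct:
  assumes e: "e1 \<in> rs (1, 0)" "e1 \<noteq> 0" "e2 \<in> rs (0, 1)" "e2 \<noteq> 0"
    and P: "P e1" "P e2" "\<And>X Y. X \<in> L \<Longrightarrow> Y \<in> L \<Longrightarrow> P X \<Longrightarrow> P Y \<Longrightarrow> P (lie_bracket X Y)" "\<And>c X. X \<in> L \<Longrightarrow> P X \<Longrightarrow> P (cscale c X)"
    and X: "X \<in> rs p" "p \<in> G2_roots" "0 \<le> fst p" "0 \<le> snd p"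
  shows "P X"
proof -
  define e3 where "e3 = lie_bracket e1 e2"
  define e4 where "e4 = lie_bracket e1 e3"
  define e5 where "e5 = lie_bracket e1 e4"
  define e6 where "e6 = lie_bracket e2 e5"
  have r3: "e3 \<in> rs (1, 1)" unfolding e3_def using rs_bracket[OF e(1,3)] by simp
  have r4: "e4 \<in> rs (2, 1)" unfolding e4_def using rs_bracket[OF e(1) r3] by simp
  have r5: "e5 \<in> rs (3, 1)" unfolding e5_def using rs_bracket[OF e(1) r4] by simp
  have r6: "e6 \<in> rs (3, 2)" unfolding e6_def using rs_bracket[OF e(3) r5] by simp
  have rt: "(1, 0) \<in> G2_roots" "(0, 1) \<in> G2_roots" by (simp_all add: G2_defs)
  obtain x1 y1 where t1: "triple (1, 0) x1 y1 (hh (1, 0))" using hh_triple[OF rt(1)] by blast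
  obtain x2 y2 where t2: "triple (0, 1) x2 y2 (hh (0, 1))" using hh_triple[OF rt(2)] by blast
  obtain c1 where c1: "x1 = cscale c1 e1" using rs_prop[OF rt(1) e(1,2) tripleD(1)[OF t1]] by blast
  obtain c2 where c2: "x2 = cscale c2 e2" using rs_prop[OF rt(2) e(3,4) tripleD(1)[OF t2]] by blast
  have s1: "\<forall>i\<le>3. (lie_bracket x1 ^^ i) e2 \<noteq> 0"
  proof -
    obtain n where n: "ev (0, 1) (hh (1, 0)) = - of_nat n" "\<forall>i\<le>n. (lie_bracket x1 ^^ i) e2 \<noteq> 0"
      using string_lowest[OF t1 e(3,4), of 3] by (auto simp: G2_defs zero_prod_def)
    have "of_nat n = (of_nat 3 :: complex)" using n(1) by (simp add: ev_hh)
    then have "n = 3" by (metis of_nat_eq_iff)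
    with n(2) show ?thesis by simp
  qed
  have "(lie_bracket x1 ^^ 3) e2 \<noteq> 0" using s1 by simp
  then have n5: "e5 \<noteq> 0"
    by (auto simp: numeral_3_eq_3 c1 lie_bracket_lin e5_def e4_def e3_def)
  then have n34: "e3 \<noteq> 0" "e4 \<noteq> 0"
    by (auto simp: e5_def e4_def lie_bracket_lin)
  have n6: "e6 \<noteq> 0"
  proof -
    obtain n where n: "ev (3, 1) (hh (0, 1)) = - of_nat n" "\<forall>i\<le>n. (lie_bracket x2 ^^ i) e5 \<noteq> 0"
      using string_lowest[OF t2 r5 n5, of 1] by (auto simp: G2_defs zero_prod_def)
    have "of_nat n = (of_nat 1 :: complex)" using n(1) ev_pair[of 3 1 "hh (0, 1)"] by (simp add: ev_hh)
    then have "n = 1" by (metis of_nat_eq_iff)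
    then have "lie_bracket x2 e5 \<noteq> 0" using n(2)[rule_format, of 1] by simp
    then show ?thesis by (auto simp: c2 lie_bracket_lin e6_def)
  qed
  note eL = rsD(1)[OF e(1)] rsD(1)[OF e(3)] rsD(1)[OF r3] rsD(1)[OF r4] rsD(1)[OF r5] rsD(1)[OF r6]
  have P3: "P e3" unfolding e3_def by (rule P(3)[OF eL(1,2) P(1,2)])
  have P4: "P e4" unfolding e4_def by (rule P(3)[OF eL(1,3) P(1) P3])
  have P5: "P e5" unfolding e5_def by (rule P(3)[OF eL(1,4) P(1) P4])
  have P6: "P e6" unfolding e6_def by (rule P(3)[OF eL(2,5) P(2) P5])
  have fin: "P X" if "Y \<in> rs p" "Y \<noteq> 0" "P Y" for Y
    using rs_prop[OF X(2) that(1,2) X(1)] P(4)[OF rsD(1)[OF that(1)] that(3)] by blast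
  have "p \<in> {(1, 0), (0, 1), (1, 1), (2, 1), (3, 1), (3, 2)}"
    using X by (auto simp: G2_defs)
  then show ?thesis
    using fin[of e1] fin[of e2] fin[of e3] fin[of e4] fin[of e5] fin[of e6] e P(1,2) r3 r4 r5 r6 n34 n5 n6 P3 P4 P5 P6 by auto
qed

text \<open>The simple root vectors generate the nilradical of the Lie algebra of \<open>B\<close>;
  inversion turns the right action of \<open>B\<close> into the left action.\<close>

lemma highest_vector_left_eigen:
  assumes e: "e1 \<in> rs (1, 0)" "e1 \<noteq> 0" "e2 \<in> rs (0, 1)" "e2 \<noteq> 0"
    and v: "v \<in> R" "v \<noteq> 0" "D e1 v = 0" "D e2 v = 0" and x: "\<And>x. x \<in> \<tt> \<Longrightarrow> D x v = fscale (ev w x) v"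
  shows "\<exists>l. left_eigen l (res G (\<lambda>A. v (matrix_inv A))) \<and> (\<forall>x\<in>\<tt>. l x = ev w x)"
proof -
  let ?Q = "{p \<in> G2_roots. 0 \<le> fst p \<and> 0 \<le> snd p}"
  have z: "D X v = 0" if p: "p \<in> ?Q" "X \<in> rs p" for p X
  proof (rule pos_root_induct[OF e, where P = "\<lambda>X. D X v = 0"])
    show "D (lie_bracket X Y) v = 0" if XY: "X \<in> L" "Y \<in> L" "D X v = 0" "D Y v = 0" for X Y
      using rder_commutator[OF v(1) XY(1,2)] XY by (simp add: rder_0)
    show "D (cscale c X) v = 0" if "X \<in> L" "D X v = 0" for c X
      using rder_lin(2)[OF v(1) that(1,1), of c] that(2) by (simp add: fun_eq_iff)
  qed (use v p in auto)
  have lieB: "lie_algebra B = par ?Q"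
    unfolding par_def subroots_B[symmetric] by (rule lie_sub[OF algB BG(2) BsubG])
  have re: "right_eigen ?Q (ev w) v"
    unfolding right_eigen_def using z x by blast
  have "\<exists>d. D Y v = fscale d v" if "Y \<in> lie_algebra B" for Y
    by (rule right_eigen_par[OF v(1) re _ that[unfolded lieB]]) auto
  then obtain l where l: "\<And>Y. Y \<in> lie_algebra B \<Longrightarrow> D Y v = fscale (l Y) v"
    by metis
  have "l x = ev w x" if "x \<in> \<tt>" for x
  proof -
    have "fscale (l x) v = fscale (ev w x) v"
      by (rule trans[OF l[OF tB[OF that], symmetric] x[OF that]])
    then show ?thesis
      using v(2) by (auto simp: fun_eq_iff)
  qed
  moreover have "left_eigen l (res G (\<lambda>A. v (matrix_inv A)))"
    unfolding left_eigen_def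
  proof (intro conjI ballI allI coord_ring_inverse v(1))
    fix Y g z assume Y: "Y \<in> lie_algebra B" and g: "g \<in> G"
    have "matrix_inv (mexp (cscale z Y) ** g) = matrix_inv g ** mexp (cscale (- z) Y)"
      using K_inv[OF g] by (simp add: matrix_inv_mult)
    moreover have "v (matrix_inv g ** mexp (cscale (- z) Y)) = exp (l Y * (- z)) * v (matrix_inv g)"
      by (rule rder_eigen_exp[OF v(1) LB(1)[OF Y] l[OF Y] K_minv[OF g]])
    ultimately show "res G (\<lambda>A. v (matrix_inv A)) (mexp (cscale z Y) ** g) = exp (- l Y * z) * res G (\<lambda>A. v (matrix_inv A)) g"
      using g K_mult[OF LB(2)[OF Y] g] by (simp add: res_def)
  qed
  ultimately show ?thesis by blast
qed

text \<open>A left semi-invariant whose right weight is the negative of its left weight is killed by the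
  negative roots: otherwise a word in negative root vectors would be non-zero at the identity, while
  the left and right actions of \<open>\<tt>\<close> agree there.\<close>

lemma left_eigen_lowest:
  assumes m: "left_eigen l m" "\<And>x. x \<in> \<tt> \<Longrightarrow> D x m = fscale (- l x) m"
    and p: "p \<in> G2_roots" "0 \<le> fst p" "0 \<le> snd p" and X: "X \<in> rs (- p)"
  shows "D X m = 0"
proof (rule ccontr)
  assume nz: "D X m \<noteq> 0"
  have mR: "m \<in> R" using m(1) by (simp add: left_eigen_def)
  have XL: "X \<in> L" by (rule rsD(1)[OF X])
  have vR: "D X m \<in> R" by (rule rder_closed[OF mR XL])
  let ?Q = "{p \<in> G2_roots. 0 \<le> fst p \<and> 0 \<le> snd p}"
  define C where "C = (\<Union>q\<in>?Q. rs (- q))"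
  have CL: "C \<subseteq> L" using rsD(1) by (auto simp: C_def)
  \<comment> \<open>On root spaces, \<open>x\<close> acts by the height.\<close>
  obtain x where x: "x \<in> \<tt>" "ev (1, 0) x = 1" "ev (0, 1) x = 1"
    using t_exists by blast
  have "\<exists>k::nat. k \<ge> 1 \<and> lie_bracket x Y = cscale (- of_nat k) Y" if YC: "Y \<in> C" for Y
  proof -
    obtain q where q: "q \<in> ?Q" "Y \<in> rs (- q)" using YC unfolding C_def by blast
    have "lie_bracket x Y = cscale (ev (- q) x) Y" by (rule rsD(2)[OF q(2) x(1)])
    moreover have "ev (- q) x = - of_nat (nat (fst q + snd q))"
      using q(1) ev_pair[of "fst q" "snd q" x] x by (simp add: ev_minus)
    moreover have "nat (fst q + snd q) \<ge> 1"
      using q(1) by (auto simp: G2_defs)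
    ultimately show ?thesis by metis
  qed
  then obtain k :: "complex^'n^'n \<Rightarrow> nat" where k: "\<And>Y. Y \<in> C \<Longrightarrow> k Y \<ge> 1"
    "\<And>Y. Y \<in> C \<Longrightarrow> lie_bracket x Y = cscale (- of_nat (k Y)) Y" by metis
  have dec: "L \<subseteq> cm.span (lie_algebra B \<union> (C \<union> {0}))"
  proof (rule L_subset_span)
    fix q :: "int \<times> int" assume "q \<in> insert 0 G2_roots"
    then consider "q = 0" | "q \<in> G2_roots" "0 \<le> fst q" "0 \<le> snd q" | "- q \<in> ?Q"
      by (auto simp: G2_defs)
    then have "rs q \<subseteq> lie_algebra B \<union> (C \<union> {0})"
    proof cases
      case 1
      then show ?thesis using tB by (auto simp: rs_0)
    next
      case 2
      then show ?thesis using rsB by blast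
    next
      case 3
      have "rs (- (- q)) \<subseteq> C"
        unfolding C_def by (rule UN_upper[OF 3])
      then show ?thesis by auto
    qed
    then show "rs q \<subseteq> cm.span (lie_algebra B \<union> (C \<union> {0}))"
      by (meson cm.span_superset subset_trans)
  qed
  obtain Xs where Xs: "set Xs \<subseteq> L" "word Xs (D X m) (mat 1) \<noteq> 0"
    using words_determine[OF vR K_one] nz by blast
  have "\<exists>Ys. set Ys \<subseteq> C \<and> word Ys (D X m) (mat 1) \<noteq> 0"
  proof (rule word_reduction[OF vR _ _ _ _ CL _ Xs])
    show "lie_algebra B \<subseteq> L" using LB(1) by blast
    show "{0} \<subseteq> L" using lie_algebra_0 by blast
    show "\<exists>d. word (Y # Ys) (D X m) (mat 1) = d * word Ys (D X m) (mat 1)" if "Y \<in> lie_algebra B" "set Ys \<subseteq> L" for Y Ys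
      using left_eigen_value(1)[OF left_eigen_word[OF left_eigen_rder[OF m(1) XL] that(2)] that(1) K_one]
      by (intro exI[of _ "- l Y"]) simp
    show "\<exists>d. D Z (D X m) = fscale d (D X m)" if "Z \<in> {0}" for Z
      using that rder_lin(2)[OF vR XL XL, of 0] by (intro exI[of _ 0]) simp
    show "\<exists>Y\<in>lie_algebra B. \<exists>Z\<in>{0}. \<exists>W\<in>cm.span C. Z' = Y + W + Z" if "Z' \<in> L" for Z'
      by (rule span_sum3[OF lie_algebra_subspace]) (use dec that in auto)
  qed
  then obtain Ys where Ys: "set Ys \<subseteq> C" "word Ys (D X m) (mat 1) \<noteq> 0" by blast
  define Zs where "Zs = Ys @ [X]"
  have XC: "X \<in> C"
    unfolding C_def using X p by blast
  have Zs: "set Zs \<subseteq> C" "word Zs m (mat 1) \<noteq> 0"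
    using Ys XC by (auto simp: Zs_def)
  have ZL: "set Zs \<subseteq> L" using Zs(1) CL by blast
  have "D x (word Zs m) = fscale (- l x + sum_list (map (\<lambda>Y. - of_nat (k Y)) Zs)) (word Zs m)"
    by (rule word_weight[OF mR t_L[OF x(1)] m(2)[OF x(1)] ZL]) (use k(2) Zs(1) in blast)
  moreover have "D x (word Zs m) (mat 1) = - l x * word Zs m (mat 1)"
    using left_eigen_value(1)[OF left_eigen_word[OF m(1) ZL] tB[OF x(1)] K_one] by simp
  ultimately have "(- l x + sum_list (map (\<lambda>Y. - of_nat (k Y)) Zs)) * word Zs m (mat 1) = - l x * word Zs m (mat 1)"
    by simp
  then have "- l x + sum_list (map (\<lambda>Y. - of_nat (k Y)) Zs) = - l x"
    using Zs(2) by (metis mult_right_cancel)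
  moreover have "sum_list (map (\<lambda>Y. - of_nat (k Y) :: complex) Zs) = - of_nat (sum_list (map k Zs))"
    by (induction Zs) auto
  ultimately have "of_nat (sum_list (map k Zs)) = (0 :: complex)" by simp
  then have "sum_list (map k Zs) = 0" by (metis of_nat_eq_0_iff)
  moreover have "k X \<ge> 1" using k(1)[of X] Zs(1) by (simp add: Zs_def)
  ultimately show False by (simp add: Zs_def)
qed

lemma sl2_raise:
  assumes t: "triple p e f h" "p \<noteq> 0" and v: "v \<in> R" "v \<noteq> 0" "D f v = 0" "D h v = fscale (- of_nat k) v"
  shows "\<forall>i\<le>k. (D e ^^ i) v \<noteq> 0" "(D e ^^ Suc k) v = 0"
proof -
  note t' = tripleD[OF t(1)]
  obtain N where N: "mpow e N = 0" using rs_nilpotent[OF t(2) t'(1)] by blast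
  obtain n where n: "- of_nat k = (- of_nat n :: complex)" "\<forall>i\<le>n. (D e ^^ i) v \<noteq> 0" "\<forall>i>n. (D e ^^ i) v = 0"
    using rder_sl2_lowest[OF t'(10,11,4,8) N v] by blast
  have "k = n" using n(1) by (metis neg_equal_iff_equal of_nat_eq_iff)
  with n show "\<forall>i\<le>k. (D e ^^ i) v \<noteq> 0" "(D e ^^ Suc k) v = 0" by auto
qed

text \<open>The representation of \<open>sl\<^sub>2\<close> generated by \<open>v\<close> has lowest
  weight \<open>0\<close>, so it is trivial.\<close>

lemma sl2_invariant:
  assumes p: "p \<in> G2_roots" and v: "v \<in> R" "\<And>X. X \<in> rs (- p) \<Longrightarrow> D X v = 0" "D (hh p) v = 0" and X: "X \<in> rs p"
  shows "D X v = 0"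
proof (cases "v = 0")
  case True
  then show ?thesis using rder_0[OF rsD(1)[OF X]] by simp
next
  case False
  obtain e f where t: "triple p e f (hh p)" using hh_triple[OF p] by blast
  note t' = tripleD[OF t]
  have p0: "p \<noteq> 0" using p G2_0 by blast
  have "D (hh p) v = fscale (- of_nat 0) v" using v(3) by (simp add: fun_eq_iff)
  then have "D e v = 0"
    using sl2_raise(2)[OF t p0 v(1) False v(2)[OF t'(2)], of 0] by simp
  moreover obtain c where "X = cscale c e" using rs_prop[OF p t'(1,6) X] by blast
  ultimately show ?thesis
    using rder_lin(2)[OF v(1) t'(10,10), of c] by (simp add: fun_eq_iff)
qed

text \<open>Applying a root vector \<open>e\<close> to a function annihilated by the root spaces in
  \<open>N\<close>: brackets of \<open>e\<close> with the negative long root vectors must act by zero,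
  and then vanishing of the new weight on the coroot of \<open>a\<^sub>2\<close> takes care of
  \<open>a\<^sub>2\<close> itself.\<close>

lemma right_eigen_raise:
  assumes m: "m \<in> R" "\<And>q X. q \<in> N \<Longrightarrow> X \<in> rs q \<Longrightarrow> D X m = 0" "\<And>x. x \<in> \<tt> \<Longrightarrow> D x m = fscale (c x) m"
    and e: "e \<in> rs p" and N: "neg_long \<subseteq> N" "\<And>q. q \<in> neg_long \<Longrightarrow> q + p \<in> N \<or> q + p \<notin> insert 0 G2_roots"
    and c: "c (hh (0, 1)) + ev p (hh (0, 1)) = 0"
  shows "right_eigen Q0 (\<lambda>x. c x + ev p x) (D e m)"
proof -
  have eL: "e \<in> L" by (rule rsD(1)[OF e])
  have R: "D e m \<in> R" by (rule rder_closed[OF m(1) eL])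
  have neg: "D X (D e m) = 0" if q: "q \<in> neg_long" "X \<in> rs q" for q X
  proof -
    have XL: "X \<in> L" by (rule rsD(1)[OF q(2)])
    have "D X m = 0" using m(2) N(1) q by blast
    moreover have "D (lie_bracket X e) m = 0"
    proof (cases "q + p \<in> N")
      case True
      then show ?thesis using m(2) rs_bracket[OF q(2) e] by blast
    next
      case False
      then have "lie_bracket X e = 0"
        using N(2)[OF q(1)] rs_nonroot[OF _ _ rs_bracket[OF q(2) e]] by blast
      then show ?thesis
        using rder_lin(2)[OF m(1) XL XL, of 0] by simp
    qed
    ultimately show ?thesis
      using rder_commutator[OF m(1) XL eL] rder_0[OF eL] by simp
  qed
  have x: "D x (D e m) = fscale (c x + ev p x) (D e m)" if "x \<in> \<tt>" for x
  proof -
    have "D x (D e m) = D e (fscale (c x) m) + D (cscale (ev p x) e) m"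
      using rder_commutator[OF m(1) t_L[OF that] eL] m(3)[OF that] rsD(2)[OF e that] by simp
    then show ?thesis
      using rder_fscale[OF m(1) eL] rder_lin(2)[OF m(1) eL eL, of "ev p x"] by (simp add: fs.scale_left_distrib)
  qed
  have r: "(0, 1) \<in> G2_roots" by (simp add: G2_defs)
  have "D X (D e m) = 0" if "X \<in> rs (0, 1)" for X
  proof (rule sl2_invariant[OF r R _ _ that])
    show "D X (D e m) = 0" if "X \<in> rs (- (0, 1))" for X
      by (rule neg[of "(0, - 1)"]) (use that in \<open>auto simp: neg_long_def\<close>)
    show "D (hh (0, 1)) (D e m) = 0"
      using x[OF hh_t[OF r]] c by (simp add: fun_eq_iff)
  qed
  with neg x show ?thesis
    unfolding right_eigen_def Q0_def by blast
qed

subsection \<open>The functions of weight \<open>\<omega>\<^sub>2\<close>\<close>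

text \<open>The coefficient of the adjoint representation between a highest and a lowest weight
  vector.\<close>

lemma lowest_function_2: "\<exists>l m. left_eigen l m \<and> m \<noteq> 0 \<and> (\<forall>x\<in>\<tt>. l x = ev (3, 2) x \<and> D x m = fscale (- ev (3, 2) x) m)"
proof -
  have rt: "(1, 0) \<in> G2_roots" "(0, 1) \<in> G2_roots" "(3, 2) \<in> G2_roots" by (simp_all add: G2_defs)
  obtain e1 where e1: "e1 \<in> rs (1, 0)" "e1 \<noteq> 0" using rs_nonzero[OF rt(1)] by blast
  obtain e2 where e2: "e2 \<in> rs (0, 1)" "e2 \<noteq> 0" using rs_nonzero[OF rt(2)] by blast
  obtain e f h where t: "triple (3, 2) e f h" using triple_exists[OF rt(3)] by blast
  note t' = tripleD[OF t]
  define v where "v = Lf f e"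
  define m where "m = Rf f e"
  have inv: "m = res G (\<lambda>A. v (matrix_inv A))" by (simp add: m_def v_def Rf_Lf)
  have vR: "v \<in> R" by (simp add: v_def Lf_R)
  have "m (mat 1) = trace (e ** f)" by (simp add: m_def Rf_1)
  then have m0: "m (mat 1) \<noteq> 0" using trace_root_vectors[OF rt(3) t'(1,6,2,7)] by simp
  then have v0: "v \<noteq> 0" by (auto simp: inv res_def zero_fun_apply split: if_splits)
  have "lie_bracket e1 e = 0" "lie_bracket e2 e = 0"
    by (rule rs_nonroot[OF _ _ rs_bracket[OF e1(1) t'(1)]], auto simp: G2_defs zero_prod_def)
      (rule rs_nonroot[OF _ _ rs_bracket[OF e2(1) t'(1)]], auto simp: G2_defs zero_prod_def)
  then have k: "D e1 v = 0" "D e2 v = 0"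
    using rder_Lf[OF rsD(1)[OF e1(1)], of f e] rder_Lf[OF rsD(1)[OF e2(1)], of f e] by (auto simp: v_def Lf_lin fun_eq_iff)
  have x: "D x v = fscale (ev (3, 2) x) v" if "x \<in> \<tt>" for x
    using rder_Lf[OF t_L[OF that], of f e] rsD(2)[OF t'(1) that] by (auto simp: v_def Lf_lin fun_eq_iff)
  obtain l where l: "left_eigen l m" "\<forall>x\<in>\<tt>. l x = ev (3, 2) x"
    using highest_vector_left_eigen[OF e1 e2 vR v0 k x] by (auto simp: inv)
  have "D x m = fscale (- ev (3, 2) x) m" if "x \<in> \<tt>" for x
    using rder_Rf[OF t_L[OF that], of f e] rsD(2)[OF t'(2) that] ev_minus[of "(3, 2)" x] by (auto simp: m_def Rf_lin fun_eq_iff)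
  moreover have "m \<noteq> 0" using m0 by auto
  ultimately show ?thesis using l by blast
qed

subsection \<open>The functions of weight \<open>\<omega>\<^sub>1\<close>\<close>

end

text \<open>The highest weight vector of weight \<open>2a\<^sub>1 + a\<^sub>2\<close> in the third symmetric power of the adjoint
  representation, in terms of the Chevalley basis with \<open>e\<^sub>3 = [e\<^sub>1, e\<^sub>2]\<close>, \<open>e\<^sub>4 = [e\<^sub>1, e\<^sub>3]\<close>, \<open>e\<^sub>5 = [e\<^sub>1, e\<^sub>4]\<close>,
  \<open>e\<^sub>6 = [e\<^sub>2, e\<^sub>5]\<close>, \<open>f\<^sub>3 = [f\<^sub>1, f\<^sub>2]\<close>, \<open>f\<^sub>4 = [f\<^sub>1, f\<^sub>3]\<close>.  It is the unique cubic of this weight, up to a factor,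
  that is annihilated by \<open>e\<^sub>1\<close> and \<open>e\<^sub>2\<close>; its coefficients solve that linear system.\<close>

definition cubic :: "complex \<Rightarrow> complex \<Rightarrow> complex \<Rightarrow> complex \<Rightarrow> complex \<Rightarrow> complex \<Rightarrow> complex \<Rightarrow> complex \<Rightarrow>
    complex \<Rightarrow> complex \<Rightarrow> complex \<Rightarrow> complex \<Rightarrow> complex" where
  "cubic e1 e2 e3 e4 e5 e6 h1 h2 f1 f2 f3 f4 =
    2 * (f4 * (e1 * e6)) + 2 * (f4 * (e3 * e5)) - f4 * (e4 * e4) + 4 * (f3 * (h1 * e6)) - 12 * (f3 * (e2 * e5)) + 4 * (f3 * (e3 * e4))
    - 12 * (f2 * (f1 * e6)) + 36 * (f2 * (e2 * e4)) - 24 * (f2 * (e3 * e3)) + 4 * (f1 * (h1 * e5)) + 12 * (f1 * (h2 * e5))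
    - 4 * (f1 * (e1 * e4)) - 4 * (h1 * (h1 * e4)) - 12 * (h1 * (h2 * e4)) - 24 * (h2 * (e1 * e3)) + 24 * (e1 * (e1 * e2))"

lemma cubic_derivative:
  assumes "(e1 has_field_derivative e1') (at z)" "(e2 has_field_derivative e2') (at z)" "(e3 has_field_derivative e3') (at z)"
    "(e4 has_field_derivative e4') (at z)" "(e5 has_field_derivative e5') (at z)" "(e6 has_field_derivative e6') (at z)"
    "(h1 has_field_derivative h1') (at z)" "(h2 has_field_derivative h2') (at z)" "(f1 has_field_derivative f1') (at z)"
    "(f2 has_field_derivative f2') (at z)" "(f3 has_field_derivative f3') (at z)" "(f4 has_field_derivative f4') (at z)"
  shows "((\<lambda>w. cubic (e1 w) (e2 w) (e3 w) (e4 w) (e5 w) (e6 w) (h1 w) (h2 w) (f1 w) (f2 w) (f3 w) (f4 w)) has_field_derivative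
    2 * (f4' * (e1 z * e6 z) + f4 z * (e1' * e6 z + e1 z * e6')) + 2 * (f4' * (e3 z * e5 z) + f4 z * (e3' * e5 z + e3 z * e5'))
    - (f4' * (e4 z * e4 z) + f4 z * (e4' * e4 z + e4 z * e4')) + 4 * (f3' * (h1 z * e6 z) + f3 z * (h1' * e6 z + h1 z * e6'))
    - 12 * (f3' * (e2 z * e5 z) + f3 z * (e2' * e5 z + e2 z * e5')) + 4 * (f3' * (e3 z * e4 z) + f3 z * (e3' * e4 z + e3 z * e4'))
    - 12 * (f2' * (f1 z * e6 z) + f2 z * (f1' * e6 z + f1 z * e6')) + 36 * (f2' * (e2 z * e4 z) + f2 z * (e2' * e4 z + e2 z * e4'))
    - 24 * (f2' * (e3 z * e3 z) + f2 z * (e3' * e3 z + e3 z * e3')) + 4 * (f1' * (h1 z * e5 z) + f1 z * (h1' * e5 z + h1 z * e5'))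
    + 12 * (f1' * (h2 z * e5 z) + f1 z * (h2' * e5 z + h2 z * e5')) - 4 * (f1' * (e1 z * e4 z) + f1 z * (e1' * e4 z + e1 z * e4'))
    - 4 * (h1' * (h1 z * e4 z) + h1 z * (h1' * e4 z + h1 z * e4')) - 12 * (h1' * (h2 z * e4 z) + h1 z * (h2' * e4 z + h2 z * e4'))
    - 24 * (h2' * (e1 z * e3 z) + h2 z * (e1' * e3 z + e1 z * e3')) + 24 * (e1' * (e1 z * e2 z) + e1 z * (e1' * e2 z + e1 z * e2')))
    (at z)"
proof -
  have m: "((\<lambda>w. c * (f w * (g w * h w))) has_field_derivative c * (f' * (g z * h z) + f z * (g' * h z + g z * h'))) (at z)"
    if "(f has_field_derivative f') (at z)" "(g has_field_derivative g') (at z)" "(h has_field_derivative h') (at z)" for c f g h f' g' h'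
    using that by (auto intro!: derivative_eq_intros simp: algebra_simps)
  have m1: "((\<lambda>w. f w * (g w * h w)) has_field_derivative (f' * (g z * h z) + f z * (g' * h z + g z * h'))) (at z)"
    if "(f has_field_derivative f') (at z)" "(g has_field_derivative g') (at z)" "(h has_field_derivative h') (at z)" for f g h f' g' h'
    using m[OF that, of 1] by simp
  show ?thesis
    unfolding cubic_def by (intro DERIV_add DERIV_diff m m1 assms)
qed

context g2_sl3
begin

lemma coord_ring_cubic:
  assumes "e1 \<in> R" "e2 \<in> R" "e3 \<in> R" "e4 \<in> R" "e5 \<in> R" "e6 \<in> R" "h1 \<in> R" "h2 \<in> R" "f1 \<in> R" "f2 \<in> R" "f3 \<in> R" "f4 \<in> R"
  shows "(\<lambda>A. cubic (e1 A) (e2 A) (e3 A) (e4 A) (e5 A) (e6 A) (h1 A) (h2 A) (f1 A) (f2 A) (f3 A) (f4 A)) \<in> R"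
  unfolding cubic_def by (intro coord_ring_pointwise assms)

text \<open>The cubic \<open>v\<close> in the coefficients with respect to \<open>h \<in> \<tt>\<close>
  is a highest weight vector of weight \<open>\<omega>\<^sub>1\<close> and invariant under
  \<open>T\<close> from the other side.  Its derivative in the direction \<open>f\<^sub>4\<close> has the
  required weights, and the choice of \<open>h\<close> reduces its value at the identity to a single
  term, which is not zero.\<close>

lemma lowest_function_1: "\<exists>l m. left_eigen l m \<and> m \<noteq> 0 \<and> (\<forall>x\<in>\<tt>. l x = ev (2, 1) x \<and> D x m = fscale (- ev (2, 1) x) m)"
proof -
  have rt: "(1, 0) \<in> G2_roots" "(0, 1) \<in> G2_roots" "(2, 1) \<in> G2_roots" by (simp_all add: G2_defs)
  define h1 h2 where "h1 = hh (1, 0)" and "h2 = hh (0, 1)"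
  obtain e1 f1 where t1: "triple (1, 0) e1 f1 h1" unfolding h1_def using hh_triple[OF rt(1)] by blast
  obtain e2 f2 where t2: "triple (0, 1) e2 f2 h2" unfolding h2_def using hh_triple[OF rt(2)] by blast
  note t1' = tripleD[OF t1] and t2' = tripleD[OF t2]
  define e3 where "e3 = lie_bracket e1 e2"
  define e4 where "e4 = lie_bracket e1 e3"
  define e5 where "e5 = lie_bracket e1 e4"
  define e6 where "e6 = lie_bracket e2 e5"
  define f3 where "f3 = lie_bracket f1 f2"
  define f4 where "f4 = lie_bracket f1 f3"
  have f1r: "f1 \<in> rs (- 1, 0)" and f2r: "f2 \<in> rs (0, - 1)" using t1'(2) t2'(2) by simp_all
  have r3: "e3 \<in> rs (1, 1)" unfolding e3_def using rs_bracket[OF t1'(1) t2'(1)] by simp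
  have r4: "e4 \<in> rs (2, 1)" unfolding e4_def using rs_bracket[OF t1'(1) r3] by simp
  have r5: "e5 \<in> rs (3, 1)" unfolding e5_def using rs_bracket[OF t1'(1) r4] by simp
  have r6: "e6 \<in> rs (3, 2)" unfolding e6_def using rs_bracket[OF t2'(1) r5] by simp
  have q3: "f3 \<in> rs (- 1, - 1)" unfolding f3_def using rs_bracket[OF f1r f2r] by simp
  have q4: "f4 \<in> rs (- 2, - 1)" unfolding f4_def using rs_bracket[OF f1r q3] by simp
  have n4: "e4 \<noteq> 0"
  proof -
    obtain n where n: "ev (0, 1) h1 = - of_nat n" "\<forall>i\<le>n. (lie_bracket e1 ^^ i) e2 \<noteq> 0"
      using string_lowest[OF t1 t2'(1,6), of 3] by (auto simp: G2_defs zero_prod_def)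
    have "of_nat n = (of_nat 3 :: complex)" using n(1) by (simp add: ev_hh h1_def)
    then have "n = 3" by (metis of_nat_eq_iff)
    then have "(lie_bracket e1 ^^ 2) e2 \<noteq> 0" using n(2) by simp
    then show ?thesis by (simp add: numeral_2_eq_2 e4_def e3_def)
  qed
  have m4: "f4 \<noteq> 0"
  proof -
    obtain n where n: "ev (0, - 1) (- h1) = - of_nat n" "\<forall>i\<le>n. (lie_bracket f1 ^^ i) f2 \<noteq> 0"
      using string_lowest[OF triple_swap[OF t1] f2r t2'(7), of 3] by (auto simp: G2_defs zero_prod_def)
    have "of_nat n = (of_nat 3 :: complex)" using n(1) ev_minus[of "(0, 1)" h1] ev_lin(3)[OF t1'(3)] by (simp add: ev_hh h1_def)
    then have "n = 3" by (metis of_nat_eq_iff)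
    then have "(lie_bracket f1 ^^ 2) f2 \<noteq> 0" using n(2) by simp
    then show ?thesis by (simp add: numeral_2_eq_2 f4_def f3_def)
  qed
  have nr: "lie_bracket X Y = 0" if "X \<in> rs p" "Y \<in> rs q" "p + q \<notin> insert 0 G2_roots" for X Y p q
    using rs_nonroot[OF _ _ rs_bracket[OF that(1,2)]] that(3) by blast
  have evs: "ev (1, 0) h1 = 2" "ev (0, 1) h1 = - 3" "ev (1, 0) h2 = - 1" "ev (0, 1) h2 = 2"
    by (simp_all add: h1_def h2_def ev_hh)
  have z: "lie_bracket e1 e5 = 0" "lie_bracket e1 e6 = 0" "lie_bracket e1 f2 = 0" "lie_bracket e2 e3 = 0" "lie_bracket e2 e4 = 0"
    "lie_bracket e2 e6 = 0" "lie_bracket e2 f1 = 0" "lie_bracket e2 f4 = 0"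
    using nr[OF t1'(1) r5] nr[OF t1'(1) r6] nr[OF t1'(1) f2r] nr[OF t2'(1) r3] nr[OF t2'(1) r4] nr[OF t2'(1) r6]
      nr[OF t2'(1) f1r] nr[OF t2'(1) q4] by (simp_all add: G2_defs zero_prod_def)
  have hf: "lie_bracket h1 f2 = cscale 3 f2" "lie_bracket h1 f3 = cscale 1 f3" "lie_bracket h2 f1 = f1"
    using rsD(2)[OF f2r t1'(3)] rsD(2)[OF q3 t1'(3)] rsD(2)[OF f1r t2'(3)]
      ev_pair[of 0 "- 1" h1] ev_pair[of "- 1" "- 1" h1] ev_pair[of "- 1" 0 h2] by (simp_all add: evs)
  have a1: "lie_bracket e1 h1 = cscale (- 2) e1" "lie_bracket e1 h2 = e1" "lie_bracket e1 f1 = h1"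
    using lie_bracket_swap[of e1 h1] lie_bracket_swap[of e1 h2] rsD(2)[OF t1'(1) t2'(3)] t1'(4,8) by (simp_all add: evs)
  have a1f3: "lie_bracket e1 f3 = cscale 3 f2"
    using jacobi[of e1 f1 f2] a1(3) z(3) hf(1) by (simp add: f3_def lie_bracket_lin)
  have a1f4: "lie_bracket e1 f4 = cscale 4 f3"
  proof -
    have "lie_bracket e1 f4 = lie_bracket h1 f3 + lie_bracket f1 (cscale 3 f2)"
      using jacobi[of e1 f1 f3] a1(3) a1f3 by (simp add: f4_def)
    also have "\<dots> = cscale 1 f3 + cscale 3 f3"
      by (simp only: hf(2) lie_bracket_lin f3_def[symmetric])
    also have "\<dots> = cscale 4 f3"
      using cm.scale_left_distrib[of 1 3 f3] by simp
    finally show ?thesis .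
  qed
  have a2: "lie_bracket e2 e1 = - e3" "lie_bracket e2 h1 = cscale 3 e2" "lie_bracket e2 h2 = cscale (- 2) e2" "lie_bracket e2 f2 = h2"
    using lie_bracket_swap[of e2 e1] lie_bracket_swap[of e2 h1] lie_bracket_swap[of e2 h2] rsD(2)[OF t2'(1) t1'(3)] t2'(4,8)
    by (simp_all add: evs e3_def)
  have a2f3: "lie_bracket e2 f3 = - f1"
    using jacobi[of e2 f1 f2] a2(4) z(7) hf(3) lie_bracket_swap[of f1 h2] by (simp add: f3_def lie_bracket_lin)
  \<comment> \<open>As \<open>a\<^sub>2\<close> vanishes on \<open>h\<close>, so does the coefficient of \<open>h2\<close> at the identity.\<close>
  obtain h where h: "h \<in> \<tt>" "ev (1, 0) h = 1" "ev (0, 1) h = 0" using t_exists by blast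
  define Qc where "Qc u = cubic (u e1) (u e2) (u e3) (u e4) (u e5) (u e6) (u h1) (u h2) (u f1) (u f2) (u f3) (u f4)" for u :: "complex^'n^'n \<Rightarrow> complex"
  define v where "v A = Qc (\<lambda>Z. Lf h Z A)" for A
  have vR: "v \<in> R" unfolding v_def Qc_def by (intro coord_ring_cubic Lf_R)
  have dL: "((\<lambda>w. Lf h Z (A ** mexp (cscale w Y))) has_field_derivative Lf h (lie_bracket Y Z) A) (at 0)"
    if "Y \<in> L" "A \<in> G" for Z Y A
    using rder_curve_0[OF Lf_R that] by (simp add: rder_Lf[OF that(1)])
  have De1: "D e1 v = 0"
  proof (rule coord_ring_eqI[OF rder_closed[OF vR t1'(10)] coord_ring_0])
    fix A assume A: "A \<in> G"
    note d = dL[OF t1'(10) A]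
    show "D e1 v A = 0 A"
      by (rule rder_unique[OF vR t1'(10) A], unfold v_def Qc_def, rule DERIV_cong,
          rule cubic_derivative[OF d d d d d d d d d d d d])
        (simp add: z a1 a1f3 a1f4 e3_def[symmetric] e4_def[symmetric] e5_def[symmetric] Lf_lin algebra_simps)
  qed
  have De2: "D e2 v = 0"
  proof (rule coord_ring_eqI[OF rder_closed[OF vR t2'(10)] coord_ring_0])
    fix A assume A: "A \<in> G"
    note d = dL[OF t2'(10) A]
    show "D e2 v A = 0 A"
      by (rule rder_unique[OF vR t2'(10) A], unfold v_def Qc_def, rule DERIV_cong,
          rule cubic_derivative[OF d d d d d d d d d d d d])
        (simp add: z a2 a2f3 e6_def[symmetric] Lf_lin algebra_simps)
  qed
  have Dx: "D x v = fscale (ev (2, 1) x) v" if x: "x \<in> \<tt>" for x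
  proof (rule coord_ring_eqI[OF rder_closed[OF vR t_L[OF x]] coord_ring_fscale[OF vR]])
    fix A assume A: "A \<in> G"
    note d = dL[OF t_L[OF x] A]
    have b: "lie_bracket x h1 = 0" "lie_bracket x h2 = 0"
      using rsD(2)[of h1 0 x] rsD(2)[of h2 0 x] t1'(3) t2'(3) x by (simp_all add: rs_0 ev_0)
    define s u where "s = ev (1, 0) x" and "u = ev (0, 1) x"
    note w = rsD(2)[OF t1'(1) x] rsD(2)[OF t2'(1) x] rsD(2)[OF r3 x] rsD(2)[OF r4 x] rsD(2)[OF r5 x] rsD(2)[OF r6 x]
      rsD(2)[OF f1r x] rsD(2)[OF f2r x] rsD(2)[OF q3 x] rsD(2)[OF q4 x]
    note p = ev_pair[of 1 1 x] ev_pair[of 2 1 x] ev_pair[of 3 1 x] ev_pair[of 3 2 x] ev_pair[of "- 1" 0 x] ev_pair[of 0 "- 1" x]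
      ev_pair[of "- 1" "- 1" x] ev_pair[of "- 2" "- 1" x]
    show "D x v A = fscale (ev (2, 1) x) v A"
      by (rule rder_unique[OF vR t_L[OF x] A], unfold v_def Qc_def, rule DERIV_cong,
          rule cubic_derivative[OF d d d d d d d d d d d d])
        (simp add: b w p s_def[symmetric] u_def[symmetric] Lf_lin, simp add: cubic_def algebra_simps)
  qed
  define fh where "fh = res G (\<lambda>A. v (matrix_inv A))"
  have fhR: "fh \<in> R" unfolding fh_def by (rule coord_ring_inverse[OF vR])
  have fh: "fh A = Qc (\<lambda>Z. Rf h Z A)" if "A \<in> G" for A
    using that K_minv by (simp add: fh_def res_def v_def Rf_Lf)
  have dR: "((\<lambda>w. Rf h Z (A ** mexp (cscale w X))) has_field_derivative Rf (lie_bracket X h) Z A) (at 0)"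
    if "X \<in> L" "A \<in> G" for Z X A
    using rder_curve_0[OF Rf_R that] by (simp add: rder_Rf[OF that(1)])
  have dfh: "D X fh A = d" if X: "X \<in> L" "A \<in> G" and d: "((\<lambda>w. Qc (\<lambda>Z. Rf h Z (A ** mexp (cscale w X)))) has_field_derivative d) (at 0)" for X A d
  proof (rule rder_unique[OF fhR X])
    have "fh (A ** mexp (cscale w X)) = Qc (\<lambda>Z. Rf h Z (A ** mexp (cscale w X)))" for w
      by (rule fh) (use X K_mexp(1) K_mult in blast)
    then show "((\<lambda>w. fh (A ** mexp (cscale w X))) has_field_derivative d) (at 0)"
      using d by simp
  qed
  have xfh: "D x fh = 0" if x: "x \<in> \<tt>" for x
  proof (rule coord_ring_eqI[OF rder_closed[OF fhR t_L[OF x]] coord_ring_0])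
    fix A assume A: "A \<in> G"
    have b: "lie_bracket x h = 0"
      using rsD(2)[of h 0 x] h(1) x by (simp add: rs_0 ev_0)
    note d = dR[OF t_L[OF x] A]
    show "D x fh A = 0 A"
      by (rule dfh[OF t_L[OF x] A], unfold Qc_def, rule DERIV_cong, rule cubic_derivative[OF d d d d d d d d d d d d])
        (simp add: b Rf_lin)
  qed
  define m where "m = D f4 fh"
  have f4L: "f4 \<in> L" by (rule rsD(1)[OF q4])
  have b4: "lie_bracket f4 h = cscale 2 f4"
    using lie_bracket_swap[of f4 h] rsD(2)[OF q4 h(1)] ev_pair[of "- 2" "- 1" h] h by simp
  have h0: "h \<in> rs 0" using h(1) by (simp add: rs_0)
  have th: "trace (Z ** h) = 0" if "Z \<in> rs p" "p \<noteq> 0" for Z p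
    using trace_orthogonal[OF that(1) h0] that(2) by simp
  have tf: "trace (Z ** f4) = 0" if "Z \<in> rs p" "p \<noteq> (2, 1)" for Z p
    using trace_orthogonal[OF that(1) q4] that(2) by (cases p) (simp add: zero_prod_def)
  have h12: "h1 \<in> rs 0" "h2 \<in> rs 0" using t1'(3) t2'(3) by (simp_all add: rs_0)
  have tr: "trace (h1 ** h) = trace (e1 ** f1)" "trace (h2 ** h) = 0"
    using bracket_opposite(2)[OF t1'(1,2) h(1)] bracket_opposite(2)[OF t2'(1,2) h(1)] t1'(4) t2'(4) h by simp_all
  note tz = th[OF t1'(1)] th[OF t2'(1)] th[OF r3] th[OF r4] th[OF r5] th[OF r6] th[OF f1r] th[OF f2r] th[OF q3] th[OF q4]
    tf[OF t1'(1)] tf[OF t2'(1)] tf[OF r3] tf[OF r5] tf[OF r6] tf[OF f1r] tf[OF f2r] tf[OF q3] tf[OF q4] tf[OF h12(1)] tf[OF h12(2)]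
  note d = dR[OF f4L K_one]
  have "m (mat 1) = - 8 * trace (e1 ** f1) * trace (e1 ** f1) * trace (e4 ** f4)"
    unfolding m_def
    by (rule dfh[OF f4L K_one], unfold Qc_def, rule DERIV_cong, rule cubic_derivative[OF d d d d d d d d d d d d])
      (simp add: b4 Rf_lin Rf_1 tz tr zero_prod_def trace_cscale)
  moreover have "trace (e1 ** f1) \<noteq> 0" "trace (e4 ** f4) \<noteq> 0"
    using trace_root_vectors[OF rt(1) t1'(1,6,2,7)] trace_root_vectors[OF rt(3) r4 n4 _ m4] q4 by simp_all
  ultimately have m1: "m (mat 1) \<noteq> 0" by simp
  then have m0: "m \<noteq> 0" by auto
  have "fh \<noteq> 0" using m0 rder_0[OF f4L] by (auto simp: m_def)
  have v0: "v \<noteq> 0"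
  proof
    assume "v = 0"
    then have "fh = 0"
      unfolding fh_def by (simp add: res_def fun_eq_iff)
    with \<open>fh \<noteq> 0\<close> show False by blast
  qed
  obtain l where l: "left_eigen l fh" "\<forall>x\<in>\<tt>. l x = ev (2, 1) x"
    using highest_vector_left_eigen[OF t1'(1,6) t2'(1,6) vR v0 De1 De2 Dx] unfolding fh_def by blast
  have "D x m = fscale (- ev (2, 1) x) m" if x: "x \<in> \<tt>" for x
  proof -
    have "D x m = D (lie_bracket x f4) fh"
      using rder_commutator[OF fhR t_L[OF x] f4L] xfh[OF x] rder_0[OF f4L] by (simp add: m_def)
    also have "lie_bracket x f4 = cscale (- ev (2, 1) x) f4"
      using rsD(2)[OF q4 x] ev_minus[of "(2, 1)" x] by simp
    finally show ?thesis
      using rder_lin(2)[OF fhR f4L f4L, of "- ev (2, 1) x"] by (simp only: m_def)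
  qed
  moreover have "left_eigen l m"
    unfolding m_def by (rule left_eigen_rder[OF l(1) f4L])
  ultimately show ?thesis using l(2) m0 by blast
qed

subsection \<open>The three generators\<close>

text \<open>With \<open>m\<close> and \<open>m'\<close> the functions of left weight
  \<open>\<omega>\<^sub>1\<close> and \<open>\<omega>\<^sub>2\<close> that are lowest weight vectors from
  the right, the generators are \<open>m\<close>, its derivative along \<open>2a\<^sub>1 +
  a\<^sub>2\<close>, and the derivative of \<open>m'\<close> along \<open>a\<^sub>1 + a\<^sub>2\<close>;
  by the theory of \<open>sl\<^sub>2\<close> these do not vanish.\<close>

lemma generators_Q0:
  "\<exists>l f. left_eigen l f \<and> f \<noteq> 0 \<and> (\<forall>x\<in>\<tt>. l x = ev (2, 1) x) \<and> right_eigen Q0 (\<lambda>x. 0) f"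
  "\<exists>l f. left_eigen l f \<and> f \<noteq> 0 \<and> (\<forall>x\<in>\<tt>. l x = ev (2, 1) x) \<and> right_eigen Q0 (\<lambda>x. - ev (2, 1) x) f"
  "\<exists>l f. left_eigen l f \<and> f \<noteq> 0 \<and> (\<forall>x\<in>\<tt>. l x = ev (3, 2) x) \<and> right_eigen Q0 (\<lambda>x. - ev (2, 1) x) f"
proof -
  let ?N = "{p \<in> G2_roots. 0 \<le> - fst p \<and> 0 \<le> - snd p}"
  have rt: "(0, 1) \<in> G2_roots" "(2, 1) \<in> G2_roots" "(1, 1) \<in> G2_roots" "(1, 0) \<in> G2_roots" by (simp_all add: G2_defs)
  have h2: "ev (2, 1) (hh (0, 1)) = 0" using ev_pair[of 2 1 "hh (0, 1)"] by (simp add: ev_hh)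
  have neg: "D X m = 0" if "left_eigen l m" "\<And>x. x \<in> \<tt> \<Longrightarrow> D x m = fscale (- l x) m" "q \<in> ?N" "X \<in> rs q" for l m q X
    by (rule left_eigen_lowest[OF that(1,2), of "- q"]) (use that(3,4) G2_minus[of q] in auto)
  have NL: "neg_long \<subseteq> ?N" by (auto simp: neg_long_def G2_defs)
  obtain l m where m: "left_eigen l m" "m \<noteq> 0" "\<And>x. x \<in> \<tt> \<Longrightarrow> l x = ev (2, 1) x" "\<And>x. x \<in> \<tt> \<Longrightarrow> D x m = fscale (- ev (2, 1) x) m"
    using lowest_function_1 by blast
  have mR: "m \<in> R" using m(1) by (simp add: left_eigen_def)
  have neg1: "D X m = 0" if "q \<in> ?N" "X \<in> rs q" for q X
    by (rule neg[OF m(1) _ that]) (use m(3,4) in simp)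
  have "D X m = 0" if "X \<in> rs (0, 1)" for X
  proof (rule sl2_invariant[OF rt(1) mR _ _ that])
    show "D X m = 0" if "X \<in> rs (- (0, 1))" for X
      by (rule neg1[OF _ that]) (simp add: G2_defs)
    show "D (hh (0, 1)) m = 0"
      using m(4)[OF hh_t[OF rt(1)]] h2 by (simp add: fun_eq_iff)
  qed
  then have "right_eigen Q0 (\<lambda>x. - ev (2, 1) x) m"
    unfolding right_eigen_def Q0_def using neg1 NL m(4) by blast
  with m show "\<exists>l f. left_eigen l f \<and> f \<noteq> 0 \<and> (\<forall>x\<in>\<tt>. l x = ev (2, 1) x) \<and> right_eigen Q0 (\<lambda>x. - ev (2, 1) x) f"
    by blast
  show "\<exists>l f. left_eigen l f \<and> f \<noteq> 0 \<and> (\<forall>x\<in>\<tt>. l x = ev (2, 1) x) \<and> right_eigen Q0 (\<lambda>x. 0) f"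
  proof -
    obtain e f where t: "triple (2, 1) e f (hh (2, 1))" using hh_triple[OF rt(2)] by blast
    note t' = tripleD[OF t]
    have "right_eigen Q0 (\<lambda>x. - ev (2, 1) x + ev (2, 1) x) (D e m)"
    proof (rule right_eigen_raise[OF mR neg1 m(4) t'(1) NL])
      show "q + (2, 1) \<in> ?N \<or> q + (2, 1) \<notin> insert 0 G2_roots" if "q \<in> neg_long" for q
        using that by (auto simp: neg_long_def G2_defs zero_prod_def)
      show "- ev (2, 1) (hh (0, 1)) + ev (2, 1) (hh (0, 1)) = 0" by (rule left_minus)
    qed
    moreover have "D e m \<noteq> 0"
    proof -
      have "(2, 1) \<noteq> (0 :: int \<times> int)" by (simp add: zero_prod_def)
      moreover have "D f m = 0"
        by (rule neg1[OF _ t'(2)]) (simp add: G2_defs)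
      moreover have "D (hh (2, 1)) m = fscale (- of_nat 2) m"
        using m(4)[OF t'(3)] t'(5) by simp
      ultimately show ?thesis
        using sl2_raise(1)[OF t _ mR m(2), of 2, rule_format, of 1] by simp
    qed
    ultimately show ?thesis
      using left_eigen_rder[OF m(1) t'(10)] m(3) by auto
  qed
  obtain l' m' where m': "left_eigen l' m'" "m' \<noteq> 0" "\<And>x. x \<in> \<tt> \<Longrightarrow> l' x = ev (3, 2) x" "\<And>x. x \<in> \<tt> \<Longrightarrow> D x m' = fscale (- ev (3, 2) x) m'"
    using lowest_function_2 by blast
  have m'R: "m' \<in> R" using m'(1) by (simp add: left_eigen_def)
  have neg2: "D X m' = 0" if "q \<in> ?N" "X \<in> rs q" for q X
    by (rule neg[OF m'(1) _ that]) (use m'(3,4) in simp)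
  have z10: "D X m' = 0" if "X \<in> rs (1, 0)" for X
  proof (rule sl2_invariant[OF rt(4) m'R _ _ that])
    show "D X m' = 0" if "X \<in> rs (- (1, 0))" for X
      by (rule neg2[OF _ that]) (simp add: G2_defs)
    show "D (hh (1, 0)) m' = 0"
      using m'(4)[OF hh_t[OF rt(4)]] ev_pair[of 3 2 "hh (1, 0)"] by (simp add: fun_eq_iff ev_hh)
  qed
  obtain e f where t: "triple (1, 1) e f (hh (1, 1))" using hh_triple[OF rt(3)] by blast
  note t' = tripleD[OF t]
  have "right_eigen Q0 (\<lambda>x. - ev (3, 2) x + ev (1, 1) x) (D e m')"
  proof (rule right_eigen_raise[where N = "insert (1, 0) ?N"])
    show "D X m' = 0" if "q \<in> insert (1, 0) ?N" "X \<in> rs q" for q X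
      using that z10 neg2 by blast
    show "q + (1, 1) \<in> insert (1, 0) ?N \<or> q + (1, 1) \<notin> insert 0 G2_roots" if "q \<in> neg_long" for q
      using that by (auto simp: neg_long_def G2_defs zero_prod_def)
    show "- ev (3, 2) (hh (0, 1)) + ev (1, 1) (hh (0, 1)) = 0"
      using ev_pair[of 3 2 "hh (0, 1)"] ev_pair[of 1 1 "hh (0, 1)"] by (simp add: ev_hh)
  qed (use m'R m'(4) t'(1) NL in auto)
  moreover have "- ev (3, 2) x + ev (1, 1) x = - ev (2, 1) x" for x
    using ev_pair[of 3 2 x] ev_pair[of 1 1 x] ev_pair[of 2 1 x] by simp
  moreover have "D e m' \<noteq> 0"
  proof -
    have "(1, 1) \<noteq> (0 :: int \<times> int)" by (simp add: zero_prod_def)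
    moreover have "D f m' = 0"
      by (rule neg2[OF _ t'(2)]) (simp add: G2_defs)
    moreover have "D (hh (1, 1)) m' = fscale (- of_nat 3) m'"
      using m'(4)[OF t'(3)] by (simp add: ev_hh)
    ultimately show ?thesis
      using sl2_raise(1)[OF t _ m'R m'(2), of 3, rule_format, of 1] by simp
  qed
  ultimately show "\<exists>l f. left_eigen l f \<and> f \<noteq> 0 \<and> (\<forall>x\<in>\<tt>. l x = ev (3, 2) x) \<and> right_eigen Q0 (\<lambda>x. - ev (2, 1) x) f"
    using left_eigen_rder[OF m'(1) t'(10)] m'(3) by auto
qed

subsection \<open>Both parabolic subgroups\<close>

text \<open>The parabolic subgroup whose Levi factor has the root \<open>w\<close> corresponds to the fundamental weight that
  vanishes on the coroot of \<open>w\<close>.\<close>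

definition levi_weight :: "int \<times> int \<Rightarrow> int \<times> int" where
  "levi_weight w = (if w = (0, 1) then (2, 1) else (1, 1))"

lemma ev_reflect:
  assumes x: "x \<in> \<tt>"
  shows "ev (2, 1) (x - cscale (ev (1, 0) x) (hh (1, 0))) = ev (1, 1) x"
    "ev (1, 1) (x - cscale (ev (1, 0) x) (hh (1, 0))) = ev (2, 1) x"
    "(let y = x - cscale (ev (1, 0) x) (hh (1, 0)) in y - cscale (ev (1, 0) y) (hh (1, 0))) = x"
proof -
  have h: "hh (1, 0) \<in> \<tt>" by (rule hh_t) (simp add: G2_defs)
  show "ev (2, 1) (x - cscale (ev (1, 0) x) (hh (1, 0))) = ev (1, 1) x"
    "ev (1, 1) (x - cscale (ev (1, 0) x) (hh (1, 0))) = ev (2, 1) x"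
    using x h ev_pair[of 2 1 x] ev_pair[of 1 1 x] ev_pair[of 2 1 "hh (1, 0)"] ev_pair[of 1 1 "hh (1, 0)"]
    by (simp_all add: ev_lin lie_algebra_cscale ev_hh)
  show "(let y = x - cscale (ev (1, 0) x) (hh (1, 0)) in y - cscale (ev (1, 0) y) (hh (1, 0))) = x"
    using x h by (simp add: Let_def ev_lin lie_algebra_cscale ev_hh)
qed

lemma s1_Q0: "q \<in> Q0 \<Longrightarrow> s1 q \<in> insert (3, 1) neg_long" "q \<in> insert (3, 1) neg_long \<Longrightarrow> s1 q \<in> Q0"
  by (auto simp: Q0_def neg_long_def s1_def)

lemma right_eigen_cong: "right_eigen Q c f \<Longrightarrow> (\<And>x. x \<in> \<tt> \<Longrightarrow> c x = c' x) \<Longrightarrow> right_eigen Q c' f"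
  by (simp add: right_eigen_def)

lemma semi_invariant_bound:
  assumes f: "left_eigen l f" "f \<noteq> 0" and w: "w = (0, 1) \<or> w = (3, 1)" and r: "right_eigen (insert w neg_long) c f"
    and l: "\<And>a b. l (cscale a (hh (1, 0)) + cscale b (hh (0, 1))) = a * l (hh (1, 0)) + b * l (hh (0, 1))"
  shows "\<exists>a b n. l (hh (1, 0)) = of_nat a \<and> l (hh (0, 1)) = of_nat b \<and> (\<forall>x\<in>\<tt>. c x = - of_nat n * ev (levi_weight w) x) \<and>
    b \<le> n \<and> n \<le> a + b"
  using w
proof
  assume w: "w = (0, 1)"
  have "right_eigen Q0 c f"
    using r unfolding w Q0_def .
  from upper_bound[OF f this l] show ?thesis
    unfolding w levi_weight_def if_P[OF refl] .
next
  assume w: "w = (3, 1)"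
  have "\<exists>f'. left_eigen l f' \<and> f' \<noteq> 0 \<and> right_eigen Q0 (\<lambda>x. c (x - cscale (ev (1, 0) x) (hh (1, 0)))) f'"
    by (rule right_translate[OF f r]) (simp only: w s1_Q0(1))
  then obtain f' where f': "left_eigen l f'" "f' \<noteq> 0" "right_eigen Q0 (\<lambda>x. c (x - cscale (ev (1, 0) x) (hh (1, 0)))) f'"
    by (elim exE conjE) (rule that)
  obtain a b n where n: "l (hh (1, 0)) = of_nat a" "l (hh (0, 1)) = of_nat b" "b \<le> n" "n \<le> a + b"
    "\<And>x. x \<in> \<tt> \<Longrightarrow> c (x - cscale (ev (1, 0) x) (hh (1, 0))) = - of_nat n * ev (2, 1) x"
    using upper_bound[OF f' l] by blast
  have "c x = - of_nat n * ev (levi_weight w) x" if x: "x \<in> \<tt>" for x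
  proof -
    have "hh (1, 0) \<in> \<tt>" by (rule hh_t) (simp add: G2_defs)
    then have "x - cscale (ev (1, 0) x) (hh (1, 0)) \<in> \<tt>"
      by (intro lie_algebra_diff lie_algebra_cscale x)
    from n(5)[OF this] show ?thesis
      unfolding ev_reflect(3)[OF x, unfolded Let_def] ev_reflect(1)[OF x] by (simp add: w levi_weight_def)
  qed
  with n(1-4) show ?thesis by blast
qed

lemma generators:
  assumes w: "w = (0, 1) \<or> w = (3, 1)"
  shows "\<exists>l f. left_eigen l f \<and> f \<noteq> 0 \<and> (\<forall>x\<in>\<tt>. l x = ev (2, 1) x) \<and> right_eigen (insert w neg_long) (\<lambda>x. 0) f" (is ?A)
    "\<exists>l f. left_eigen l f \<and> f \<noteq> 0 \<and> (\<forall>x\<in>\<tt>. l x = ev (2, 1) x) \<and> right_eigen (insert w neg_long) (\<lambda>x. - ev (levi_weight w) x) f" (is ?B)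
    "\<exists>l f. left_eigen l f \<and> f \<noteq> 0 \<and> (\<forall>x\<in>\<tt>. l x = ev (3, 2) x) \<and> right_eigen (insert w neg_long) (\<lambda>x. - ev (levi_weight w) x) f" (is ?C)
proof -
  have "?A \<and> ?B \<and> ?C"
  proof (cases "w = (0, 1)")
    case True
    have "levi_weight w = (2, 1)"
      unfolding levi_weight_def True by simp
    moreover have "insert w neg_long = Q0"
      unfolding Q0_def True by (rule refl)
    ultimately show ?thesis
      using generators_Q0 by presburger
  next
    case False
    then have w': "w = (3, 1)" "levi_weight w = (1, 1)" using w by (auto simp: levi_weight_def)
    have tr: "\<exists>l f. left_eigen l f \<and> f \<noteq> 0 \<and> (\<forall>x\<in>\<tt>. l x = ev p x) \<and> right_eigen (insert w neg_long) c' f"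
      if ex: "\<exists>l f. left_eigen l f \<and> f \<noteq> 0 \<and> (\<forall>x\<in>\<tt>. l x = ev p x) \<and> right_eigen Q0 c f"
        and c: "\<And>x. x \<in> \<tt> \<Longrightarrow> c (x - cscale (ev (1, 0) x) (hh (1, 0))) = c' x" for p c c'
    proof -
      obtain l f where f: "left_eigen l f" "f \<noteq> 0" "\<forall>x\<in>\<tt>. l x = ev p x" "right_eigen Q0 c f"
        using ex by blast
      have "\<exists>f'. left_eigen l f' \<and> f' \<noteq> 0 \<and> right_eigen (insert w neg_long) (\<lambda>x. c (x - cscale (ev (1, 0) x) (hh (1, 0)))) f'"
        by (rule right_translate[OF f(1,2,4)]) (simp only: w'(1) s1_Q0(2))
      then obtain f' where f': "left_eigen l f'" "f' \<noteq> 0" "right_eigen (insert w neg_long) (\<lambda>x. c (x - cscale (ev (1, 0) x) (hh (1, 0)))) f'"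
        by (elim exE conjE) (rule that)
      then show ?thesis
        using right_eigen_cong[OF f'(3) c] f(3) by blast
    qed
    have A: ?A by (rule tr[OF generators_Q0(1)]) simp
    have B: ?B unfolding w'(2) by (rule tr[OF generators_Q0(2)]) (simp only: ev_reflect(1))
    have C: ?C unfolding w'(2) by (rule tr[OF generators_Q0(3)]) (simp only: ev_reflect(1))
    from A B C show ?thesis by blast
  qed
  then show ?A ?B ?C by blast+
qed

end

section \<open>Semi-invariance under the groups and under their Lie algebras\<close>

context g2_sl3
begin

lemma restrict_character:
  assumes K: "algebraic_group K" "T \<subseteq> K" and \<phi>: "\<phi> \<in> characters K"
  shows "restrict \<phi> T \<in> characters T" "x \<in> \<tt> \<Longrightarrow> differential T (restrict \<phi> T) x = differential K \<phi> x"
proof -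
  show c: "restrict \<phi> T \<in> characters T"
  proof (rule charactersI[OF _ _ _ algT])
    show "regular_on T \<phi>"
      using charactersD(2)[OF \<phi>] K(2) unfolding regular_on_def by blast
  qed (use charactersD(3,4)[OF \<phi>] K(2) in blast)+
  show "differential T (restrict \<phi> T) x = differential K \<phi> x" if x: "x \<in> \<tt>"
  proof (rule differential_eqI[OF algT c x])
    have "x \<in> lie_algebra K" using lie_algebra_mono[OF K(2)] x by blast
    then show "restrict \<phi> T (mexp (cscale z x)) = exp (differential K \<phi> x * z)" for z
      using mexp_mem(1)[OF algT x] char_mexp(1)[OF K(1) \<phi>] by simp
  qed
qed

text \<open>Differentiation along one-parameter subgroups; root vectors are nilpotent, so that they act
  by zero.\<close>

lemma semi_invariant_infinitesimal:
  assumes P: "connected_algebraic_group P" "T \<subseteq> P" "P \<subseteq> H" and \<omega>: "\<omega> \<in> characters B" and \<phi>: "\<phi> \<in> characters P"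
    and f: "regular_on G f" "g0 \<in> G" "f g0 \<noteq> 0"
    and sem: "\<And>b g p. b \<in> B \<Longrightarrow> g \<in> G \<Longrightarrow> p \<in> P \<Longrightarrow> f (matrix_inv b ** g ** p) = \<omega> b * f g * \<phi> p"
  shows "left_eigen (differential B \<omega>) (res G f)" "res G f \<noteq> 0" "right_eigen (subroots P) (differential P \<phi>) (res G f)"
proof -
  have algP: "algebraic_group P" using P(1) by (simp add: connected_algebraic_group_def)
  have PG: "P \<subseteq> G" using P(3) H(3) by blast
  have FR: "res G f \<in> R" by (rule regular_coord[OF f(1)])
  show F0: "res G f \<noteq> 0"
  proof
    assume "res G f = 0"
    then have "res G f g0 = 0" by simp
    then show False using f(2,3) by (simp add: res_def)
  qed
  have B1: "mat 1 \<in> B" and P1: "mat 1 \<in> P"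
    using algebraic_groupD(2) algB algP by blast+
  have one: "\<omega> (mat 1) = 1" "\<phi> (mat 1) = 1"
    using char_one[OF algB \<omega>] char_one[OF algP \<phi>] by simp_all
  show "left_eigen (differential B \<omega>) (res G f)"
    unfolding left_eigen_def
  proof (intro conjI ballI allI FR)
    fix Y g z assume Y: "Y \<in> lie_algebra B" and g: "g \<in> G"
    have "f (matrix_inv (mexp (cscale (- z) Y)) ** g ** mat 1) = \<omega> (mexp (cscale (- z) Y)) * f g * \<phi> (mat 1)"
      by (rule sem[OF mexp_mem(1)[OF algB Y] g P1])
    moreover have "\<omega> (mexp (cscale (- z) Y)) = exp (differential B \<omega> Y * (- z))"
      by (rule char_mexp(1)[OF algB \<omega> Y])
    moreover have "matrix_inv (mexp (cscale (- z) Y)) = mexp (cscale z Y)"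
      by (simp add: matrix_inv_mexp)
    ultimately show "res G f (mexp (cscale z Y) ** g) = exp (- differential B \<omega> Y * z) * res G f g"
      using g K_mult[OF LB(2)[OF Y] g] one by (simp add: res_def)
  qed
  have d: "D X (res G f) = fscale (differential P \<phi> X) (res G f)" if X: "X \<in> lie_algebra P" for X
  proof (rule coord_ring_eqI)
    have XL: "X \<in> L" using lie_algebra_mono[OF PG] X by blast
    show "D X (res G f) \<in> R" "fscale (differential P \<phi> X) (res G f) \<in> R"
      using FR XL by (auto intro: coord_ring_fscale)
    fix A assume A: "A \<in> G"
    have "res G f (A ** mexp (cscale w X)) = exp (differential P \<phi> X * w) * res G f A" for w
    proof -
      have "f (matrix_inv (mat 1) ** A ** mexp (cscale w X)) = \<omega> (mat 1) * f A * \<phi> (mexp (cscale w X))"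
        by (rule sem[OF B1 A mexp_mem(1)[OF algP X]])
      moreover have "A ** mexp (cscale w X) \<in> G"
        by (rule K_mult[OF A K_mexp(1)[OF XL]])
      ultimately show ?thesis
        using A one char_mexp(1)[OF algP \<phi> X] by (simp add: res_def)
    qed
    moreover have "((\<lambda>w. exp (differential P \<phi> X * w) * res G f A) has_field_derivative differential P \<phi> X * res G f A) (at 0)"
      by (auto intro!: derivative_eq_intros)
    ultimately show "D X (res G f) A = fscale (differential P \<phi> X) (res G f) A"
      using rder_unique[OF FR XL A] by simp
  qed
  show "right_eigen (subroots P) (differential P \<phi>) (res G f)"
    unfolding right_eigen_def
  proof (intro conjI ballI)
    fix q X assume q: "q \<in> subroots P" and X: "X \<in> rs q"
    have XP: "X \<in> lie_algebra P" and qr: "q \<in> G2_roots" using q X by (auto simp: subroots_def)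
    have "q \<noteq> 0" using qr G2_0 by blast
    then obtain N where N: "mpow X N = 0" using rs_nilpotent[OF _ X] by blast
    have "differential P \<phi> X = 0"
      by (rule nilpotent_eigenvalue[OF FR F0 rsD(1)[OF X] N d[OF XP]])
    then show "D X (res G f) = 0"
      using d[OF XP] by (simp add: fun_eq_iff)
  next
    fix x assume "x \<in> \<tt>"
    then show "D x (res G f) = fscale (differential P \<phi> x) (res G f)"
      using d lie_algebra_mono[OF P(2)] by blast
  qed
qed

text \<open>Induction over products of exponentials.\<close>

lemma left_eigen_translate:
  assumes f: "left_eigen l f" and b: "b \<in> B"
  shows "\<exists>k. \<forall>g\<in>G. f (b ** g) = k * f g"
proof (rule connected_algebraic_induct[OF conB b, where P = "\<lambda>b. \<exists>k. \<forall>g\<in>G. f (b ** g) = k * f g"])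
  show "\<exists>k. \<forall>g\<in>G. f (mat 1 ** g) = k * f g"
    by (intro exI[of _ 1]) simp
  fix A X assume A: "A \<in> B" and ih: "\<exists>k. \<forall>g\<in>G. f (A ** g) = k * f g" and X: "X \<in> lie_algebra B"
  obtain k where k: "\<And>g. g \<in> G \<Longrightarrow> f (A ** g) = k * f g" using ih by blast
  have m: "mexp X \<in> G" using LB(2)[OF X, of 1] by simp
  have "f (A ** mexp X ** g) = k * exp (- l X) * f g" if g: "g \<in> G" for g
  proof -
    have "f (A ** mexp X ** g) = k * f (mexp X ** g)"
      using k[OF K_mult[OF m g]] by (simp add: matrix_mul_assoc)
    also have "f (mexp (cscale 1 X) ** g) = exp (- l X * 1) * f g"
      using f X g unfolding left_eigen_def by blast
    then have "f (mexp X ** g) = exp (- l X) * f g" by simp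
    finally show ?thesis by simp
  qed
  then show "\<exists>k. \<forall>g\<in>G. f (A ** mexp X ** g) = k * f g" by blast
qed

lemma right_eigen_translate:
  assumes P: "connected_algebraic_group P" "T \<subseteq> P" "P \<subseteq> H"
    and f: "f \<in> R" "right_eigen (subroots P) c f" and p: "p \<in> P"
  shows "\<exists>k. \<forall>g\<in>G. f (g ** p) = k * f g"
proof (rule connected_algebraic_induct[OF P(1) p, where P = "\<lambda>p. \<exists>k. \<forall>g\<in>G. f (g ** p) = k * f g"])
  have algP: "algebraic_group P" using P(1) by (simp add: connected_algebraic_group_def)
  have PG: "P \<subseteq> G" using P(3) H(3) by blast
  show "\<exists>k. \<forall>g\<in>G. f (g ** mat 1) = k * f g"
    by (intro exI[of _ 1]) simp
  fix A X assume A: "A \<in> P" and ih: "\<exists>k. \<forall>g\<in>G. f (g ** A) = k * f g" and X: "X \<in> lie_algebra P"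
  obtain k where k: "\<And>g. g \<in> G \<Longrightarrow> f (g ** A) = k * f g" using ih by blast
  have XL: "X \<in> L" using lie_algebra_mono[OF PG] X by blast
  have "lie_algebra P = par (subroots P)"
    unfolding par_def by (rule lie_sub[OF algP P(2) PG])
  then obtain d where d: "D X f = fscale d f"
    using right_eigen_par[OF f(1,2), of X] X by (auto simp: subroots_def)
  have "f (g ** (A ** mexp X)) = exp d * k * f g" if g: "g \<in> G" for g
  proof -
    have "g ** A \<in> G" using g A PG K_mult by blast
    from rder_eigen_exp[OF f(1) XL d this, of 1] show ?thesis
      using k[OF g] by (simp add: matrix_mul_assoc)
  qed
  then show "\<exists>k. \<forall>g\<in>G. f (g ** (A ** mexp X)) = k * f g" by blast
qed

text \<open>Both groups act on \<open>f\<close> by scalars, which are read off at a point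
  \<open>g0\<close> with \<open>f g0 \<noteq> 0\<close>; this shows that they depend on the group element
  as a regular function.\<close>

lemma infinitesimal_semi_invariant:
  assumes P: "connected_algebraic_group P" "T \<subseteq> P" "P \<subseteq> H"
    and f: "left_eigen l f" "f \<noteq> 0" "right_eigen (subroots P) c f"
    and w: "\<And>x. x \<in> \<tt> \<Longrightarrow> l x = ev p x" "\<And>x. x \<in> \<tt> \<Longrightarrow> c x = ev q x"
  shows "(rv p, rv q) \<in> extended_weight_monoid G B T P T"
proof -
  have algP: "algebraic_group P" using P(1) by (simp add: connected_algebraic_group_def)
  have PG: "P \<subseteq> G" using P(3) H(3) by blast
  have fR: "f \<in> R" using f(1) by (simp add: left_eigen_def)
  obtain g0 where g0: "f g0 \<noteq> 0" "g0 \<in> G"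
    using f(2) coord_ring_outside[OF fR] by (metis ext zero_fun_apply)
  obtain F where F: "matrix_poly F" "f = res G F" using fR by (elim coord_ringE)
  have fF: "f A = F A" if "A \<in> G" for A using that by (simp add: F(2) res_def)
  define \<omega>0 where "\<omega>0 b = f (matrix_inv b ** g0) / f g0" for b
  define \<phi>0 where "\<phi>0 p = f (g0 ** p) / f g0" for p
  have invB: "matrix_inv b \<in> B" if "b \<in> B" for b by (rule algebraic_groupD(4)[OF algB that])
  have BG': "b \<in> G" if "b \<in> B" for b using that BsubG by blast
  have \<omega>0: "f (matrix_inv b ** g) = \<omega>0 b * f g" if b: "b \<in> B" and g: "g \<in> G" for b g
  proof -
    obtain k where k: "\<forall>g\<in>G. f (matrix_inv b ** g) = k * f g"
      using left_eigen_translate[OF f(1) invB[OF b]] by blast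
    then have "k = \<omega>0 b" using g0 by (simp add: \<omega>0_def)
    then show ?thesis using k g by blast
  qed
  have \<phi>0: "f (g ** p) = \<phi>0 p * f g" if p: "p \<in> P" and g: "g \<in> G" for p g
  proof -
    obtain k where k: "\<forall>g\<in>G. f (g ** p) = k * f g"
      using right_eigen_translate[OF P fR f(3) p] by blast
    then have "k = \<phi>0 p" using g0 by (simp add: \<phi>0_def)
    then show ?thesis using k g by blast
  qed
  have \<omega>c: "restrict \<omega>0 B \<in> characters B"
  proof (rule charactersI[OF _ _ _ algB])
    have reg: "regular_on B (\<lambda>b. inverse (f g0) * F (matrix_inv b ** g0))"
      by (intro regular_on_mult regular_on_poly[OF matrix_poly.const]
          regular_on_inv[OF algB regular_on_poly[OF matrix_poly_mult_right[OF F(1)]]])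
    have "\<omega>0 b = inverse (f g0) * F (matrix_inv b ** g0)" if "b \<in> B" for b
      using fF[OF K_mult[OF BG'[OF invB[OF that]] g0(2)]] by (simp add: \<omega>0_def divide_inverse)
    from regular_on_cong[of B, OF this] show "regular_on B \<omega>0"
      using reg by (rule iffD2)
    fix b assume b: "b \<in> B"
    show "\<omega>0 b \<noteq> 0"
    proof
      assume "\<omega>0 b = 0"
      then have z: "f (matrix_inv b ** g0) = 0" using g0 by (simp add: \<omega>0_def)
      obtain k where "\<forall>g\<in>G. f (b ** g) = k * f g" using left_eigen_translate[OF f(1) b] by blast
      from bspec[OF this K_mult[OF BG'[OF invB[OF b]] g0(2)]]
      have "f (b ** (matrix_inv b ** g0)) = k * f (matrix_inv b ** g0)" .
      then show False using z g0(1) K_inv[OF BG'[OF b]] by simp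
    qed
    fix b' assume b': "b' \<in> B"
    have "f (matrix_inv (b ** b') ** g0) = f (matrix_inv b' ** (matrix_inv b ** g0))"
      using K_inv[OF BG'[OF b]] K_inv[OF BG'[OF b']] by (simp add: matrix_inv_mult matrix_mul_assoc)
    also have "\<dots> = \<omega>0 b' * (\<omega>0 b * f g0)"
      using \<omega>0[OF b' K_mult[OF BG'[OF invB[OF b]] g0(2)]] \<omega>0[OF b g0(2)] by simp
    finally show "\<omega>0 (b ** b') = \<omega>0 b * \<omega>0 b'"
      using g0(1) by (simp add: \<omega>0_def[of "b ** b'"])
  qed
  have \<phi>c: "restrict \<phi>0 P \<in> characters P"
  proof (rule charactersI[OF _ _ _ algP])
    have reg: "regular_on P (\<lambda>b. inverse (f g0) * F (g0 ** b))"
      by (intro regular_on_mult regular_on_poly[OF matrix_poly.const] regular_on_poly[OF matrix_poly_mult_left[OF F(1)]])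
    have "\<phi>0 b = inverse (f g0) * F (g0 ** b)" if "b \<in> P" for b
      using fF[OF K_mult[OF g0(2) subsetD[OF PG that]]] by (simp add: \<phi>0_def divide_inverse)
    from regular_on_cong[of P, OF this] show "regular_on P \<phi>0"
      using reg by (rule iffD2)
    fix b assume b: "b \<in> P"
    have gb: "g0 ** b \<in> G" by (rule K_mult[OF g0(2) subsetD[OF PG b]])
    show "\<phi>0 b \<noteq> 0"
    proof
      assume "\<phi>0 b = 0"
      then have "f (g0 ** b) = 0" using g0 by (simp add: \<phi>0_def)
      then have "f (g0 ** b ** matrix_inv b) = 0"
        using \<phi>0[OF algebraic_groupD(4)[OF algP b] gb] by simp
      moreover have "g0 ** b ** matrix_inv b = g0"
        using K_inv[OF subsetD[OF PG b]] by (simp add: matrix_mul_assoc[symmetric] invertible_inv_mult)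
      ultimately show False using g0(1) by simp
    qed
    fix b' assume b': "b' \<in> P"
    have "f (g0 ** (b ** b')) = \<phi>0 b' * (\<phi>0 b * f g0)"
      using \<phi>0[OF b' gb] \<phi>0[OF b g0(2)] by (simp add: matrix_mul_assoc)
    then show "\<phi>0 (b ** b') = \<phi>0 b * \<phi>0 b'"
      using g0(1) by (simp add: \<phi>0_def[of "b ** b'"])
  qed
  have sem: "f (matrix_inv b ** g ** p) = restrict \<omega>0 B b * f g * restrict \<phi>0 P p" if b: "b \<in> B" and g: "g \<in> G" and p: "p \<in> P" for b g p
    using \<phi>0[OF p K_mult[OF BG'[OF invB[OF b]] g]] \<omega>0[OF b g] b p by simp
  have e1: "rv p = restrict (restrict \<omega>0 B) T"
  proof (rule characters_eq_differential[OF connT rv_char restrict_character(1)[OF algB BG(2) \<omega>c]])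
    fix x assume x: "x \<in> \<tt>"
    have "differential B (restrict \<omega>0 B) x = ev p x"
    proof (rule differential_eqI[OF algB \<omega>c tB[OF x]])
      fix z
      have "f (mexp (cscale (- z) x) ** g0) = exp (- l x * (- z)) * f g0"
        using f(1) tB[OF x] g0(2) unfolding left_eigen_def by blast
      moreover have "matrix_inv (mexp (cscale z x)) = mexp (cscale (- z) x)"
        by (simp add: matrix_inv_mexp)
      ultimately show "restrict \<omega>0 B (mexp (cscale z x)) = exp (ev p x * z)"
        using mexp_mem(1)[OF algB tB[OF x]] g0(1) w(1)[OF x] by (simp add: \<omega>0_def)
    qed
    then show "differential T (rv p) x = differential T (restrict (restrict \<omega>0 B) T) x"
      using ev_differential[OF x] restrict_character(2)[OF algB BG(2) \<omega>c x] by simp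
  qed
  have e2: "rv q = restrict (restrict \<phi>0 P) T"
  proof (rule characters_eq_differential[OF connT rv_char restrict_character(1)[OF algP P(2) \<phi>c]])
    fix x assume x: "x \<in> \<tt>"
    have xP: "x \<in> lie_algebra P" using lie_algebra_mono[OF P(2)] x by blast
    have "D x f = fscale (ev q x) f" using f(3) x w(2)[OF x] by (simp add: right_eigen_def)
    then have "differential P (restrict \<phi>0 P) x = ev q x"
      using rder_eigen_exp[OF fR t_L[OF x] _ g0(2), of "ev q x"] mexp_mem(1)[OF algP xP] g0(1)
      by (intro differential_eqI[OF algP \<phi>c xP]) (simp add: \<phi>0_def)
    then show "differential T (rv q) x = differential T (restrict (restrict \<phi>0 P) T) x"
      using ev_differential[OF x] restrict_character(2)[OF algP P(2) \<phi>c x] by simp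
  qed
  show ?thesis
    unfolding extended_weight_monoid_def mem_Collect_eq
  proof (intro exI conjI)
    show "(rv p, rv q) = (restrict (restrict \<omega>0 B) T, restrict (restrict \<phi>0 P) T)"
      by (rule arg_cong2[OF e1 e2])
    show "restrict \<omega>0 B \<in> characters B" "restrict \<phi>0 P \<in> characters P" by (fact \<omega>c \<phi>c)+
    show "regular_on G f" by (rule coord_regular[OF fR])
    show "\<exists>g\<in>G. f g \<noteq> 0" using g0 by blast
    show "\<forall>b\<in>B. \<forall>g\<in>G. \<forall>p\<in>P. f (matrix_inv b ** g ** p) = restrict \<omega>0 B b * f g * restrict \<phi>0 P p"
      using sem by blast
  qed
qed

section \<open>The extended weight monoid\<close>

text \<open>For \<open>Q\<close> the roots of \<open>P\<close> and up to the coordinates of characters, this is membership in the extended weight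
  monoid.\<close>

definition semi_weight :: "(int \<times> int) set \<Rightarrow> int \<times> int \<Rightarrow> int \<times> int \<Rightarrow> bool" where
  "semi_weight Q p q \<longleftrightarrow> (\<exists>l c f. left_eigen l f \<and> f \<noteq> 0 \<and> right_eigen Q c f \<and> (\<forall>x\<in>\<tt>. l x = ev p x \<and> c x = ev q x))"

lemma semi_weight_0:
  assumes Q: "Q \<subseteq> G2_roots"
  shows "semi_weight Q 0 0"
proof -
  let ?f = "res G (\<lambda>A. 1)"
  have fR: "?f \<in> R" by (rule res_coord[OF matrix_poly.const])
  have z: "D X ?f = 0" if "X \<in> L" for X
    using rder_res[OF matrix_poly.const[of 1] that] by (simp add: res_def fun_eq_iff)
  have "?f (mat 1) = 1" using K_one by (simp add: res_def)
  then have "?f \<noteq> 0" by (metis zero_fun_apply zero_neq_one)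
  moreover have "left_eigen (\<lambda>x. 0) ?f"
    unfolding left_eigen_def using fR LB(2) K_mult by (auto simp: res_def)
  moreover have "right_eigen Q (\<lambda>x. 0) ?f"
    unfolding right_eigen_def using z rsD(1) t_L by (simp add: fun_eq_iff)
  ultimately show ?thesis
    unfolding semi_weight_def by (intro exI[of _ "\<lambda>x. 0"] exI[of _ ?f]) (simp add: ev_0)
qed

lemma semi_weight_add:
  assumes "semi_weight Q p q" "semi_weight Q p' q'"
  shows "semi_weight Q (p + p') (q + q')"
proof -
  obtain l c f where f: "left_eigen l f" "f \<noteq> 0" "right_eigen Q c f" "\<forall>x\<in>\<tt>. l x = ev p x \<and> c x = ev q x"
    using assms(1) unfolding semi_weight_def by blast
  obtain l' c' f' where f': "left_eigen l' f'" "f' \<noteq> 0" "right_eigen Q c' f'" "\<forall>x\<in>\<tt>. l' x = ev p' x \<and> c' x = ev q' x"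
    using assms(2) unfolding semi_weight_def by blast
  have R: "f \<in> R" "f' \<in> R" using f(1) f'(1) by (simp_all add: left_eigen_def)
  let ?f = "\<lambda>A. f A * f' A"
  have "left_eigen (\<lambda>x. l x + l' x) ?f"
    unfolding left_eigen_def
  proof (intro conjI ballI allI coord_ring_mult R)
    fix Y g z assume "Y \<in> lie_algebra B" "g \<in> G"
    then show "f (mexp (cscale z Y) ** g) * f' (mexp (cscale z Y) ** g) = exp (- (l Y + l' Y) * z) * (f g * f' g)"
      using f(1) f'(1) by (simp add: left_eigen_def exp_add[symmetric] algebra_simps)
  qed
  moreover have "?f \<noteq> 0"
    by (rule coord_ring_no_zero_divisors[OF R(1) f(2) R(2) f'(2)])
  moreover have "right_eigen Q (\<lambda>x. c x + c' x) ?f"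
    unfolding right_eigen_def
  proof (intro conjI ballI)
    fix s X assume s: "s \<in> Q" "X \<in> rs s"
    then have "D X f = 0" "D X f' = 0" using f(3) f'(3) by (auto simp: right_eigen_def)
    then show "D X ?f = 0"
      using rder_mult[OF R rsD(1)[OF s(2)]] by (simp add: fun_eq_iff)
  next
    fix x assume x: "x \<in> \<tt>"
    then have "D x f = fscale (c x) f" "D x f' = fscale (c' x) f'" using f(3) f'(3) by (auto simp: right_eigen_def)
    then show "D x ?f = fscale (c x + c' x) ?f"
      using rder_mult[OF R t_L[OF x]] by (simp add: fun_eq_iff algebra_simps)
  qed
  moreover have "\<forall>x\<in>\<tt>. l x + l' x = ev (p + p') x \<and> c x + c' x = ev (q + q') x"
    using f(4) f'(4) by (simp add: ev_add)
  ultimately show ?thesis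
    unfolding semi_weight_def by (intro exI[of _ "\<lambda>x. l x + l' x"] exI[of _ "\<lambda>x. c x + c' x"] exI[of _ ?f]) blast
qed

lemma nmul_simps: "nmul 0 p = 0" "nmul (m + n) p = nmul m p + nmul n p" "nmul (Suc n) p = nmul n p + p" "nmul n 0 = 0"
  by (simp_all add: nmul_def prod_eq_iff algebra_simps)

lemma semi_weight_nmul: "Q \<subseteq> G2_roots \<Longrightarrow> semi_weight Q p q \<Longrightarrow> semi_weight Q (nmul n p) (nmul n q)"
  by (induction n) (auto simp: nmul_simps semi_weight_0 intro: semi_weight_add)

lemma semi_weight_generated:
  assumes w: "w = (0, 1) \<or> w = (3, 1)"
  shows "semi_weight (insert w neg_long) (nmul (x + y) (2, 1) + nmul z (3, 2)) (nmul (y + z) (- levi_weight w))"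
proof -
  let ?Q = "insert w neg_long"
  have Q: "?Q \<subseteq> G2_roots" using w by (auto simp: neg_long_def G2_defs)
  have g: "semi_weight ?Q (2, 1) 0" "semi_weight ?Q (2, 1) (- levi_weight w)" "semi_weight ?Q (3, 2) (- levi_weight w)"
  proof -
    show "semi_weight ?Q (2, 1) 0"
      using generators(1)[OF w] unfolding semi_weight_def ev_0 by blast
    show "semi_weight ?Q (2, 1) (- levi_weight w)"
      using generators(2)[OF w] unfolding semi_weight_def ev_minus by blast
    show "semi_weight ?Q (3, 2) (- levi_weight w)"
      using generators(3)[OF w] unfolding semi_weight_def ev_minus by blast
  qed
  have "semi_weight ?Q (nmul x (2, 1) + nmul y (2, 1) + nmul z (3, 2))
      (nmul x 0 + nmul y (- levi_weight w) + nmul z (- levi_weight w))"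
    by (intro semi_weight_add semi_weight_nmul Q g)
  then show ?thesis by (simp only: nmul_simps add_0_left)
qed

lemma ev_nmul: "ev (nmul n p) x = of_nat n * ev p x"
  by (simp add: ev_def nmul_def algebra_simps)

text \<open>The inequalities \<open>b \<le> n \<le> a + b\<close> say precisely that \<open>x = a + b -
  n\<close>, \<open>y = n - b\<close> and \<open>z = b\<close> are natural numbers.\<close>

lemma extended_weight_monoid_eq:
  assumes P: "connected_algebraic_group P" "T \<subseteq> P" "P \<subseteq> H" "subroots P = insert w neg_long" and w: "w = (0, 1) \<or> w = (3, 1)"
  shows "extended_weight_monoid G B T P T =
    {(rv (nmul (x + y) (2, 1) + nmul z (3, 2)), rv (nmul (y + z) (- levi_weight w))) | x y z. True}" (is "?M = ?S")
proof
  have algP: "algebraic_group P" using P(1) by (simp add: connected_algebraic_group_def)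
  have hr: "(1, 0) \<in> G2_roots" "(0, 1) \<in> G2_roots" by (simp_all add: G2_defs)
  note ht = hh_t[OF hr(1)] hh_t[OF hr(2)]
  show "?S \<subseteq> ?M"
  proof
    fix s assume "s \<in> ?S"
    then obtain x y z where s: "s = (rv (nmul (x + y) (2, 1) + nmul z (3, 2)), rv (nmul (y + z) (- levi_weight w)))" by blast
    obtain l c f where f: "left_eigen l f" "f \<noteq> 0" "right_eigen (insert w neg_long) c f"
      "\<forall>t\<in>\<tt>. l t = ev (nmul (x + y) (2, 1) + nmul z (3, 2)) t \<and> c t = ev (nmul (y + z) (- levi_weight w)) t"
      using semi_weight_generated[OF w, of x y z] unfolding semi_weight_def by blast
    show "s \<in> ?M"
      unfolding s by (rule infinitesimal_semi_invariant[OF P(1-3) f(1,2) f(3)[folded P(4)]]) (use f(4) in blast)+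
  qed
  show "?M \<subseteq> ?S"
  proof
    fix s assume "s \<in> ?M"
    then obtain \<omega> \<phi> f g0 where s: "s = (restrict \<omega> T, restrict \<phi> T)" and c: "\<omega> \<in> characters B" "\<phi> \<in> characters P"
      and f: "regular_on G f" "g0 \<in> G" "f g0 \<noteq> 0"
      and sem: "\<forall>b\<in>B. \<forall>g\<in>G. \<forall>p\<in>P. f (matrix_inv b ** g ** p) = \<omega> b * f g * \<phi> p"
      unfolding extended_weight_monoid_def by blast
    let ?l = "differential B \<omega>" and ?c = "differential P \<phi>"
    have e: "left_eigen ?l (res G f)" "res G f \<noteq> 0"
      by (rule semi_invariant_infinitesimal(1,2)[OF P(1-3) c f], use sem in blast)+
    have r: "right_eigen (insert w neg_long) ?c (res G f)"
      unfolding P(4)[symmetric] by (rule semi_invariant_infinitesimal(3)[OF P(1-3) c f]) (use sem in blast)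
    have lin: "?l (cscale a (hh (1, 0)) + cscale b (hh (0, 1))) = a * ?l (hh (1, 0)) + b * ?l (hh (0, 1))" for a b
      using tB[OF ht(1)] tB[OF ht(2)] by (simp add: differential_lin[OF algB c(1)] lie_algebra_cscale)
    obtain a b n where n: "?l (hh (1, 0)) = of_nat a" "?l (hh (0, 1)) = of_nat b"
      "\<forall>x\<in>\<tt>. ?c x = - of_nat n * ev (levi_weight w) x" "b \<le> n" "n \<le> a + b"
      using semi_invariant_bound[OF e w r lin] by blast
    define x y z where "x = a + b - n" and "y = n - b" and "z = b"
    have xyz: "x + y = a" "y + z = n" "z = b"
      using n(4,5) by (simp_all add: x_def y_def z_def)
    have e21: "ev (2, 1) (hh (1, 0)) = 1" "ev (2, 1) (hh (0, 1)) = 0" "ev (3, 2) (hh (1, 0)) = 0" "ev (3, 2) (hh (0, 1)) = 1"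
      using ev_pair[of 2 1 "hh (1, 0)"] ev_pair[of 2 1 "hh (0, 1)"] ev_pair[of 3 2 "hh (1, 0)"] ev_pair[of 3 2 "hh (0, 1)"]
      by (simp_all add: ev_hh)
    have "restrict \<omega> T = rv (nmul (x + y) (2, 1) + nmul z (3, 2))"
    proof (rule characters_eq_coroots[OF restrict_character(1)[OF algB BG(2) c(1)] rv_char])
      show "differential T (restrict \<omega> T) (hh (1, 0)) = differential T (rv (nmul (x + y) (2, 1) + nmul z (3, 2))) (hh (1, 0))"
        "differential T (restrict \<omega> T) (hh (0, 1)) = differential T (rv (nmul (x + y) (2, 1) + nmul z (3, 2))) (hh (0, 1))"
        by (simp_all add: ht restrict_character(2)[OF algB BG(2) c(1)] ev_differential ev_add ev_nmul e21 n(1,2) xyz(1,3))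
    qed
    moreover have "restrict \<phi> T = rv (nmul (y + z) (- levi_weight w))"
    proof (rule characters_eq_differential[OF connT restrict_character(1)[OF algP P(2) c(2)] rv_char])
      fix t assume t: "t \<in> \<tt>"
      show "differential T (restrict \<phi> T) t = differential T (rv (nmul (y + z) (- levi_weight w))) t"
        using n(3) t by (simp add: restrict_character(2)[OF algP P(2) c(2)] ev_differential ev_nmul ev_minus xyz(2))
    qed
    ultimately show "s \<in> ?S" unfolding s by blast
  qed
qed

lemma free_generation:
  assumes P: "connected_algebraic_group P" "T \<subseteq> P" "P \<subseteq> H" "subroots P = insert w neg_long" and w: "w = (0, 1) \<or> w = (3, 1)"
  shows "freely_generated (char_group T \<times>\<times> char_group T) (extended_weight_monoid G B T P T)
    {(rv (2, 1), \<one>\<^bsub>char_group T\<^esub>), (rv (2, 1), inv\<^bsub>char_group T\<^esub> rv (levi_weight w)), (rv (3, 2), inv\<^bsub>char_group T\<^esub> rv (levi_weight w))}"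
proof -
  let ?M = "char_group T \<times>\<times> char_group T"
  let ?u = "- levi_weight w"
  interpret M: comm_group ?M
  proof (rule group.group_comm_groupI)
    show "group ?M" by (rule DirProd_group) (rule X.is_group)+
    show "s \<otimes>\<^bsub>?M\<^esub> s' = s' \<otimes>\<^bsub>?M\<^esub> s" if "s \<in> carrier ?M" "s' \<in> carrier ?M" for s s'
      using that by (auto simp: X.m_comm)
  qed
  have mult: "(rv p, rv q) \<otimes>\<^bsub>?M\<^esub> (rv p', rv q') = (rv (p + p'), rv (q + q'))" for p q p' q'
    by (simp add: rv_add)
  have carr: "(rv p, rv q) \<in> carrier ?M" for p q
    by (simp add: rv_char)
  have pow: "(rv p, rv q) [^]\<^bsub>?M\<^esub> (n::nat) = (rv (nmul n p), rv (nmul n q))" for p q n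
    by (induction n) (simp_all add: nmul_simps rv_0 mult del: mult_DirProd)
  define g1 g2 g3 where "g1 = (rv (2, 1), rv 0)" and "g2 = (rv (2, 1), rv ?u)" and "g3 = (rv (3, 2), rv ?u)"
  have u: "snd (levi_weight w) = 1" by (simp add: levi_weight_def)
  then have u0: "levi_weight w \<noteq> 0" by (auto simp: prod_eq_iff)
  have dist: "g1 \<noteq> g2" "g1 \<noteq> g3" "g2 \<noteq> g3"
    using u0 by (auto simp: g1_def g2_def g3_def rv_inj)
  have gc: "g1 \<in> carrier ?M" "g2 \<in> carrier ?M" "g3 \<in> carrier ?M"
    unfolding g1_def g2_def g3_def by (rule carr)+
  let ?A = "{g1, g2, g3}"
  have A: "{(rv (2, 1), \<one>\<^bsub>char_group T\<^esub>), (rv (2, 1), inv\<^bsub>char_group T\<^esub> rv (levi_weight w)), (rv (3, 2), inv\<^bsub>char_group T\<^esub> rv (levi_weight w))} = ?A"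
    by (simp add: g1_def g2_def g3_def rv_0 rv_inv)
  let ?F = "\<lambda>n. \<Otimes>\<^bsub>?M\<^esub>a\<in>?A. a [^]\<^bsub>?M\<^esub> (n a :: nat)"
  have F: "?F n = (rv (nmul (n g1 + n g2) (2, 1) + nmul (n g3) (3, 2)), rv (nmul (n g2 + n g3) ?u))" for n
  proof -
    have "?F n = g1 [^]\<^bsub>?M\<^esub> n g1 \<otimes>\<^bsub>?M\<^esub> (g2 [^]\<^bsub>?M\<^esub> n g2 \<otimes>\<^bsub>?M\<^esub> g3 [^]\<^bsub>?M\<^esub> n g3)"
      using dist gc by (simp add: Pi_def M.nat_pow_closed M.r_one del: carrier_DirProd one_DirProd)
    also have "\<dots> = (rv (nmul (n g1) (2, 1) + (nmul (n g2) (2, 1) + nmul (n g3) (3, 2))), rv (nmul (n g1) 0 + (nmul (n g2) ?u + nmul (n g3) ?u)))"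
      unfolding g1_def g2_def g3_def pow mult ..
    finally show ?thesis
      by (simp only: nmul_simps add_0_left add.assoc)
  qed
  have inj: "n g1 = n' g1 \<and> n g2 = n' g2 \<and> n g3 = n' g3" if eq: "?F n = ?F n'" for n n'
  proof -
    have "nmul (n g1 + n g2) (2, 1) + nmul (n g3) (3, 2) = nmul (n' g1 + n' g2) (2, 1) + nmul (n' g3) (3, 2)"
      "nmul (n g2 + n g3) ?u = nmul (n' g2 + n' g3) ?u"
      using eq unfolding F by (simp_all only: prod.inject rv_inj)
    then show ?thesis
      using u by (auto simp: nmul_def prod_eq_iff)
  qed
  have "bij_betw ?F (?A \<rightarrow>\<^sub>E UNIV) (extended_weight_monoid G B T P T)"
    unfolding bij_betw_def
  proof
    show "inj_on ?F (?A \<rightarrow>\<^sub>E UNIV)"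
    proof (rule inj_onI)
      fix n n' assume n: "n \<in> ?A \<rightarrow>\<^sub>E (UNIV :: nat set)" "n' \<in> ?A \<rightarrow>\<^sub>E (UNIV :: nat set)" and eq: "?F n = ?F n'"
      show "n = n'"
        by (rule PiE_ext[OF n]) (use inj[OF eq] in auto)
    qed
    show "?F ` (?A \<rightarrow>\<^sub>E UNIV) = extended_weight_monoid G B T P T"
      unfolding extended_weight_monoid_eq[OF P w]
    proof
      show "?F ` (?A \<rightarrow>\<^sub>E UNIV) \<subseteq> {(rv (nmul (x + y) (2, 1) + nmul z (3, 2)), rv (nmul (y + z) ?u)) | x y z. True}"
        unfolding F by blast
      show "{(rv (nmul (x + y) (2, 1) + nmul z (3, 2)), rv (nmul (y + z) ?u)) | x y z. True} \<subseteq> ?F ` (?A \<rightarrow>\<^sub>E UNIV)"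
      proof
        fix s assume "s \<in> {(rv (nmul (x + y) (2, 1) + nmul z (3, 2)), rv (nmul (y + z) ?u)) | x y z. True}"
        then obtain x y z where s: "s = (rv (nmul (x + y) (2, 1) + nmul z (3, 2)), rv (nmul (y + z) ?u))" by blast
        define n where "n = (\<lambda>a\<in>?A. if a = g1 then x else if a = g2 then y else z)"
        have "n g1 = x" "n g2 = y" "n g3 = z" using dist by (simp_all add: n_def)
        then have "s = ?F n" unfolding F s by simp
        moreover have "n \<in> ?A \<rightarrow>\<^sub>E UNIV" unfolding n_def by simp
        ultimately show "s \<in> ?F ` (?A \<rightarrow>\<^sub>E UNIV)" by (rule image_eqI)
      qed
    qed
  qed
  then show ?thesis
    unfolding freely_generated_def A using gc by simp
qed

lemma fundamental_weight_G:
  assumes "fundamental_weight G T {a1, a2} a \<omega>"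
  shows "a = a1 \<Longrightarrow> \<omega> = rv (2, 1)" "a = a2 \<Longrightarrow> \<omega> = rv (3, 2)"
proof -
  have hr: "(1, 0) \<in> G2_roots" "(0, 1) \<in> G2_roots" "- (1, 0) \<in> G2_roots" "- (0, 1) \<in> G2_roots" by (simp_all add: G2_defs)
  have co: "coroot G T a1 = hh (1, 0)" "coroot G T a2 = hh (0, 1)"
    using coroot_sub[OF subset_refl, of "(1, 0)"] coroot_sub[OF subset_refl, of "(0, 1)"] hr
    by (simp_all only: subroots_G a_rv[symmetric])
  have \<omega>: "\<omega> \<in> characters T" "differential T \<omega> (hh (1, 0)) = (if a1 = a then 1 else 0)" "differential T \<omega> (hh (0, 1)) = (if a2 = a then 1 else 0)"
    using assms by (auto simp: fundamental_weight_def co)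
  have e: "ev (2, 1) (hh (1, 0)) = 1" "ev (2, 1) (hh (0, 1)) = 0" "ev (3, 2) (hh (1, 0)) = 0" "ev (3, 2) (hh (0, 1)) = 1"
    using ev_pair[of 2 1 "hh (1, 0)"] ev_pair[of 2 1 "hh (0, 1)"] ev_pair[of 3 2 "hh (1, 0)"] ev_pair[of 3 2 "hh (0, 1)"]
    by (simp_all add: ev_hh)
  show "\<omega> = rv (2, 1)" if "a = a1"
    by (rule characters_eq_coroots[OF \<omega>(1) rv_char]) (use a12 that in \<open>simp_all add: \<omega> ev_differential[OF hh_t[OF hr(1)]] ev_differential[OF hh_t[OF hr(2)]] e\<close>)
  show "\<omega> = rv (3, 2)" if "a = a2"
    by (rule characters_eq_coroots[OF \<omega>(1) rv_char]) (use a12 that in \<open>simp_all add: \<omega> ev_differential[OF hh_t[OF hr(1)]] ev_differential[OF hh_t[OF hr(2)]] e\<close>)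
qed

text \<open>The fundamental weight of \<open>b\<close> vanishes on the coroot of the other simple root
  \<open>w\<close>.\<close>

lemma fundamental_weight_H:
  assumes "fundamental_weight H T {b1, b2} b \<omega>" and b: "b \<in> {b1, b2}" and w: "{b1, b2} - {b} = {rv w}" "w = (0, 1) \<or> w = (3, 1)"
  shows "\<omega> = rv (levi_weight w)"
proof -
  have hr: "(0, 1) \<in> G2_roots" "(3, 1) \<in> G2_roots" by (simp_all add: G2_defs)
  have co: "coroot H T (rv (0, 1)) = hh (0, 1)" "coroot H T (rv (3, 1)) = hh (3, 1)"
    by (auto intro!: coroot_sub[OF H(3)] simp: subroots_H G2_long_def)
  have \<omega>: "\<omega> \<in> characters T" "differential T \<omega> (hh (0, 1)) = (if rv (0, 1) = b then 1 else 0)"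
    "differential T \<omega> (hh (3, 1)) = (if rv (3, 1) = b then 1 else 0)"
    using assms(1) by (auto simp: fundamental_weight_def base_H co)
  have bw: "b = (if w = (0, 1) then rv (3, 1) else rv (0, 1))"
  proof -
    have ne: "rv (0, 1) \<noteq> rv (3, 1)" by (simp add: rv_inj)
    have "b = rv (0, 1) \<or> b = rv (3, 1)" using b unfolding base_H by blast
    then show ?thesis
    proof
      assume b: "b = rv (0, 1)"
      have "rv (3, 1) \<in> {rv w}" using ne unfolding w(1)[symmetric] base_H b by simp
      then have "w = (3, 1)" by (simp add: rv_inj)
      then show ?thesis using b by simp
    next
      assume b: "b = rv (3, 1)"
      have "rv (0, 1) \<in> {rv w}" using ne unfolding w(1)[symmetric] base_H b by simp
      then have "w = (0, 1)" by (simp add: rv_inj)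
      then show ?thesis using b by simp
    qed
  qed
  have e: "ev (2, 1) (hh (0, 1)) = 0" "ev (2, 1) (hh (3, 1)) = 1" "ev (1, 1) (hh (0, 1)) = 1" "ev (1, 1) (hh (3, 1)) = 0"
    using ev_pair[of 2 1 "hh (0, 1)"] ev_pair[of 2 1 "hh (3, 1)"] ev_pair[of 1 1 "hh (0, 1)"] ev_pair[of 1 1 "hh (3, 1)"]
    by (simp_all add: ev_hh)
  have eq: "differential T \<omega> (hh (0, 1)) = ev (levi_weight w) (hh (0, 1))" "differential T \<omega> (hh (3, 1)) = ev (levi_weight w) (hh (3, 1))"
    using w(2) by (auto simp: \<omega> bw rv_inj levi_weight_def e)
  show ?thesis
  proof (rule characters_eq_differential[OF connT \<omega>(1) rv_char])
    fix x assume x: "x \<in> \<tt>"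
    let ?s = "ev (1, 0) x + ev (0, 1) x" and ?t = "2 * ev (1, 0) x + ev (0, 1) x"
    have ht: "hh (0, 1) \<in> \<tt>" "hh (3, 1) \<in> \<tt>" by (auto intro!: hh_t hr)
    have "differential T \<omega> (cscale ?s (hh (0, 1)) + cscale ?t (hh (3, 1))) =
        ev (levi_weight w) (cscale ?s (hh (0, 1)) + cscale ?t (hh (3, 1)))"
      using ht by (simp add: differential_lin[OF algT \<omega>(1)] ev_lin lie_algebra_cscale eq)
    then have "differential T \<omega> x = ev (levi_weight w) x"
      unfolding t_coords_H[OF x, symmetric] .
    then show "differential T \<omega> x = differential T (rv (levi_weight w)) x"
      by (simp add: ev_differential[OF x])
  qed
qed

lemma weight_monoid_free:
  assumes P: "parabolic_of H T BH' {b1, b2} {b} P" and b: "b \<in> {b1, b2}"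
    and \<omega>: "fundamental_weight G T {a1, a2} a1 \<omega>1" "fundamental_weight G T {a1, a2} a2 \<omega>2"
    and \<omega>H: "fundamental_weight H T {b1, b2} b \<omega>b"
  shows "freely_generated (char_group T \<times>\<times> char_group T) (extended_weight_monoid G B T P T)
    {(\<omega>1, \<one>\<^bsub>char_group T\<^esub>), (\<omega>1, inv\<^bsub>char_group T\<^esub> \<omega>b), (\<omega>2, inv\<^bsub>char_group T\<^esub> \<omega>b)}"
proof -
  have "b = rv (0, 1) \<or> b = rv (3, 1)" using b unfolding base_H by blast
  then have "{b1, b2} - {b} = {rv (3, 1)} \<or> {b1, b2} - {b} = {rv (0, 1)}"
    unfolding base_H by (elim disjE) (simp_all add: insert_Diff_if rv_inj)
  then have "\<exists>w. {b1, b2} - {b} = {rv w} \<and> (w = (0, 1) \<or> w = (3, 1))" by blast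
  then obtain w where w: "{b1, b2} - {b} = {rv w}" "w = (0, 1) \<or> w = (3, 1)" by blast
  have "\<omega>1 = rv (2, 1)" "\<omega>2 = rv (3, 2)" "\<omega>b = rv (levi_weight w)"
    using fundamental_weight_G(1)[OF \<omega>(1)] fundamental_weight_G(2)[OF \<omega>(2)] fundamental_weight_H[OF \<omega>H b w] by simp_all
  then show ?thesis
    using free_generation[OF parabolic_roots[OF P w] w(2)] by simp
qed

end

section \<open>The theorem\<close>

theorem mainTheorem8:
  fixes G T B H T\<^sub>H B\<^sub>H B\<^sub>H' :: "(complex^'n^'n) set"
    and P :: "nat \<Rightarrow> (complex^'n^'n) set"
    and \<alpha> \<omega> \<beta> \<omega>\<^sub>H :: "nat \<Rightarrow> (complex^'n^'n \<Rightarrow> complex)"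
  assumes G: "type_G2 G T B (\<alpha> 1) (\<alpha> 2)"
    and B: "borel_subgroup B G" "T \<subseteq> B"
    and \<omega>: "\<forall>i\<in>{1, 2}. fundamental_weight G T (\<alpha> ` {1, 2}) (\<alpha> i) (\<omega> i)"
    and H: "connected_algebraic_group H" "T \<subseteq> H" "H \<subseteq> G"
      "roots H T = int_combinations T (\<alpha> 1) (\<alpha> 2) G2_long"
    and T\<^sub>H: "maximal_torus T\<^sub>H H" "T\<^sub>H \<subseteq> T"
    and B\<^sub>H: "borel_subgroup B\<^sub>H H" "T\<^sub>H \<subseteq> B\<^sub>H" "B\<^sub>H \<subseteq> B"
    and \<beta>: "\<beta> 1 \<noteq> \<beta> 2" "simple_roots H T\<^sub>H B\<^sub>H (\<beta> ` {1, 2})"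
    and \<omega>\<^sub>H: "\<forall>k\<in>{1, 2}. fundamental_weight H T\<^sub>H (\<beta> ` {1, 2}) (\<beta> k) (\<omega>\<^sub>H k)"
    and B\<^sub>H': "opposite_borel H T\<^sub>H B\<^sub>H B\<^sub>H'"
    and P: "\<forall>k\<in>{1, 2}. parabolic_of H T\<^sub>H B\<^sub>H' (\<beta> ` {1, 2}) {\<beta> k} (P k)"
  shows "\<forall>k\<in>{1, 2}.
    freely_generated (char_group T \<times>\<times> char_group T\<^sub>H)
      (extended_weight_monoid G B T (P k) T\<^sub>H)
      {(\<omega> 1, \<one>\<^bsub>char_group T\<^sub>H\<^esub>),
       (\<omega> 1, inv\<^bsub>char_group T\<^sub>H\<^esub> (\<omega>\<^sub>H k)),
       (\<omega> 2, inv\<^bsub>char_group T\<^sub>H\<^esub> (\<omega>\<^sub>H k))}"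
proof -
  have "maximal_torus T G"
    using G by (simp add: type_G2_def semisimple_pair_def)
  then have torus: "algebraic_torus T"
    by (simp add: maximal_torus_def)
  \<comment> \<open>\<open>T\<close> is a torus of \<open>H\<close> as well, so that the smaller maximal torus is equal to it.\<close>
  have TH: "T\<^sub>H = T"
    using T\<^sub>H torus H(2) by (auto simp: maximal_torus_def)
  obtain S where "diag_torus T S"
    using algebraic_torusE[OF torus] by blast
  then interpret diag_torus T S .
  interpret g2_sl3 T S G B "\<alpha> 1" "\<alpha> 2" H B\<^sub>H B\<^sub>H' "\<beta> 1" "\<beta> 2"
  proof
    show "type_G2 G T B (\<alpha> 1) (\<alpha> 2)" by (rule G)
    show "T \<subseteq> B\<^sub>H" "simple_roots H T B\<^sub>H {\<beta> 1, \<beta> 2}" "opposite_borel H T B\<^sub>H B\<^sub>H'"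
      using B\<^sub>H(2) \<beta>(2) B\<^sub>H' by (simp_all add: TH)
  qed (fact B H B\<^sub>H(1,3) \<beta>(1))+
  show ?thesis
    unfolding TH
  proof
    fix k :: nat assume k: "k \<in> {1, 2}"
    show "freely_generated (char_group T \<times>\<times> char_group T) (extended_weight_monoid G B T (P k) T)
        {(\<omega> 1, \<one>\<^bsub>char_group T\<^esub>), (\<omega> 1, inv\<^bsub>char_group T\<^esub> (\<omega>\<^sub>H k)), (\<omega> 2, inv\<^bsub>char_group T\<^esub> (\<omega>\<^sub>H k))}"
    proof (rule weight_monoid_free)
      show "parabolic_of H T B\<^sub>H' {\<beta> 1, \<beta> 2} {\<beta> k} (P k)" "fundamental_weight H T {\<beta> 1, \<beta> 2} (\<beta> k) (\<omega>\<^sub>H k)"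
        using bspec[OF P k] bspec[OF \<omega>\<^sub>H k] by (simp_all add: TH)
      show "\<beta> k \<in> {\<beta> 1, \<beta> 2}" using k by auto
      show "fundamental_weight G T {\<alpha> 1, \<alpha> 2} (\<alpha> 1) (\<omega> 1)" "fundamental_weight G T {\<alpha> 1, \<alpha> 2} (\<alpha> 2) (\<omega> 2)"
        using \<omega> by simp_all
    qed
  qed
qed

end
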